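(* Let $E=\{x\in\mathbb{R}^n: |x|\le 1\}$ be the closed unit ball of $\mathbb{R}^n$. Suppose $\gamma,g:[0,1]\to(0,\infty)$ are Lipschitz continuous with $$\frac{g(1)}{\gamma(1)^2}>\sqrt{2}-1 .$$ Then pathwise uniqueness holds for the stochastic differential equation $$dX_t=[1-|X_t|^2]^{1/2}\,\gamma(|X_t|)\,dB_t-g(|X_t|)X_t\,dt$$ in $E$.
   Context: Here $B$ is a standard $n$-dimensional Brownian motion and $|\cdot|$ is the Euclidean norm. A solution of the equation in $E$ is a continuous adapted process $X$ with values in $E$ for all $t\ge 0$, defined on a filtered probability space carrying a Brownian motion $B$ relative to the filtration, such that the integrated form of the equation holds. Pathwise uniqueness means: if $X$ and $\widetilde X$ are two solutions in $E$ on the same filtered probability space, with the same Brownian motion $B$ and with $X_0=\widetilde X_0$ a.s., then almost surely $X_t=\widetilde X_t$ for all $t\ge 0$. *)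

theory Defs
  imports "HOL-Probability.Probability"
begin

text \<open>Time is \<^typ>\<open>real\<close>, so that the library locale \<^locale>\<open>filtration\<close> applies, but processes
  are only ever considered at times \<open>t \<ge> 0\<close>. A filtration given on \<open>t \<ge> 0\<close> extends to negative
  times by its value at \<open>0\<close>. No completeness or right-continuity is assumed.\<close>

locale filtered_prob_space = prob_space M + filtration "space M" F
  for M :: "'w measure" and F :: "real \<Rightarrow> 'w measure" +
  assumes sets_F_subset: "sets (F t) \<subseteq> sets M"

definition adapted :: "(real \<Rightarrow> 'w measure) \<Rightarrow> (real \<Rightarrow> 'w \<Rightarrow> 'b::topological_space) \<Rightarrow> bool" where
  "adapted F X \<longleftrightarrow> (\<forall>t\<ge>0. X t \<in> borel_measurable (F t))"

locale brownian_motion = filtered_prob_space M F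
  for M :: "'w measure" and F :: "real \<Rightarrow> 'w measure" +
  fixes B :: "real \<Rightarrow> 'w \<Rightarrow> real ^ 'n"
  assumes adapted_B: "adapted F B"
    and continuous_B: "AE \<omega> in M. continuous_on {0..} (\<lambda>t. B t \<omega>)"
    and B_0: "AE \<omega> in M. B 0 \<omega> = 0"
    and increment_indep: "0 \<le> s \<Longrightarrow> s < t \<Longrightarrow>
      indep_set (sets (F s)) (sets (vimage_algebra (space M) (\<lambda>\<omega>. B t \<omega> - B s \<omega>) borel))"
    and increment_distr: "0 \<le> s \<Longrightarrow> s < t \<Longrightarrow>
      distributed M lborel (\<lambda>\<omega>. B t \<omega> - B s \<omega>)
        (\<lambda>x. ennreal (\<Prod>i\<in>UNIV. normal_density 0 (sqrt (t - s)) (x $ i)))"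

text \<open>A simple integrand is \<open>H s = \<Sum>k<m. \<xi> k * indicator {\<tau> k<..\<tau> (Suc k)} s\<close> with deterministic
  times \<open>0 \<le> \<tau> 0 < \<dots> < \<tau> m\<close> and bounded \<open>F (\<tau> k)\<close>-measurable coefficients \<open>\<xi> k\<close>.\<close>

definition simple_integrand ::
  "'w measure \<Rightarrow> (real \<Rightarrow> 'w measure) \<Rightarrow> nat \<Rightarrow> (nat \<Rightarrow> real) \<Rightarrow> (nat \<Rightarrow> 'w \<Rightarrow> real) \<Rightarrow> bool" where
  "simple_integrand M F m \<tau> \<xi> \<longleftrightarrow>
     0 \<le> \<tau> 0 \<and>
     (\<forall>k<m. \<tau> k < \<tau> (Suc k) \<and> \<xi> k \<in> borel_measurable (F (\<tau> k)) \<and>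
            (\<exists>C. \<forall>\<omega>\<in>space M. \<bar>\<xi> k \<omega>\<bar> \<le> C))"

definition simple_process ::
  "nat \<Rightarrow> (nat \<Rightarrow> real) \<Rightarrow> (nat \<Rightarrow> 'w \<Rightarrow> real) \<Rightarrow> real \<Rightarrow> 'w \<Rightarrow> real" where
  "simple_process m \<tau> \<xi> s \<omega> = (\<Sum>k<m. \<xi> k \<omega> * indicator {\<tau> k<..\<tau> (Suc k)} s)"

definition simple_integral ::
  "(real \<Rightarrow> 'w \<Rightarrow> real ^ 'n) \<Rightarrow> nat \<Rightarrow> (nat \<Rightarrow> real) \<Rightarrow> (nat \<Rightarrow> 'w \<Rightarrow> real) \<Rightarrow> real \<Rightarrow> 'w \<Rightarrow> real ^ 'n"
  where
  "simple_integral B m \<tau> \<xi> t \<omega> =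
     (\<Sum>k<m. \<xi> k \<omega> *\<^sub>R (B (min t (\<tau> (Suc k))) \<omega> - B (min t (\<tau> k)) \<omega>))"

text \<open>Ito integrands: progressively measurable, with almost surely locally square integrable
  paths.\<close>

definition ito_integrand ::
  "'w measure \<Rightarrow> (real \<Rightarrow> 'w measure) \<Rightarrow> (real \<Rightarrow> 'w \<Rightarrow> real) \<Rightarrow> bool" where
  "ito_integrand M F H \<longleftrightarrow>
     (\<forall>T\<ge>0. (\<lambda>(s, \<omega>). H s \<omega>) \<in> borel_measurable (restrict_space borel {0..T} \<Otimes>\<^sub>M F T)) \<and>
     (AE \<omega> in M. \<forall>T\<ge>0. (\<integral>\<^sup>+s\<in>{0..T}. ennreal ((H s \<omega>)\<^sup>2) \<partial>lborel) < \<infinity>)"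

text \<open>\<open>I\<close> is a continuous version of the Ito integral \<open>\<integral>\<^sub>0\<^sup>t H dB\<close>, the scalar integrand multiplying
  each component of \<open>B\<close>. It is the usual extension of the integral from simple integrands: for
  some simple integrands \<open>H\<^sub>j\<close> and all \<open>t\<close>, \<open>\<integral>\<^sub>0\<^sup>t \<bar>H\<^sub>j - H\<bar>\<^sup>2 ds \<longlonglongrightarrow> 0\<close> and \<open>\<integral>\<^sub>0\<^sup>t H\<^sub>j dB \<longlonglongrightarrow> I\<^sub>t\<close>, both in
  probability. The time integral is a \<open>nn_integral\<close> so that it cannot vanish for lack of
  integrability. \<open>I\<close> need only be \<open>M\<close>-measurable because \<open>F\<close> may lack the null sets.\<close>

definition has_ito_integral ::
  "'w measure \<Rightarrow> (real \<Rightarrow> 'w measure) \<Rightarrow> (real \<Rightarrow> 'w \<Rightarrow> real ^ 'n) \<Rightarrow>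
   (real \<Rightarrow> 'w \<Rightarrow> real) \<Rightarrow> (real \<Rightarrow> 'w \<Rightarrow> real ^ 'n) \<Rightarrow> bool" where
  "has_ito_integral M F B H I \<longleftrightarrow>
     ito_integrand M F H \<and>
     (\<forall>t\<ge>0. I t \<in> borel_measurable M) \<and>
     (AE \<omega> in M. continuous_on {0..} (\<lambda>t. I t \<omega>)) \<and>
     (\<exists>m \<tau> \<xi>. (\<forall>j. simple_integrand M F (m j) (\<tau> j) (\<xi> j)) \<and>
        (\<forall>t\<ge>0. \<forall>\<epsilon>>0.
          (\<lambda>j. measure M {\<omega> \<in> space M. ennreal \<epsilon> <
             (\<integral>\<^sup>+s\<in>{0..t}. ennreal ((simple_process (m j) (\<tau> j) (\<xi> j) s \<omega> - H s \<omega>)\<^sup>2) \<partial>lborel)})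
            \<longlonglongrightarrow> 0 \<and>
          (\<lambda>j. measure M {\<omega> \<in> space M. \<epsilon> <
             norm (simple_integral B (m j) (\<tau> j) (\<xi> j) t \<omega> - I t \<omega>)}) \<longlonglongrightarrow> 0))"

text \<open>\<open>X\<close> solves \<open>dX\<^sub>t = \<sigma>(X\<^sub>t) dB\<^sub>t + b(X\<^sub>t) dt\<close> in \<open>E\<close>, with a scalar dispersion coefficient \<open>\<sigma>\<close>. The
  initial value is an arbitrary \<open>F 0\<close>-measurable random variable with values in \<open>E\<close>.\<close>

definition sde_solution ::
  "'w measure \<Rightarrow> (real \<Rightarrow> 'w measure) \<Rightarrow> (real \<Rightarrow> 'w \<Rightarrow> real ^ 'n) \<Rightarrow> (real ^ 'n) set \<Rightarrow>
   (real ^ 'n \<Rightarrow> real) \<Rightarrow> (real ^ 'n \<Rightarrow> real ^ 'n) \<Rightarrow> (real \<Rightarrow> 'w \<Rightarrow> real ^ 'n) \<Rightarrow> bool" where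
  "sde_solution M F B E \<sigma> b X \<longleftrightarrow>
     brownian_motion M F B \<and>
     adapted F X \<and>
     (\<forall>\<omega>\<in>space M. continuous_on {0..} (\<lambda>t. X t \<omega>) \<and> (\<forall>t\<ge>0. X t \<omega> \<in> E)) \<and>
     (\<exists>I. has_ito_integral M F B (\<lambda>t \<omega>. \<sigma> (X t \<omega>)) I \<and>
       (AE \<omega> in M. \<forall>t\<ge>0.
          set_integrable lborel {0..t} (\<lambda>s. b (X s \<omega>)) \<and>
          X t \<omega> = X 0 \<omega> + I t \<omega> + (LINT s:{0..t}|lborel. b (X s \<omega>))))"

text \<open>The type argument is the sample space type of the probability spaces quantified over; it
  is to be left as a type variable in theorems.\<close>

definition pathwise_unique ::
  "'w itself \<Rightarrow> (real ^ 'n) set \<Rightarrow> (real ^ 'n \<Rightarrow> real) \<Rightarrow> (real ^ 'n \<Rightarrow> real ^ 'n) \<Rightarrow> bool" where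
  "pathwise_unique _ E \<sigma> b \<longleftrightarrow>
     (\<forall>(M :: 'w measure) F B X Y.
        sde_solution M F B E \<sigma> b X \<longrightarrow> sde_solution M F B E \<sigma> b Y \<longrightarrow>
        (AE \<omega> in M. X 0 \<omega> = Y 0 \<omega>) \<longrightarrow>
        (AE \<omega> in M. \<forall>t\<ge>0. X t \<omega> = Y t \<omega>))"

end

theory Submission
  imports Defs
begin

text \<open>Put \<open>h x = 1 - \<bar>x\<bar>\<^sup>2\<close> and \<open>p = 2 - 1 / sqrt 2\<close>, and let \<open>X\<close>, \<open>Y\<close> be two solutions. Ito's formula
  is applied in expectation to the square of \<open>(h X + \<epsilon>)\<^sup>q - (h Y + \<epsilon>)\<^sup>q\<close>, where \<open>q = p / 2\<close>, plus a
  small multiple of \<open>\<bar>X - Y\<bar>\<^sup>2\<close>. As \<open>\<epsilon> \<rightarrow> 0\<close> the singular part of the drift is monotone, and by the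
  inequality \<open>(u\<^sup>w - v\<^sup>w)\<^sup>2 \<le> w\<^sup>2 (u v)\<^bsup>w - 1\<^esup> (u - v)\<^sup>2\<close> with \<open>w = p - 1\<close> it dominates the quadratic
  variation when \<open>2 g(1) / \<gamma>(1)\<^sup>2 > (p - 1)\<^sup>2 / (2 - p) + (2 - p)\<close>; the chosen \<open>p\<close> minimises the right
  hand side. The surplus, a negative multiple of the square of \<open>sqrt (h X) - sqrt (h Y)\<close>, absorbs the
  growth of the expectation of \<open>\<bar>X - Y\<bar>\<^sup>2\<close>, and Gronwall's inequality gives \<open>X = Y\<close>. The limit
  \<open>\<epsilon> \<rightarrow> 0\<close> is a reverse Fatou argument, since the generator is bounded above uniformly in \<open>\<epsilon>\<close>.

  Ito's formula in expectation is a telescoping sum of second order Taylor expansions whose errors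
  are \<open>O(dt\<^bsup>3/2\<^esup>)\<close>. These rest on the isometry and the fourth moments of the integral, which pass to
  the limit from simple integrands after truncating them.\<close>

section \<open>Brownian increments\<close>

text \<open>The squared distance alone satisfies no closed inequality: the dispersion coefficient
  contains \<open>sqrt (h x)\<close>, which is only Hoelder continuous of order 1/2 at the sphere,
  and the noise in all n coordinates leaves n times the square of the difference of the two
  dispersion coefficients in its drift. A second functional must pay for this square. A power of
  \<open>h\<close> with exponent below 1 has a drift that blows up at the sphere and pulls unequal
  values together; an exponent above 1/2 keeps its dispersion bounded. The shift by \<epsilon> makes
  the functional smooth up to the sphere, so the time that solutions spend there never enters. Where
  exactly one of the two points lies on the sphere, the generator tends to minus infinity because
  \<open>g 1\<close> is positive.

  The stochastic integral is known only as a limit in probability, over a filtration that may lack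
  null sets. The calculus is therefore reduced to expectations of increments multiplied by bounded
  weights known at the earlier time, which is enough for a formula for expectations of smooth
  functions of both solutions.\<close>

lemma prod_UNIV_eq_prod_Basis:
  fixes f :: "'n::finite \<Rightarrow> real \<Rightarrow> 'a::comm_monoid_mult" and x :: "real ^ 'n"
  shows "(\<Prod>i\<in>UNIV. f i (x $ i)) = (\<Prod>b\<in>Basis. f (THE i. b = axis i 1) (x \<bullet> b))"
proof -
  have inj: "inj (\<lambda>i::'n. axis i (1::real))"
    by (auto simp: inj_on_def axis_eq_axis)
  have B: "(Basis :: (real ^ 'n) set) = range (\<lambda>i. axis i 1)"
    by (auto simp: Basis_vec_def)
  show ?thesis
    unfolding B by (subst prod.reindex[OF inj]) (auto simp: inner_axis axis_eq_axis)
qed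

text \<open>Lebesgue measure is a product measure over \<open>Basis\<close>; sending an index to its
  axis vector identifies this basis with the coordinates, so Tonelli's theorem over
  \<open>Basis\<close> becomes one over coordinates.\<close>

lemma nn_integral_lborel_prod_vec:
  fixes f :: "'n::finite \<Rightarrow> real \<Rightarrow> ennreal"
  assumes [measurable]: "\<And>i. f i \<in> borel_measurable borel"
  shows "(\<integral>\<^sup>+x. (\<Prod>i\<in>UNIV. f i (x $ i)) \<partial>(lborel :: (real ^ 'n) measure)) = (\<Prod>i\<in>UNIV. \<integral>\<^sup>+x. f i x \<partial>lborel)"
proof -
  have inj: "inj (\<lambda>i::'n. axis i (1::real))"
    by (auto simp: inj_on_def axis_eq_axis)
  have B: "(Basis :: (real ^ 'n) set) = range (\<lambda>i. axis i 1)"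
    by (auto simp: Basis_vec_def)
  have "(\<integral>\<^sup>+x. (\<Prod>i\<in>UNIV. f i (x $ i)) \<partial>(lborel :: (real ^ 'n) measure))
     = (\<Prod>b\<in>(Basis :: (real ^ 'n) set). \<integral>\<^sup>+x. f (THE i. b = axis i 1) x \<partial>lborel)"
    unfolding prod_UNIV_eq_prod_Basis by (rule nn_integral_lborel_prod) auto
  also have "\<dots> = (\<Prod>i\<in>UNIV. \<integral>\<^sup>+x. f i x \<partial>lborel)"
    unfolding B by (subst prod.reindex[OF inj]) (auto simp: axis_eq_axis)
  finally show ?thesis .
qed

lemma Int_stable_vimage_sets: "Int_stable {X -` A \<inter> S |A. A \<in> sets N}"
proof (rule Int_stableI)
  fix a b assume "a \<in> {X -` A \<inter> S |A. A \<in> sets N}" "b \<in> {X -` A \<inter> S |A. A \<in> sets N}"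
  then obtain A C where "A \<in> sets N" "C \<in> sets N" "a = X -` A \<inter> S" "b = X -` C \<inter> S" by auto
  then have "a \<inter> b = X -` (A \<inter> C) \<inter> S \<and> A \<inter> C \<in> sets N" by auto
  then show "a \<inter> b \<in> {X -` A \<inter> S |A. A \<in> sets N}" by blast
qed

lemma borel_measurable_nth: "(\<lambda>x::real ^ 'n. x $ i) \<in> borel_measurable borel"
  by (intro borel_measurable_continuous_onI continuous_intros)

context brownian_motion
begin

lemma measurable_F_mono:
  "f \<in> measurable (F s) N \<Longrightarrow> s \<le> t \<Longrightarrow> f \<in> measurable (F t) N"
  using measurable_mono[of N N "F s" "F t"] sets_F_mono space_F by auto

lemma measurable_F_M: "f \<in> measurable (F s) N \<Longrightarrow> f \<in> measurable M N"
  using measurable_mono[of N N "F s" M] sets_F_subset space_F by auto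

lemma B_measurable_F: "0 \<le> s \<Longrightarrow> s \<le> t \<Longrightarrow> B s \<in> borel_measurable (F t)"
  using adapted_B measurable_F_mono unfolding adapted_def by blast

lemma B_measurable [measurable]: "0 \<le> t \<Longrightarrow> B t \<in> borel_measurable M"
  using B_measurable_F measurable_F_M by blast

section \<open>Joint Gaussian law of the coordinates of an increment\<close>

definition inc :: "'n \<Rightarrow> real \<Rightarrow> real \<Rightarrow> 'w \<Rightarrow> real" where
  "inc i a b \<omega> = B b \<omega> $ i - B a \<omega> $ i"

lemma inc_measurable_F: "0 \<le> a \<Longrightarrow> a \<le> b \<Longrightarrow> inc i a b \<in> borel_measurable (F b)"
  unfolding inc_def[abs_def]
  by (intro borel_measurable_diff measurable_compose[OF _ borel_measurable_nth] B_measurable_F) auto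

lemma inc_measurable: "0 \<le> a \<Longrightarrow> a \<le> b \<Longrightarrow> inc i a b \<in> borel_measurable M"
  using inc_measurable_F measurable_F_M by blast

text \<open>The joint density is a product, so rectangle probabilities factor. With all sides but
  one, or all but two, equal to \<open>UNIV\<close>, this gives the marginal law of a coordinate and
  the independence of two coordinates.\<close>

lemma increment_rectangle:
  assumes "0 \<le> a" "a < b" and [measurable]: "\<And>i. A i \<in> sets borel"
  shows "emeasure M {\<omega>\<in>space M. \<forall>i. inc i a b \<omega> \<in> A i} =
    (\<Prod>i\<in>UNIV. \<integral>\<^sup>+x. ennreal (normal_density 0 (sqrt (b - a)) x) * indicator (A i) x \<partial>lborel)"
proof -
  let ?d = "\<lambda>x::real ^ 'n. ennreal (\<Prod>i\<in>UNIV. normal_density 0 (sqrt (b - a)) (x $ i))"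
  have S: "{x::real^'n. \<forall>i. x $ i \<in> A i} \<in> sets borel" by measurable
  have "emeasure M {\<omega>\<in>space M. \<forall>i. inc i a b \<omega> \<in> A i}
      = emeasure M ((\<lambda>\<omega>. B b \<omega> - B a \<omega>) -` {x::real^'n. \<forall>i. x $ i \<in> A i} \<inter> space M)"
    by (rule arg_cong[where f="emeasure M"]) (auto simp: inc_def)
  also have "\<dots> = (\<integral>\<^sup>+x. ?d x * indicator {x::real^'n. \<forall>i. x $ i \<in> A i} x \<partial>lborel)"
    by (rule distributed_emeasure[OF increment_distr[OF assms(1,2)]]) (use S in auto)
  also have "\<dots> = (\<integral>\<^sup>+x. (\<Prod>i\<in>UNIV. ennreal (normal_density 0 (sqrt (b - a)) (x $ i)) * indicator (A i) (x $ i)) \<partial>(lborel :: (real^'n) measure))"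
  proof (rule nn_integral_cong)
    fix x :: "real ^ 'n"
    have "indicator {x::real^'n. \<forall>i. x $ i \<in> A i} x = (\<Prod>i\<in>UNIV. indicator (A i) (x $ i) :: ennreal)"
      by (auto simp: indicator_def prod_zero_iff)
    then show "?d x * indicator {x::real^'n. \<forall>i. x $ i \<in> A i} x = (\<Prod>i\<in>UNIV. ennreal (normal_density 0 (sqrt (b - a)) (x $ i)) * indicator (A i) (x $ i))"
      by (simp add: prod.distrib prod_ennreal[symmetric])
  qed
  also have "\<dots> = (\<Prod>i\<in>UNIV. \<integral>\<^sup>+x. ennreal (normal_density 0 (sqrt (b - a)) x) * indicator (A i) x \<partial>lborel)"
    by (rule nn_integral_lborel_prod_vec) auto
  finally show ?thesis .
qed

lemma normal_density_total:
  assumes "\<sigma> > 0" shows "(\<integral>\<^sup>+x. ennreal (normal_density 0 \<sigma> x) \<partial>lborel) = 1"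
  using prob_space.emeasure_space_1[OF prob_space_normal_density[OF assms, of 0]]
  by (simp add: emeasure_density)

lemma inc_distributed:
  assumes "0 \<le> a" "a < b"
  shows "distributed M lborel (inc i a b) (normal_density 0 (sqrt (b - a)))"
proof -
  have [measurable]: "inc i a b \<in> borel_measurable M" using inc_measurable assms by auto
  have "distr M lborel (inc i a b) = density lborel (normal_density 0 (sqrt (b - a)))"
  proof (rule measure_eqI)
    fix A assume "A \<in> sets (distr M lborel (inc i a b))"
    then have A[measurable]: "A \<in> sets borel" by simp
    have "emeasure (distr M lborel (inc i a b)) A = emeasure M (inc i a b -` A \<inter> space M)"
      by (rule emeasure_distr) auto
    also have "\<dots> = emeasure M {\<omega>\<in>space M. \<forall>j. inc j a b \<omega> \<in> (if j = i then A else UNIV)}"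
      by (rule arg_cong[where f="emeasure M"]) auto
    also have "\<dots> = (\<Prod>j\<in>UNIV. \<integral>\<^sup>+x. ennreal (normal_density 0 (sqrt (b - a)) x) * indicator (if j = i then A else UNIV) x \<partial>lborel)"
      by (rule increment_rectangle[OF assms]) auto
    also have "\<dots> = (\<Prod>j\<in>UNIV. if j = i then \<integral>\<^sup>+x. ennreal (normal_density 0 (sqrt (b - a)) x) * indicator A x \<partial>lborel else 1)"
      using assms by (intro prod.cong) (auto simp: normal_density_total)
    also have "\<dots> = emeasure (density lborel (normal_density 0 (sqrt (b - a)))) A"
      by (simp add: emeasure_density)
    finally show "emeasure (distr M lborel (inc i a b)) A = emeasure (density lborel (normal_density 0 (sqrt (b - a)))) A" .
  qed simp
  then show ?thesis unfolding distributed_def by auto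
qed

lemma inc_indep:
  assumes "0 \<le> a" "a < b" "i \<noteq> j"
  shows "indep_var borel (inc i a b) borel (inc j a b)"
proof -
  have [measurable]: "inc i a b \<in> borel_measurable M" for i using inc_measurable assms by auto
  let ?E = "\<lambda>i. {inc i a b -` A \<inter> space M |A. A \<in> sets (borel :: real measure)}"
  have nd: "emeasure M (inc k a b -` A \<inter> space M) = (\<integral>\<^sup>+x. ennreal (normal_density 0 (sqrt (b - a)) x) * indicator A x \<partial>lborel)"
    if "A \<in> sets borel" for A k
    by (rule distributed_emeasure[OF inc_distributed[OF assms(1,2)]]) (use that in auto)
  have "indep_set (?E i) (?E j)"
  proof (rule indep_setI)
    show "?E i \<subseteq> events" "?E j \<subseteq> events" by auto
  next
    fix U V assume "U \<in> ?E i" "V \<in> ?E j"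
    then obtain A C where A[measurable]: "A \<in> sets borel" "C \<in> sets borel"
       and U: "U = inc i a b -` A \<inter> space M" and V: "V = inc j a b -` C \<inter> space M" by auto
    let ?G = "\<lambda>k. if k = i then A else if k = j then C else UNIV"
    have "emeasure M (U \<inter> V) = emeasure M {\<omega>\<in>space M. \<forall>k. inc k a b \<omega> \<in> ?G k}"
      unfolding U V using assms(3) by (intro arg_cong[where f="emeasure M"]) auto
    also have "\<dots> = (\<Prod>k\<in>UNIV. \<integral>\<^sup>+x. ennreal (normal_density 0 (sqrt (b - a)) x) * indicator (?G k) x \<partial>lborel)"
      by (rule increment_rectangle[OF assms(1,2)]) auto
    \<comment> \<open>Each factor splits into an i-part and a j-part because the two indices differ;
      every other coordinate contributes total mass 1.\<close>
    also have "\<dots> = (\<Prod>k\<in>UNIV. (if k = i then emeasure M U else 1) * (if k = j then emeasure M V else 1))"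
      using assms by (intro prod.cong) (auto simp: normal_density_total U V nd)
    also have "\<dots> = emeasure M U * emeasure M V" by (simp add: prod.distrib)
    finally show "prob (U \<inter> V) = prob U * prob V"
      by (simp add: measure_def enn2real_mult)
  qed
  moreover have "Int_stable (?E k)" for k by (rule Int_stable_vimage_sets)
  ultimately show ?thesis
    unfolding indep_var_eq by (auto intro!: indep_set_sigma_sets)
qed

lemma inc_moment_integrable:
  assumes "0 \<le> a" "a < b"
  shows "integrable M (\<lambda>\<omega>. inc i a b \<omega> ^ k)"
proof -
  have "integrable lborel (\<lambda>x. normal_density 0 (sqrt (b - a)) x * x ^ k)"
    using integrable_normal_moment[of "sqrt (b - a)" 0 k] assms by simp
  then show ?thesis
    by (subst (asm) distributed_integrable[OF inc_distributed[OF assms, of i]]) auto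
qed

lemma inc_moment_eq:
  assumes "0 \<le> a" "a < b"
  shows "expectation (\<lambda>\<omega>. inc i a b \<omega> ^ k) = (\<integral>x. normal_density 0 (sqrt (b - a)) x * x ^ k \<partial>lborel)"
  by (subst distributed_integral[OF inc_distributed[OF assms, of i]]) auto

lemma inc_moments:
  assumes "0 \<le> a" "a < b"
  shows "expectation (\<lambda>\<omega>. inc i a b \<omega>) = 0" "expectation (\<lambda>\<omega>. inc i a b \<omega> ^ 2) = b - a"
    "expectation (\<lambda>\<omega>. inc i a b \<omega> ^ 3) = 0" "expectation (\<lambda>\<omega>. inc i a b \<omega> ^ 4) = 3 * (b - a)\<^sup>2"
proof -
  have p: "sqrt (b - a) > 0" using assms by simp
  show "expectation (\<lambda>\<omega>. inc i a b \<omega>) = 0"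
    using inc_moment_eq[OF assms, of i 1] integral_normal_moment_odd[OF p, of 0 0] by simp
  show "expectation (\<lambda>\<omega>. inc i a b \<omega> ^ 2) = b - a"
    using inc_moment_eq[OF assms, of i 2] integral_normal_moment_even[OF p, of 0 1] assms by simp
  show "expectation (\<lambda>\<omega>. inc i a b \<omega> ^ 3) = 0"
    using inc_moment_eq[OF assms, of i 3] integral_normal_moment_odd[OF p, of 0 1] by simp
  show "expectation (\<lambda>\<omega>. inc i a b \<omega> ^ 4) = 3 * (b - a)\<^sup>2"
    using inc_moment_eq[OF assms, of i 4] integral_normal_moment_even[OF p, of 0 2] assms
    by (simp add: fact_numeral power2_eq_square field_simps)
qed

text \<open>Preimages under \<eta> lie in \<open>F a\<close> and preimages under \<open>f\<close> of
  the increment lie in the algebra generated by the increment, so both inherit the independence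
  required of a Brownian motion and the expectation factors. Every martingale computation below
  rests on this fact.\<close>

lemma expectation_F_mult_increment:
  fixes f :: "real ^ 'n \<Rightarrow> real"
  assumes ab: "0 \<le> a" "a < b" and [measurable]: "f \<in> borel_measurable borel"
    and \<eta>: "\<eta> \<in> borel_measurable (F a)" "integrable M \<eta>"
    and f: "integrable M (\<lambda>\<omega>. f (B b \<omega> - B a \<omega>))"
  shows "integrable M (\<lambda>\<omega>. \<eta> \<omega> * f (B b \<omega> - B a \<omega>))"
    and "expectation (\<lambda>\<omega>. \<eta> \<omega> * f (B b \<omega> - B a \<omega>)) = expectation \<eta> * expectation (\<lambda>\<omega>. f (B b \<omega> - B a \<omega>))"
proof -
  let ?D = "\<lambda>\<omega>. B b \<omega> - B a \<omega>"
  have [measurable]: "?D \<in> borel_measurable M" using ab by auto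
  have [measurable]: "\<eta> \<in> borel_measurable M" using \<eta>(2) by auto
  let ?E1 = "{\<eta> -` A \<inter> space M |A. A \<in> sets (borel :: real measure)}"
  let ?E2 = "{(\<lambda>\<omega>. f (?D \<omega>)) -` A \<inter> space M |A. A \<in> sets (borel :: real measure)}"
  have 1: "?E1 \<subseteq> sets (F a)" using \<eta>(1) by (auto simp: measurable_def space_F)
  have 2: "?E2 \<subseteq> sets (vimage_algebra (space M) ?D borel)"
  proof
    fix U assume "U \<in> ?E2"
    then obtain A where "A \<in> sets borel" "U = ?D -` (f -` A) \<inter> space M" by auto
    moreover from this have "f -` A \<in> sets borel" using measurable_sets[of f borel borel A] by auto
    ultimately show "U \<in> sets (vimage_algebra (space M) ?D borel)" by (auto intro: in_vimage_algebra)
  qed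
  have "indep_set ?E1 ?E2"
  proof (rule indep_setI)
    show "?E1 \<subseteq> events" using 1 indep_setD_ev1[OF increment_indep[OF ab]] by (rule subset_trans)
    show "?E2 \<subseteq> events" using 2 indep_setD_ev2[OF increment_indep[OF ab]] by (rule subset_trans)
    show "prob (U \<inter> V) = prob U * prob V" if "U \<in> ?E1" "V \<in> ?E2" for U V
      by (rule indep_setD[OF increment_indep[OF ab]]) (use 1 2 that in blast)+
  qed
  moreover have "Int_stable ?E1" by (rule Int_stable_vimage_sets)
  moreover have "Int_stable ?E2" by (rule Int_stable_vimage_sets)
  ultimately have I: "indep_var borel \<eta> borel (\<lambda>\<omega>. f (?D \<omega>))"
    unfolding indep_var_eq by (auto intro!: indep_set_sigma_sets)
  show "integrable M (\<lambda>\<omega>. \<eta> \<omega> * f (?D \<omega>))" by (rule indep_var_integrable[OF I \<eta>(2) f])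
  show "expectation (\<lambda>\<omega>. \<eta> \<omega> * f (?D \<omega>)) = expectation \<eta> * expectation (\<lambda>\<omega>. f (?D \<omega>))"
    by (rule indep_var_lebesgue_integral[OF I \<eta>(2) f])
qed

section \<open>Moments and covariances of increments against weights from the past\<close>

lemma inc_self [simp]: "inc i a a = (\<lambda>\<omega>. 0)"
  by (auto simp: inc_def)

text \<open>The exponent is a successor so that in the degenerate case \<open>a = b\<close> both
  sides vanish.\<close>

lemma F_mult_power_inc:
  assumes ab: "0 \<le> a" "a \<le> b" and \<eta>: "\<eta> \<in> borel_measurable (F a)" "integrable M \<eta>"
  shows "integrable M (\<lambda>\<omega>. \<eta> \<omega> * inc i a b \<omega> ^ Suc k)"
    and "expectation (\<lambda>\<omega>. \<eta> \<omega> * inc i a b \<omega> ^ Suc k) = expectation \<eta> * expectation (\<lambda>\<omega>. inc i a b \<omega> ^ Suc k)"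
proof -
  have "integrable M (\<lambda>\<omega>. \<eta> \<omega> * inc i a b \<omega> ^ Suc k) \<and>
    expectation (\<lambda>\<omega>. \<eta> \<omega> * inc i a b \<omega> ^ Suc k) = expectation \<eta> * expectation (\<lambda>\<omega>. inc i a b \<omega> ^ Suc k)"
  proof (cases "a = b")
    case False
    then have ab': "a < b" using ab by simp
    have m: "(\<lambda>x::real^'n. (x $ i) ^ Suc k) \<in> borel_measurable borel"
      by (intro borel_measurable_power borel_measurable_nth)
    show ?thesis
      using expectation_F_mult_increment[OF ab(1) ab' m \<eta>] inc_moment_integrable[OF ab(1) ab', of i "Suc k"]
      by (simp add: inc_def)
  qed simp
  then show "integrable M (\<lambda>\<omega>. \<eta> \<omega> * inc i a b \<omega> ^ Suc k)"
    "expectation (\<lambda>\<omega>. \<eta> \<omega> * inc i a b \<omega> ^ Suc k) = expectation \<eta> * expectation (\<lambda>\<omega>. inc i a b \<omega> ^ Suc k)"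
    by blast+
qed

lemma inc_moments':
  assumes "0 \<le> a" "a \<le> b"
  shows "expectation (\<lambda>\<omega>. inc i a b \<omega>) = 0" "expectation (\<lambda>\<omega>. inc i a b \<omega> ^ 2) = b - a"
    "expectation (\<lambda>\<omega>. inc i a b \<omega> ^ 3) = 0" "expectation (\<lambda>\<omega>. inc i a b \<omega> ^ 4) = 3 * (b - a)\<^sup>2"
  using inc_moments[of a b i] assms by (cases "a = b"; simp)+

lemma F_mult_inc:
  assumes ab: "0 \<le> a" "a \<le> b" and \<eta>: "\<eta> \<in> borel_measurable (F a)" "integrable M \<eta>"
  shows "integrable M (\<lambda>\<omega>. \<eta> \<omega> * inc i a b \<omega>)"
    and "expectation (\<lambda>\<omega>. \<eta> \<omega> * inc i a b \<omega>) = 0"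
  using F_mult_power_inc[OF assms, of i 0] inc_moments'[OF ab, of i] by simp_all

lemma F_mult_inc_inc:
  assumes ab: "0 \<le> a" "a \<le> b" and \<eta>: "\<eta> \<in> borel_measurable (F a)" "integrable M \<eta>"
  shows "integrable M (\<lambda>\<omega>. \<eta> \<omega> * (inc i a b \<omega> * inc j a b \<omega>))"
    and "expectation (\<lambda>\<omega>. \<eta> \<omega> * (inc i a b \<omega> * inc j a b \<omega>)) = (if i = j then (b - a) * expectation \<eta> else 0)"
proof -
  have "integrable M (\<lambda>\<omega>. \<eta> \<omega> * (inc i a b \<omega> * inc j a b \<omega>)) \<and>
    expectation (\<lambda>\<omega>. \<eta> \<omega> * (inc i a b \<omega> * inc j a b \<omega>)) = (if i = j then (b - a) * expectation \<eta> else 0)"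
  proof (cases "i = j \<or> a = b")
    case True
    then show ?thesis
      using F_mult_power_inc[OF assms, of i 1] inc_moments'[OF ab, of i] by (auto simp: power2_eq_square)
  next
    case False
    then have ab': "a < b" and ij: "i \<noteq> j" using ab by auto
    have m: "(\<lambda>x::real^'n. x $ i * x $ j) \<in> borel_measurable borel"
      by (intro borel_measurable_times borel_measurable_nth)
    have i1: "integrable M (inc k a b)" for k
      using inc_moment_integrable[OF ab(1) ab', of k 1] by simp
    have i2: "integrable M (\<lambda>\<omega>. inc i a b \<omega> * inc j a b \<omega>)"
      by (rule indep_var_integrable[OF inc_indep[OF ab(1) ab' ij] i1 i1])
    have e: "expectation (\<lambda>\<omega>. inc i a b \<omega> * inc j a b \<omega>) = 0"
      using indep_var_lebesgue_integral[OF inc_indep[OF ab(1) ab' ij] i1 i1] inc_moments'[OF ab] by simp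
    show ?thesis
      using expectation_F_mult_increment[OF ab(1) ab' m \<eta>] i2 e ij by (simp add: inc_def)
  qed
  then show "integrable M (\<lambda>\<omega>. \<eta> \<omega> * (inc i a b \<omega> * inc j a b \<omega>))"
    "expectation (\<lambda>\<omega>. \<eta> \<omega> * (inc i a b \<omega> * inc j a b \<omega>)) = (if i = j then (b - a) * expectation \<eta> else 0)"
    by blast+
qed

definition bounded_F :: "real \<Rightarrow> ('w \<Rightarrow> real) \<Rightarrow> bool" where
  "bounded_F s \<xi> \<longleftrightarrow> \<xi> \<in> borel_measurable (F s) \<and> (\<exists>C. \<forall>\<omega>\<in>space M. \<bar>\<xi> \<omega>\<bar> \<le> C)"

lemma bounded_F_measurable: "bounded_F s \<xi> \<Longrightarrow> \<xi> \<in> borel_measurable (F s)"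
  unfolding bounded_F_def by blast

lemma bounded_F_mono: "bounded_F s \<xi> \<Longrightarrow> s \<le> t \<Longrightarrow> bounded_F t \<xi>"
  unfolding bounded_F_def using measurable_F_mono by blast

lemma bounded_F_mult:
  assumes "bounded_F s \<xi>" "bounded_F s \<zeta>" shows "bounded_F s (\<lambda>\<omega>. \<xi> \<omega> * \<zeta> \<omega>)"
proof -
  obtain C D where "\<forall>\<omega>\<in>space M. \<bar>\<xi> \<omega>\<bar> \<le> C" "\<forall>\<omega>\<in>space M. \<bar>\<zeta> \<omega>\<bar> \<le> D"
    using assms unfolding bounded_F_def by blast
  then have "\<forall>\<omega>\<in>space M. \<bar>\<xi> \<omega> * \<zeta> \<omega>\<bar> \<le> C * D"
    by (metis abs_ge_zero abs_mult mult_mono order_trans)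
  then show ?thesis
    using assms unfolding bounded_F_def by auto
qed

lemma bounded_F_integrable: "bounded_F s \<xi> \<Longrightarrow> integrable M \<xi>"
  unfolding bounded_F_def using measurable_F_M
  by (auto intro!: integrable_const_bound AE_I2)

lemma bounded_F_const [simp]: "bounded_F s (\<lambda>_. c)"
  unfolding bounded_F_def by auto

text \<open>Cutting the two windows at \<open>c\<close> and at \<open>min b d\<close> leaves one
  common piece and otherwise products whose last factor is an increment over times after everything
  else, which has mean zero against the rest. The common piece contributes its length if the
  coordinates agree and nothing otherwise.\<close>

lemma covariance_aux:
  assumes ab: "0 \<le> a" "a \<le> c" "a \<le> b" and cd: "c \<le> d"
    and \<zeta>: "bounded_F a \<zeta>" and \<xi>: "bounded_F c \<xi>"
  shows "integrable M (\<lambda>\<omega>. (\<zeta> \<omega> * inc i a b \<omega>) * (\<xi> \<omega> * inc j c d \<omega>)) \<and>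
     expectation (\<lambda>\<omega>. (\<zeta> \<omega> * inc i a b \<omega>) * (\<xi> \<omega> * inc j c d \<omega>)) =
     (if i = j then expectation (\<lambda>\<omega>. \<zeta> \<omega> * \<xi> \<omega>) * max 0 (min b d - c) else 0)"
proof -
  have bm: "bounded_F t (\<lambda>\<omega>. \<zeta> \<omega> * \<xi> \<omega>)" if "c \<le> t" for t
    using bounded_F_mult[OF bounded_F_mono[OF \<zeta>] bounded_F_mono[OF \<xi>]] ab that by simp
  have pre: "integrable M (\<lambda>\<omega>. (\<zeta> \<omega> * \<xi> \<omega>) * inc i a' b' \<omega> * inc j c' d' \<omega>) \<and>
      expectation (\<lambda>\<omega>. (\<zeta> \<omega> * \<xi> \<omega>) * inc i a' b' \<omega> * inc j c' d' \<omega>) = 0"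
    if "0 \<le> a'" "a' \<le> b'" "b' \<le> c'" "c' \<le> d'" "c \<le> c'"
      "integrable M (\<lambda>\<omega>. (\<zeta> \<omega> * \<xi> \<omega>) * inc i a' b' \<omega>)" for a' b' c' d'
  proof -
    have "(\<lambda>\<omega>. (\<zeta> \<omega> * \<xi> \<omega>) * inc i a' b' \<omega>) \<in> borel_measurable (F c')"
      using bounded_F_measurable[OF bm[OF that(5)]] measurable_F_mono[OF inc_measurable_F[OF that(1,2)] that(3)]
      by (rule borel_measurable_times)
    then show ?thesis using F_mult_inc[of c' d' "(\<lambda>\<omega>. (\<zeta> \<omega> * \<xi> \<omega>) * inc i a' b' \<omega>)"] that by auto
  qed
  obtain C where C: "\<forall>\<omega>\<in>space M. \<bar>\<xi> \<omega>\<bar> \<le> C" using \<xi> unfolding bounded_F_def by blast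
  \<comment> \<open>The weight \<xi> is measurable only from time \<open>c\<close> on. For
    increments that begin earlier, integrability comes from domination by \<open>C\<close> times the
    product without \<xi>.\<close>
  have int: "integrable M (\<lambda>\<omega>. (\<zeta> \<omega> * \<xi> \<omega>) * inc k a' b' \<omega>)" if "a \<le> a'" "a' \<le> b'" for a' b' k
  proof -
    have i: "integrable M (\<lambda>\<omega>. \<zeta> \<omega> * inc k a' b' \<omega>)"
      using F_mult_inc[of a' b' \<zeta>] ab that bounded_F_mono[OF \<zeta>] bounded_F_measurable bounded_F_integrable \<zeta>
      by simp
    have "integrable M (\<lambda>\<omega>. C * (\<zeta> \<omega> * inc k a' b' \<omega>))" by (intro integrable_mult_right i)
    then show ?thesis
    proof (rule Bochner_Integration.integrable_bound)
      show "(\<lambda>\<omega>. (\<zeta> \<omega> * \<xi> \<omega>) * inc k a' b' \<omega>) \<in> borel_measurable M"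
        by (intro borel_measurable_times inc_measurable measurable_F_M[OF bounded_F_measurable[OF \<zeta>]]
            measurable_F_M[OF bounded_F_measurable[OF \<xi>]]) (use ab that in auto)
      show "AE \<omega> in M. norm ((\<zeta> \<omega> * \<xi> \<omega>) * inc k a' b' \<omega>) \<le> norm (C * (\<zeta> \<omega> * inc k a' b' \<omega>))"
        using C by (intro AE_I2) (auto simp: abs_mult mult.assoc mult.left_commute[of _ "\<bar>\<xi> _\<bar>"] intro!: mult_right_mono)
    qed
  qed
  show ?thesis
  proof (cases "b \<le> c")
    case True
    then have "min b d - c \<le> 0" by simp
    then show ?thesis
      using pre[OF ab(1,3) True cd order_refl int[OF order_refl ab(3)]] by (simp add: ac_simps)
  next
    case False
    define e where "e = min b d"
    have e: "c \<le> e" "e \<le> b" "e \<le> d" using False cd unfolding e_def by auto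
    have c0: "0 \<le> c" using ab by simp
    have eq: "inc i a b \<omega> = inc i a c \<omega> + inc i c e \<omega> + inc i e b \<omega>" "inc j c d \<omega> = inc j c e \<omega> + inc j e d \<omega>" for \<omega>
      by (auto simp: inc_def)
    \<comment> \<open>At most one of the two windows extends beyond their common end
      \<open>e\<close>, so the product of the two tails is zero.\<close>
    have z: "inc i e b \<omega> * inc j e d \<omega> = 0" for \<omega> unfolding e_def by (auto simp: min_def)
    have dec: "(\<zeta> \<omega> * inc i a b \<omega>) * (\<xi> \<omega> * inc j c d \<omega>) =
        (\<zeta> \<omega> * \<xi> \<omega>) * inc i a c \<omega> * inc j c d \<omega>
      + (\<zeta> \<omega> * \<xi> \<omega>) * (inc i c e \<omega> * inc j c e \<omega>)
      + (\<zeta> \<omega> * \<xi> \<omega>) * inc i c e \<omega> * inc j e d \<omega>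
      + (\<zeta> \<omega> * \<xi> \<omega>) * inc j c e \<omega> * inc i e b \<omega>" for \<omega>
      using z[of \<omega>] by (simp add: eq algebra_simps)
    have 1: "integrable M (\<lambda>\<omega>. (\<zeta> \<omega> * \<xi> \<omega>) * inc i a c \<omega> * inc j c d \<omega>)"
        "expectation (\<lambda>\<omega>. (\<zeta> \<omega> * \<xi> \<omega>) * inc i a c \<omega> * inc j c d \<omega>) = 0"
      using pre[OF ab(1,2) order_refl cd order_refl int[OF order_refl ab(2)]] by auto
    have 2: "integrable M (\<lambda>\<omega>. (\<zeta> \<omega> * \<xi> \<omega>) * (inc i c e \<omega> * inc j c e \<omega>))"
        "expectation (\<lambda>\<omega>. (\<zeta> \<omega> * \<xi> \<omega>) * (inc i c e \<omega> * inc j c e \<omega>)) =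
          (if i = j then (e - c) * expectation (\<lambda>\<omega>. \<zeta> \<omega> * \<xi> \<omega>) else 0)"
      using F_mult_inc_inc[OF c0 e(1) bounded_F_measurable[OF bm[OF order_refl]] bounded_F_integrable[OF bm[OF order_refl]]] by auto
    have me: "inc k c e \<in> borel_measurable (F e)" for k using c0 e by (intro inc_measurable_F) auto
    have mm: "(\<lambda>\<omega>. (\<zeta> \<omega> * \<xi> \<omega>) * inc k c e \<omega>) \<in> borel_measurable (F e)" for k
      using bounded_F_measurable[OF bm[OF e(1)]] me by (rule borel_measurable_times)
    have 3: "integrable M (\<lambda>\<omega>. (\<zeta> \<omega> * \<xi> \<omega>) * inc i c e \<omega> * inc j e d \<omega>)"
        "expectation (\<lambda>\<omega>. (\<zeta> \<omega> * \<xi> \<omega>) * inc i c e \<omega> * inc j e d \<omega>) = 0"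
      using F_mult_inc[OF _ e(3) mm[of i] int[OF ab(2) e(1)]] c0 e by auto
    have 4: "integrable M (\<lambda>\<omega>. (\<zeta> \<omega> * \<xi> \<omega>) * inc j c e \<omega> * inc i e b \<omega>)"
        "expectation (\<lambda>\<omega>. (\<zeta> \<omega> * \<xi> \<omega>) * inc j c e \<omega> * inc i e b \<omega>) = 0"
      using F_mult_inc[OF _ e(2) mm[of j] int[OF ab(2) e(1)]] c0 e by auto
    have "max 0 (min b d - c) = e - c" using e unfolding e_def by simp
    then show ?thesis unfolding dec using 1 2 3 4 by (simp add: mult.commute)
  qed
qed

lemma covariance:
  assumes ab: "0 \<le> a" "a \<le> b" and cd: "0 \<le> c" "c \<le> d"
    and \<zeta>: "bounded_F a \<zeta>" and \<xi>: "bounded_F c \<xi>"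
  shows "integrable M (\<lambda>\<omega>. (\<zeta> \<omega> * inc i a b \<omega>) * (\<xi> \<omega> * inc j c d \<omega>))"
    and "expectation (\<lambda>\<omega>. (\<zeta> \<omega> * inc i a b \<omega>) * (\<xi> \<omega> * inc j c d \<omega>)) =
     (if i = j then expectation (\<lambda>\<omega>. \<zeta> \<omega> * \<xi> \<omega>) * max 0 (min b d - max a c) else 0)"
proof -
  have "integrable M (\<lambda>\<omega>. (\<zeta> \<omega> * inc i a b \<omega>) * (\<xi> \<omega> * inc j c d \<omega>)) \<and>
    expectation (\<lambda>\<omega>. (\<zeta> \<omega> * inc i a b \<omega>) * (\<xi> \<omega> * inc j c d \<omega>)) =
     (if i = j then expectation (\<lambda>\<omega>. \<zeta> \<omega> * \<xi> \<omega>) * max 0 (min b d - max a c) else 0)"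
  proof (cases "a \<le> c")
    case True
    then show ?thesis using covariance_aux[OF ab(1) True ab(2) cd(2) \<zeta> \<xi>] by (simp add: max_absorb2)
  next
    case False
    then have "c \<le> a" by simp
    then show ?thesis using covariance_aux[OF cd(1) _ cd(2) ab(2) \<xi> \<zeta>, of j i] False
      by (simp add: max_absorb1 ac_simps min.commute eq_commute[of j i])
  qed
  then show "integrable M (\<lambda>\<omega>. (\<zeta> \<omega> * inc i a b \<omega>) * (\<xi> \<omega> * inc j c d \<omega>))"
    "expectation (\<lambda>\<omega>. (\<zeta> \<omega> * inc i a b \<omega>) * (\<xi> \<omega> * inc j c d \<omega>)) =
     (if i = j then expectation (\<lambda>\<omega>. \<zeta> \<omega> * \<xi> \<omega>) * max 0 (min b d - max a c) else 0)" by blast+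
qed

text \<open>Each new increment is independent of the past and has vanishing odd moments, so only
  even powers survive when the next partial sum is expanded. The bound on the fourth moment
  reproduces itself because its recursion is 3 K^4 times the expansion of
  \<open>(x + d)\<^sup>2\<close>, with x the elapsed time and d the new step; the middle term of
  this square is why the second moment is carried along.\<close>

lemma discrete_integral_moments:
  fixes t :: "nat \<Rightarrow> real" and \<zeta> :: "nat \<Rightarrow> 'w \<Rightarrow> real" and i :: 'n
  assumes t0: "0 \<le> t 0" and t: "\<And>k. k < m \<Longrightarrow> t k \<le> t (Suc k)"
    and \<zeta>: "\<And>k. k < m \<Longrightarrow> \<zeta> k \<in> borel_measurable (F (t k))"
    and K: "\<And>k \<omega>. k < m \<Longrightarrow> \<omega> \<in> space M \<Longrightarrow> \<bar>\<zeta> k \<omega>\<bar> \<le> K"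
    and K0: "0 \<le> K"
  defines "S \<equiv> \<lambda>k \<omega>. \<Sum>l<k. \<zeta> l \<omega> * inc i (t l) (t (Suc l)) \<omega>"
  assumes n: "n \<le> m"
  shows "0 \<le> t n \<and> t 0 \<le> t n \<and> S n \<in> borel_measurable (F (t n)) \<and>
     integrable M (\<lambda>\<omega>. S n \<omega> ^ 4) \<and>
     expectation (\<lambda>\<omega>. S n \<omega> ^ 2) \<le> K\<^sup>2 * (t n - t 0) \<and>
     expectation (\<lambda>\<omega>. S n \<omega> ^ 4) \<le> 3 * K ^ 4 * (t n - t 0)\<^sup>2"
  using n
proof (induction n)
  case 0
  then show ?case using t0 by (simp add: S_def)
next
  case (Suc n)
  then have IH: "0 \<le> t n" "t 0 \<le> t n" "S n \<in> borel_measurable (F (t n))" "integrable M (\<lambda>\<omega>. S n \<omega> ^ 4)"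
     "expectation (\<lambda>\<omega>. S n \<omega> ^ 2) \<le> K\<^sup>2 * (t n - t 0)"
     "expectation (\<lambda>\<omega>. S n \<omega> ^ 4) \<le> 3 * K ^ 4 * (t n - t 0)\<^sup>2" and n: "n < m" by auto
  note tn = t[OF n]
  let ?d = "t (Suc n) - t n"
  have d0: "0 \<le> ?d" using tn by simp
  note mz = \<zeta>[OF n]
  have [measurable]: "S n \<in> borel_measurable M" "\<zeta> n \<in> borel_measurable M"
    using IH(3) mz measurable_F_M by auto
  let ?D = "inc i (t n) (t (Suc n))"
  have SS: "S (Suc n) \<omega> = S n \<omega> + \<zeta> n \<omega> * ?D \<omega>" for \<omega> by (simp add: S_def)
  \<comment> \<open>The induction carries integrability of the fourth power only; this domination
    yields it for all lower powers.\<close>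
  have pw: "\<bar>x\<bar> ^ j \<le> 1 + x ^ 4" if "j \<le> 4" for x :: real and j
  proof (cases "\<bar>x\<bar> \<le> 1")
    case True
    then have "\<bar>x\<bar> ^ j \<le> 1" by (simp add: power_le_one)
    then show ?thesis by (smt (verit) zero_le_even_power even_numeral)
  next
    case False
    then have "\<bar>x\<bar> ^ j \<le> \<bar>x\<bar> ^ 4" using that by (intro power_increasing) auto
    then show ?thesis by (simp add: power_even_abs)
  qed
  have intSz: "integrable M (\<lambda>\<omega>. S n \<omega> ^ j * \<zeta> n \<omega> ^ k)" if "j \<le> 4" for j k
  proof (rule Bochner_Integration.integrable_bound)
    show "integrable M (\<lambda>\<omega>. K ^ k * (1 + S n \<omega> ^ 4))" using IH(4) by simp
    have "\<bar>S n \<omega>\<bar> ^ j * \<bar>\<zeta> n \<omega>\<bar> ^ k \<le> K ^ k * (1 + S n \<omega> ^ 4)" if "\<omega> \<in> space M" for \<omega>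
      using pw[OF \<open>j \<le> 4\<close>, of "S n \<omega>"] power_mono[OF K[OF n that], of k]
      by (subst mult.commute) (intro mult_mono, auto simp: K0)
    then show "AE \<omega> in M. norm (S n \<omega> ^ j * \<zeta> n \<omega> ^ k) \<le> norm (K ^ k * (1 + S n \<omega> ^ 4))"
      by (intro AE_I2) (auto simp: abs_mult power_abs K0)
  qed simp
  have mSz: "(\<lambda>\<omega>. S n \<omega> ^ j * \<zeta> n \<omega> ^ k) \<in> borel_measurable (F (t n))" for j k
    using IH(3) mz by measurable
  have E: "integrable M (\<lambda>\<omega>. S n \<omega> ^ j * \<zeta> n \<omega> ^ k * ?D \<omega> ^ Suc l)"
     "expectation (\<lambda>\<omega>. S n \<omega> ^ j * \<zeta> n \<omega> ^ k * ?D \<omega> ^ Suc l) = expectation (\<lambda>\<omega>. S n \<omega> ^ j * \<zeta> n \<omega> ^ k) * expectation (\<lambda>\<omega>. ?D \<omega> ^ Suc l)"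
    if "j \<le> 4" for j k l
    using F_mult_power_inc[OF IH(1) tn mSz intSz[OF that]] by auto
  note mom = inc_moments'[OF IH(1) tn, of i]
  have i2: "integrable M (\<lambda>\<omega>. S n \<omega> ^ j)" if "j \<le> 4" for j using intSz[of j 0] that by simp
  have z2: "expectation (\<lambda>\<omega>. \<zeta> n \<omega> ^ 2) \<le> K\<^sup>2"
  proof -
    have "expectation (\<lambda>\<omega>. \<zeta> n \<omega> ^ 2) \<le> expectation (\<lambda>\<omega>. K\<^sup>2)"
      using intSz[of 0 2] K[OF n] by (intro integral_mono) (auto simp: abs_le_square_iff[symmetric] K0)
    then show ?thesis by (simp add: prob_space)
  qed
  have z4: "expectation (\<lambda>\<omega>. \<zeta> n \<omega> ^ 4) \<le> K ^ 4"
  proof -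
    have "expectation (\<lambda>\<omega>. \<zeta> n \<omega> ^ 4) \<le> expectation (\<lambda>\<omega>. K ^ 4)"
      using intSz[of 0 4] K[OF n] power_mono[OF K[OF n], of _ 4] by (intro integral_mono) (auto simp: power_even_abs)
    then show ?thesis by (simp add: prob_space)
  qed
  have sz: "expectation (\<lambda>\<omega>. S n \<omega> ^ 2 * \<zeta> n \<omega> ^ 2) \<le> K\<^sup>2 * (K\<^sup>2 * (t n - t 0))"
  proof -
    have "expectation (\<lambda>\<omega>. S n \<omega> ^ 2 * \<zeta> n \<omega> ^ 2) \<le> expectation (\<lambda>\<omega>. S n \<omega> ^ 2 * K\<^sup>2)"
      using intSz[of 2 2] i2[of 2] K[OF n] by (intro integral_mono) (auto simp: abs_le_square_iff[symmetric] K0 intro!: mult_left_mono)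
    also have "\<dots> \<le> (K\<^sup>2 * (t n - t 0)) * K\<^sup>2" using IH(5) by (simp add: mult_right_mono)
    finally show ?thesis by (simp add: ac_simps)
  qed
  have e2: "S (Suc n) \<omega> ^ 2 = S n \<omega> ^ 2 + 2 * (S n \<omega> ^ 1 * \<zeta> n \<omega> ^ 1 * ?D \<omega> ^ Suc 0) + S n \<omega> ^ 0 * \<zeta> n \<omega> ^ 2 * ?D \<omega> ^ Suc 1" for \<omega>
    unfolding SS by (simp add: power2_eq_square algebra_simps)
  have e4: "S (Suc n) \<omega> ^ 4 = S n \<omega> ^ 4 + 4 * (S n \<omega> ^ 3 * \<zeta> n \<omega> ^ 1 * ?D \<omega> ^ Suc 0) + 6 * (S n \<omega> ^ 2 * \<zeta> n \<omega> ^ 2 * ?D \<omega> ^ Suc 1)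
     + 4 * (S n \<omega> ^ 1 * \<zeta> n \<omega> ^ 3 * ?D \<omega> ^ Suc 2) + S n \<omega> ^ 0 * \<zeta> n \<omega> ^ 4 * ?D \<omega> ^ Suc 3" for \<omega>
    unfolding SS by (simp add: numeral_eq_Suc algebra_simps)
  have E2: "expectation (\<lambda>\<omega>. S (Suc n) \<omega> ^ 2) = expectation (\<lambda>\<omega>. S n \<omega> ^ 2) + expectation (\<lambda>\<omega>. \<zeta> n \<omega> ^ 2) * ?d"
    unfolding e2 using i2[of 2] E(1)[of 1 1 0] E(1)[of 0 2 1] E(2)[of 1 1 0] E(2)[of 0 2 1] mom by (simp add: numeral_eq_Suc)
  have E4: "expectation (\<lambda>\<omega>. S (Suc n) \<omega> ^ 4) = expectation (\<lambda>\<omega>. S n \<omega> ^ 4)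
      + 6 * expectation (\<lambda>\<omega>. S n \<omega> ^ 2 * \<zeta> n \<omega> ^ 2) * ?d + expectation (\<lambda>\<omega>. \<zeta> n \<omega> ^ 4) * (3 * ?d\<^sup>2)"
    unfolding e4 using i2[of 4] E(1)[of 3 1 0] E(1)[of 2 2 1] E(1)[of 1 3 2] E(1)[of 0 4 3]
      E(2)[of 3 1 0] E(2)[of 2 2 1] E(2)[of 1 3 2] E(2)[of 0 4 3] mom by (simp add: numeral_eq_Suc)
  have "expectation (\<lambda>\<omega>. S (Suc n) \<omega> ^ 2) \<le> K\<^sup>2 * (t n - t 0) + K\<^sup>2 * ?d"
    unfolding E2 using IH(5) z2 d0 by (intro add_mono mult_right_mono) auto
  then have r2: "expectation (\<lambda>\<omega>. S (Suc n) \<omega> ^ 2) \<le> K\<^sup>2 * (t (Suc n) - t 0)" by (simp add: algebra_simps)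
  have "expectation (\<lambda>\<omega>. S (Suc n) \<omega> ^ 4) \<le> 3 * K ^ 4 * (t n - t 0)\<^sup>2 + 6 * (K\<^sup>2 * (K\<^sup>2 * (t n - t 0))) * ?d + K ^ 4 * (3 * ?d\<^sup>2)"
    unfolding E4 using IH(6) z4 sz d0 by (intro add_mono mult_right_mono) auto
  also have "\<dots> = 3 * K ^ 4 * (t (Suc n) - t 0)\<^sup>2" by (simp add: numeral_eq_Suc algebra_simps)
  finally have r4: "expectation (\<lambda>\<omega>. S (Suc n) \<omega> ^ 4) \<le> 3 * K ^ 4 * (t (Suc n) - t 0)\<^sup>2" .
  have "integrable M (\<lambda>\<omega>. S (Suc n) \<omega> ^ 4)"
    unfolding e4 by (intro Bochner_Integration.integrable_add integrable_mult_right E(1) i2) auto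
  moreover have "S (Suc n) \<in> borel_measurable (F (t (Suc n)))"
    unfolding SS[abs_def]
    by (intro borel_measurable_add borel_measurable_times inc_measurable_F IH(1) tn
         measurable_F_mono[OF IH(3) tn] measurable_F_mono[OF mz tn])
  ultimately show ?case using r2 r4 IH(1,2) tn by simp
qed

end

section \<open>Integrals of simple integrands\<close>

definition clip :: "real \<Rightarrow> real \<Rightarrow> real \<Rightarrow> real" where
  "clip s u x = max s (min u x)"

lemma clip_mono: "x \<le> y \<Longrightarrow> clip s u x \<le> clip s u y"
  by (auto simp: clip_def)

lemma clip_bounds: "s \<le> u \<Longrightarrow> s \<le> clip s u x" "s \<le> u \<Longrightarrow> clip s u x \<le> u"
  by (auto simp: clip_def)

text \<open>The left side is the overlap length that \<open>covariance\<close> produces for two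
  clipped grid cells, the right side is what the time integral of a product of simple processes
  produces. Their equality is the link in the isometry.\<close>

lemma clip_overlap:
  assumes "s \<le> u"
  shows "max 0 (min (clip s u b) (clip s u d) - max (clip s u a) (clip s u c)) =
    measure lborel ({s..u} \<inter> ({a<..b} \<inter> {c<..d}))"
proof -
  let ?A = "max a c" and ?B = "min b d"
  have 1: "min (clip s u b) (clip s u d) = clip s u ?B" "max (clip s u a) (clip s u c) = clip s u ?A"
    by (auto simp: clip_def)
  have 2: "{a<..b} \<inter> {c<..d} = {?A<..?B}" by auto
  show ?thesis
  proof (cases "?B \<le> ?A")
    case True
    then have "{s..u} \<inter> ({a<..b} \<inter> {c<..d}) = {}" unfolding 2 by auto
    then have "measure lborel ({s..u} \<inter> ({a<..b} \<inter> {c<..d})) = 0" by (simp only: measure_empty)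
    then show ?thesis unfolding 1 using clip_mono[OF True, of s u] by linarith
  next
    case False
    show ?thesis
    proof (cases "s \<le> ?A")
      case True
      have "{s..u} \<inter> {?A<..?B} = {?A<..min u ?B}" using True by auto
      moreover have "clip s u ?A = min u ?A" "clip s u ?B = min u ?B" using True False assms by (auto simp: clip_def)
      moreover have "measure lborel {?A<..min u ?B} = max 0 (min u ?B - min u ?A)"
        using False by (cases "?A \<le> u") (auto simp: not_le)
      ultimately show ?thesis unfolding 1 2 by simp
    next
      case A: False
      have "{s..u} \<inter> {?A<..?B} = {s..min u ?B}" using A by auto
      moreover have "clip s u ?A = s" "clip s u ?B = max s (min u ?B)" using A assms by (auto simp: clip_def)
      ultimately show ?thesis unfolding 1 2 by (auto simp: max_def)
    qed
  qed
qed

lemma simple_integrand_mono: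
  assumes "simple_integrand M F m \<tau> \<xi>"
  shows "i \<le> j \<Longrightarrow> j \<le> m \<Longrightarrow> \<tau> i \<le> \<tau> j"
proof (induction j)
  case (Suc j)
  moreover have "\<tau> j < \<tau> (Suc j)" using assms Suc.prems unfolding simple_integrand_def by simp
  ultimately show ?case by (cases "i = Suc j") auto
qed simp

lemma simple_integrand_nonneg:
  assumes "simple_integrand M F m \<tau> \<xi>" "k \<le> m" shows "0 \<le> \<tau> k"
  using simple_integrand_mono[OF assms(1), of 0 k] assms unfolding simple_integrand_def by auto

text \<open>At any time at most one indicator of the grid is nonzero, so a function that fixes 0
  passes through the sum. Truncating or squaring a simple process is thereby done on its
  coefficients.\<close>

lemma simple_process_map:
  fixes \<xi> :: "nat \<Rightarrow> 'w \<Rightarrow> real"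
  assumes "simple_integrand M F m \<tau> \<zeta>" and f: "f 0 = (0::real)"
  shows "simple_process m \<tau> (\<lambda>k \<omega>. f (\<xi> k \<omega>)) r \<omega> = f (simple_process m \<tau> \<xi> r \<omega>)"
proof (cases "\<exists>k<m. r \<in> {\<tau> k<..\<tau> (Suc k)}")
  case True
  then obtain k where k: "k < m" "r \<in> {\<tau> k<..\<tau> (Suc k)}" by blast
  have "r \<notin> {\<tau> j<..\<tau> (Suc j)}" if "j < m" "j \<noteq> k" for j
  proof (cases "j < k")
    case True
    then show ?thesis using simple_integrand_mono[OF assms(1), of "Suc j" k] k by auto
  next
    case False
    then show ?thesis using simple_integrand_mono[OF assms(1), of "Suc k" j] k that by auto
  qed
  then have "indicator {\<tau> j<..\<tau> (Suc j)} r = (if j = k then 1 else 0 :: real)" if "j < m" for j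
    using k that by (auto simp: indicator_def)
  then have "simple_process m \<tau> \<zeta> r \<omega> = \<zeta> k \<omega>" for \<zeta> :: "nat \<Rightarrow> 'w \<Rightarrow> real"
    unfolding simple_process_def using k by (simp add: if_distrib[of "(*) _"] cong: if_cong)
  then show ?thesis by simp
next
  case False
  then have "simple_process m \<tau> \<zeta> r \<omega> = 0" for \<zeta> :: "nat \<Rightarrow> 'w \<Rightarrow> real"
    unfolding simple_process_def by (intro sum.neutral) auto
  then show ?thesis by (simp add: f)
qed

lemma simple_integrand_map:
  assumes "simple_integrand M F m \<tau> \<xi>" and "f \<in> borel_measurable borel" and "\<And>x::real. \<bar>f x\<bar> \<le> \<bar>x\<bar>"
  shows "simple_integrand M F m \<tau> (\<lambda>k \<omega>. f (\<xi> k \<omega>))"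
  unfolding simple_integrand_def
proof (intro conjI allI impI)
  fix k assume k: "k < m"
  have "\<xi> k \<in> borel_measurable (F (\<tau> k))" using assms(1) k unfolding simple_integrand_def by blast
  then show "(\<lambda>\<omega>. f (\<xi> k \<omega>)) \<in> borel_measurable (F (\<tau> k))" using assms(2) by (rule measurable_compose)
  obtain C where "\<forall>\<omega>\<in>space M. \<bar>\<xi> k \<omega>\<bar> \<le> C" using assms(1) k unfolding simple_integrand_def by blast
  then show "\<exists>C. \<forall>\<omega>\<in>space M. \<bar>f (\<xi> k \<omega>)\<bar> \<le> C" using assms(3) order_trans by blast
qed (use assms(1) in \<open>auto simp: simple_integrand_def\<close>)

context brownian_motion
begin

lemma simple_integral_diff:
  assumes "s \<le> u"
  shows "simple_integral B m \<tau> \<xi> u \<omega> $ i - simple_integral B m \<tau> \<xi> s \<omega> $ i =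
    (\<Sum>k<m. \<xi> k \<omega> * inc i (clip s u (\<tau> k)) (clip s u (\<tau> (Suc k))) \<omega>)"
proof -
  \<comment> \<open>The extra term at \<open>s\<close> is the same for both ends of a cell and
    cancels, leaving only the clipped grid points.\<close>
  have c: "B (min u x) \<omega> $ i - B (min s x) \<omega> $ i = B (clip s u x) \<omega> $ i - B s \<omega> $ i" for x
    using assms by (auto simp: clip_def min_def max_def)
  have *: "B (min u x) \<omega> $ i - B (min u y) \<omega> $ i - (B (min s x) \<omega> $ i - B (min s y) \<omega> $ i) = inc i (clip s u y) (clip s u x) \<omega>" for x y
    using c[of x] c[of y] by (simp add: inc_def)
  show ?thesis
    unfolding simple_integral_def
    by (simp add: sum_subtractf[symmetric] right_diff_distrib[symmetric] *)
qed

lemma simple_integral_0: "simple_integrand M F m \<tau> \<xi> \<Longrightarrow> simple_integral B m \<tau> \<xi> 0 \<omega> = 0"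
  unfolding simple_integral_def
  using simple_integrand_nonneg[of M F m \<tau> \<xi>] by (intro sum.neutral) (simp add: min_absorb1)

text \<open>Coefficients beyond the window \<open>[s, u]\<close> are set to zero, since they need not be
  measurable at the clipped times.\<close>

definition window :: "real \<Rightarrow> (nat \<Rightarrow> real) \<Rightarrow> (nat \<Rightarrow> 'w \<Rightarrow> real) \<Rightarrow> nat \<Rightarrow> 'w \<Rightarrow> real" where
  "window u \<tau> \<xi> k = (\<lambda>\<omega>. if \<tau> k \<le> u then \<xi> k \<omega> else 0)"

lemma window_inc:
  assumes "simple_integrand M F m \<tau> \<xi>" "k < m" "s \<le> u"
  shows "\<xi> k \<omega> * inc i (clip s u (\<tau> k)) (clip s u (\<tau> (Suc k))) \<omega> = window u \<tau> \<xi> k \<omega> * inc i (clip s u (\<tau> k)) (clip s u (\<tau> (Suc k))) \<omega>"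
proof (cases "\<tau> k \<le> u")
  case False
  then have "clip s u (\<tau> k) = clip s u (\<tau> (Suc k))"
    using assms unfolding simple_integrand_def clip_def by (metis le_less_trans less_imp_le min.absorb1 not_le)
  then show ?thesis by simp
qed (simp add: window_def)

lemma window_bounded_F:
  assumes "simple_integrand M F m \<tau> \<xi>" "k < m" "s \<le> u"
  shows "bounded_F (clip s u (\<tau> k)) (window u \<tau> \<xi> k)"
proof (cases "\<tau> k \<le> u")
  case True
  then have "\<tau> k \<le> clip s u (\<tau> k)" by (simp add: clip_def)
  moreover have "bounded_F (\<tau> k) (\<xi> k)" using assms unfolding simple_integrand_def bounded_F_def by blast
  ultimately show ?thesis using True bounded_F_mono by (simp add: window_def)
qed (simp add: window_def)

lemma simple_integral_diff':
  assumes "simple_integrand M F m \<tau> \<xi>" "s \<le> u"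
  shows "simple_integral B m \<tau> \<xi> u \<omega> $ i - simple_integral B m \<tau> \<xi> s \<omega> $ i =
    (\<Sum>k<m. window u \<tau> \<xi> k \<omega> * inc i (clip s u (\<tau> k)) (clip s u (\<tau> (Suc k))) \<omega>)"
  unfolding simple_integral_diff[OF assms(2)] using window_inc[OF assms(1) _ assms(2)] by (intro sum.cong) auto

lemma simple_integral_mean:
  assumes si: "simple_integrand M F m \<tau> \<xi>" and su: "0 \<le> s" "s \<le> u" and \<zeta>: "bounded_F s \<zeta>"
  shows "expectation (\<lambda>\<omega>. \<zeta> \<omega> * (simple_integral B m \<tau> \<xi> u \<omega> $ i - simple_integral B m \<tau> \<xi> s \<omega> $ i)) = 0"
proof -
  let ?c = "\<lambda>k. clip s u (\<tau> k)"
  have "integrable M (\<lambda>\<omega>. (\<zeta> \<omega> * window u \<tau> \<xi> k \<omega>) * inc i (?c k) (?c (Suc k)) \<omega>) \<and>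
    expectation (\<lambda>\<omega>. (\<zeta> \<omega> * window u \<tau> \<xi> k \<omega>) * inc i (?c k) (?c (Suc k)) \<omega>) = 0" if k: "k < m" for k
  proof -
    have "bounded_F (?c k) (\<lambda>\<omega>. \<zeta> \<omega> * window u \<tau> \<xi> k \<omega>)"
      using bounded_F_mult[OF bounded_F_mono[OF \<zeta> clip_bounds(1)[OF su(2)]] window_bounded_F[OF si k su(2)]] .
    moreover have "0 \<le> ?c k" using clip_bounds(1)[OF su(2)] su order_trans by blast
    moreover have "?c k \<le> ?c (Suc k)" using si k unfolding simple_integrand_def by (intro clip_mono less_imp_le) auto
    ultimately show ?thesis using F_mult_inc bounded_F_measurable bounded_F_integrable by blast
  qed
  then show ?thesis
    unfolding simple_integral_diff'[OF si su(2)] by (simp add: sum_distrib_left mult.assoc)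
qed

lemma simple_process_integral:
  assumes su: "s \<le> u"
  shows "(LINT r:{s..u}|lborel. simple_process m \<tau> \<xi> r \<omega> * simple_process m' \<tau>' \<xi>' r \<omega>) =
    (\<Sum>k<m. \<Sum>l<m'. (\<xi> k \<omega> * \<xi>' l \<omega>) * measure lborel ({s..u} \<inter> ({\<tau> k<..\<tau> (Suc k)} \<inter> {\<tau>' l<..\<tau>' (Suc l)})))"
proof -
  define A where "A k l = {s..u} \<inter> ({\<tau> k<..\<tau> (Suc k)} \<inter> {\<tau>' l<..\<tau>' (Suc l)})" for k l
  have Am: "A k l \<in> sets lborel" for k l unfolding A_def by simp
  have fin: "emeasure lborel (A k l) < \<infinity>" for k l
    by (rule le_less_trans[OF emeasure_mono[of _ "{s..u}"]]) (use su in \<open>auto simp: A_def\<close>)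
  have int: "integrable lborel (\<lambda>r. (\<xi> k \<omega> * \<xi>' l \<omega>) * indicator (A k l) r)" for k l
    by (intro integrable_mult_right integrable_real_indicator Am fin)
  have "(LINT r:{s..u}|lborel. simple_process m \<tau> \<xi> r \<omega> * simple_process m' \<tau>' \<xi>' r \<omega>)
    = (LINT r|lborel. (\<Sum>k<m. \<Sum>l<m'. (\<xi> k \<omega> * \<xi>' l \<omega>) * indicator (A k l) r))"
    unfolding set_lebesgue_integral_def simple_process_def A_def
    by (intro Bochner_Integration.integral_cong refl)
      (simp only: sum_product, simp only: sum_distrib_left indicator_inter_arith real_scaleR_def, simp only: mult_ac)
  also have "\<dots> = (\<Sum>k<m. \<Sum>l<m'. (\<xi> k \<omega> * \<xi>' l \<omega>) * measure lborel (A k l))"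
  proof -
    have "(LINT r|lborel. (\<Sum>k<m. \<Sum>l<m'. (\<xi> k \<omega> * \<xi>' l \<omega>) * indicator (A k l) r))
      = (\<Sum>k<m. LINT r|lborel. (\<Sum>l<m'. (\<xi> k \<omega> * \<xi>' l \<omega>) * indicator (A k l) r))"
      by (rule Bochner_Integration.integral_sum) (intro Bochner_Integration.integrable_sum int)
    also have "\<dots> = (\<Sum>k<m. \<Sum>l<m'. LINT r|lborel. (\<xi> k \<omega> * \<xi>' l \<omega>) * indicator (A k l) r)"
      by (intro sum.cong refl Bochner_Integration.integral_sum int)
    also have "\<dots> = (\<Sum>k<m. \<Sum>l<m'. (\<xi> k \<omega> * \<xi>' l \<omega>) * measure lborel (A k l))"
      by (intro sum.cong refl) simp
    finally show ?thesis .
  qed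
  finally show ?thesis unfolding A_def .
qed

lemma expectation_double_sum:
  fixes f :: "nat \<Rightarrow> nat \<Rightarrow> 'w \<Rightarrow> real"
  assumes "\<And>k l. k < m \<Longrightarrow> l < m' \<Longrightarrow> integrable M (f k l)"
  shows "expectation (\<lambda>\<omega>. \<Sum>k<m. \<Sum>l<m'. f k l \<omega>) = (\<Sum>k<m. \<Sum>l<m'. expectation (f k l))"
proof -
  have "expectation (\<lambda>\<omega>. \<Sum>k<m. \<Sum>l<m'. f k l \<omega>) = (\<Sum>k<m. expectation (\<lambda>\<omega>. \<Sum>l<m'. f k l \<omega>))"
    by (rule Bochner_Integration.integral_sum) (intro Bochner_Integration.integrable_sum assms, auto)
  also have "\<dots> = (\<Sum>k<m. \<Sum>l<m'. expectation (f k l))"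
    by (intro sum.cong refl Bochner_Integration.integral_sum assms) auto
  finally show ?thesis .
qed

text \<open>The isometry is needed in polarised form, for two integrands on different grids, since
  two solutions share one Brownian motion, and in conditional form, with a weight known at time
  \<open>s\<close>. Because \<open>covariance\<close> treats any two cells, no common refinement of
  the grids has to be formed.\<close>

lemma simple_integral_isometry:
  assumes si: "simple_integrand M F m \<tau> \<xi>" "simple_integrand M F m' \<tau>' \<xi>'" and su: "0 \<le> s" "s \<le> u" and \<zeta>: "bounded_F s \<zeta>"
  shows "expectation (\<lambda>\<omega>. \<zeta> \<omega> * ((simple_integral B m \<tau> \<xi> u \<omega> $ i - simple_integral B m \<tau> \<xi> s \<omega> $ i) *
       (simple_integral B m' \<tau>' \<xi>' u \<omega> $ j - simple_integral B m' \<tau>' \<xi>' s \<omega> $ j))) =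
    (if i = j then expectation (\<lambda>\<omega>. \<zeta> \<omega> * (LINT r:{s..u}|lborel. simple_process m \<tau> \<xi> r \<omega> * simple_process m' \<tau>' \<xi>' r \<omega>)) else 0)"
proof -
  let ?c = "\<lambda>k. clip s u (\<tau> k)" and ?c' = "\<lambda>k. clip s u (\<tau>' k)"
  let ?w = "window u \<tau> \<xi>" and ?w' = "window u \<tau>' \<xi>'"
  let ?len = "\<lambda>k l. measure lborel ({s..u} \<inter> ({\<tau> k<..\<tau> (Suc k)} \<inter> {\<tau>' l<..\<tau>' (Suc l)}))"
  have 1: "integrable M (\<lambda>\<omega>. ((\<zeta> \<omega> * ?w k \<omega>) * inc i (?c k) (?c (Suc k)) \<omega>) * (?w' l \<omega> * inc j (?c' l) (?c' (Suc l)) \<omega>))"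
    "expectation (\<lambda>\<omega>. ((\<zeta> \<omega> * ?w k \<omega>) * inc i (?c k) (?c (Suc k)) \<omega>) * (?w' l \<omega> * inc j (?c' l) (?c' (Suc l)) \<omega>)) =
      (if i = j then expectation (\<lambda>\<omega>. (\<zeta> \<omega> * ?w k \<omega>) * ?w' l \<omega>) * ?len k l else 0)"
    if kl: "k < m" "l < m'" for k l
  proof -
    have "bounded_F (?c k) (\<lambda>\<omega>. \<zeta> \<omega> * ?w k \<omega>)"
      using bounded_F_mult[OF bounded_F_mono[OF \<zeta> clip_bounds(1)[OF su(2)]] window_bounded_F[OF si(1) kl(1) su(2)]] .
    moreover have "0 \<le> ?c k" "0 \<le> ?c' l" using clip_bounds(1)[OF su(2)] su order_trans by blast+
    moreover have "?c k \<le> ?c (Suc k)" using si kl unfolding simple_integrand_def by (intro clip_mono less_imp_le) auto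
    moreover have "?c' l \<le> ?c' (Suc l)" using si kl unfolding simple_integrand_def by (intro clip_mono less_imp_le) auto
    moreover note window_bounded_F[OF si(2) kl(2) su(2)]
    ultimately show "integrable M (\<lambda>\<omega>. ((\<zeta> \<omega> * ?w k \<omega>) * inc i (?c k) (?c (Suc k)) \<omega>) * (?w' l \<omega> * inc j (?c' l) (?c' (Suc l)) \<omega>))"
    "expectation (\<lambda>\<omega>. ((\<zeta> \<omega> * ?w k \<omega>) * inc i (?c k) (?c (Suc k)) \<omega>) * (?w' l \<omega> * inc j (?c' l) (?c' (Suc l)) \<omega>)) =
      (if i = j then expectation (\<lambda>\<omega>. (\<zeta> \<omega> * ?w k \<omega>) * ?w' l \<omega>) * ?len k l else 0)"
      using covariance[of "?c k" "?c (Suc k)" "?c' l" "?c' (Suc l)" "\<lambda>\<omega>. \<zeta> \<omega> * ?w k \<omega>" "?w' l" i j] clip_overlap[OF su(2)] by auto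
  qed
  \<comment> \<open>A cell that starts after \<open>u\<close> does not meet \<open>{s..u}\<close>,
    so the windowed coefficients give the same time integral.\<close>
  have len0: "(\<xi> k \<omega> * \<xi>' l \<omega>) * ?len k l = (?w k \<omega> * ?w' l \<omega>) * ?len k l" for k l \<omega>
  proof (cases "\<tau> k \<le> u \<and> \<tau>' l \<le> u")
    case False
    then have "{s..u} \<inter> ({\<tau> k<..\<tau> (Suc k)} \<inter> {\<tau>' l<..\<tau>' (Suc l)}) = {}" by auto
    then show ?thesis by simp
  qed (simp add: window_def)
  have bw: "integrable M (\<lambda>\<omega>. (\<zeta> \<omega> * ?w k \<omega>) * ?w' l \<omega>)" if kl: "k < m" "l < m'" for k l
  proof -
    have "bounded_F u (\<lambda>\<omega>. (\<zeta> \<omega> * ?w k \<omega>) * ?w' l \<omega>)"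
      using bounded_F_mono[OF window_bounded_F[OF si(1) kl(1) su(2)] clip_bounds(2)[OF su(2)]]
        bounded_F_mono[OF window_bounded_F[OF si(2) kl(2) su(2)] clip_bounds(2)[OF su(2)]] bounded_F_mono[OF \<zeta> su(2)]
      by (intro bounded_F_mult) auto
    then show ?thesis by (rule bounded_F_integrable)
  qed
  have "expectation (\<lambda>\<omega>. \<zeta> \<omega> * ((simple_integral B m \<tau> \<xi> u \<omega> $ i - simple_integral B m \<tau> \<xi> s \<omega> $ i) *
       (simple_integral B m' \<tau>' \<xi>' u \<omega> $ j - simple_integral B m' \<tau>' \<xi>' s \<omega> $ j)))
    = expectation (\<lambda>\<omega>. \<Sum>k<m. \<Sum>l<m'. ((\<zeta> \<omega> * ?w k \<omega>) * inc i (?c k) (?c (Suc k)) \<omega>) * (?w' l \<omega> * inc j (?c' l) (?c' (Suc l)) \<omega>))"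
    unfolding simple_integral_diff'[OF si(1) su(2)] simple_integral_diff'[OF si(2) su(2)]
    by (simp only: sum_product, simp only: sum_distrib_left mult.assoc)
  also have "\<dots> = (\<Sum>k<m. \<Sum>l<m'. if i = j then expectation (\<lambda>\<omega>. (\<zeta> \<omega> * ?w k \<omega>) * ?w' l \<omega>) * ?len k l else 0)"
    by (subst expectation_double_sum) (use 1 in auto)
  also have "\<dots> = (if i = j then expectation (\<lambda>\<omega>. \<Sum>k<m. \<Sum>l<m'. ((\<zeta> \<omega> * ?w k \<omega>) * ?w' l \<omega>) * ?len k l) else 0)"
    by (subst expectation_double_sum) (use bw in auto)
  also have "(\<lambda>\<omega>. \<Sum>k<m. \<Sum>l<m'. ((\<zeta> \<omega> * ?w k \<omega>) * ?w' l \<omega>) * ?len k l) =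
     (\<lambda>\<omega>. \<zeta> \<omega> * (LINT r:{s..u}|lborel. simple_process m \<tau> \<xi> r \<omega> * simple_process m' \<tau>' \<xi>' r \<omega>))"
    unfolding simple_process_integral[OF su(2)] len0 by (simp add: sum_distrib_left mult.assoc)
  finally show ?thesis .
qed

lemma simple_integral_fourth_moment:
  assumes si: "simple_integrand M F m \<tau> \<xi>" and su: "0 \<le> s" "s \<le> u"
    and K: "\<And>k \<omega>. k < m \<Longrightarrow> \<omega> \<in> space M \<Longrightarrow> \<bar>\<xi> k \<omega>\<bar> \<le> K" and K0: "0 \<le> K"
  shows "integrable M (\<lambda>\<omega>. (simple_integral B m \<tau> \<xi> u \<omega> $ i - simple_integral B m \<tau> \<xi> s \<omega> $ i) ^ 4)"
    and "expectation (\<lambda>\<omega>. (simple_integral B m \<tau> \<xi> u \<omega> $ i - simple_integral B m \<tau> \<xi> s \<omega> $ i) ^ 4) \<le> 3 * K ^ 4 * (u - s)\<^sup>2"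
proof -
  let ?c = "\<lambda>k. clip s u (\<tau> k)" and ?w = "window u \<tau> \<xi>"
  have D: "0 \<le> ?c m \<and> ?c 0 \<le> ?c m \<and> (\<lambda>\<omega>. \<Sum>l<m. ?w l \<omega> * inc i (?c l) (?c (Suc l)) \<omega>) \<in> borel_measurable (F (?c m)) \<and>
     integrable M (\<lambda>\<omega>. (\<Sum>l<m. ?w l \<omega> * inc i (?c l) (?c (Suc l)) \<omega>) ^ 4) \<and>
     expectation (\<lambda>\<omega>. (\<Sum>l<m. ?w l \<omega> * inc i (?c l) (?c (Suc l)) \<omega>) ^ 2) \<le> K\<^sup>2 * (?c m - ?c 0) \<and>
     expectation (\<lambda>\<omega>. (\<Sum>l<m. ?w l \<omega> * inc i (?c l) (?c (Suc l)) \<omega>) ^ 4) \<le> 3 * K ^ 4 * (?c m - ?c 0)\<^sup>2"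
  proof (rule discrete_integral_moments)
    show "0 \<le> ?c 0" using clip_bounds(1)[OF su(2)] su order_trans by blast
    show "?c k \<le> ?c (Suc k)" if "k < m" for k using si that unfolding simple_integrand_def by (intro clip_mono less_imp_le) auto
    show "?w k \<in> borel_measurable (F (?c k))" if "k < m" for k
      using bounded_F_measurable[OF window_bounded_F[OF si that su(2)]] .
    show "\<bar>?w k \<omega>\<bar> \<le> K" if "k < m" "\<omega> \<in> space M" for k \<omega>
      using K[OF that] K0 by (simp add: window_def)
  qed (use K0 in auto)
  show "integrable M (\<lambda>\<omega>. (simple_integral B m \<tau> \<xi> u \<omega> $ i - simple_integral B m \<tau> \<xi> s \<omega> $ i) ^ 4)"
    unfolding simple_integral_diff'[OF si su(2)] using D by blast
  have "0 \<le> ?c m - ?c 0" "?c m - ?c 0 \<le> u - s" using D clip_bounds[OF su(2), of "\<tau> m"] clip_bounds[OF su(2), of "\<tau> 0"] by auto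
  then have "(?c m - ?c 0)\<^sup>2 \<le> (u - s)\<^sup>2" by (intro power_mono)
  then have "3 * K ^ 4 * (?c m - ?c 0)\<^sup>2 \<le> 3 * K ^ 4 * (u - s)\<^sup>2" by (intro mult_left_mono) auto
  then show "expectation (\<lambda>\<omega>. (simple_integral B m \<tau> \<xi> u \<omega> $ i - simple_integral B m \<tau> \<xi> s \<omega> $ i) ^ 4) \<le> 3 * K ^ 4 * (u - s)\<^sup>2"
    unfolding simple_integral_diff'[OF si su(2)] using D by linarith
qed

lemma simple_integral_measurable:
  assumes si: "simple_integrand M F m \<tau> \<xi>" and "0 \<le> t"
  shows "(\<lambda>\<omega>. simple_integral B m \<tau> \<xi> t \<omega>) \<in> borel_measurable M"
proof -
  have "\<xi> k \<in> borel_measurable M" if "k < m" for k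
    using si that measurable_F_M unfolding simple_integrand_def by blast
  moreover have "B (min t (\<tau> k)) \<in> borel_measurable M" if "k \<le> m" for k
    using simple_integrand_nonneg[OF si that] assms by (intro B_measurable) auto
  ultimately show ?thesis unfolding simple_integral_def
    by (intro borel_measurable_sum borel_measurable_scaleR borel_measurable_diff) auto
qed

lemma simple_process_energy:
  assumes si: "simple_integrand M F m \<tau> \<xi>" and t: "0 \<le> t"
  shows "(LINT r:{0..t}|lborel. simple_process m \<tau> \<xi> r \<omega> * simple_process m \<tau> \<xi> r \<omega>) =
    (\<Sum>k<m. (\<xi> k \<omega>)\<^sup>2 * (clip 0 t (\<tau> (Suc k)) - clip 0 t (\<tau> k)))"
proof -
  have sq: "simple_process m \<tau> \<xi> r \<omega> * simple_process m \<tau> \<xi> r \<omega> = simple_process m \<tau> (\<lambda>k \<omega>. (\<xi> k \<omega>)\<^sup>2) r \<omega>" for r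
    using simple_process_map[OF si, of "\<lambda>x. x\<^sup>2" \<xi>] by (simp add: power2_eq_square)
  define A where "A k = {0..t} \<inter> {\<tau> k<..\<tau> (Suc k)}" for k
  have Am: "A k \<in> sets lborel" for k unfolding A_def by simp
  have fin: "emeasure lborel (A k) < \<infinity>" for k
    by (rule le_less_trans[OF emeasure_mono[of _ "{0..t}"]]) (use t in \<open>auto simp: A_def\<close>)
  have int: "integrable lborel (\<lambda>r. (\<xi> k \<omega>)\<^sup>2 * indicator (A k) r)" for k
    by (intro integrable_mult_right integrable_real_indicator Am fin)
  have "(LINT r:{0..t}|lborel. simple_process m \<tau> \<xi> r \<omega> * simple_process m \<tau> \<xi> r \<omega>)
    = (LINT r|lborel. (\<Sum>k<m. (\<xi> k \<omega>)\<^sup>2 * indicator (A k) r))"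
    unfolding set_lebesgue_integral_def sq unfolding simple_process_def A_def
    by (intro Bochner_Integration.integral_cong refl)
      (simp only: sum_distrib_left indicator_inter_arith real_scaleR_def, simp only: mult_ac)
  also have "\<dots> = (\<Sum>k<m. LINT r|lborel. (\<xi> k \<omega>)\<^sup>2 * indicator (A k) r)"
    by (intro Bochner_Integration.integral_sum int)
  also have "\<dots> = (\<Sum>k<m. (\<xi> k \<omega>)\<^sup>2 * measure lborel (A k))"
    by (intro sum.cong refl) simp
  also have "\<dots> = (\<Sum>k<m. (\<xi> k \<omega>)\<^sup>2 * (clip 0 t (\<tau> (Suc k)) - clip 0 t (\<tau> k)))"
  proof (intro sum.cong refl arg_cong2[where f="(*)"])
    fix k assume k: "k \<in> {..<m}"
    have "clip 0 t (\<tau> k) \<le> clip 0 t (\<tau> (Suc k))"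
      using si k by (intro clip_mono) (simp add: simple_integrand_def less_imp_le)
    then show "measure lborel (A k) = clip 0 t (\<tau> (Suc k)) - clip 0 t (\<tau> k)"
      using clip_overlap[OF t, of "\<tau> (Suc k)" "\<tau> (Suc k)" "\<tau> k" "\<tau> k"]
      by (simp only: A_def Int_absorb min.idem max.idem max_absorb2 diff_ge_0_iff_ge)
  qed
  finally show ?thesis .
qed

text \<open>Lenglart's inequality: stopping the integrand before its energy exceeds \<open>\<eta>\<close> changes the
  integral only where the energy exceeds \<open>\<eta>\<close>.\<close>

lemma simple_integral_lenglart:
  assumes si: "simple_integrand M F m \<tau> \<xi>" and t: "0 \<le> t" and \<eta>: "0 < \<eta>" and \<epsilon>: "0 < \<epsilon>"
  defines "len \<equiv> \<lambda>k. clip 0 t (\<tau> (Suc k)) - clip 0 t (\<tau> k)"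
  shows "prob {\<omega>\<in>space M. \<epsilon> < \<bar>simple_integral B m \<tau> \<xi> t \<omega> $ i\<bar>} \<le>
    prob {\<omega>\<in>space M. \<eta> < (\<Sum>k<m. (\<xi> k \<omega>)\<^sup>2 * len k)} + \<eta> / \<epsilon>\<^sup>2"
proof -
  define Q where "Q = (\<lambda>k \<omega>. \<Sum>l<k. (\<xi> l \<omega>)\<^sup>2 * len l)"
  \<comment> \<open>The stopping is predictable: \<open>Q (Suc k)\<close> already counts the energy
    of cell k, but involves only coefficients up to index k and is therefore
    \<open>F (\<tau> k)\<close>-measurable. Counting the current cell is what keeps the energy from
    overshooting \<eta>.\<close>
  define \<xi>' where "\<xi>' = (\<lambda>k \<omega>. if Q (Suc k) \<omega> \<le> \<eta> then \<xi> k \<omega> else 0)"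
  have m\<xi>: "\<xi> k \<in> borel_measurable (F (\<tau> k))" if "k < m" for k
    using si that unfolding simple_integrand_def by blast
  have len0: "0 \<le> len k" if "k < m" for k
    unfolding len_def using si that clip_mono[of "\<tau> k" "\<tau> (Suc k)" 0 t] by (simp add: simple_integrand_def less_imp_le)
  have mQ: "Q (Suc k) \<in> borel_measurable (F (\<tau> k))" if "k < m" for k
    unfolding Q_def
    using that simple_integrand_mono[OF si] measurable_F_mono[OF m\<xi>]
    by (intro borel_measurable_sum borel_measurable_times borel_measurable_power) auto
  have si': "simple_integrand M F m \<tau> \<xi>'"
    unfolding simple_integrand_def
  proof (intro conjI allI impI)
    fix k assume k: "k < m"
    note [measurable] = mQ[OF k] m\<xi>[OF k]
    show "\<xi>' k \<in> borel_measurable (F (\<tau> k))" unfolding \<xi>'_def by measurable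
    obtain C where C: "\<forall>\<omega>\<in>space M. \<bar>\<xi> k \<omega>\<bar> \<le> C" using si k unfolding simple_integrand_def by blast
    then have "\<forall>\<omega>\<in>space M. \<bar>\<xi>' k \<omega>\<bar> \<le> C" unfolding \<xi>'_def by (smt (verit) abs_ge_zero abs_0_eq)
    then show "\<exists>C. \<forall>\<omega>\<in>space M. \<bar>\<xi>' k \<omega>\<bar> \<le> C" by blast
  qed (use si in \<open>auto simp: simple_integrand_def\<close>)
  have Qmono: "Q k \<omega> \<le> Q l \<omega>" if "k \<le> l" "l \<le> m" for k l \<omega>
    unfolding Q_def using that len0 by (intro sum_mono2) auto
  have energy: "(\<Sum>l<k. (\<xi>' l \<omega>)\<^sup>2 * len l) \<le> \<eta> \<and> (Q k \<omega> \<le> \<eta> \<longrightarrow> (\<Sum>l<k. (\<xi>' l \<omega>)\<^sup>2 * len l) = Q k \<omega>)" if "k \<le> m" for k \<omega>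
    using that
  proof (induction k)
    case 0 then show ?case using \<eta> by (simp add: Q_def)
  next
    case (Suc k)
    show ?case
    proof (cases "Q (Suc k) \<omega> \<le> \<eta>")
      case True
      then have "Q k \<omega> \<le> \<eta>" using Qmono[of k "Suc k" \<omega>] Suc.prems by simp
      then show ?thesis using True Suc by (simp add: \<xi>'_def Q_def)
    next
      case False
      then show ?thesis using Suc by (simp add: \<xi>'_def)
    qed
  qed
  let ?I = "\<lambda>\<xi> \<omega>. simple_integral B m \<tau> \<xi> t \<omega> $ i"
  have lint: "(LINT r:{0..t}|lborel. simple_process m \<tau> \<xi>' r \<omega> * simple_process m \<tau> \<xi>' r \<omega>) \<le> \<eta>" for \<omega>
    using energy[of m \<omega>] unfolding simple_process_energy[OF si' t] len_def by simp
  have b1: "bounded_F 0 (\<lambda>_. 1)" by simp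
  have [measurable]: "?I \<xi> \<in> borel_measurable M" "?I \<xi>' \<in> borel_measurable M"
    using simple_integral_measurable[OF si t] simple_integral_measurable[OF si' t] borel_measurable_nth measurable_compose by blast+
  have [measurable]: "\<xi> k \<in> borel_measurable M" if "k < m" for k using m\<xi>[OF that] measurable_F_M by blast
  obtain C where C: "0 \<le> C" "\<And>k \<omega>. k < m \<Longrightarrow> \<omega> \<in> space M \<Longrightarrow> \<bar>\<xi>' k \<omega>\<bar> \<le> C"
  proof -
    have "\<forall>k\<in>{..<m}. \<exists>C. \<forall>\<omega>\<in>space M. \<bar>\<xi>' k \<omega>\<bar> \<le> C" using si' unfolding simple_integrand_def by blast
    then obtain C where C: "\<forall>k\<in>{..<m}. \<forall>\<omega>\<in>space M. \<bar>\<xi>' k \<omega>\<bar> \<le> C k" by metis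
    have "\<bar>\<xi>' k \<omega>\<bar> \<le> (\<Sum>k<m. \<bar>C k\<bar>)" if "k < m" "\<omega> \<in> space M" for k \<omega>
    proof -
      have "\<bar>\<xi>' k \<omega>\<bar> \<le> \<bar>C k\<bar>" using C that by force
      also have "\<dots> \<le> (\<Sum>k<m. \<bar>C k\<bar>)" using that by (intro member_le_sum) auto
      finally show ?thesis .
    qed
    then show ?thesis using that[of "\<Sum>k<m. \<bar>C k\<bar>"] by (simp add: sum_nonneg)
  qed
  have i4: "integrable M (\<lambda>\<omega>. (?I \<xi>' \<omega>) ^ 4)"
    using simple_integral_fourth_moment(1)[OF si' order_refl t C(2,1), of i] by (simp add: simple_integral_0[OF si'])
  have i2: "integrable M (\<lambda>\<omega>. (?I \<xi>' \<omega>)\<^sup>2)"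
    using i4 by (intro square_integrable_imp_integrable[of "\<lambda>\<omega>. (?I \<xi>' \<omega>)\<^sup>2"]) (auto simp flip: power_mult)
  have "expectation (\<lambda>\<omega>. (?I \<xi>' \<omega>)\<^sup>2) = expectation (\<lambda>\<omega>. (LINT r:{0..t}|lborel. simple_process m \<tau> \<xi>' r \<omega> * simple_process m \<tau> \<xi>' r \<omega>))"
    using simple_integral_isometry[OF si' si' order_refl t b1, of i i] by (simp add: power2_eq_square simple_integral_0[OF si'])
  also have "\<dots> \<le> \<eta>"
  \<comment> \<open>In the other case the expectation is 0 by convention and the bound holds
    trivially.\<close>
  proof (cases "integrable M (\<lambda>\<omega>. (LINT r:{0..t}|lborel. simple_process m \<tau> \<xi>' r \<omega> * simple_process m \<tau> \<xi>' r \<omega>))")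
    case True
    then have "expectation (\<lambda>\<omega>. (LINT r:{0..t}|lborel. simple_process m \<tau> \<xi>' r \<omega> * simple_process m \<tau> \<xi>' r \<omega>)) \<le> expectation (\<lambda>_. \<eta>)"
      using lint by (intro integral_mono) auto
    then show ?thesis by (simp add: prob_space)
  qed (use \<eta> in \<open>simp add: not_integrable_integral_eq\<close>)
  finally have E: "expectation (\<lambda>\<omega>. (?I \<xi>' \<omega>)\<^sup>2) \<le> \<eta>" .
  have "prob {\<omega>\<in>space M. \<epsilon> < \<bar>?I \<xi>' \<omega>\<bar>} \<le> prob {\<omega>\<in>space M. \<epsilon>\<^sup>2 \<le> (?I \<xi>' \<omega>)\<^sup>2}"
    using \<epsilon> by (intro finite_measure_mono) (auto simp: abs_le_square_iff[symmetric])
  also have "\<dots> \<le> expectation (\<lambda>\<omega>. (?I \<xi>' \<omega>)\<^sup>2) / \<epsilon>\<^sup>2"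
    using integral_Markov_inequality_measure[OF i2, of "{}" "\<epsilon>\<^sup>2"] \<epsilon> by simp
  also have "\<dots> \<le> \<eta> / \<epsilon>\<^sup>2" using E by (simp add: divide_right_mono)
  finally have P: "prob {\<omega>\<in>space M. \<epsilon> < \<bar>?I \<xi>' \<omega>\<bar>} \<le> \<eta> / \<epsilon>\<^sup>2" .
  have same: "?I \<xi> \<omega> = ?I \<xi>' \<omega>" if "Q m \<omega> \<le> \<eta>" for \<omega>
  proof -
    have "\<xi>' k \<omega> = \<xi> k \<omega>" if "k < m" for k
      using Qmono[of "Suc k" m \<omega>] that \<open>Q m \<omega> \<le> \<eta>\<close> by (simp add: \<xi>'_def)
    then show ?thesis unfolding simple_integral_def by simp
  qed
  have "{\<omega>\<in>space M. \<epsilon> < \<bar>?I \<xi> \<omega>\<bar>} \<subseteq> {\<omega>\<in>space M. \<eta> < Q m \<omega>} \<union> {\<omega>\<in>space M. \<epsilon> < \<bar>?I \<xi>' \<omega>\<bar>}"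
  proof
    fix \<omega> assume "\<omega> \<in> {\<omega>\<in>space M. \<epsilon> < \<bar>?I \<xi> \<omega>\<bar>}"
    then show "\<omega> \<in> {\<omega>\<in>space M. \<eta> < Q m \<omega>} \<union> {\<omega>\<in>space M. \<epsilon> < \<bar>?I \<xi>' \<omega>\<bar>}"
      using same[of \<omega>] by (cases "Q m \<omega> \<le> \<eta>") auto
  qed
  moreover have "{\<omega>\<in>space M. \<eta> < Q m \<omega>} \<in> events" unfolding Q_def by measurable
  moreover have "{\<omega>\<in>space M. \<epsilon> < \<bar>?I \<xi>' \<omega>\<bar>} \<in> events" by measurable
  ultimately have "prob {\<omega>\<in>space M. \<epsilon> < \<bar>?I \<xi> \<omega>\<bar>} \<le> prob {\<omega>\<in>space M. \<eta> < Q m \<omega>} + prob {\<omega>\<in>space M. \<epsilon> < \<bar>?I \<xi>' \<omega>\<bar>}"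
    by (meson finite_measure_mono measure_Un_le order_trans sets.Un)
  then show ?thesis using P unfolding Q_def by linarith
qed

end

section \<open>Convergence in probability\<close>

lemma (in prob_space) fatou_bound:
  fixes X :: "nat \<Rightarrow> 'a \<Rightarrow> real"
  assumes X: "\<And>j. integrable M (X j)" "\<And>j \<omega>. 0 \<le> X j \<omega>" "\<And>j. expectation (X j) \<le> C"
    and lim: "AE \<omega> in M. (\<lambda>j. X j \<omega>) \<longlonglongrightarrow> Y \<omega>" and Y[measurable]: "Y \<in> borel_measurable M"
  shows "integrable M Y" "expectation Y \<le> C"
proof -
  have [measurable]: "X j \<in> borel_measurable M" for j using X(1) by auto
  have "0 \<le> expectation (X 0)" using X(2) by (intro Bochner_Integration.integral_nonneg)
  then have C0: "0 \<le> C" using X(3)[of 0] by linarith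
  have Y0: "AE \<omega> in M. 0 \<le> Y \<omega>"
    using lim X(2) by (auto elim!: eventually_mono intro: LIMSEQ_le_const)
  have "(\<integral>\<^sup>+\<omega>. ennreal (Y \<omega>) \<partial>M) = (\<integral>\<^sup>+\<omega>. liminf (\<lambda>j. ennreal (X j \<omega>)) \<partial>M)"
    using lim by (intro nn_integral_cong_AE) (auto elim!: eventually_mono intro!: lim_imp_Liminf[symmetric] tendsto_ennrealI)
  also have "\<dots> \<le> liminf (\<lambda>j. \<integral>\<^sup>+\<omega>. ennreal (X j \<omega>) \<partial>M)"
    by (rule nn_integral_liminf) auto
  also have "\<dots> \<le> liminf (\<lambda>j::nat. ennreal C)"
    using X by (intro Liminf_mono always_eventually allI) (simp add: nn_integral_eq_integral ennreal_leI)
  also have "\<dots> = ennreal C" by (simp add: Liminf_const)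
  finally have le: "(\<integral>\<^sup>+\<omega>. ennreal (Y \<omega>) \<partial>M) \<le> ennreal C" .
  show iY: "integrable M Y"
    using le Y0 by (intro integrableI_nonneg) (auto simp: le_less_trans)
  show "expectation Y \<le> C"
    using le C0 nn_integral_eq_integral[OF iY Y0] by (simp add: ennreal_le_iff)
qed

text \<open>An L2 bound gives uniform integrability. The difference cut off at level
  \<open>L\<close> converges in mean by dominated convergence, and what lies above the cut-off has
  mean at most its second moment divided by \<open>L\<close>.\<close>

lemma (in prob_space) expectation_tendsto_L2_bounded:
  fixes X :: "nat \<Rightarrow> 'a \<Rightarrow> real"
  assumes Xm[measurable]: "\<And>j. X j \<in> borel_measurable M"
    and X: "\<And>j. integrable M (\<lambda>\<omega>. (X j \<omega>)\<^sup>2)" "\<And>j. expectation (\<lambda>\<omega>. (X j \<omega>)\<^sup>2) \<le> C"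
    and lim: "AE \<omega> in M. (\<lambda>j. X j \<omega>) \<longlonglongrightarrow> Y \<omega>" and Y[measurable]: "Y \<in> borel_measurable M"
  shows "integrable M Y" "(\<lambda>j. expectation (X j)) \<longlonglongrightarrow> expectation Y"
proof -
  have "AE \<omega> in M. (\<lambda>j. (X j \<omega>)\<^sup>2) \<longlonglongrightarrow> (Y \<omega>)\<^sup>2"
    using lim by (auto elim!: eventually_mono intro: tendsto_power)
  then have Y2: "integrable M (\<lambda>\<omega>. (Y \<omega>)\<^sup>2)" "expectation (\<lambda>\<omega>. (Y \<omega>)\<^sup>2) \<le> C"
    using fatou_bound[of "\<lambda>j \<omega>. (X j \<omega>)\<^sup>2" C "\<lambda>\<omega>. (Y \<omega>)\<^sup>2"] X by auto
  show iY: "integrable M Y" by (rule square_integrable_imp_integrable[OF Y Y2(1)])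
  have iX: "integrable M (X j)" for j by (rule square_integrable_imp_integrable[OF Xm X(1)])
  have "0 \<le> expectation (\<lambda>\<omega>. (Y \<omega>)\<^sup>2)" by simp
  then have C0: "0 \<le> C" using Y2(2) by linarith
  have d2: "(X j \<omega> - Y \<omega>)\<^sup>2 \<le> 2 * (X j \<omega>)\<^sup>2 + 2 * (Y \<omega>)\<^sup>2" for j \<omega>
    using zero_le_power2[of "X j \<omega> + Y \<omega>"] by (simp add: power2_eq_square algebra_simps)
  have iD2: "integrable M (\<lambda>\<omega>. (X j \<omega> - Y \<omega>)\<^sup>2)" for j
    by (rule Bochner_Integration.integrable_bound[of _ "\<lambda>\<omega>. 2 * (X j \<omega>)\<^sup>2 + 2 * (Y \<omega>)\<^sup>2"])
      (use X(1) Y2(1) d2 in \<open>auto intro!: AE_I2\<close>)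
  have D2: "expectation (\<lambda>\<omega>. (X j \<omega> - Y \<omega>)\<^sup>2) \<le> 4 * C" for j
  proof -
    have "expectation (\<lambda>\<omega>. (X j \<omega> - Y \<omega>)\<^sup>2) \<le> expectation (\<lambda>\<omega>. 2 * (X j \<omega>)\<^sup>2 + 2 * (Y \<omega>)\<^sup>2)"
      using X(1) Y2(1) d2 iD2 by (intro integral_mono) auto
    also have "\<dots> = 2 * expectation (\<lambda>\<omega>. (X j \<omega>)\<^sup>2) + 2 * expectation (\<lambda>\<omega>. (Y \<omega>)\<^sup>2)"
      using X(1) Y2(1) by simp
    finally show ?thesis using X(2)[of j] Y2(2) by linarith
  qed
  have small: "(\<lambda>j. expectation (\<lambda>\<omega>. min L \<bar>X j \<omega> - Y \<omega>\<bar>)) \<longlonglongrightarrow> 0" if "0 < L" for L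
  proof -
    have "(\<lambda>j. expectation (\<lambda>\<omega>. min L \<bar>X j \<omega> - Y \<omega>\<bar>)) \<longlonglongrightarrow> expectation (\<lambda>\<omega>. 0)"
    proof (rule integral_dominated_convergence[where w="\<lambda>_. L"])
      show "AE \<omega> in M. (\<lambda>j. min L \<bar>X j \<omega> - Y \<omega>\<bar>) \<longlonglongrightarrow> 0"
        using lim
      proof eventually_elim
        fix \<omega> assume "(\<lambda>j. X j \<omega>) \<longlonglongrightarrow> Y \<omega>"
        then have "(\<lambda>j. min L \<bar>X j \<omega> - Y \<omega>\<bar>) \<longlonglongrightarrow> min L \<bar>Y \<omega> - Y \<omega>\<bar>"
          by (intro tendsto_intros)
        then show "(\<lambda>j. min L \<bar>X j \<omega> - Y \<omega>\<bar>) \<longlonglongrightarrow> 0" using that by simp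
      qed
    qed (use that in auto)
    then show ?thesis by simp
  qed
  have ineq: "\<bar>expectation (X j) - expectation Y\<bar> \<le> expectation (\<lambda>\<omega>. min L \<bar>X j \<omega> - Y \<omega>\<bar>) + 4 * C / L" if L: "0 < L" for j L
  proof -
    have im: "integrable M (\<lambda>\<omega>. min L \<bar>X j \<omega> - Y \<omega>\<bar>)"
      by (rule integrable_const_bound[of _ L]) (use L in \<open>auto intro!: AE_I2\<close>)
    have pt: "\<bar>x\<bar> \<le> min L \<bar>x\<bar> + x\<^sup>2 / L" for x :: real
    proof (cases "\<bar>x\<bar> \<le> L")
      case False
      then have "L * \<bar>x\<bar> \<le> \<bar>x\<bar> * \<bar>x\<bar>" by (intro mult_right_mono) auto
      then have "\<bar>x\<bar> \<le> x\<^sup>2 / L" using L by (simp add: field_simps power2_eq_square)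
      then show ?thesis using L by (simp add: min_def)
    qed (use L in simp)
    have "\<bar>expectation (X j) - expectation Y\<bar> = \<bar>expectation (\<lambda>\<omega>. X j \<omega> - Y \<omega>)\<bar>"
      using iX iY by simp
    also have "\<dots> \<le> expectation (\<lambda>\<omega>. \<bar>X j \<omega> - Y \<omega>\<bar>)" by (rule integral_abs_bound)
    also have "\<dots> \<le> expectation (\<lambda>\<omega>. min L \<bar>X j \<omega> - Y \<omega>\<bar> + (X j \<omega> - Y \<omega>)\<^sup>2 / L)"
      using iX iY im iD2 pt by (intro integral_mono) auto
    also have "\<dots> = expectation (\<lambda>\<omega>. min L \<bar>X j \<omega> - Y \<omega>\<bar>) + expectation (\<lambda>\<omega>. (X j \<omega> - Y \<omega>)\<^sup>2) / L"
      using im iD2 by simp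
    also have "\<dots> \<le> expectation (\<lambda>\<omega>. min L \<bar>X j \<omega> - Y \<omega>\<bar>) + 4 * C / L"
      using D2[of j] L by (simp add: divide_right_mono)
    finally show ?thesis .
  qed
  show "(\<lambda>j. expectation (X j)) \<longlonglongrightarrow> expectation Y"
  proof (rule LIMSEQ_I)
    fix e :: real assume e: "0 < e"
    \<comment> \<open>Chosen so that the tail contribution \<open>4 * C / L\<close> stays below
      \<open>e / 2\<close>, also when \<open>C\<close> is 0.\<close>
    define L where "L = (8 * C + 1) / e"
    have L: "0 < L" using C0 e unfolding L_def by simp
    have "4 * C / L < e / 2"
      using C0 e unfolding L_def by (simp add: field_simps)
    moreover obtain N where "\<forall>j\<ge>N. norm (expectation (\<lambda>\<omega>. min L \<bar>X j \<omega> - Y \<omega>\<bar>) - 0) < e / 2"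
      using LIMSEQ_D[OF small[OF L], of "e / 2"] e by auto
    ultimately have "\<forall>j\<ge>N. norm (expectation (X j) - expectation Y) < e"
      using ineq[OF L] by (smt (verit) real_norm_def field_sum_of_halves)
    then show "\<exists>N. \<forall>j\<ge>N. norm (expectation (X j) - expectation Y) < e" by blast
  qed
qed

text \<open>Convergence to 0 in probability. Measurability belongs to the notion because
  \<open>prob\<close> is 0 on sets that are not measurable, which would make the limit void.\<close>

definition (in prob_space) vanishes :: "(nat \<Rightarrow> 'a \<Rightarrow> real) \<Rightarrow> bool" where
  "vanishes Z \<longleftrightarrow> (\<forall>j. Z j \<in> borel_measurable M) \<and>
     (\<forall>\<epsilon>>0. (\<lambda>j. prob {\<omega>\<in>space M. \<epsilon> < \<bar>Z j \<omega>\<bar>}) \<longlonglongrightarrow> 0)"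

lemma (in prob_space) vanishesD:
  assumes "vanishes Z"
  shows "Z j \<in> borel_measurable M" "0 < \<epsilon> \<Longrightarrow> (\<lambda>j. prob {\<omega>\<in>space M. \<epsilon> < \<bar>Z j \<omega>\<bar>}) \<longlonglongrightarrow> 0"
  using assms unfolding vanishes_def by auto

lemma (in prob_space) vanishes_le_add:
  assumes Z: "vanishes Z" and Z': "vanishes Z'" and [measurable]: "\<And>j. W j \<in> borel_measurable M"
    and le: "\<And>j \<omega>. \<omega> \<in> space M \<Longrightarrow> \<bar>W j \<omega>\<bar> \<le> \<bar>Z j \<omega>\<bar> + \<bar>Z' j \<omega>\<bar>"
  shows "vanishes W"
  unfolding vanishes_def
proof (intro conjI allI impI)
  fix \<epsilon> :: real assume "0 < \<epsilon>"
  then have e: "0 < \<epsilon> / 2" by simp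
  have [measurable]: "Z j \<in> borel_measurable M" "Z' j \<in> borel_measurable M" for j
    using Z Z' unfolding vanishes_def by auto
  have l: "(\<lambda>j. prob {\<omega>\<in>space M. \<epsilon>/2 < \<bar>Z j \<omega>\<bar>} + prob {\<omega>\<in>space M. \<epsilon>/2 < \<bar>Z' j \<omega>\<bar>}) \<longlonglongrightarrow> 0"
    using vanishesD(2)[OF Z e] vanishesD(2)[OF Z' e] by (rule tendsto_add_zero)
  have "prob {\<omega>\<in>space M. \<epsilon> < \<bar>W j \<omega>\<bar>} \<le> prob {\<omega>\<in>space M. \<epsilon>/2 < \<bar>Z j \<omega>\<bar>} + prob {\<omega>\<in>space M. \<epsilon>/2 < \<bar>Z' j \<omega>\<bar>}" for j
  proof -
    have "{\<omega>\<in>space M. \<epsilon> < \<bar>W j \<omega>\<bar>} \<subseteq> {\<omega>\<in>space M. \<epsilon>/2 < \<bar>Z j \<omega>\<bar>} \<union> {\<omega>\<in>space M. \<epsilon>/2 < \<bar>Z' j \<omega>\<bar>}"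
      using le[of _ j] by fastforce
    then have "prob {\<omega>\<in>space M. \<epsilon> < \<bar>W j \<omega>\<bar>} \<le> prob ({\<omega>\<in>space M. \<epsilon>/2 < \<bar>Z j \<omega>\<bar>} \<union> {\<omega>\<in>space M. \<epsilon>/2 < \<bar>Z' j \<omega>\<bar>})"
      by (intro finite_measure_mono) auto
    also have "\<dots> \<le> prob {\<omega>\<in>space M. \<epsilon>/2 < \<bar>Z j \<omega>\<bar>} + prob {\<omega>\<in>space M. \<epsilon>/2 < \<bar>Z' j \<omega>\<bar>}"
      by (intro measure_Un_le) auto
    finally show ?thesis .
  qed
  then show "(\<lambda>j. prob {\<omega>\<in>space M. \<epsilon> < \<bar>W j \<omega>\<bar>}) \<longlonglongrightarrow> 0"
    by (intro tendsto_sandwich[OF _ _ tendsto_const l]) (auto intro!: always_eventually)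
qed simp

lemma (in prob_space) vanishes_add:
  assumes "vanishes Z" "vanishes Z'" shows "vanishes (\<lambda>j \<omega>. \<bar>Z j \<omega>\<bar> + \<bar>Z' j \<omega>\<bar>)"
  using vanishesD(1)[OF assms(1)] vanishesD(1)[OF assms(2)]
  by (intro vanishes_le_add[OF assms] borel_measurable_add borel_measurable_abs) auto

text \<open>Convergence in probability implies convergence of \<open>min 1 \<bar>Z j\<bar>\<close>
  to 0 in mean, and a sequence converging in mean has an almost surely convergent subsequence.
  Eventually the minimum with 1 is inactive.\<close>

lemma (in prob_space) vanishes_AE_subseq:
  assumes Z: "vanishes Z"
  shows "\<exists>r::nat\<Rightarrow>nat. strict_mono r \<and> (AE \<omega> in M. (\<lambda>j. Z (r j) \<omega>) \<longlonglongrightarrow> 0)"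
proof -
  have [measurable]: "Z j \<in> borel_measurable M" for j
    using Z unfolding vanishes_def by auto
  have iu: "integrable M (\<lambda>\<omega>. min 1 \<bar>Z j \<omega>\<bar>)" for j
    by (rule integrable_const_bound[of _ 1]) (auto intro!: AE_I2)
  have bound: "expectation (\<lambda>\<omega>. min 1 \<bar>Z j \<omega>\<bar>) \<le> \<epsilon> + prob {\<omega>\<in>space M. \<epsilon> < \<bar>Z j \<omega>\<bar>}" if "0 < \<epsilon>" for \<epsilon> j
  proof -
    have "expectation (\<lambda>\<omega>. min 1 \<bar>Z j \<omega>\<bar>) \<le> expectation (\<lambda>\<omega>. \<epsilon> + indicator {\<omega>\<in>space M. \<epsilon> < \<bar>Z j \<omega>\<bar>} \<omega>)"
      using iu that by (intro integral_mono Bochner_Integration.integrable_add integrable_real_indicator)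
        (auto simp: indicator_def emeasure_eq_measure)
    also have "\<dots> = \<epsilon> + prob {\<omega>\<in>space M. \<epsilon> < \<bar>Z j \<omega>\<bar>}"
      by (subst Bochner_Integration.integral_add) (auto simp: prob_space emeasure_eq_measure)
    finally show ?thesis .
  qed
  have "(\<lambda>j. expectation (\<lambda>\<omega>. norm (min 1 \<bar>Z j \<omega>\<bar>))) \<longlonglongrightarrow> 0"
  proof (rule LIMSEQ_I)
    fix e :: real assume e: "0 < e"
    have "(\<lambda>j. prob {\<omega>\<in>space M. e / 2 < \<bar>Z j \<omega>\<bar>}) \<longlonglongrightarrow> 0" using vanishesD(2)[OF Z, of "e / 2"] e by simp
    from LIMSEQ_D[OF this, of "e / 2"] e obtain N where N: "\<forall>j\<ge>N. prob {\<omega>\<in>space M. e / 2 < \<bar>Z j \<omega>\<bar>} < e / 2" by auto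
    have "expectation (\<lambda>\<omega>. norm (min 1 \<bar>Z j \<omega>\<bar>)) < e" if "N \<le> j" for j
      using bound[of "e / 2" j] N that e by (fastforce simp: abs_of_nonneg)
    moreover have "0 \<le> expectation (\<lambda>\<omega>. norm (min 1 \<bar>Z j \<omega>\<bar>))" for j by simp
    ultimately show "\<exists>N. \<forall>j\<ge>N. norm (expectation (\<lambda>\<omega>. norm (min 1 \<bar>Z j \<omega>\<bar>)) - 0) < e" by (intro exI[of _ N]) simp
  qed
  from tendsto_L1_AE_subseq[OF iu this] obtain r :: "nat \<Rightarrow> nat" where r: "strict_mono r"
    "AE \<omega> in M. (\<lambda>j. min 1 \<bar>Z (r j) \<omega>\<bar>) \<longlonglongrightarrow> 0" by blast
  have "(\<lambda>j. Z (r j) \<omega>) \<longlonglongrightarrow> 0" if l: "(\<lambda>j. min 1 \<bar>Z (r j) \<omega>\<bar>) \<longlonglongrightarrow> 0" for \<omega>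
  proof -
    have "eventually (\<lambda>j. min 1 \<bar>Z (r j) \<omega>\<bar> < 1) sequentially" by (rule order_tendstoD(2)[OF l]) simp
    then have "eventually (\<lambda>j. min 1 \<bar>Z (r j) \<omega>\<bar> = \<bar>Z (r j) \<omega>\<bar>) sequentially"
      by (auto elim!: eventually_mono)
    then have "(\<lambda>j. \<bar>Z (r j) \<omega>\<bar>) \<longlonglongrightarrow> 0" using l by (rule Lim_transform_eventually[rotated])
    then show ?thesis by (rule tendsto_rabs_zero_cancel)
  qed
  then show ?thesis using r by (auto elim!: eventually_mono)
qed

section \<open>Ito integrals of bounded integrands\<close>

lemma set_integrable_bounded:
  fixes f :: "real \<Rightarrow> real"
  assumes [measurable]: "f \<in> borel_measurable borel" and b: "\<And>r. r \<in> {s..u} \<Longrightarrow> \<bar>f r\<bar> \<le> C"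
  shows "set_integrable lborel {s..u} f"
  unfolding set_integrable_def
proof (rule Bochner_Integration.integrable_bound[of _ "\<lambda>r. C * indicator {s..u} r"])
  show "integrable lborel (\<lambda>r. C * indicator {s..u} r)"
    by (intro integrable_mult_right integrable_real_indicator) (auto simp: emeasure_lborel_Icc_eq)
  show "AE r in lborel. norm (indicator {s..u} r *\<^sub>R f r) \<le> norm (C * indicator {s..u} r)"
    using b by (intro AE_I2) (fastforce simp: indicator_def)
qed auto

lemma set_lebesgue_integral_abs_le:
  fixes f :: "real \<Rightarrow> real"
  assumes "s \<le> u" and b: "\<And>r. r \<in> {s..u} \<Longrightarrow> \<bar>f r\<bar> \<le> C"
  shows "\<bar>LINT r:{s..u}|lborel. f r\<bar> \<le> C * (u - s)"
proof -
  have "C \<ge> 0" using b[of s] assms(1) by force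
  have iC: "integrable lborel (\<lambda>r. C * indicator {s..u} r)"
    by (intro integrable_mult_right integrable_real_indicator) (auto simp: emeasure_lborel_Icc_eq)
  have "norm (LINT r:{s..u}|lborel. f r) \<le> (LINT r|lborel. C * indicator {s..u} r)"
  proof (cases "set_integrable lborel {s..u} f")
    case True
    then show ?thesis unfolding set_lebesgue_integral_def set_integrable_def
      using b by (intro Bochner_Integration.integral_norm_bound_integral[OF _ iC]) (fastforce simp: indicator_def)+
  next
    case False
    then show ?thesis using \<open>C \<ge> 0\<close> assms(1)
      unfolding set_lebesgue_integral_def set_integrable_def by (simp add: not_integrable_integral_eq)
  qed
  then show ?thesis using assms(1) by simp
qed

text \<open>Only this inequality holds for arbitrary nonnegative \<open>f\<close>: the Bochner
  integral of a non-integrable function is the default 0.\<close>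

lemma ennreal_set_integral_le:
  assumes "\<And>r. 0 \<le> f r"
  shows "ennreal (LINT r:A|N. f r) \<le> (\<integral>\<^sup>+r\<in>A. ennreal (f r) \<partial>N)"
proof -
  have eq: "(\<integral>\<^sup>+r\<in>A. ennreal (f r) \<partial>N) = (\<integral>\<^sup>+r. ennreal (indicator A r *\<^sub>R f r) \<partial>N)"
    by (intro nn_integral_cong) (auto simp: indicator_def)
  show ?thesis
  proof (cases "integrable N (\<lambda>r. indicator A r *\<^sub>R f r)")
    case True
    then show ?thesis unfolding eq set_lebesgue_integral_def
      using assms by (subst nn_integral_eq_integral) (auto intro!: AE_I2)
  next
    case False
    then show ?thesis by (simp add: set_lebesgue_integral_def not_integrable_integral_eq)
  qed
qed

definition trunc :: "real \<Rightarrow> real \<Rightarrow> real" where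
  "trunc K x = max (- K) (min K x)"

lemma trunc_measurable [measurable]: "trunc K \<in> borel_measurable borel"
  unfolding trunc_def[abs_def] by measurable

text \<open>The last two facts compare with a value \<open>h\<close> already in
  \<open>[-K, K]\<close>: clamping moves a point closer to \<open>h\<close>, and what is cut off is
  at most the distance to \<open>h\<close>. Hence closeness of an approximation to a bounded
  integrand controls both the truncated approximation and the remainder.\<close>

lemma trunc_facts:
  assumes "0 \<le> K"
  shows "trunc K 0 = 0" "\<bar>trunc K x\<bar> \<le> K" "\<bar>trunc K x\<bar> \<le> \<bar>x\<bar>" "\<bar>x - trunc K x\<bar> \<le> \<bar>x\<bar>"
    "\<bar>h\<bar> \<le> K \<Longrightarrow> \<bar>trunc K x - h\<bar> \<le> \<bar>x - h\<bar>" "\<bar>h\<bar> \<le> K \<Longrightarrow> \<bar>x - trunc K x\<bar> \<le> \<bar>x - h\<bar>"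
  using assms by (auto simp: trunc_def)

context brownian_motion
begin

text \<open>Progressive measurability speaks about times in \<open>{0..T}\<close> only. Composing
  with \<open>clip\<close> extends the integrand to all real times without changing it on
  \<open>{0..T}\<close>, so that joint measurability over all of \<open>lborel\<close> is available
  for iterated integrals.\<close>

lemma ito_integrand_clip_measurable:
  assumes H: "ito_integrand M F H" and T: "0 \<le> T"
    and f: "f \<in> borel_measurable N" and g: "g \<in> measurable N M"
  shows "(\<lambda>x. H (clip 0 T (f x)) (g x)) \<in> borel_measurable N"
proof -
  have HT: "(\<lambda>(s, \<omega>). H s \<omega>) \<in> borel_measurable (restrict_space borel {0..T} \<Otimes>\<^sub>M F T)"
    using H T unfolding ito_integrand_def by blast
  have "(\<lambda>\<omega>. \<omega>) \<in> measurable M (F T)"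
    using sets_F_subset[of T] by (auto simp: measurable_def space_F Int_absorb2 sets.sets_into_space)
  then have 1: "g \<in> measurable N (F T)" using measurable_compose[OF g] by blast
  have "(\<lambda>x. clip 0 T (f x)) \<in> borel_measurable N"
    unfolding clip_def using f by measurable
  then have 2: "(\<lambda>x. clip 0 T (f x)) \<in> measurable N (restrict_space borel {0..T})"
    using clip_bounds[OF T] by (intro measurable_restrict_space2) auto
  show ?thesis
    using measurable_compose[OF measurable_Pair[OF 2 1] HT] by simp
qed

lemma simple_process_measurable:
  assumes si: "simple_integrand M F m \<tau> \<xi>"
    and f: "f \<in> borel_measurable N" and g: "g \<in> measurable N M"
  shows "(\<lambda>x. simple_process m \<tau> \<xi> (f x) (g x)) \<in> borel_measurable N"
proof -
  have "\<xi> k \<in> borel_measurable M" if "k < m" for k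
    using si that measurable_F_M unfolding simple_integrand_def by blast
  then have "(\<lambda>x. \<xi> k (g x)) \<in> borel_measurable N" if "k < m" for k using that measurable_compose[OF g] by blast
  moreover have "(\<lambda>x. indicator {\<tau> k<..\<tau> (Suc k)} (f x) :: real) \<in> borel_measurable N" for k
    using f by measurable
  ultimately show ?thesis unfolding simple_process_def
    by (intro borel_measurable_sum borel_measurable_times) auto
qed

lemma clip_Icc: "r \<in> {0..t} \<Longrightarrow> clip 0 t r = r"
  by (auto simp: clip_def)

lemma simple_integral_diff_coeff:
  "simple_integral B m \<tau> (\<lambda>k \<omega>. \<xi> k \<omega> - \<xi>' k \<omega>) t \<omega> = simple_integral B m \<tau> \<xi> t \<omega> - simple_integral B m \<tau> \<xi>' t \<omega>"
  unfolding simple_integral_def by (simp add: scaleR_left_diff_distrib sum_subtractf)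

text \<open>The given simple integrands need not be bounded uniformly, so their moments are out of
  reach. Cut off at \<open>K\<close>, they remain close to \<open>H\<close>, which is itself bounded
  by \<open>K\<close>; the part cut off has energy at most that of the original error, and
  \<open>simple_integral_lenglart\<close> makes its integral vanish in probability. The truncated
  integrals therefore still converge to \<open>I\<close>.\<close>

lemma ito_approximation:
  assumes I: "has_ito_integral M F B H I" and K0: "0 \<le> K"
    and K: "\<And>s \<omega>. 0 \<le> s \<Longrightarrow> \<omega> \<in> space M \<Longrightarrow> \<bar>H s \<omega>\<bar> \<le> K"
  obtains m \<tau> \<xi> where "\<And>j. simple_integrand M F (m j) (\<tau> j) (\<xi> j)"
    and "\<And>j k \<omega>. \<bar>\<xi> j k \<omega>\<bar> \<le> K"
    and "\<And>t i. 0 \<le> t \<Longrightarrow> vanishes (\<lambda>j \<omega>. simple_integral B (m j) (\<tau> j) (\<xi> j) t \<omega> $ i - I t \<omega> $ i)"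
    and "\<And>t. 0 \<le> t \<Longrightarrow> vanishes (\<lambda>j \<omega>. LINT r:{0..t}|lborel. (simple_process (m j) (\<tau> j) (\<xi> j) r \<omega> - H r \<omega>)\<^sup>2)"
proof -
  obtain m \<tau> \<xi>0 where si: "\<And>j. simple_integrand M F (m j) (\<tau> j) (\<xi>0 j)"
    and lim: "\<And>t \<epsilon>. 0 \<le> t \<Longrightarrow> 0 < \<epsilon> \<Longrightarrow> (\<lambda>j. measure M {\<omega> \<in> space M. ennreal \<epsilon> <
             (\<integral>\<^sup>+s\<in>{0..t}. ennreal ((simple_process (m j) (\<tau> j) (\<xi>0 j) s \<omega> - H s \<omega>)\<^sup>2) \<partial>lborel)})
            \<longlonglongrightarrow> 0"
         "\<And>t \<epsilon>. 0 \<le> t \<Longrightarrow> 0 < \<epsilon> \<Longrightarrow> (\<lambda>j. measure M {\<omega> \<in> space M. \<epsilon> <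
             norm (simple_integral B (m j) (\<tau> j) (\<xi>0 j) t \<omega> - I t \<omega>)}) \<longlonglongrightarrow> 0"
    using I unfolding has_ito_integral_def by blast
  have H: "ito_integrand M F H" and Im: "\<And>t. 0 \<le> t \<Longrightarrow> I t \<in> borel_measurable M"
    using I unfolding has_ito_integral_def by auto
  define \<xi> where "\<xi> = (\<lambda>j k \<omega>. trunc K (\<xi>0 j k \<omega>))"
  define \<rho> where "\<rho> = (\<lambda>j k \<omega>. \<xi>0 j k \<omega> - trunc K (\<xi>0 j k \<omega>))"
  have si\<xi>: "simple_integrand M F (m j) (\<tau> j) (\<xi> j)" for j
    unfolding \<xi>_def by (rule simple_integrand_map[OF si]) (use trunc_facts[OF K0] in auto)
  have si\<rho>: "simple_integrand M F (m j) (\<tau> j) (\<rho> j)" for j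
    unfolding \<rho>_def by (rule simple_integrand_map[OF si, where f="\<lambda>x. x - trunc K x"]) (use trunc_facts[OF K0] in auto)
  have SP\<xi>: "simple_process (m j) (\<tau> j) (\<xi> j) r \<omega> = trunc K (simple_process (m j) (\<tau> j) (\<xi>0 j) r \<omega>)" for j r \<omega>
    unfolding \<xi>_def by (rule simple_process_map[OF si]) (rule trunc_facts[OF K0])
  have SP\<rho>: "simple_process (m j) (\<tau> j) (\<rho> j) r \<omega> = simple_process (m j) (\<tau> j) (\<xi>0 j) r \<omega> - trunc K (simple_process (m j) (\<tau> j) (\<xi>0 j) r \<omega>)" for j r \<omega>
    unfolding \<rho>_def by (rule simple_process_map[OF si, where f="\<lambda>x. x - trunc K x"]) (simp add: trunc_facts[OF K0])
  define E where "E = (\<lambda>t j \<omega>. \<integral>\<^sup>+s\<in>{0..t}. ennreal ((simple_process (m j) (\<tau> j) (\<xi>0 j) s \<omega> - H s \<omega>)\<^sup>2) \<partial>lborel)"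
  have Em [measurable]: "E t j \<in> borel_measurable M" if t: "0 \<le> t" for t j
  proof -
    have eq: "E t j = (\<lambda>\<omega>. \<integral>\<^sup>+s. ennreal ((simple_process (m j) (\<tau> j) (\<xi>0 j) s \<omega> - H (clip 0 t s) \<omega>)\<^sup>2) * indicator {0..t} s \<partial>lborel)"
      unfolding E_def by (intro ext nn_integral_cong) (auto simp: indicator_def clip_Icc)
    note [measurable] = simple_process_measurable[OF si, of snd "M \<Otimes>\<^sub>M lborel" fst j]
      ito_integrand_clip_measurable[OF H t, of snd "M \<Otimes>\<^sub>M lborel" fst]
    have "(\<lambda>x. ennreal ((simple_process (m j) (\<tau> j) (\<xi>0 j) (snd x) (fst x) - H (clip 0 t (snd x)) (fst x))\<^sup>2) * indicator {0..t} (snd x))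
       \<in> borel_measurable (M \<Otimes>\<^sub>M lborel)" by measurable
    then show ?thesis unfolding eq
      by (intro lborel.borel_measurable_nn_integral) (simp add: split_beta)
  qed
  have Elim: "(\<lambda>j. prob {\<omega> \<in> space M. ennreal \<epsilon> < E t j \<omega>}) \<longlonglongrightarrow> 0" if "0 \<le> t" "0 < \<epsilon>" for t \<epsilon>
    using lim(1)[OF that] unfolding E_def .
  have vD: "vanishes (\<lambda>j \<omega>. LINT r:{0..t}|lborel. (simple_process (m j) (\<tau> j) (\<xi> j) r \<omega> - H r \<omega>)\<^sup>2)" if t: "0 \<le> t" for t
    unfolding vanishes_def
  proof (intro conjI allI impI)
    fix j
    have eq: "(\<lambda>\<omega>. LINT r:{0..t}|lborel. (simple_process (m j) (\<tau> j) (\<xi> j) r \<omega> - H r \<omega>)\<^sup>2) =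
      (\<lambda>\<omega>. LINT r|lborel. indicator {0..t} r *\<^sub>R (simple_process (m j) (\<tau> j) (\<xi> j) r \<omega> - H (clip 0 t r) \<omega>)\<^sup>2)"
      unfolding set_lebesgue_integral_def by (intro ext Bochner_Integration.integral_cong) (auto simp: indicator_def clip_Icc)
    note [measurable] = simple_process_measurable[OF si\<xi>, of snd "M \<Otimes>\<^sub>M lborel" fst j]
      ito_integrand_clip_measurable[OF H t, of snd "M \<Otimes>\<^sub>M lborel" fst]
    have "(\<lambda>x. indicator {0..t} (snd x) *\<^sub>R (simple_process (m j) (\<tau> j) (\<xi> j) (snd x) (fst x) - H (clip 0 t (snd x)) (fst x))\<^sup>2)
       \<in> borel_measurable (M \<Otimes>\<^sub>M lborel)" by measurable
    then show "(\<lambda>\<omega>. LINT r:{0..t}|lborel. (simple_process (m j) (\<tau> j) (\<xi> j) r \<omega> - H r \<omega>)\<^sup>2) \<in> borel_measurable M"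
      unfolding eq by (intro lborel.borel_measurable_lebesgue_integral) (simp add: split_beta)
  next
    fix \<epsilon> :: real assume e: "0 < \<epsilon>"
    let ?D = "\<lambda>j \<omega>. LINT r:{0..t}|lborel. (simple_process (m j) (\<tau> j) (\<xi> j) r \<omega> - H r \<omega>)\<^sup>2"
    have "prob {\<omega> \<in> space M. \<epsilon> < \<bar>?D j \<omega>\<bar>} \<le> prob {\<omega> \<in> space M. ennreal \<epsilon> < E t j \<omega>}" for j
    proof (rule finite_measure_mono)
      show "{\<omega> \<in> space M. \<epsilon> < \<bar>?D j \<omega>\<bar>} \<subseteq> {\<omega> \<in> space M. ennreal \<epsilon> < E t j \<omega>}"
      proof safe
        fix \<omega> assume w: "\<omega> \<in> space M" and "\<epsilon> < \<bar>?D j \<omega>\<bar>"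
        moreover have "0 \<le> ?D j \<omega>" unfolding set_lebesgue_integral_def by (intro Bochner_Integration.integral_nonneg) auto
        ultimately have "ennreal \<epsilon> < ennreal (?D j \<omega>)" using e by (simp add: ennreal_lessI)
        also have "\<dots> \<le> (\<integral>\<^sup>+r\<in>{0..t}. ennreal ((simple_process (m j) (\<tau> j) (\<xi> j) r \<omega> - H r \<omega>)\<^sup>2) \<partial>lborel)"
          by (rule ennreal_set_integral_le) simp
        also have "\<dots> \<le> E t j \<omega>" unfolding E_def SP\<xi>
          using trunc_facts(5)[OF K0 K] w
          by (intro nn_integral_mono) (auto simp: indicator_def abs_le_square_iff[symmetric] intro!: ennreal_leI)
        finally show "ennreal \<epsilon> < E t j \<omega>" .
      qed
    qed (use Em[OF t] in measurable)
    then show "(\<lambda>j. prob {\<omega> \<in> space M. \<epsilon> < \<bar>?D j \<omega>\<bar>}) \<longlonglongrightarrow> 0"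
      by (intro tendsto_sandwich[OF _ _ tendsto_const Elim[OF t e]]) (auto intro!: always_eventually)
  qed
  have mS: "(\<lambda>\<omega>. simple_integral B (m j) (\<tau> j) (\<zeta> j) t \<omega> $ i) \<in> borel_measurable M"
    if "simple_integrand M F (m j) (\<tau> j) (\<zeta> j)" "0 \<le> t" for j t i and \<zeta> :: "nat \<Rightarrow> nat \<Rightarrow> 'w \<Rightarrow> real"
    using measurable_compose[OF simple_integral_measurable[OF that] borel_measurable_nth] .
  have mI: "(\<lambda>\<omega>. I t \<omega> $ i) \<in> borel_measurable M" if "0 \<le> t" for t i
    using measurable_compose[OF Im[OF that] borel_measurable_nth] .
  have v\<rho>: "vanishes (\<lambda>j \<omega>. simple_integral B (m j) (\<tau> j) (\<rho> j) t \<omega> $ i)" if t: "0 \<le> t" for t i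
    unfolding vanishes_def
  proof (intro conjI allI impI mS[OF si\<rho> t])
    fix \<epsilon> :: real assume e: "0 < \<epsilon>"
    let ?P = "\<lambda>j. prob {\<omega>\<in>space M. \<epsilon> < \<bar>simple_integral B (m j) (\<tau> j) (\<rho> j) t \<omega> $ i\<bar>}"
    have bound: "?P j \<le> prob {\<omega> \<in> space M. ennreal \<eta> < E t j \<omega>} + \<eta> / \<epsilon>\<^sup>2" if \<eta>: "0 < \<eta>" for j \<eta>
    proof -
      let ?Q = "\<lambda>\<omega>. \<Sum>k<m j. (\<rho> j k \<omega>)\<^sup>2 * (clip 0 t (\<tau> j (Suc k)) - clip 0 t (\<tau> j k))"
      have "prob {\<omega>\<in>space M. \<eta> < ?Q \<omega>} \<le> prob {\<omega> \<in> space M. ennreal \<eta> < E t j \<omega>}"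
      proof (rule finite_measure_mono)
        show "{\<omega>\<in>space M. \<eta> < ?Q \<omega>} \<subseteq> {\<omega> \<in> space M. ennreal \<eta> < E t j \<omega>}"
        proof safe
          fix \<omega> assume w: "\<omega> \<in> space M" and "\<eta> < ?Q \<omega>"
          then have "ennreal \<eta> < ennreal (?Q \<omega>)" using \<eta> by (simp add: ennreal_lessI)
          also have "\<dots> = ennreal (LINT r:{0..t}|lborel. simple_process (m j) (\<tau> j) (\<rho> j) r \<omega> * simple_process (m j) (\<tau> j) (\<rho> j) r \<omega>)"
            using simple_process_energy[OF si\<rho> t, of j \<omega>] by simp
          also have "\<dots> \<le> (\<integral>\<^sup>+r\<in>{0..t}. ennreal (simple_process (m j) (\<tau> j) (\<rho> j) r \<omega> * simple_process (m j) (\<tau> j) (\<rho> j) r \<omega>) \<partial>lborel)"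
            by (rule ennreal_set_integral_le) simp
          also have "\<dots> \<le> E t j \<omega>" unfolding E_def SP\<rho> power2_eq_square[symmetric]
            using trunc_facts(6)[OF K0 K] w
            by (intro nn_integral_mono) (auto simp: indicator_def abs_le_square_iff[symmetric] intro!: ennreal_leI)
          finally show "ennreal \<eta> < E t j \<omega>" .
        qed
      qed (use Em[OF t] in measurable)
      then show ?thesis using simple_integral_lenglart[OF si\<rho> t \<eta> e, of j i] by linarith
    qed
    show "?P \<longlonglongrightarrow> 0"
    proof (rule LIMSEQ_I)
      fix \<delta> :: real assume d: "0 < \<delta>"
      \<comment> \<open>The second term of Lenglart's bound,
        \<open>\<eta> / \<epsilon>\<^sup>2\<close>, then equals half of \<delta>.\<close>
      define \<eta> where "\<eta> = \<epsilon>\<^sup>2 * \<delta> / 2"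
      have \<eta>: "0 < \<eta>" "\<eta> / \<epsilon>\<^sup>2 = \<delta> / 2" using d e unfolding \<eta>_def by auto
      obtain N where N: "\<forall>j\<ge>N. norm (prob {\<omega> \<in> space M. ennreal \<eta> < E t j \<omega>} - 0) < \<delta> / 2"
        using LIMSEQ_D[OF Elim[OF t \<eta>(1)], of "\<delta> / 2"] d by auto
      have "norm (?P j - 0) < \<delta>" if "N \<le> j" for j
        using bound[OF \<eta>(1), of j] N that \<eta>(2) by fastforce
      then show "\<exists>N. \<forall>j\<ge>N. norm (?P j - 0) < \<delta>" by blast
    qed
  qed
  have v0: "vanishes (\<lambda>j \<omega>. simple_integral B (m j) (\<tau> j) (\<xi>0 j) t \<omega> $ i - I t \<omega> $ i)" if t: "0 \<le> t" for t i
    unfolding vanishes_def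
  proof (intro conjI allI impI borel_measurable_diff mS[OF si t] mI[OF t])
    fix \<epsilon> :: real assume e: "0 < \<epsilon>"
    have "prob {\<omega>\<in>space M. \<epsilon> < \<bar>simple_integral B (m j) (\<tau> j) (\<xi>0 j) t \<omega> $ i - I t \<omega> $ i\<bar>} \<le>
       prob {\<omega>\<in>space M. \<epsilon> < norm (simple_integral B (m j) (\<tau> j) (\<xi>0 j) t \<omega> - I t \<omega>)}" for j
    proof (rule finite_measure_mono)
      show "{\<omega>\<in>space M. \<epsilon> < \<bar>simple_integral B (m j) (\<tau> j) (\<xi>0 j) t \<omega> $ i - I t \<omega> $ i\<bar>} \<subseteq>
        {\<omega>\<in>space M. \<epsilon> < norm (simple_integral B (m j) (\<tau> j) (\<xi>0 j) t \<omega> - I t \<omega>)}"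
        using component_le_norm_cart[of "simple_integral B (m j) (\<tau> j) (\<xi>0 j) t _ - I t _" i]
        by (auto intro: less_le_trans)
      show "{\<omega>\<in>space M. \<epsilon> < norm (simple_integral B (m j) (\<tau> j) (\<xi>0 j) t \<omega> - I t \<omega>)} \<in> events"
        using simple_integral_measurable[OF si t, of j] Im[OF t] by measurable
    qed
    then show "(\<lambda>j. prob {\<omega>\<in>space M. \<epsilon> < \<bar>simple_integral B (m j) (\<tau> j) (\<xi>0 j) t \<omega> $ i - I t \<omega> $ i\<bar>}) \<longlonglongrightarrow> 0"
      by (intro tendsto_sandwich[OF _ _ tendsto_const lim(2)[OF t e]]) (auto intro!: always_eventually)
  qed
  have v\<xi>: "vanishes (\<lambda>j \<omega>. simple_integral B (m j) (\<tau> j) (\<xi> j) t \<omega> $ i - I t \<omega> $ i)" if t: "0 \<le> t" for t i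
  proof (rule vanishes_le_add[OF v0[OF t, of i] v\<rho>[OF t, of i]])
    show "(\<lambda>\<omega>. simple_integral B (m j) (\<tau> j) (\<xi> j) t \<omega> $ i - I t \<omega> $ i) \<in> borel_measurable M" for j
      by (intro borel_measurable_diff mS[OF si\<xi> t] mI[OF t])
    have "simple_integral B (m j) (\<tau> j) (\<rho> j) t \<omega> = simple_integral B (m j) (\<tau> j) (\<xi>0 j) t \<omega> - simple_integral B (m j) (\<tau> j) (\<xi> j) t \<omega>" for j \<omega>
      unfolding \<rho>_def \<xi>_def by (rule simple_integral_diff_coeff)
    then show "\<bar>simple_integral B (m j) (\<tau> j) (\<xi> j) t \<omega> $ i - I t \<omega> $ i\<bar> \<le>
       \<bar>simple_integral B (m j) (\<tau> j) (\<xi>0 j) t \<omega> $ i - I t \<omega> $ i\<bar> + \<bar>simple_integral B (m j) (\<tau> j) (\<rho> j) t \<omega> $ i\<bar>" for j \<omega>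
      by simp
  qed
  show ?thesis
    by (rule that[OF si\<xi> _ v\<xi> vD]) (simp add: \<xi>_def trunc_facts(2)[OF K0])
qed

end

text \<open>The difference of products is split so that each part is a bounded factor times one
  error. The pointwise bound |x| by \<kappa> + x^2 / \<kappa> then replaces the Cauchy-Schwarz
  inequality; \<kappa> is free and is fixed before the errors are sent to 0.\<close>

lemma set_integral_product_close:
  fixes G G' h h' :: "real \<Rightarrow> real"
  assumes [measurable]: "G \<in> borel_measurable borel" "G' \<in> borel_measurable borel" "h \<in> borel_measurable borel" "h' \<in> borel_measurable borel"
    and K: "\<And>r. \<bar>G r\<bar> \<le> K" "\<And>r. \<bar>G' r\<bar> \<le> K" "\<And>r. \<bar>h r\<bar> \<le> K" "\<And>r. \<bar>h' r\<bar> \<le> K"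
    and su: "0 \<le> s" "s \<le> u" and \<kappa>: "0 < \<kappa>"
  shows "\<bar>(LINT r:{s..u}|lborel. G r * G' r) - (LINT r:{s..u}|lborel. h r * h' r)\<bar> \<le>
    2 * K * \<kappa> * (u - s) + K / \<kappa> * ((LINT r:{0..u}|lborel. (G r - h r)\<^sup>2) + (LINT r:{0..u}|lborel. (G' r - h' r)\<^sup>2))"
proof -
  have K0: "0 \<le> K" using K(1)[of 0] by linarith
  have KK: "\<bar>x * y\<bar> \<le> K * K" if "\<bar>x\<bar> \<le> K" "\<bar>y\<bar> \<le> K" for x y :: real
    using that K0 by (auto simp: abs_mult intro!: mult_mono)
  have sq: "\<bar>(x - y)\<^sup>2\<bar> \<le> (2 * K)\<^sup>2" if "\<bar>x\<bar> \<le> K" "\<bar>y\<bar> \<le> K" for x y :: real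
  proof -
    have "\<bar>x - y\<bar> \<le> \<bar>2 * K\<bar>" using that by linarith
    then show ?thesis by (simp only: abs_power2 abs_le_square_iff)
  qed
  have i1: "set_integrable lborel {s..u} (\<lambda>r. G r * G' r)" "set_integrable lborel {s..u} (\<lambda>r. h r * h' r)"
    by (intro set_integrable_bounded[where C="K * K"] KK K; measurable)+
  have i2: "set_integrable lborel {0..u} (\<lambda>r. (G r - h r)\<^sup>2)" "set_integrable lborel {0..u} (\<lambda>r. (G' r - h' r)\<^sup>2)"
    by (intro set_integrable_bounded[where C="(2 * K)\<^sup>2"] sq K; measurable)+
  have i3: "integrable lborel (\<lambda>r. 2 * K * \<kappa> * indicator {s..u} r)"
    by (intro integrable_mult_right integrable_real_indicator) (auto simp: emeasure_lborel_Icc_eq)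
  have young: "\<bar>x\<bar> \<le> \<kappa> + x\<^sup>2 / \<kappa>" for x :: real
  proof (cases "\<bar>x\<bar> \<le> \<kappa>")
    case False
    then have "\<kappa> * \<bar>x\<bar> \<le> \<bar>x\<bar> * \<bar>x\<bar>" by (intro mult_right_mono) auto
    then have "\<bar>x\<bar> \<le> x\<^sup>2 / \<kappa>" using \<kappa> by (simp add: field_simps power2_eq_square)
    then show ?thesis using \<kappa> by simp
  qed (use \<kappa> in \<open>simp add: add_increasing2\<close>)
  have pt: "\<bar>G r * G' r - h r * h' r\<bar> \<le> 2 * K * \<kappa> + K / \<kappa> * ((G r - h r)\<^sup>2 + (G' r - h' r)\<^sup>2)" for r
  proof -
    have eq: "G r * G' r - h r * h' r = G r * (G' r - h' r) + h' r * (G r - h r)" by (simp add: algebra_simps)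
    have "\<bar>G r * G' r - h r * h' r\<bar> \<le> K * \<bar>G' r - h' r\<bar> + K * \<bar>G r - h r\<bar>"
      unfolding eq
      using K by (intro order_trans[OF abs_triangle_ineq]) (auto simp: abs_mult intro!: add_mono mult_right_mono)
    also have "\<dots> \<le> K * (\<kappa> + (G' r - h' r)\<^sup>2 / \<kappa>) + K * (\<kappa> + (G r - h r)\<^sup>2 / \<kappa>)"
      using young K0 by (intro add_mono mult_left_mono) auto
    also have "\<dots> = 2 * K * \<kappa> + K / \<kappa> * ((G r - h r)\<^sup>2 + (G' r - h' r)\<^sup>2)"
      by (simp add: algebra_simps add_divide_distrib)
    finally show ?thesis .
  qed
  let ?W = "\<lambda>r. 2 * K * \<kappa> * indicator {s..u} r + K / \<kappa> * (indicator {0..u} r *\<^sub>R (G r - h r)\<^sup>2 + indicator {0..u} r *\<^sub>R (G' r - h' r)\<^sup>2)"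
  have iW: "integrable lborel ?W"
    using i2 i3 unfolding set_integrable_def by (intro Bochner_Integration.integrable_add integrable_mult_right) auto
  have eq: "(LINT r:{s..u}|lborel. G r * G' r) - (LINT r:{s..u}|lborel. h r * h' r) =
    (LINT r|lborel. indicator {s..u} r *\<^sub>R (G r * G' r) - indicator {s..u} r *\<^sub>R (h r * h' r))"
    using i1 unfolding set_integrable_def set_lebesgue_integral_def by simp
  have "\<bar>(LINT r:{s..u}|lborel. G r * G' r) - (LINT r:{s..u}|lborel. h r * h' r)\<bar> \<le> (LINT r|lborel. ?W r)"
    unfolding eq real_norm_def[symmetric]
  proof (rule Bochner_Integration.integral_norm_bound_integral[OF _ iW])
    show "integrable lborel (\<lambda>r. indicator {s..u} r *\<^sub>R (G r * G' r) - indicator {s..u} r *\<^sub>R (h r * h' r))"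
      using i1 unfolding set_integrable_def by (rule Bochner_Integration.integrable_diff)
    fix r
    have "0 \<le> K / \<kappa> * (indicator {0..u} r *\<^sub>R (G r - h r)\<^sup>2 + indicator {0..u} r *\<^sub>R (G' r - h' r)\<^sup>2)"
      using K0 \<kappa> by (intro mult_nonneg_nonneg) auto
    then show "norm (indicator {s..u} r *\<^sub>R (G r * G' r) - indicator {s..u} r *\<^sub>R (h r * h' r)) \<le> ?W r"
      using pt[of r] su by (auto simp: indicator_def)
  qed
  also have "(LINT r|lborel. ?W r) = 2 * K * \<kappa> * (u - s) + K / \<kappa> * ((LINT r:{0..u}|lborel. (G r - h r)\<^sup>2) + (LINT r:{0..u}|lborel. (G' r - h' r)\<^sup>2))"
    using i2 i3 su unfolding set_integrable_def set_lebesgue_integral_def by simp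
  finally show ?thesis .
qed

lemma tendsto_of_product_bound:
  fixes y d :: "nat \<Rightarrow> real"
  assumes d: "d \<longlonglongrightarrow> 0" and A: "0 \<le> A" and le: "\<And>\<kappa> j. 0 < \<kappa> \<Longrightarrow> \<bar>y j - L\<bar> \<le> A * \<kappa> + c / \<kappa> * d j"
  shows "y \<longlonglongrightarrow> L"
proof (rule LIMSEQ_I)
  fix e :: real assume e: "0 < e"
  define \<kappa> where "\<kappa> = e / (2 * (A + 1))"
  have \<kappa>: "0 < \<kappa>" "A * \<kappa> < e / 2" using A e unfolding \<kappa>_def by (auto simp: field_simps)
  have "(\<lambda>j. c / \<kappa> * d j) \<longlonglongrightarrow> c / \<kappa> * 0" by (intro tendsto_intros d)
  then have "(\<lambda>j. c / \<kappa> * d j) \<longlonglongrightarrow> 0" by simp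
  from LIMSEQ_D[OF this, of "e / 2"] e obtain N where N: "\<forall>j\<ge>N. norm (c / \<kappa> * d j - 0) < e / 2" by auto
  have "norm (y j - L) < e" if "N \<le> j" for j
  proof -
    have "\<bar>c / \<kappa> * d j\<bar> < e / 2" using N that by simp
    then show ?thesis using le[OF \<kappa>(1), of j] \<kappa>(2) unfolding real_norm_def by linarith
  qed
  then show "\<exists>N. \<forall>j\<ge>N. norm (y j - L) < e" by blast
qed

context brownian_motion
begin

lemma simple_process_bound:
  assumes si: "simple_integrand M F m \<tau> \<xi>" and K0: "0 \<le> K" and K: "\<And>k \<omega>. \<bar>\<xi> k \<omega>\<bar> \<le> K"
  shows "\<bar>simple_process m \<tau> \<xi> r \<omega>\<bar> \<le> K"
proof -
  have "trunc K (\<xi> k \<omega>) = \<xi> k \<omega>" for k \<omega> using K[of k \<omega>] by (auto simp: trunc_def)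
  then have "simple_process m \<tau> \<xi> r \<omega> = simple_process m \<tau> (\<lambda>k \<omega>. trunc K (\<xi> k \<omega>)) r \<omega>" by simp
  also have "\<dots> = trunc K (simple_process m \<tau> \<xi> r \<omega>)"
    by (rule simple_process_map[OF si]) (rule trunc_facts[OF K0])
  finally show ?thesis using trunc_facts(2)[OF K0] by metis
qed

lemma ito_product_integral_measurable:
  assumes H: "ito_integrand M F H" "ito_integrand M F H'" and su: "0 \<le> s" "s \<le> u"
  shows "(\<lambda>\<omega>. LINT r:{s..u}|lborel. H r \<omega> * H' r \<omega>) \<in> borel_measurable M"
proof -
  have u: "0 \<le> u" using su by simp
  have eq: "(\<lambda>\<omega>. LINT r:{s..u}|lborel. H r \<omega> * H' r \<omega>) =
    (\<lambda>\<omega>. LINT r|lborel. indicator {s..u} r *\<^sub>R (H (clip 0 u r) \<omega> * H' (clip 0 u r) \<omega>))"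
    unfolding set_lebesgue_integral_def using su by (intro ext Bochner_Integration.integral_cong) (auto simp: indicator_def clip_Icc)
  note [measurable] = ito_integrand_clip_measurable[OF H(1) u, of snd "M \<Otimes>\<^sub>M lborel" fst]
     ito_integrand_clip_measurable[OF H(2) u, of snd "M \<Otimes>\<^sub>M lborel" fst]
  have "(\<lambda>x. indicator {s..u} (snd x) *\<^sub>R (H (clip 0 u (snd x)) (fst x) * H' (clip 0 u (snd x)) (fst x)))
       \<in> borel_measurable (M \<Otimes>\<^sub>M lborel)" by measurable
  then show ?thesis
    unfolding eq by (intro lborel.borel_measurable_lebesgue_integral) (simp add: split_beta)
qed

text \<open>All identities hold for the truncated simple integrals and pass to the limit along a
  subsequence that converges almost surely. Uniform fourth moments give the uniform L2 bounds needed
  for the expectations on the left; the time integrals on the right are bounded and converge by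
  domination.\<close>

lemma ito_increment_facts:
  assumes I: "has_ito_integral M F B H I" and I': "has_ito_integral M F B H' I'" and K0: "0 \<le> K"
    and K: "\<And>s \<omega>. 0 \<le> s \<Longrightarrow> \<omega> \<in> space M \<Longrightarrow> \<bar>H s \<omega>\<bar> \<le> K" "\<And>s \<omega>. 0 \<le> s \<Longrightarrow> \<omega> \<in> space M \<Longrightarrow> \<bar>H' s \<omega>\<bar> \<le> K"
    and su: "0 \<le> s" "s \<le> u" and \<zeta>: "bounded_F s \<zeta>"
  shows "integrable M (\<lambda>\<omega>. (I u \<omega> $ i - I s \<omega> $ i) ^ 4)"
    and "expectation (\<lambda>\<omega>. (I u \<omega> $ i - I s \<omega> $ i) ^ 4) \<le> 3 * K ^ 4 * (u - s)\<^sup>2"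
    and "integrable M (\<lambda>\<omega>. \<zeta> \<omega> * (I u \<omega> $ i - I s \<omega> $ i))"
    and "expectation (\<lambda>\<omega>. \<zeta> \<omega> * (I u \<omega> $ i - I s \<omega> $ i)) = 0"
    and "integrable M (\<lambda>\<omega>. \<zeta> \<omega> * ((I u \<omega> $ i - I s \<omega> $ i) * (I' u \<omega> $ l - I' s \<omega> $ l)))"
    and "expectation (\<lambda>\<omega>. \<zeta> \<omega> * ((I u \<omega> $ i - I s \<omega> $ i) * (I' u \<omega> $ l - I' s \<omega> $ l))) =
      (if i = l then expectation (\<lambda>\<omega>. \<zeta> \<omega> * (LINT r:{s..u}|lborel. H r \<omega> * H' r \<omega>)) else 0)"
proof -
  have u0: "0 \<le> u" using su by simp
  obtain m \<tau> \<xi> where si: "\<And>j. simple_integrand M F (m j) (\<tau> j) (\<xi> j)"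
    and \<xi>K: "\<And>j k \<omega>. \<bar>\<xi> j k \<omega>\<bar> \<le> K"
    and vI: "\<And>t i. 0 \<le> t \<Longrightarrow> vanishes (\<lambda>j \<omega>. simple_integral B (m j) (\<tau> j) (\<xi> j) t \<omega> $ i - I t \<omega> $ i)"
    and vH: "\<And>t. 0 \<le> t \<Longrightarrow> vanishes (\<lambda>j \<omega>. LINT r:{0..t}|lborel. (simple_process (m j) (\<tau> j) (\<xi> j) r \<omega> - H r \<omega>)\<^sup>2)"
    by (rule ito_approximation[OF I K0 K(1)]) (assumption | rule that)+
  obtain m' \<tau>' \<xi>' where si': "\<And>j. simple_integrand M F (m' j) (\<tau>' j) (\<xi>' j)"
    and \<xi>K': "\<And>j k \<omega>. \<bar>\<xi>' j k \<omega>\<bar> \<le> K"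
    and vI': "\<And>t i. 0 \<le> t \<Longrightarrow> vanishes (\<lambda>j \<omega>. simple_integral B (m' j) (\<tau>' j) (\<xi>' j) t \<omega> $ i - I' t \<omega> $ i)"
    and vH': "\<And>t. 0 \<le> t \<Longrightarrow> vanishes (\<lambda>j \<omega>. LINT r:{0..t}|lborel. (simple_process (m' j) (\<tau>' j) (\<xi>' j) r \<omega> - H' r \<omega>)\<^sup>2)"
    by (rule ito_approximation[OF I' K0 K(2)]) (assumption | rule that)+
  have H: "ito_integrand M F H" "ito_integrand M F H'" and Im: "\<And>t. 0 \<le> t \<Longrightarrow> I t \<in> borel_measurable M" "\<And>t. 0 \<le> t \<Longrightarrow> I' t \<in> borel_measurable M"
    using I I' unfolding has_ito_integral_def by auto
  define S where "S = (\<lambda>j t \<omega>. simple_integral B (m j) (\<tau> j) (\<xi> j) t \<omega> $ i)"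
  define S' where "S' = (\<lambda>j t \<omega>. simple_integral B (m' j) (\<tau>' j) (\<xi>' j) t \<omega> $ l)"
  define G where "G = (\<lambda>j. simple_process (m j) (\<tau> j) (\<xi> j))"
  define G' where "G' = (\<lambda>j. simple_process (m' j) (\<tau>' j) (\<xi>' j))"
  define D where "D = (\<lambda>j \<omega>. LINT r:{0..u}|lborel. (G j r \<omega> - H r \<omega>)\<^sup>2)"
  define D' where "D' = (\<lambda>j \<omega>. LINT r:{0..u}|lborel. (G' j r \<omega> - H' r \<omega>)\<^sup>2)"
  let ?Z1 = "\<lambda>j \<omega>. \<bar>S j s \<omega> - I s \<omega> $ i\<bar> + \<bar>S j u \<omega> - I u \<omega> $ i\<bar>"
  let ?Z2 = "\<lambda>j \<omega>. \<bar>S' j s \<omega> - I' s \<omega> $ l\<bar> + \<bar>S' j u \<omega> - I' u \<omega> $ l\<bar>"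
  let ?Z3 = "\<lambda>j \<omega>. \<bar>D j \<omega>\<bar> + \<bar>D' j \<omega>\<bar>"
  have vz: "vanishes ?Z1" "vanishes ?Z2" "vanishes ?Z3"
    unfolding S_def S'_def D_def D'_def G_def G'_def
    by (intro vanishes_add vI vI' vH vH' su u0)+
  \<comment> \<open>The sum of all error terms vanishes in probability, so a single subsequence
    serves all of them at once.\<close>
  obtain r :: "nat \<Rightarrow> nat" where r: "strict_mono r"
    and AE0: "AE \<omega> in M. (\<lambda>j. \<bar>\<bar>?Z1 (r j) \<omega>\<bar> + \<bar>?Z2 (r j) \<omega>\<bar>\<bar> + \<bar>?Z3 (r j) \<omega>\<bar>) \<longlonglongrightarrow> 0"
    using vanishes_AE_subseq[OF vanishes_add[OF vanishes_add[OF vz(1,2)] vz(3)]] by blast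
  have conv: "AE \<omega> in M. (\<lambda>j. S (r j) s \<omega>) \<longlonglongrightarrow> I s \<omega> $ i \<and> (\<lambda>j. S (r j) u \<omega>) \<longlonglongrightarrow> I u \<omega> $ i \<and>
     (\<lambda>j. S' (r j) s \<omega>) \<longlonglongrightarrow> I' s \<omega> $ l \<and> (\<lambda>j. S' (r j) u \<omega>) \<longlonglongrightarrow> I' u \<omega> $ l \<and>
     (\<lambda>j. D (r j) \<omega> + D' (r j) \<omega>) \<longlonglongrightarrow> 0"
    using AE0
  proof eventually_elim
    fix \<omega> assume z: "(\<lambda>j. \<bar>\<bar>?Z1 (r j) \<omega>\<bar> + \<bar>?Z2 (r j) \<omega>\<bar>\<bar> + \<bar>?Z3 (r j) \<omega>\<bar>) \<longlonglongrightarrow> 0"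
    have sq: "f \<longlonglongrightarrow> c" if "\<And>j. \<bar>f j - c\<bar> \<le> \<bar>\<bar>?Z1 (r j) \<omega>\<bar> + \<bar>?Z2 (r j) \<omega>\<bar>\<bar> + \<bar>?Z3 (r j) \<omega>\<bar>" for f c
    proof -
      have "(\<lambda>j. \<bar>f j - c\<bar>) \<longlonglongrightarrow> 0"
        by (rule tendsto_sandwich[OF _ _ tendsto_const z]; rule always_eventually, rule allI) (rule abs_ge_zero, rule that)
      then show ?thesis by (rule LIM_zero_cancel[OF tendsto_rabs_zero_cancel])
    qed
    have le: "\<bar>a\<bar> \<le> \<bar>\<bar>\<bar>a\<bar> + \<bar>b\<bar>\<bar> + \<bar>\<bar>c\<bar> + \<bar>d\<bar>\<bar>\<bar> + \<bar>\<bar>e\<bar> + \<bar>f\<bar>\<bar>"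
      "\<bar>b\<bar> \<le> \<bar>\<bar>\<bar>a\<bar> + \<bar>b\<bar>\<bar> + \<bar>\<bar>c\<bar> + \<bar>d\<bar>\<bar>\<bar> + \<bar>\<bar>e\<bar> + \<bar>f\<bar>\<bar>"
      "\<bar>c\<bar> \<le> \<bar>\<bar>\<bar>a\<bar> + \<bar>b\<bar>\<bar> + \<bar>\<bar>c\<bar> + \<bar>d\<bar>\<bar>\<bar> + \<bar>\<bar>e\<bar> + \<bar>f\<bar>\<bar>"
      "\<bar>d\<bar> \<le> \<bar>\<bar>\<bar>a\<bar> + \<bar>b\<bar>\<bar> + \<bar>\<bar>c\<bar> + \<bar>d\<bar>\<bar>\<bar> + \<bar>\<bar>e\<bar> + \<bar>f\<bar>\<bar>"
      "\<bar>(e + f) - 0\<bar> \<le> \<bar>\<bar>\<bar>a\<bar> + \<bar>b\<bar>\<bar> + \<bar>\<bar>c\<bar> + \<bar>d\<bar>\<bar>\<bar> + \<bar>\<bar>e\<bar> + \<bar>f\<bar>\<bar>" for a b c d e f :: real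
      by (simp_all only: abs_of_nonneg add_nonneg_nonneg abs_ge_zero diff_0_right)
    show "(\<lambda>j. S (r j) s \<omega>) \<longlonglongrightarrow> I s \<omega> $ i \<and> (\<lambda>j. S (r j) u \<omega>) \<longlonglongrightarrow> I u \<omega> $ i \<and>
     (\<lambda>j. S' (r j) s \<omega>) \<longlonglongrightarrow> I' s \<omega> $ l \<and> (\<lambda>j. S' (r j) u \<omega>) \<longlonglongrightarrow> I' u \<omega> $ l \<and>
     (\<lambda>j. D (r j) \<omega> + D' (r j) \<omega>) \<longlonglongrightarrow> 0"
      by (intro conjI sq le)
  qed
  let ?a = "\<lambda>j \<omega>. S (r j) u \<omega> - S (r j) s \<omega>" and ?b = "\<lambda>j \<omega>. S' (r j) u \<omega> - S' (r j) s \<omega>"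
  have mS [measurable]: "S j t \<in> borel_measurable M" "S' j t \<in> borel_measurable M" if "0 \<le> t" for j t
    unfolding S_def S'_def
    using measurable_compose[OF simple_integral_measurable[OF si that] borel_measurable_nth]
      measurable_compose[OF simple_integral_measurable[OF si' that] borel_measurable_nth] by auto
  have mI [measurable]: "(\<lambda>\<omega>. I t \<omega> $ i) \<in> borel_measurable M" "(\<lambda>\<omega>. I' t \<omega> $ l) \<in> borel_measurable M" if "0 \<le> t" for t
    using measurable_compose[OF Im(1)[OF that] borel_measurable_nth] measurable_compose[OF Im(2)[OF that] borel_measurable_nth] by auto
  have [measurable]: "S j s \<in> borel_measurable M" "S' j s \<in> borel_measurable M" "S j u \<in> borel_measurable M" "S' j u \<in> borel_measurable M" for j
    using mS su u0 by auto
  have [measurable]: "(\<lambda>\<omega>. I s \<omega> $ i) \<in> borel_measurable M" "(\<lambda>\<omega>. I' s \<omega> $ l) \<in> borel_measurable M"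
     "(\<lambda>\<omega>. I u \<omega> $ i) \<in> borel_measurable M" "(\<lambda>\<omega>. I' u \<omega> $ l) \<in> borel_measurable M"
    using mI su u0 by auto
  have [measurable]: "\<zeta> \<in> borel_measurable M" using measurable_F_M[OF bounded_F_measurable[OF \<zeta>]] .
  obtain C where C: "\<And>\<omega>. \<omega> \<in> space M \<Longrightarrow> \<bar>\<zeta> \<omega>\<bar> \<le> C" using \<zeta> unfolding bounded_F_def by blast
  have C0: "0 \<le> C" using C not_empty by force
  have a4: "integrable M (\<lambda>\<omega>. (?a j \<omega>) ^ 4)" "expectation (\<lambda>\<omega>. (?a j \<omega>) ^ 4) \<le> 3 * K ^ 4 * (u - s)\<^sup>2" for j
    using simple_integral_fourth_moment[OF si su \<xi>K K0] unfolding S_def by auto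
  have b4: "integrable M (\<lambda>\<omega>. (?b j \<omega>) ^ 4)" "expectation (\<lambda>\<omega>. (?b j \<omega>) ^ 4) \<le> 3 * K ^ 4 * (u - s)\<^sup>2" for j
    using simple_integral_fourth_moment[OF si' su \<xi>K' K0] unfolding S'_def by auto
  have l4: "AE \<omega> in M. (\<lambda>j. (?a j \<omega>) ^ 4) \<longlonglongrightarrow> (I u \<omega> $ i - I s \<omega> $ i) ^ 4"
    using conv by eventually_elim (auto intro!: tendsto_intros)
  show "integrable M (\<lambda>\<omega>. (I u \<omega> $ i - I s \<omega> $ i) ^ 4)" "expectation (\<lambda>\<omega>. (I u \<omega> $ i - I s \<omega> $ i) ^ 4) \<le> 3 * K ^ 4 * (u - s)\<^sup>2"
    by (rule fatou_bound[OF a4(1) _ a4(2) l4], simp, measurable)+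
  have C2: "(\<zeta> \<omega>)\<^sup>2 \<le> C\<^sup>2" if "\<omega> \<in> space M" for \<omega>
    using C[OF that] C0 by (simp add: abs_le_square_iff[symmetric])
  \<comment> \<open>This bound and the next turn uniform fourth moments into the L2 bounds required
    by \<open>expectation_tendsto_L2_bounded\<close>, for the weighted increment and for the
    weighted product of increments.\<close>
  have p4: "x\<^sup>2 \<le> 1 + x ^ 4" for x :: real
  proof -
    have "2 * x\<^sup>2 \<le> 1 + x ^ 4"
      using sum_squares_bound[of 1 "x\<^sup>2"] by simp
    then show ?thesis using zero_le_power2[of x] by linarith
  qed
  have xy: "(x * y)\<^sup>2 \<le> x ^ 4 + y ^ 4" for x y :: real
  proof -
    have "2 * (x * y)\<^sup>2 \<le> x ^ 4 + y ^ 4"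
      using sum_squares_bound[of "x\<^sup>2" "y\<^sup>2"] by (simp add: power_mult_distrib)
    then show ?thesis using zero_le_power2[of "x * y"] by linarith
  qed
  let ?W = "3 * K ^ 4 * (u - s)\<^sup>2"
  have q1: "integrable M (\<lambda>\<omega>. (\<zeta> \<omega> * ?a j \<omega>)\<^sup>2) \<and> expectation (\<lambda>\<omega>. (\<zeta> \<omega> * ?a j \<omega>)\<^sup>2) \<le> C\<^sup>2 * (1 + ?W)" for j
  proof -
    have i: "integrable M (\<lambda>\<omega>. C\<^sup>2 * (1 + (?a j \<omega>) ^ 4))" using a4(1) by simp
    have le: "(\<zeta> \<omega> * ?a j \<omega>)\<^sup>2 \<le> C\<^sup>2 * (1 + (?a j \<omega>) ^ 4)" if "\<omega> \<in> space M" for \<omega>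
      using C2[OF that] p4 by (simp add: power_mult_distrib mult_mono)
    have i': "integrable M (\<lambda>\<omega>. (\<zeta> \<omega> * ?a j \<omega>)\<^sup>2)"
      by (rule Bochner_Integration.integrable_bound[OF i]) (use le in \<open>auto intro!: AE_I2 intro: order_trans[OF _ abs_ge_self]\<close>)
    have "expectation (\<lambda>\<omega>. (\<zeta> \<omega> * ?a j \<omega>)\<^sup>2) \<le> expectation (\<lambda>\<omega>. C\<^sup>2 * (1 + (?a j \<omega>) ^ 4))"
      by (rule integral_mono[OF i' i le])
    also have "\<dots> = C\<^sup>2 * (1 + expectation (\<lambda>\<omega>. (?a j \<omega>) ^ 4))" using a4(1)[of j] by (simp add: prob_space)
    also have "\<dots> \<le> C\<^sup>2 * (1 + ?W)" using a4(2)[of j] by (intro mult_left_mono) auto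
    finally show ?thesis using i' by blast
  qed
  have q2: "integrable M (\<lambda>\<omega>. (\<zeta> \<omega> * (?a j \<omega> * ?b j \<omega>))\<^sup>2) \<and> expectation (\<lambda>\<omega>. (\<zeta> \<omega> * (?a j \<omega> * ?b j \<omega>))\<^sup>2) \<le> C\<^sup>2 * (?W + ?W)" for j
  proof -
    have i: "integrable M (\<lambda>\<omega>. C\<^sup>2 * ((?a j \<omega>) ^ 4 + (?b j \<omega>) ^ 4))" using a4(1) b4(1) by simp
    have le: "(\<zeta> \<omega> * (?a j \<omega> * ?b j \<omega>))\<^sup>2 \<le> C\<^sup>2 * ((?a j \<omega>) ^ 4 + (?b j \<omega>) ^ 4)" if "\<omega> \<in> space M" for \<omega>
      using C2[OF that] xy[of "?a j \<omega>" "?b j \<omega>"] by (subst power_mult_distrib) (intro mult_mono, auto)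
    have i': "integrable M (\<lambda>\<omega>. (\<zeta> \<omega> * (?a j \<omega> * ?b j \<omega>))\<^sup>2)"
      by (rule Bochner_Integration.integrable_bound[OF i]) (use le in \<open>auto intro!: AE_I2 intro: order_trans[OF _ abs_ge_self]\<close>)
    have "expectation (\<lambda>\<omega>. (\<zeta> \<omega> * (?a j \<omega> * ?b j \<omega>))\<^sup>2) \<le> expectation (\<lambda>\<omega>. C\<^sup>2 * ((?a j \<omega>) ^ 4 + (?b j \<omega>) ^ 4))"
      by (rule integral_mono[OF i' i le])
    also have "\<dots> = C\<^sup>2 * (expectation (\<lambda>\<omega>. (?a j \<omega>) ^ 4) + expectation (\<lambda>\<omega>. (?b j \<omega>) ^ 4))" using a4(1)[of j] b4(1)[of j] by simp
    also have "\<dots> \<le> C\<^sup>2 * (?W + ?W)" using a4(2)[of j] b4(2)[of j] by (intro mult_left_mono add_mono) auto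
    finally show ?thesis using i' by blast
  qed
  have l1: "AE \<omega> in M. (\<lambda>j. \<zeta> \<omega> * ?a j \<omega>) \<longlonglongrightarrow> \<zeta> \<omega> * (I u \<omega> $ i - I s \<omega> $ i)"
    using conv by eventually_elim (auto intro!: tendsto_intros)
  have t1: "integrable M (\<lambda>\<omega>. \<zeta> \<omega> * (I u \<omega> $ i - I s \<omega> $ i))"
     "(\<lambda>j. expectation (\<lambda>\<omega>. \<zeta> \<omega> * ?a j \<omega>)) \<longlonglongrightarrow> expectation (\<lambda>\<omega>. \<zeta> \<omega> * (I u \<omega> $ i - I s \<omega> $ i))"
    by (rule expectation_tendsto_L2_bounded[OF _ conjunct1[OF q1] conjunct2[OF q1] l1]; measurable)+
  show "integrable M (\<lambda>\<omega>. \<zeta> \<omega> * (I u \<omega> $ i - I s \<omega> $ i))" by (rule t1)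
  have "expectation (\<lambda>\<omega>. \<zeta> \<omega> * ?a j \<omega>) = 0" for j
    using simple_integral_mean[OF si su \<zeta>] unfolding S_def by blast
  then show "expectation (\<lambda>\<omega>. \<zeta> \<omega> * (I u \<omega> $ i - I s \<omega> $ i)) = 0"
    using t1(2) LIMSEQ_unique[OF _ tendsto_const[of 0]] by auto
  have l2: "AE \<omega> in M. (\<lambda>j. \<zeta> \<omega> * (?a j \<omega> * ?b j \<omega>)) \<longlonglongrightarrow> \<zeta> \<omega> * ((I u \<omega> $ i - I s \<omega> $ i) * (I' u \<omega> $ l - I' s \<omega> $ l))"
    using conv by eventually_elim (auto intro!: tendsto_intros)
  have t2: "integrable M (\<lambda>\<omega>. \<zeta> \<omega> * ((I u \<omega> $ i - I s \<omega> $ i) * (I' u \<omega> $ l - I' s \<omega> $ l)))"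
     "(\<lambda>j. expectation (\<lambda>\<omega>. \<zeta> \<omega> * (?a j \<omega> * ?b j \<omega>))) \<longlonglongrightarrow> expectation (\<lambda>\<omega>. \<zeta> \<omega> * ((I u \<omega> $ i - I s \<omega> $ i) * (I' u \<omega> $ l - I' s \<omega> $ l)))"
    by (rule expectation_tendsto_L2_bounded[OF _ conjunct1[OF q2] conjunct2[OF q2] l2]; measurable)+
  show "integrable M (\<lambda>\<omega>. \<zeta> \<omega> * ((I u \<omega> $ i - I s \<omega> $ i) * (I' u \<omega> $ l - I' s \<omega> $ l)))" by (rule t2)
  let ?L = "\<lambda>\<omega>. LINT r:{s..u}|lborel. H r \<omega> * H' r \<omega>" and ?Lj = "\<lambda>j \<omega>. LINT x:{s..u}|lborel. G (r j) x \<omega> * G' (r j) x \<omega>"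
  have iso: "expectation (\<lambda>\<omega>. \<zeta> \<omega> * (?a j \<omega> * ?b j \<omega>)) = (if i = l then expectation (\<lambda>\<omega>. \<zeta> \<omega> * ?Lj j \<omega>) else 0)" for j
    using simple_integral_isometry[OF si si' su \<zeta>] unfolding S_def S'_def G_def G'_def by blast
  have GK: "\<bar>G j x \<omega>\<bar> \<le> K" "\<bar>G' j x \<omega>\<bar> \<le> K" for j x \<omega>
    unfolding G_def G'_def using simple_process_bound[OF si K0 \<xi>K] simple_process_bound[OF si' K0 \<xi>K'] by auto
  have KK: "\<bar>x * y\<bar> \<le> K * K" if "\<bar>x\<bar> \<le> K" "\<bar>y\<bar> \<le> K" for x y :: real
    using that K0 by (auto simp: abs_mult intro!: mult_mono)
  have cl0: "0 \<le> clip 0 u x" for x using clip_bounds(1)[OF u0] .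
  \<comment> \<open>Clipping the time does not change the integrals, and it provides integrands that
    are measurable and bounded by \<open>K\<close> on the whole real line.\<close>
  have Hs: "(LINT r:{s..u}|lborel. H r \<omega> * H' r \<omega>) = (LINT r:{s..u}|lborel. H (clip 0 u r) \<omega> * H' (clip 0 u r) \<omega>)" for \<omega>
    using su by (intro set_lebesgue_integral_cong) (auto simp: clip_Icc)
  have Ds: "D j \<omega> = (LINT r:{0..u}|lborel. (G j r \<omega> - H (clip 0 u r) \<omega>)\<^sup>2)" "D' j \<omega> = (LINT r:{0..u}|lborel. (G' j r \<omega> - H' (clip 0 u r) \<omega>)\<^sup>2)" for j \<omega>
    unfolding D_def D'_def by (intro set_lebesgue_integral_cong; auto simp: clip_Icc)+
  have Lconv: "AE \<omega> in M. (\<lambda>j. \<zeta> \<omega> * ?Lj j \<omega>) \<longlonglongrightarrow> \<zeta> \<omega> * ?L \<omega>"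
    using conv AE_space
  proof eventually_elim
    fix \<omega> assume c: "(\<lambda>j. S (r j) s \<omega>) \<longlonglongrightarrow> I s \<omega> $ i \<and> (\<lambda>j. S (r j) u \<omega>) \<longlonglongrightarrow> I u \<omega> $ i \<and>
     (\<lambda>j. S' (r j) s \<omega>) \<longlonglongrightarrow> I' s \<omega> $ l \<and> (\<lambda>j. S' (r j) u \<omega>) \<longlonglongrightarrow> I' u \<omega> $ l \<and>
     (\<lambda>j. D (r j) \<omega> + D' (r j) \<omega>) \<longlonglongrightarrow> 0" and w: "\<omega> \<in> space M"
    have mg: "(\<lambda>x. G j x \<omega>) \<in> borel_measurable borel" "(\<lambda>x. G' j x \<omega>) \<in> borel_measurable borel"
      "(\<lambda>x. H (clip 0 u x) \<omega>) \<in> borel_measurable borel" "(\<lambda>x. H' (clip 0 u x) \<omega>) \<in> borel_measurable borel" for j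
      unfolding G_def G'_def
      using w by (intro simple_process_measurable[OF si] simple_process_measurable[OF si']
        ito_integrand_clip_measurable[OF H(1) u0] ito_integrand_clip_measurable[OF H(2) u0]; simp)+
    have "(\<lambda>j. ?Lj j \<omega>) \<longlonglongrightarrow> ?L \<omega>"
    proof (rule tendsto_of_product_bound[where A="2 * K * (u - s)" and c=K])
      show "(\<lambda>j. D (r j) \<omega> + D' (r j) \<omega>) \<longlonglongrightarrow> 0" using c by blast
      show "0 \<le> 2 * K * (u - s)" using K0 su by simp
      show "\<bar>?Lj j \<omega> - ?L \<omega>\<bar> \<le> 2 * K * (u - s) * \<kappa> + K / \<kappa> * (D (r j) \<omega> + D' (r j) \<omega>)" if "0 < \<kappa>" for \<kappa> j
        unfolding Hs Ds
        using set_integral_product_close[OF mg GK(1) GK(2) K(1)[OF cl0 w] K(2)[OF cl0 w] su that, of "r j" "r j"]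
        by (simp add: mult_ac)
    qed
    then show "(\<lambda>j. \<zeta> \<omega> * ?Lj j \<omega>) \<longlonglongrightarrow> \<zeta> \<omega> * ?L \<omega>" by (intro tendsto_intros)
  qed
  have mL: "?L \<in> borel_measurable M" by (rule ito_product_integral_measurable[OF H su])
  have mLj: "?Lj j \<in> borel_measurable M" for j
  proof -
    note [measurable] = simple_process_measurable[OF si, of snd "M \<Otimes>\<^sub>M lborel" fst]
      simple_process_measurable[OF si', of snd "M \<Otimes>\<^sub>M lborel" fst]
    have "(\<lambda>x. indicator {s..u} (snd x) *\<^sub>R (G (r j) (snd x) (fst x) * G' (r j) (snd x) (fst x)))
       \<in> borel_measurable (M \<Otimes>\<^sub>M lborel)" unfolding G_def G'_def by measurable
    then show ?thesis unfolding set_lebesgue_integral_def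
      by (intro lborel.borel_measurable_lebesgue_integral) (simp add: split_beta)
  qed
  have "(\<lambda>j. expectation (\<lambda>\<omega>. \<zeta> \<omega> * ?Lj j \<omega>)) \<longlonglongrightarrow> expectation (\<lambda>\<omega>. \<zeta> \<omega> * ?L \<omega>)"
  proof (rule integral_dominated_convergence[where w="\<lambda>_. C * (K * K * (u - s))"])
    show "AE \<omega> in M. norm (\<zeta> \<omega> * ?Lj j \<omega>) \<le> C * (K * K * (u - s))" for j
    proof (rule AE_I2)
      fix \<omega> assume "\<omega> \<in> space M"
      then show "norm (\<zeta> \<omega> * ?Lj j \<omega>) \<le> C * (K * K * (u - s))"
        using C set_lebesgue_integral_abs_le[OF su(2), of "\<lambda>x. G (r j) x \<omega> * G' (r j) x \<omega>" "K * K"] KK[OF GK] C0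
        by (simp add: abs_mult mult_mono)
    qed
  qed (use mL mLj Lconv in \<open>auto intro!: borel_measurable_times\<close>)
  then have "(\<lambda>j. expectation (\<lambda>\<omega>. \<zeta> \<omega> * (?a j \<omega> * ?b j \<omega>))) \<longlonglongrightarrow> (if i = l then expectation (\<lambda>\<omega>. \<zeta> \<omega> * ?L \<omega>) else 0)"
    unfolding iso by simp
  then show "expectation (\<lambda>\<omega>. \<zeta> \<omega> * ((I u \<omega> $ i - I s \<omega> $ i) * (I' u \<omega> $ l - I' s \<omega> $ l))) =
      (if i = l then expectation (\<lambda>\<omega>. \<zeta> \<omega> * ?L \<omega>) else 0)"
    using t2(2) LIMSEQ_unique by blast
qed

end

section \<open>Ito's formula in expectation\<close>

lemma floor_approximation: "(\<lambda>n. real_of_int \<lfloor>real (Suc n) * r\<rfloor> / real (Suc n)) \<longlonglongrightarrow> r"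
proof (rule tendsto_sandwich[OF _ _ _ tendsto_const])
  have "(\<lambda>n. r - 1 / real (Suc n)) \<longlonglongrightarrow> r - 0"
    by (intro tendsto_diff tendsto_const lim_1_over_n[THEN LIMSEQ_Suc])
  then show "(\<lambda>n. r - 1 / real (Suc n)) \<longlonglongrightarrow> r" by simp
  show "\<forall>\<^sub>F n in sequentially. r - 1 / real (Suc n) \<le> real_of_int \<lfloor>real (Suc n) * r\<rfloor> / real (Suc n)"
  proof (intro always_eventually allI)
    fix n
    have "real (Suc n) * r - 1 \<le> real_of_int \<lfloor>real (Suc n) * r\<rfloor>" by linarith
    then have "(real (Suc n) * r - 1) / real (Suc n) \<le> real_of_int \<lfloor>real (Suc n) * r\<rfloor> / real (Suc n)"
      by (intro divide_right_mono) auto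
    then show "r - 1 / real (Suc n) \<le> real_of_int \<lfloor>real (Suc n) * r\<rfloor> / real (Suc n)"
      by (simp add: diff_divide_distrib)
  qed
  show "\<forall>\<^sub>F n in sequentially. real_of_int \<lfloor>real (Suc n) * r\<rfloor> / real (Suc n) \<le> r"
  proof (intro always_eventually allI)
    fix n
    have "real_of_int \<lfloor>real (Suc n) * r\<rfloor> \<le> real (Suc n) * r" by linarith
    then show "real_of_int \<lfloor>real (Suc n) * r\<rfloor> / real (Suc n) \<le> r"
      by (subst pos_divide_le_eq) (auto simp: mult.commute)
  qed
qed

text \<open>Paths are continuous and bounded at every sample point, not just almost surely, as the
  paths of solutions are. This makes joint measurability, continuity of expectations and Fubini's
  theorem available without completing \<open>M\<close>.\<close>

definition (in prob_space) cprocess :: "real \<Rightarrow> (real \<Rightarrow> 'a \<Rightarrow> real) \<Rightarrow> bool" where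
  "cprocess C f \<longleftrightarrow> (\<forall>r\<ge>0. f r \<in> borel_measurable M) \<and>
     (\<forall>\<omega>\<in>space M. continuous_on {0..} (\<lambda>r. f r \<omega>) \<and> (\<forall>r\<ge>0. \<bar>f r \<omega>\<bar> \<le> C))"

context prob_space
begin

lemma cprocessD:
  assumes "cprocess C f"
  shows "0 \<le> r \<Longrightarrow> f r \<in> borel_measurable M"
    and "\<omega> \<in> space M \<Longrightarrow> continuous_on {0..} (\<lambda>r. f r \<omega>)"
    and "\<omega> \<in> space M \<Longrightarrow> 0 \<le> r \<Longrightarrow> \<bar>f r \<omega>\<bar> \<le> C"
  using assms unfolding cprocess_def by auto

lemma cprocess_bound_nonneg: "cprocess C f \<Longrightarrow> 0 \<le> C"
  using not_empty cprocessD(3)[of C f _ 0] by force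

lemma cprocess_integrable:
  assumes "cprocess C f" "0 \<le> r" shows "integrable M (f r)"
  using cprocessD[OF assms(1)] assms(2) by (intro integrable_const_bound[of _ C]) auto

lemma cprocess_mult:
  assumes f: "cprocess C f" and g: "cprocess D g"
  shows "cprocess (C * D) (\<lambda>r \<omega>. f r \<omega> * g r \<omega>)"
  using cprocessD[OF f] cprocessD[OF g] cprocess_bound_nonneg[OF f]
  unfolding cprocess_def by (auto simp: abs_mult intro!: continuous_on_mult mult_mono)

lemma cprocess_const:
  assumes "\<xi> \<in> borel_measurable M" "\<And>\<omega>. \<omega> \<in> space M \<Longrightarrow> \<bar>\<xi> \<omega>\<bar> \<le> C"
  shows "cprocess C (\<lambda>_. \<xi>)"
  using assms unfolding cprocess_def by auto

lemma cprocess_expectation_continuous: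
  assumes f: "cprocess C f" shows "continuous_on {0..} (\<lambda>r. expectation (f r))"
  unfolding continuous_on_sequentially
proof (intro allI ballI impI)
  fix r and x :: real assume x: "x \<in> {0..}" and r: "(\<forall>n. r n \<in> {0..}) \<and> r \<longlonglongrightarrow> x"
  have "(\<lambda>n. expectation (f (r n))) \<longlonglongrightarrow> expectation (f x)"
  proof (rule integral_dominated_convergence[where w="\<lambda>_. C"])
    show "AE \<omega> in M. (\<lambda>n. f (r n) \<omega>) \<longlonglongrightarrow> f x \<omega>"
      using cprocessD(2)[OF f] r x unfolding continuous_on_sequentially comp_def by (intro AE_I2) auto
  qed (use cprocessD[OF f] r x in auto)
  then show "((\<lambda>r. expectation (f r)) \<circ> r) \<longlonglongrightarrow> expectation (f x)" by (simp add: comp_def)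
qed

text \<open>By continuity the process is the limit of processes sampled at the grid point below the
  current time. These depend on time through an integer only, so their joint measurability is a
  countable case distinction. The maximum with 0 stays in the time range where the process is
  controlled.\<close>

lemma cprocess_jointly_measurable:
  assumes f: "cprocess C f"
  shows "(\<lambda>p. f (max 0 (snd p)) (fst p)) \<in> borel_measurable (M \<Otimes>\<^sub>M lborel)"
proof (rule borel_measurable_LIMSEQ_real)
  let ?q = "\<lambda>n (r::real). \<lfloor>real (Suc n) * r\<rfloor>"
  fix n
  have 1: "(\<lambda>p. f (max 0 (real_of_int k / real (Suc n))) (fst p)) \<in> borel_measurable (M \<Otimes>\<^sub>M lborel)" for k
    using cprocessD(1)[OF f] measurable_compose[OF measurable_fst] by (metis max.cobounded1)
  have 2: "(\<lambda>p. ?q n (snd p)) \<in> measurable (M \<Otimes>\<^sub>M lborel) (count_space UNIV)"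
    by measurable
  show "(\<lambda>p. f (max 0 (real_of_int (?q n (snd p)) / real (Suc n))) (fst p)) \<in> borel_measurable (M \<Otimes>\<^sub>M lborel)"
    using measurable_compose_countable[OF 1 2] .
next
  fix p assume p: "p \<in> space (M \<Otimes>\<^sub>M (lborel :: real measure))"
  let ?r = "snd p"
  have l': "(\<lambda>n. max 0 (real_of_int \<lfloor>real (Suc n) * ?r\<rfloor> / real (Suc n))) \<longlonglongrightarrow> max 0 ?r"
    by (intro tendsto_max tendsto_const floor_approximation)
  have "fst p \<in> space M" using p by (auto simp: space_pair_measure)
  from cprocessD(2)[OF f this] l'
  show "(\<lambda>n. f (max 0 (real_of_int \<lfloor>real (Suc n) * ?r\<rfloor> / real (Suc n))) (fst p)) \<longlonglongrightarrow> f (max 0 ?r) (fst p)"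
    unfolding continuous_on_sequentially comp_def by force
qed

lemma cprocess_integral:
  assumes f: "cprocess C f" and su: "0 \<le> s" "s \<le> u"
  shows "\<omega> \<in> space M \<Longrightarrow> (LINT r:{s..u}|lborel. f r \<omega>) = integral {s..u} (\<lambda>r. f r \<omega>)"
    and "(\<lambda>\<omega>. integral {s..u} (\<lambda>r. f r \<omega>)) \<in> borel_measurable M"
    and "\<omega> \<in> space M \<Longrightarrow> \<bar>integral {s..u} (\<lambda>r. f r \<omega>)\<bar> \<le> C * (u - s)"
    and "expectation (\<lambda>\<omega>. integral {s..u} (\<lambda>r. f r \<omega>)) = integral {s..u} (\<lambda>r. expectation (f r))"
proof -
  have cont: "continuous_on {s..u} (\<lambda>r. f r \<omega>)" if "\<omega> \<in> space M" for \<omega>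
    using cprocessD(2)[OF f that] su by (auto intro: continuous_on_subset)
  have eq: "(LINT r:{s..u}|lborel. f r \<omega>) = integral {s..u} (\<lambda>r. f r \<omega>)" if "\<omega> \<in> space M" for \<omega>
    by (intro set_borel_integral_eq_integral borel_integrable_atLeastAtMost' cont that)
  then show "\<omega> \<in> space M \<Longrightarrow> (LINT r:{s..u}|lborel. f r \<omega>) = integral {s..u} (\<lambda>r. f r \<omega>)" .
  have F: "(LINT r:{s..u}|lborel. f r \<omega>) = (LINT r|lborel. indicator {s..u} r *\<^sub>R f (max 0 r) \<omega>)" for \<omega>
    unfolding set_lebesgue_integral_def using su by (intro Bochner_Integration.integral_cong) (auto simp: indicator_def max_absorb2)
  let ?g = "\<lambda>\<omega> r. indicator {s..u} r *\<^sub>R f (max 0 r) \<omega>"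
  note [measurable] = cprocess_jointly_measurable[OF f]
  have gm: "(\<lambda>p. ?g (fst p) (snd p)) \<in> borel_measurable (M \<Otimes>\<^sub>M lborel)" by measurable
  have "(\<lambda>\<omega>. LINT r|lborel. ?g \<omega> r) \<in> borel_measurable M"
    using gm by (intro lborel.borel_measurable_lebesgue_integral) (simp add: split_beta)
  then have "(\<lambda>\<omega>. LINT r:{s..u}|lborel. f r \<omega>) \<in> borel_measurable M" unfolding F .
  then show "(\<lambda>\<omega>. integral {s..u} (\<lambda>r. f r \<omega>)) \<in> borel_measurable M"
    using eq by (subst measurable_cong[where g="\<lambda>\<omega>. LINT r:{s..u}|lborel. f r \<omega>"]) auto
  show "\<bar>integral {s..u} (\<lambda>r. f r \<omega>)\<bar> \<le> C * (u - s)" if "\<omega> \<in> space M"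
    using set_lebesgue_integral_abs_le[OF su(2), of "\<lambda>r. f r \<omega>" C] cprocessD(3)[OF f that] su eq[OF that] by auto
  interpret P: pair_sigma_finite M lborel ..
  have ig: "integrable (M \<Otimes>\<^sub>M lborel) (\<lambda>p. ?g (fst p) (snd p))"
  proof (rule Bochner_Integration.integrable_bound)
    show "integrable (M \<Otimes>\<^sub>M lborel) (\<lambda>p. C * indicator (space M \<times> {s..u}) p)"
      using su by (intro integrable_mult_right integrable_real_indicator)
        (auto simp: lborel.emeasure_pair_measure_Times emeasure_space_1)
    show "AE p in M \<Otimes>\<^sub>M lborel. norm (?g (fst p) (snd p)) \<le> norm (C * indicator (space M \<times> {s..u}) p)"
      using cprocessD(3)[OF f] cprocess_bound_nonneg[OF f]
      by (intro AE_I2) (auto simp: indicator_def space_pair_measure)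
  qed (rule gm)
  have ig': "integrable (M \<Otimes>\<^sub>M lborel) (\<lambda>(\<omega>, r). ?g \<omega> r)" using ig by (simp add: split_beta')
  have "expectation (\<lambda>\<omega>. integral {s..u} (\<lambda>r. f r \<omega>)) = expectation (\<lambda>\<omega>. LINT r|lborel. ?g \<omega> r)"
    using eq F by (intro Bochner_Integration.integral_cong) auto
  also have "\<dots> = (LINT r|lborel. expectation (\<lambda>\<omega>. ?g \<omega> r))"
    using P.Fubini_integral[OF ig', symmetric] .
  also have "\<dots> = (LINT r:{s..u}|lborel. expectation (f r))"
    unfolding set_lebesgue_integral_def using su
    by (intro Bochner_Integration.integral_cong) (auto simp: indicator_def max_absorb2)
  also have "\<dots> = integral {s..u} (\<lambda>r. expectation (f r))"
    using cprocess_expectation_continuous[OF f] su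
    by (intro set_borel_integral_eq_integral borel_integrable_atLeastAtMost') (auto intro: continuous_on_subset)
  finally show "expectation (\<lambda>\<omega>. integral {s..u} (\<lambda>r. f r \<omega>)) = integral {s..u} (\<lambda>r. expectation (f r))" .
qed

end

text \<open>An increment of order 3/2 in the length of the interval forces the derivative to vanish.
  This is the infinitesimal form of adding up such errors over a partition whose mesh tends to
  0.\<close>

lemma constant_of_three_halves_bound:
  fixes f :: "real \<Rightarrow> real"
  assumes b: "\<And>s u. 0 \<le> s \<Longrightarrow> s \<le> u \<Longrightarrow> u \<le> T \<Longrightarrow> \<bar>f u - f s\<bar> \<le> C * ((u - s) * sqrt (u - s))" and t: "0 \<le> t" "t \<le> T"
  shows "f t = f 0"
proof -
  have b': "\<bar>f y - f x\<bar> \<le> C * (\<bar>y - x\<bar> * sqrt \<bar>y - x\<bar>)" if "x \<in> {0..T}" "y \<in> {0..T}" for x y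
    using b[of x y] b[of y x] that by (cases "x \<le> y") (auto simp: abs_minus_commute)
  have "(f has_field_derivative 0) (at x within {0..T})" if x: "x \<in> {0..T}" for x
    unfolding has_field_derivative_iff
  proof (rule tendsto_0_le[where K=1])
    have "((\<lambda>y. C * sqrt \<bar>y - x\<bar>) \<longlongrightarrow> C * sqrt \<bar>x - x\<bar>) (at x within {0..T})"
      by (intro tendsto_intros)
    then show "((\<lambda>y. C * sqrt \<bar>y - x\<bar>) \<longlongrightarrow> 0) (at x within {0..T})" by simp
    show "\<forall>\<^sub>F y in at x within {0..T}. norm ((f y - f x) / (y - x)) \<le> norm (C * sqrt \<bar>y - x\<bar>) * 1"
      unfolding eventually_at_filter
    proof (intro always_eventually allI impI)
      fix y assume y: "y \<noteq> x" "y \<in> {0..T}"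
      have "\<bar>f y - f x\<bar> \<le> \<bar>C * sqrt \<bar>y - x\<bar>\<bar> * \<bar>y - x\<bar>"
        using b'[OF x y(2)] abs_ge_self[of "C * (\<bar>y - x\<bar> * sqrt \<bar>y - x\<bar>)"] by (simp add: abs_mult mult_ac)
      then show "norm ((f y - f x) / (y - x)) \<le> norm (C * sqrt \<bar>y - x\<bar>) * 1"
        using y by (simp add: pos_divide_le_eq)
    qed
  qed
  then obtain c where "\<forall>x\<in>{0..T}. f x = c"
    using has_field_derivative_zero_constant[of "{0..T}" f] by blast
  then show ?thesis using t by simp
qed

section \<open>Bounded Lipschitz functions and second order expansions\<close>

definition l1 :: "('k::finite \<Rightarrow> real) \<Rightarrow> ('k \<Rightarrow> real) \<Rightarrow> real" where
  "l1 z z' = (\<Sum>a\<in>UNIV. \<bar>z' a - z a\<bar>)"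

text \<open>Points are functions on a finite index type, so that a pair of vectors can be a single
  point. Boundedness is included because it makes Lipschitz functions closed under products.\<close>

definition blip :: "('k::finite \<Rightarrow> real) set \<Rightarrow> (('k \<Rightarrow> real) \<Rightarrow> real) \<Rightarrow> bool" where
  "blip S f \<longleftrightarrow> (\<exists>C\<ge>0. (\<forall>z\<in>S. \<bar>f z\<bar> \<le> C) \<and> (\<forall>z\<in>S. \<forall>z'\<in>S. \<bar>f z' - f z\<bar> \<le> C * l1 z z'))"

definition taylor2 :: "('k::finite \<Rightarrow> real) \<Rightarrow> ('k \<Rightarrow> 'k \<Rightarrow> real) \<Rightarrow> ('k \<Rightarrow> real) \<Rightarrow> real" where
  "taylor2 p R d = (\<Sum>a\<in>UNIV. p a * d a) + (\<Sum>a\<in>UNIV. \<Sum>b\<in>UNIV. R a b * (d a * d b))"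

text \<open>The matrix \<open>R\<close> contains the factor \<open>1/2\<close> of the Taylor expansion.\<close>

definition jet :: "('k::finite \<Rightarrow> real) set \<Rightarrow> (('k \<Rightarrow> real) \<Rightarrow> real) \<Rightarrow> (('k \<Rightarrow> real) \<Rightarrow> 'k \<Rightarrow> real) \<Rightarrow>
    (('k \<Rightarrow> real) \<Rightarrow> 'k \<Rightarrow> 'k \<Rightarrow> real) \<Rightarrow> bool" where
  "jet S \<Psi> P R \<longleftrightarrow> blip S \<Psi> \<and> (\<forall>a. blip S (\<lambda>z. P z a)) \<and> (\<forall>a b. blip S (\<lambda>z. R z a b)) \<and>
     (\<exists>C\<ge>0. \<forall>z\<in>S. \<forall>z'\<in>S. \<bar>\<Psi> z' - \<Psi> z - taylor2 (P z) (R z) (\<lambda>a. z' a - z a)\<bar> \<le> C * l1 z z' ^ 3)"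

lemma l1_nonneg: "0 \<le> l1 z z'"
  unfolding l1_def by (intro sum_nonneg) auto

lemma l1_component: "\<bar>z' a - z a\<bar> \<le> l1 z z'"
  unfolding l1_def by (rule member_le_sum) auto

text \<open>The Cauchy-Schwarz inequality for finite sums, applied twice.\<close>

lemma l1_pow4: "l1 z z' ^ 4 \<le> real (CARD('k::finite)) ^ 3 * (\<Sum>a\<in>UNIV. (z' a - z (a::'k)) ^ 4)"
proof -
  let ?n = "real (CARD('k))"
  have "(l1 z z')\<^sup>2 \<le> (\<Sum>a\<in>UNIV. \<bar>z' a - z a\<bar>\<^sup>2) * ?n"
    unfolding l1_def by (rule sum_squared_le_sum_of_squares)
  then have 1: "(l1 z z')\<^sup>2 \<le> (\<Sum>a\<in>UNIV. (z' a - z a)\<^sup>2) * ?n" by simp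
  have "l1 z z' ^ 4 = ((l1 z z')\<^sup>2)\<^sup>2" by simp
  also have "\<dots> \<le> ((\<Sum>a\<in>UNIV. (z' a - z a)\<^sup>2) * ?n)\<^sup>2" using 1 by (rule power_mono) simp
  also have "\<dots> = (\<Sum>a\<in>UNIV. (z' a - z a)\<^sup>2)\<^sup>2 * ?n\<^sup>2" by (simp add: power_mult_distrib)
  also have "\<dots> \<le> ((\<Sum>a\<in>UNIV. ((z' a - z a)\<^sup>2)\<^sup>2) * ?n) * ?n\<^sup>2"
    by (intro mult_right_mono sum_squared_le_sum_of_squares) simp_all
  also have "\<dots> = ?n ^ 3 * (\<Sum>a\<in>UNIV. (z' a - z a) ^ 4)" by (simp add: power3_eq_cube power2_eq_square power4_eq_xxxx mult.assoc)
  finally show ?thesis .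
qed

lemma blip_const [simp]: "blip S (\<lambda>z. c)"
  unfolding blip_def by (intro exI[of _ "\<bar>c\<bar>"]) (auto simp: l1_nonneg)

lemma blip_add:
  assumes "blip S f" "blip S g" shows "blip S (\<lambda>z. f z + g z)"
proof -
  obtain C D where C: "C \<ge> 0" "\<And>z. z \<in> S \<Longrightarrow> \<bar>f z\<bar> \<le> C" "\<And>z z'. z \<in> S \<Longrightarrow> z' \<in> S \<Longrightarrow> \<bar>f z' - f z\<bar> \<le> C * l1 z z'"
    and D: "D \<ge> 0" "\<And>z. z \<in> S \<Longrightarrow> \<bar>g z\<bar> \<le> D" "\<And>z z'. z \<in> S \<Longrightarrow> z' \<in> S \<Longrightarrow> \<bar>g z' - g z\<bar> \<le> D * l1 z z'"
    using assms unfolding blip_def by blast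
  have "\<bar>(f z' + g z') - (f z + g z)\<bar> \<le> (C + D) * l1 z z'" if "z \<in> S" "z' \<in> S" for z z'
    using C(3)[OF that] D(3)[OF that] by (simp add: algebra_simps)
  moreover have "\<bar>f z + g z\<bar> \<le> C + D" if "z \<in> S" for z using C(2)[OF that] D(2)[OF that] by linarith
  ultimately show ?thesis unfolding blip_def using C(1) D(1) by (intro exI[of _ "C + D"]) auto
qed

lemma blip_mult:
  assumes "blip S f" "blip S g" shows "blip S (\<lambda>z. f z * g z)"
proof -
  obtain C D where C: "C \<ge> 0" "\<And>z. z \<in> S \<Longrightarrow> \<bar>f z\<bar> \<le> C" "\<And>z z'. z \<in> S \<Longrightarrow> z' \<in> S \<Longrightarrow> \<bar>f z' - f z\<bar> \<le> C * l1 z z'"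
    and D: "D \<ge> 0" "\<And>z. z \<in> S \<Longrightarrow> \<bar>g z\<bar> \<le> D" "\<And>z z'. z \<in> S \<Longrightarrow> z' \<in> S \<Longrightarrow> \<bar>g z' - g z\<bar> \<le> D * l1 z z'"
    using assms unfolding blip_def by blast
  have "\<bar>f z' * g z' - f z * g z\<bar> \<le> (C * D + C * D) * l1 z z'" if z: "z \<in> S" "z' \<in> S" for z z'
  proof -
    have "\<bar>f z' * g z' - f z * g z\<bar> = \<bar>f z' * (g z' - g z) + (f z' - f z) * g z\<bar>" by (simp add: algebra_simps)
    also have "\<dots> \<le> \<bar>f z'\<bar> * \<bar>g z' - g z\<bar> + \<bar>f z' - f z\<bar> * \<bar>g z\<bar>" by (metis abs_mult abs_triangle_ineq)
    also have "\<dots> \<le> C * (D * l1 z z') + (C * l1 z z') * D"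
      using C D z l1_nonneg[of z z'] by (intro add_mono mult_mono) auto
    finally show ?thesis by (simp add: algebra_simps)
  qed
  moreover have CD: "C * D \<ge> 0" using C D by simp
  moreover have "\<bar>f z * g z\<bar> \<le> C * D + C * D" if "z \<in> S" for z
  proof -
    have "\<bar>f z * g z\<bar> \<le> C * D" using C D that by (simp add: abs_mult mult_mono)
    then show ?thesis using CD by linarith
  qed
  ultimately show ?thesis unfolding blip_def by (intro exI[of _ "C * D + C * D"]) auto
qed

lemma blip_cmult: "blip S f \<Longrightarrow> blip S (\<lambda>z. c * f z)"
  by (intro blip_mult) auto

lemma blip_minus: "blip S f \<Longrightarrow> blip S (\<lambda>z. - f z)"
  using blip_cmult[of S f "-1"] by simp

lemma blip_diff: "blip S f \<Longrightarrow> blip S g \<Longrightarrow> blip S (\<lambda>z. f z - g z)"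
  using blip_add[OF _ blip_minus, of S f g] by simp

lemma blip_sum: "(\<And>a. a \<in> A \<Longrightarrow> blip S (f a)) \<Longrightarrow> blip S (\<lambda>z. \<Sum>a\<in>A. f a z)"
  by (induction A rule: infinite_finite_induct) (auto intro: blip_add)

lemma blip_component:
  assumes "\<And>z. z \<in> S \<Longrightarrow> \<bar>z a\<bar> \<le> C" "0 \<le> C" shows "blip S (\<lambda>z. z a)"
  unfolding blip_def
proof (intro exI[of _ "C + 1"] conjI ballI)
  fix z z' assume z: "z \<in> S" "z' \<in> S"
  have "\<bar>z' a - z a\<bar> \<le> l1 z z'" by (rule l1_component)
  also have "\<dots> \<le> (C + 1) * l1 z z'" using mult_right_mono[of 1 "C + 1" "l1 z z'"] assms(2) l1_nonneg[of z z'] by simp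
  finally show "\<bar>z' a - z a\<bar> \<le> (C + 1) * l1 z z'" .
next
  fix z assume "z \<in> S"
  then show "\<bar>z a\<bar> \<le> C + 1" using assms(1)[of z] by linarith
qed (use assms in simp)

lemma blip_compose:
  assumes f: "blip S f" and J: "\<And>z. z \<in> S \<Longrightarrow> f z \<in> J"
    and \<phi>: "\<And>y. y \<in> J \<Longrightarrow> \<bar>\<phi> y\<bar> \<le> D" "\<And>y y'. y \<in> J \<Longrightarrow> y' \<in> J \<Longrightarrow> \<bar>\<phi> y' - \<phi> y\<bar> \<le> D * \<bar>y' - y\<bar>" and D: "0 \<le> D"
  shows "blip S (\<lambda>z. \<phi> (f z))"
proof -
  obtain C where C: "C \<ge> 0" "\<And>z. z \<in> S \<Longrightarrow> \<bar>f z\<bar> \<le> C" "\<And>z z'. z \<in> S \<Longrightarrow> z' \<in> S \<Longrightarrow> \<bar>f z' - f z\<bar> \<le> C * l1 z z'"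
    using f unfolding blip_def by blast
  show ?thesis unfolding blip_def
  proof (intro exI[of _ "D + D * C"] conjI ballI)
    fix z z' assume z: "z \<in> S" "z' \<in> S"
    have "\<bar>\<phi> (f z') - \<phi> (f z)\<bar> \<le> D * \<bar>f z' - f z\<bar>" using z J by (intro \<phi>) auto
    also have "\<dots> \<le> D * (C * l1 z z')" using C(3)[OF z] D by (intro mult_left_mono) auto
    also have "\<dots> \<le> (D + D * C) * l1 z z'" using D l1_nonneg[of z z'] by (simp add: algebra_simps)
    finally show "\<bar>\<phi> (f z') - \<phi> (f z)\<bar> \<le> (D + D * C) * l1 z z'" .
  next
    fix z assume z: "z \<in> S"
    show "\<bar>\<phi> (f z)\<bar> \<le> D + D * C" using \<phi>(1)[OF J[OF z]] D C(1) by (simp add: add_increasing2)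
  qed (use D C in simp)
qed

lemma jet_diff:
  assumes "jet S \<Psi> P R" "jet S \<Psi>' P' R'"
  shows "jet S (\<lambda>z. \<Psi> z - \<Psi>' z) (\<lambda>z a. P z a - P' z a) (\<lambda>z a b. R z a b - R' z a b)"
proof -
  obtain C where C: "C \<ge> 0" "\<And>z z'. z \<in> S \<Longrightarrow> z' \<in> S \<Longrightarrow> \<bar>\<Psi> z' - \<Psi> z - taylor2 (P z) (R z) (\<lambda>a. z' a - z a)\<bar> \<le> C * l1 z z' ^ 3"
    using assms(1) unfolding jet_def by blast
  obtain D where D: "D \<ge> 0" "\<And>z z'. z \<in> S \<Longrightarrow> z' \<in> S \<Longrightarrow> \<bar>\<Psi>' z' - \<Psi>' z - taylor2 (P' z) (R' z) (\<lambda>a. z' a - z a)\<bar> \<le> D * l1 z z' ^ 3"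
    using assms(2) unfolding jet_def by blast
  have t: "taylor2 (\<lambda>a. P z a - P' z a) (\<lambda>a b. R z a b - R' z a b) d = taylor2 (P z) (R z) d - taylor2 (P' z) (R' z) d" for z d
    by (simp add: taylor2_def left_diff_distrib sum_subtractf)
  have "\<bar>(\<Psi> z' - \<Psi>' z') - (\<Psi> z - \<Psi>' z) - taylor2 (\<lambda>a. P z a - P' z a) (\<lambda>a b. R z a b - R' z a b) (\<lambda>a. z' a - z a)\<bar> \<le> (C + D) * l1 z z' ^ 3"
    if "z \<in> S" "z' \<in> S" for z z'
    unfolding t distrib_right using C(2)[OF that] D(2)[OF that] by linarith
  then show ?thesis using assms C(1) D(1) unfolding jet_def
    by (auto intro!: blip_diff exI[of _ "C + D"])
qed

lemma l1_le_bounded: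
  fixes z z' :: "'k::finite \<Rightarrow> real"
  assumes "\<And>a. \<bar>z a\<bar> \<le> C" "\<And>a. \<bar>z' a\<bar> \<le> C"
  shows "l1 z z' \<le> real CARD('k) * (2 * C)"
proof -
  have "l1 z z' \<le> (\<Sum>a\<in>(UNIV::'k set). 2 * C)" unfolding l1_def
  proof (rule sum_mono)
    fix a show "\<bar>z' a - z a\<bar> \<le> 2 * C" using assms(1)[of a] assms(2)[of a] by linarith
  qed
  then show ?thesis by simp
qed

lemma taylor2_bounds:
  fixes p d :: "'k::finite \<Rightarrow> real"
  assumes "\<And>a. \<bar>p a\<bar> \<le> C" "\<And>a b. \<bar>R a b\<bar> \<le> C" "(\<Sum>a\<in>UNIV. \<bar>d a\<bar>) = \<rho>" and C: "0 \<le> C"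
  shows "\<bar>\<Sum>a\<in>UNIV. p a * d a\<bar> \<le> C * \<rho>" "\<bar>\<Sum>a\<in>UNIV. \<Sum>b\<in>UNIV. R a b * (d a * d b)\<bar> \<le> C * \<rho>\<^sup>2"
proof -
  have "\<bar>\<Sum>a\<in>UNIV. p a * d a\<bar> \<le> (\<Sum>a\<in>UNIV. C * \<bar>d a\<bar>)"
    by (rule order_trans[OF sum_abs]) (auto simp: abs_mult intro!: sum_mono mult_right_mono assms)
  then show "\<bar>\<Sum>a\<in>UNIV. p a * d a\<bar> \<le> C * \<rho>" using assms(3) by (simp add: sum_distrib_left[symmetric])
  have "\<bar>\<Sum>a\<in>UNIV. \<Sum>b\<in>UNIV. R a b * (d a * d b)\<bar> \<le> (\<Sum>a\<in>UNIV. \<Sum>b\<in>UNIV. C * (\<bar>d a\<bar> * \<bar>d b\<bar>))"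
  proof (rule order_trans[OF sum_abs], rule sum_mono, rule order_trans[OF sum_abs], rule sum_mono)
    fix a b show "\<bar>R a b * (d a * d b)\<bar> \<le> C * (\<bar>d a\<bar> * \<bar>d b\<bar>)"
      by (simp add: abs_mult mult_right_mono assms)
  qed
  also have "\<dots> = C * \<rho>\<^sup>2"
    unfolding assms(3)[symmetric] power2_eq_square by (simp add: sum_distrib_left sum_distrib_right mult_ac)
  finally show "\<bar>\<Sum>a\<in>UNIV. \<Sum>b\<in>UNIV. R a b * (d a * d b)\<bar> \<le> C * \<rho>\<^sup>2" .
qed

text \<open>The second order chain rule; like the matrix of a jet, \<phi>2 contains the factor 1/2.
  The remainder has three sources: the expansion of \<phi>, that of \<Psi>, and the replacement of
  the squared increment of \<Psi> by the square of its linear part. The last is of third order since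
  the difference of the two is of second order and their sum of first order.\<close>

lemma jet_compose:
  assumes jet: "jet S \<Psi> P R" and S: "\<And>z a. z \<in> S \<Longrightarrow> \<bar>z a\<bar> \<le> L" and J: "\<And>z. z \<in> S \<Longrightarrow> \<Psi> z \<in> J"
    and D: "0 \<le> D"
    and \<phi>: "\<And>y. y \<in> J \<Longrightarrow> \<bar>\<phi> y\<bar> \<le> D" "\<And>y y'. y \<in> J \<Longrightarrow> y' \<in> J \<Longrightarrow> \<bar>\<phi> y' - \<phi> y\<bar> \<le> D * \<bar>y' - y\<bar>"
    and \<phi>1: "\<And>y. y \<in> J \<Longrightarrow> \<bar>\<phi>1 y\<bar> \<le> D" "\<And>y y'. y \<in> J \<Longrightarrow> y' \<in> J \<Longrightarrow> \<bar>\<phi>1 y' - \<phi>1 y\<bar> \<le> D * \<bar>y' - y\<bar>"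
    and \<phi>2: "\<And>y. y \<in> J \<Longrightarrow> \<bar>\<phi>2 y\<bar> \<le> D" "\<And>y y'. y \<in> J \<Longrightarrow> y' \<in> J \<Longrightarrow> \<bar>\<phi>2 y' - \<phi>2 y\<bar> \<le> D * \<bar>y' - y\<bar>"
    and T: "\<And>y y'. y \<in> J \<Longrightarrow> y' \<in> J \<Longrightarrow> \<bar>\<phi> y' - \<phi> y - \<phi>1 y * (y' - y) - \<phi>2 y * (y' - y)\<^sup>2\<bar> \<le> D * \<bar>y' - y\<bar> ^ 3"
  shows "jet S (\<lambda>z. \<phi> (\<Psi> z)) (\<lambda>z a. \<phi>1 (\<Psi> z) * P z a) (\<lambda>z a b. \<phi>1 (\<Psi> z) * R z a b + \<phi>2 (\<Psi> z) * (P z a * P z b))"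
proof -
  have bl: "blip S \<Psi>" "\<And>a. blip S (\<lambda>z. P z a)" "\<And>a b. blip S (\<lambda>z. R z a b)"
    using jet unfolding jet_def by auto
  obtain C0 where C0: "C0 \<ge> 0" "\<And>z z'. z \<in> S \<Longrightarrow> z' \<in> S \<Longrightarrow> \<bar>\<Psi> z' - \<Psi> z - taylor2 (P z) (R z) (\<lambda>a. z' a - z a)\<bar> \<le> C0 * l1 z z' ^ 3"
    using jet unfolding jet_def by blast
  obtain C1 where C1: "C1 \<ge> 0" "\<And>z z'. z \<in> S \<Longrightarrow> z' \<in> S \<Longrightarrow> \<bar>\<Psi> z' - \<Psi> z\<bar> \<le> C1 * l1 z z'"
    using bl(1) unfolding blip_def by blast
  have "\<exists>C. \<forall>a. \<forall>z\<in>S. \<bar>P z a\<bar> \<le> C a" using bl(2) unfolding blip_def by metis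
  then obtain CP where CP: "\<And>a z. z \<in> S \<Longrightarrow> \<bar>P z a\<bar> \<le> CP a" by blast
  have "\<exists>C. \<forall>a b. \<forall>z\<in>S. \<bar>R z a b\<bar> \<le> C a b" using bl(3) unfolding blip_def by metis
  then obtain CR where CR: "\<And>a b z. z \<in> S \<Longrightarrow> \<bar>R z a b\<bar> \<le> CR a b" by blast
  define E where "E = (\<Sum>a\<in>UNIV. \<bar>CP a\<bar>) + (\<Sum>a\<in>UNIV. \<Sum>b\<in>UNIV. \<bar>CR a b\<bar>)"
  have E0: "0 \<le> E" unfolding E_def by (intro add_nonneg_nonneg sum_nonneg) auto
  have EP: "\<bar>P z a\<bar> \<le> E" if "z \<in> S" for z a
  proof -
    have "\<bar>P z a\<bar> \<le> \<bar>CP a\<bar>" using CP[OF that, of a] by linarith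
    also have "\<dots> \<le> (\<Sum>a\<in>UNIV. \<bar>CP a\<bar>)" by (rule member_le_sum) auto
    also have "\<dots> \<le> E" unfolding E_def by (simp add: sum_nonneg)
    finally show ?thesis .
  qed
  have ER: "\<bar>R z a b\<bar> \<le> E" if "z \<in> S" for z a b
  proof -
    have "\<bar>R z a b\<bar> \<le> \<bar>CR a b\<bar>" using CR[OF that, of a b] by linarith
    also have "\<dots> \<le> (\<Sum>b\<in>UNIV. \<bar>CR a b\<bar>)" by (rule member_le_sum) auto
    also have "\<dots> \<le> (\<Sum>a\<in>UNIV. \<Sum>b\<in>UNIV. \<bar>CR a b\<bar>)" by (rule member_le_sum[of a UNIV "\<lambda>a. \<Sum>b\<in>UNIV. \<bar>CR a b\<bar>"]) (auto intro: sum_nonneg)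
    also have "\<dots> \<le> E" unfolding E_def by (simp add: sum_nonneg)
    finally show ?thesis .
  qed
  \<comment> \<open>The domain lies in a box, so surplus powers of the distance can be absorbed into
    constants.\<close>
  define B where "B = real CARD('a) * (2 * \<bar>L\<bar>)"
  have B: "l1 z z' \<le> B" if "z \<in> S" "z' \<in> S" for z z'
    unfolding B_def using S[OF that(1)] S[OF that(2)] by (intro l1_le_bounded) (auto intro: order_trans[OF _ abs_ge_self])
  \<comment> \<open>The constant for the squared increment \<open>e\<close> of \<Psi> against its
    linear part \<open>p\<close>: the first factor bounds \<open>e - p\<close> and the second bounds
    \<open>e + p\<close>.\<close>
  define F where "F = (E + C0 * B) * (C1 + E)"
  let ?G = "D * C0 + D * F + D * C1 ^ 3"
  have B0: "0 \<le> B" unfolding B_def by simp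
  have rem: "\<bar>\<phi> (\<Psi> z') - \<phi> (\<Psi> z) - taylor2 (\<lambda>a. \<phi>1 (\<Psi> z) * P z a) (\<lambda>a b. \<phi>1 (\<Psi> z) * R z a b + \<phi>2 (\<Psi> z) * (P z a * P z b)) (\<lambda>a. z' a - z a)\<bar>
     \<le> ?G * l1 z z' ^ 3" if z: "z \<in> S" "z' \<in> S" for z z'
  proof -
    define d where "d = (\<lambda>a. z' a - z a)"
    define \<rho> where "\<rho> = l1 z z'"
    have \<rho>: "0 \<le> \<rho>" "\<rho> \<le> B" unfolding \<rho>_def using l1_nonneg B[OF z] by auto
    define p where "p = (\<Sum>a\<in>UNIV. P z a * d a)"
    define q where "q = (\<Sum>a\<in>UNIV. \<Sum>b\<in>UNIV. R z a b * (d a * d b))"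
    define e where "e = \<Psi> z' - \<Psi> z"
    have d\<rho>: "(\<Sum>a\<in>UNIV. \<bar>d a\<bar>) = \<rho>" unfolding d_def \<rho>_def l1_def ..
    have p: "\<bar>p\<bar> \<le> E * \<rho>" and q: "\<bar>q\<bar> \<le> E * \<rho>\<^sup>2"
      unfolding p_def q_def using taylor2_bounds[OF EP[OF z(1)] ER[OF z(1)] d\<rho> E0] by auto
    have e: "\<bar>e - p - q\<bar> \<le> C0 * \<rho> ^ 3" using C0(2)[OF z] unfolding e_def p_def q_def taylor2_def d_def \<rho>_def by (simp add: algebra_simps)
    have e1: "\<bar>e\<bar> \<le> C1 * \<rho>" using C1(2)[OF z] unfolding e_def \<rho>_def .
    have "\<bar>e - p\<bar> \<le> E * \<rho>\<^sup>2 + C0 * \<rho> ^ 3" using e q by linarith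
    also have "\<dots> = (E + C0 * \<rho>) * \<rho>\<^sup>2" by (simp add: power3_eq_cube power2_eq_square algebra_simps)
    also have "\<dots> \<le> (E + C0 * B) * \<rho>\<^sup>2" using \<rho> C0(1) by (intro mult_right_mono add_left_mono mult_left_mono) auto
    finally have ep: "\<bar>e - p\<bar> \<le> (E + C0 * B) * \<rho>\<^sup>2" .
    have "\<bar>e\<^sup>2 - p\<^sup>2\<bar> = \<bar>e - p\<bar> * \<bar>e + p\<bar>" by (simp add: abs_mult[symmetric] power2_eq_square algebra_simps)
    also have "\<dots> \<le> ((E + C0 * B) * \<rho>\<^sup>2) * ((C1 + E) * \<rho>)"
      using ep e1 p by (intro mult_mono) (auto simp: algebra_simps)
    also have "\<dots> = F * \<rho> ^ 3" unfolding F_def by (simp add: power3_eq_cube power2_eq_square)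
    finally have e2: "\<bar>e\<^sup>2 - p\<^sup>2\<bar> \<le> F * \<rho> ^ 3" .
    have pp: "p\<^sup>2 = (\<Sum>a\<in>UNIV. \<Sum>b\<in>UNIV. (P z a * P z b) * (d a * d b))"
      unfolding p_def power2_eq_square sum_product by (simp add: mult_ac)
    have t: "taylor2 (\<lambda>a. \<phi>1 (\<Psi> z) * P z a) (\<lambda>a b. \<phi>1 (\<Psi> z) * R z a b + \<phi>2 (\<Psi> z) * (P z a * P z b)) d = \<phi>1 (\<Psi> z) * (p + q) + \<phi>2 (\<Psi> z) * p\<^sup>2"
      unfolding taylor2_def pp unfolding p_def q_def by (simp add: sum_distrib_left sum.distrib algebra_simps)
    let ?y = "\<Psi> z"
    have Jz: "?y \<in> J" "\<Psi> z' \<in> J" using J z by auto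
    have i1: "\<bar>\<phi> (\<Psi> z') - \<phi> ?y - \<phi>1 ?y * e - \<phi>2 ?y * e\<^sup>2\<bar> \<le> D * (C1 ^ 3 * \<rho> ^ 3)"
    proof -
      have "\<bar>e\<bar> ^ 3 \<le> C1 ^ 3 * \<rho> ^ 3" using power_mono[OF e1, of 3] by (simp add: power_mult_distrib)
      then have "D * \<bar>e\<bar> ^ 3 \<le> D * (C1 ^ 3 * \<rho> ^ 3)" using D by (rule mult_left_mono)
      then show ?thesis using T[OF Jz] unfolding e_def by linarith
    qed
    have i2: "\<bar>\<phi>1 ?y * (e - p - q)\<bar> \<le> D * (C0 * \<rho> ^ 3)"
      unfolding abs_mult using e \<phi>1(1)[OF Jz(1)] D by (intro mult_mono) auto
    have i3: "\<bar>\<phi>2 ?y * (e\<^sup>2 - p\<^sup>2)\<bar> \<le> D * (F * \<rho> ^ 3)"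
      unfolding abs_mult using e2 \<phi>2(1)[OF Jz(1)] D by (intro mult_mono) auto
    have "\<phi> (\<Psi> z') - \<phi> ?y - (\<phi>1 ?y * (p + q) + \<phi>2 ?y * p\<^sup>2) =
       (\<phi> (\<Psi> z') - \<phi> ?y - \<phi>1 ?y * e - \<phi>2 ?y * e\<^sup>2) + \<phi>1 ?y * (e - p - q) + \<phi>2 ?y * (e\<^sup>2 - p\<^sup>2)"
      by (simp add: algebra_simps)
    then have "\<bar>\<phi> (\<Psi> z') - \<phi> ?y - (\<phi>1 ?y * (p + q) + \<phi>2 ?y * p\<^sup>2)\<bar> \<le> D * (C1 ^ 3 * \<rho> ^ 3) + D * (C0 * \<rho> ^ 3) + D * (F * \<rho> ^ 3)"
      using i1 i2 i3 by linarith
    also have "\<dots> = ?G * \<rho> ^ 3" by (simp add: algebra_simps)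
    finally show ?thesis unfolding t[symmetric] d_def \<rho>_def .
  qed
  have G0: "0 \<le> ?G" unfolding F_def using D C0 C1 E0 B0 by (intro add_nonneg_nonneg mult_nonneg_nonneg) auto
  have b\<phi>: "blip S (\<lambda>z. \<phi> (\<Psi> z))" "blip S (\<lambda>z. \<phi>1 (\<Psi> z))" "blip S (\<lambda>z. \<phi>2 (\<Psi> z))"
    by (intro blip_compose[OF bl(1) J, where D=D]; use \<phi> \<phi>1 \<phi>2 D in simp)+
  show ?thesis unfolding jet_def
  proof (intro conjI allI b\<phi> blip_mult blip_add bl)
    show "\<exists>C\<ge>0. \<forall>z\<in>S. \<forall>z'\<in>S. \<bar>\<phi> (\<Psi> z') - \<phi> (\<Psi> z) - taylor2 (\<lambda>a. \<phi>1 (\<Psi> z) * P z a) (\<lambda>a b. \<phi>1 (\<Psi> z) * R z a b + \<phi>2 (\<Psi> z) * (P z a * P z b)) (\<lambda>a. z' a - z a)\<bar> \<le> C * l1 z z' ^ 3"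
      using rem G0 by (intro exI[of _ ?G]) auto
  qed
qed

lemma blip_uniform:
  fixes f :: "'i::finite \<Rightarrow> ('k::finite \<Rightarrow> real) \<Rightarrow> real"
  assumes "\<And>i. blip S (f i)"
  obtains K where "0 \<le> K" "\<And>i z. z \<in> S \<Longrightarrow> \<bar>f i z\<bar> \<le> K" "\<And>i z z'. z \<in> S \<Longrightarrow> z' \<in> S \<Longrightarrow> \<bar>f i z' - f i z\<bar> \<le> K * l1 z z'"
proof -
  have "\<exists>C. \<forall>i. 0 \<le> C i \<and> (\<forall>z\<in>S. \<bar>f i z\<bar> \<le> C i) \<and> (\<forall>z\<in>S. \<forall>z'\<in>S. \<bar>f i z' - f i z\<bar> \<le> C i * l1 z z')"
    using assms unfolding blip_def by metis
  then obtain C where C: "\<And>i. 0 \<le> C i" "\<And>i z. z \<in> S \<Longrightarrow> \<bar>f i z\<bar> \<le> C i"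
    "\<And>i z z'. z \<in> S \<Longrightarrow> z' \<in> S \<Longrightarrow> \<bar>f i z' - f i z\<bar> \<le> C i * l1 z z'" by blast
  have le: "C i \<le> sum C UNIV" for i by (rule member_le_sum) (auto simp: C)
  show ?thesis
  proof (rule that[of "sum C UNIV"])
    show "0 \<le> sum C UNIV" using C(1) by (intro sum_nonneg)
    show "\<bar>f i z\<bar> \<le> sum C UNIV" if "z \<in> S" for i z using C(2)[OF that, of i] le[of i] by linarith
    show "\<bar>f i z' - f i z\<bar> \<le> sum C UNIV * l1 z z'" if "z \<in> S" "z' \<in> S" for i z z'
      using C(3)[OF that, of i] mult_right_mono[OF le[of i] l1_nonneg[of z z']] by linarith
  qed
qed

lemma blip_continuous_on:
  fixes f :: "('k::finite \<Rightarrow> real) \<Rightarrow> real"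
  assumes "blip S f" shows "continuous_on S f"
  unfolding continuous_on_def
proof
  fix z assume z: "z \<in> S"
  obtain C where C: "\<And>z z'. z \<in> S \<Longrightarrow> z' \<in> S \<Longrightarrow> \<bar>f z' - f z\<bar> \<le> C * l1 z z'"
    using assms unfolding blip_def by blast
  have "continuous_on UNIV (\<lambda>z'. C * l1 z z')"
    unfolding l1_def by (intro continuous_intros continuous_on_product_coordinates)
  then have "((\<lambda>z'. C * l1 z z') \<longlongrightarrow> C * l1 z z) (at z within S)"
    unfolding continuous_on_def by (metis UNIV_I tendsto_within_subset subset_UNIV)
  then have l: "((\<lambda>z'. C * l1 z z') \<longlongrightarrow> 0) (at z within S)" by (simp add: l1_def)
  have "((\<lambda>z'. f z' - f z) \<longlongrightarrow> 0) (at z within S)"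
  proof (rule Lim_null_comparison[OF _ l])
    show "\<forall>\<^sub>F z' in at z within S. norm (f z' - f z) \<le> C * l1 z z'"
      unfolding eventually_at_filter using C[OF z] by (intro always_eventually) auto
  qed
  then show "(f \<longlongrightarrow> f z) (at z within S)" by (rule LIM_zero_cancel)
qed

text \<open>With a fourth moment of order \<open>\<delta>\<^sup>2\<close>, these inequalities give a
  first moment of order 1/2 and a third moment of order 3/2 in \<delta>, in place of Hoelder's
  inequality.\<close>

lemma young_sqrt:
  assumes "0 < \<delta>" "0 \<le> \<rho>"
  shows "\<rho> \<le> sqrt \<delta> + \<rho> ^ 4 / (\<delta> * sqrt \<delta>)" "\<rho> ^ 3 \<le> \<delta> * sqrt \<delta> + \<rho> ^ 4 / sqrt \<delta>"
proof -
  define w where "w = sqrt \<delta>"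
  have w: "0 < w" "\<delta> = w * w" using assms unfolding w_def by auto
  have 1: "\<rho> \<le> w + \<rho> ^ 4 / (w * w * w)"
  proof (cases "\<rho> \<le> w")
    case True
    then show "\<rho> \<le> w + \<rho> ^ 4 / (w * w * w)" using w by (intro order_trans[OF True]) auto
  next
    case False
    then have "w ^ 3 \<le> \<rho> ^ 3" using w by (intro power_mono) auto
    then have "\<rho> * w ^ 3 \<le> \<rho> * \<rho> ^ 3" using assms by (intro mult_left_mono) auto
    then have "\<rho> \<le> \<rho> ^ 4 / (w * w * w)" using w by (simp add: field_simps numeral_eq_Suc)
    then show "\<rho> \<le> w + \<rho> ^ 4 / (w * w * w)" using w by simp
  qed
  have 2: "\<rho> ^ 3 \<le> w * w * w + \<rho> ^ 4 / w"
  proof (cases "\<rho> \<le> w")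
    case True
    then have "\<rho> ^ 3 \<le> w ^ 3" using assms by (intro power_mono) auto
    moreover have "0 \<le> \<rho> ^ 4 / w" using w by simp
    ultimately show "\<rho> ^ 3 \<le> w * w * w + \<rho> ^ 4 / w" by (simp add: power3_eq_cube)
  next
    case False
    then have "w * \<rho> ^ 3 \<le> \<rho> * \<rho> ^ 3" using assms by (intro mult_right_mono) auto
    then have "\<rho> ^ 3 \<le> \<rho> ^ 4 / w" using w by (simp add: field_simps numeral_eq_Suc)
    moreover have "0 \<le> w * w * w" using w(1) by simp
    ultimately show "\<rho> ^ 3 \<le> w * w * w + \<rho> ^ 4 / w" by linarith
  qed
  show "\<rho> \<le> sqrt \<delta> + \<rho> ^ 4 / (\<delta> * sqrt \<delta>)" using 1 unfolding w(2)[symmetric] unfolding w_def .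
  show "\<rho> ^ 3 \<le> \<delta> * sqrt \<delta> + \<rho> ^ 4 / sqrt \<delta>" using 2 unfolding w(2)[symmetric] unfolding w_def .
qed

section \<open>Dynkin's formula for smooth functions of an Ito family\<close>

lemma (in prob_space) abs_expectation_le:
  fixes f :: "'a \<Rightarrow> real"
  assumes "integrable M f" "integrable M g" "\<And>\<omega>. \<omega> \<in> space M \<Longrightarrow> norm (f \<omega>) \<le> g \<omega>"
  shows "norm (expectation f) \<le> expectation g"
  by (rule order_trans[OF integral_norm_bound integral_mono]) (use assms in auto)

context brownian_motion
begin

text \<open>Increments are controlled to the order \<open>3/2\<close> in time, in expectation against bounded
  \<open>F s\<close>-measurable weights; \<open>\<beta>\<close> is the drift and \<open>\<theta>\<close> the density of the covariation.\<close>

definition ito_family :: "real \<Rightarrow> real \<Rightarrow> ('k::finite \<Rightarrow> real \<Rightarrow> 'w \<Rightarrow> real) \<Rightarrow> ('k \<Rightarrow> real \<Rightarrow> 'w \<Rightarrow> real) \<Rightarrow>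
    ('k \<Rightarrow> 'k \<Rightarrow> real \<Rightarrow> 'w \<Rightarrow> real) \<Rightarrow> bool" where
  "ito_family T C Z \<beta> \<theta> \<longleftrightarrow>
     (\<forall>a. cprocess C (Z a)) \<and> (\<forall>a. cprocess C (\<beta> a)) \<and> (\<forall>a b. cprocess C (\<theta> a b)) \<and>
     (\<forall>a. \<forall>t\<ge>0. Z a t \<in> borel_measurable (F t)) \<and>
     (\<forall>s u. 0 \<le> s \<longrightarrow> s \<le> u \<longrightarrow> u \<le> T \<longrightarrow>
        (\<forall>a. expectation (\<lambda>\<omega>. (Z a u \<omega> - Z a s \<omega>) ^ 4) \<le> C * (u - s)\<^sup>2) \<and>
        (\<forall>\<xi> \<kappa>. \<xi> \<in> borel_measurable (F s) \<longrightarrow> (\<forall>\<omega>\<in>space M. \<bar>\<xi> \<omega>\<bar> \<le> \<kappa>) \<longrightarrow>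
          (\<forall>a. expectation (\<lambda>\<omega>. \<xi> \<omega> * (Z a u \<omega> - Z a s \<omega>)) = integral {s..u} (\<lambda>r. expectation (\<lambda>\<omega>. \<xi> \<omega> * \<beta> a r \<omega>))) \<and>
          (\<forall>a b. \<bar>expectation (\<lambda>\<omega>. \<xi> \<omega> * ((Z a u \<omega> - Z a s \<omega>) * (Z b u \<omega> - Z b s \<omega>)))
             - integral {s..u} (\<lambda>r. expectation (\<lambda>\<omega>. \<xi> \<omega> * \<theta> a b r \<omega>))\<bar> \<le> C * \<kappa> * ((u - s) * sqrt (u - s)))))"

text \<open>Over a short interval the function is expanded at the left end. The expansion
  coefficients are then weights known at time \<open>s\<close>, which is exactly what
  \<open>ito_family\<close> admits. The Taylor remainder, the covariation error and the cost of
  moving the coefficients to the current time are all of order 3/2, so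
  \<open>constant_of_three_halves_bound\<close> applies.\<close>

theorem dynkin:
  fixes Z :: "'k::finite \<Rightarrow> real \<Rightarrow> 'w \<Rightarrow> real"
  assumes fam: "ito_family T C Z \<beta> \<theta>" and jet: "jet S \<Psi> P R"
    and S: "\<And>t \<omega>. 0 \<le> t \<Longrightarrow> \<omega> \<in> space M \<Longrightarrow> (\<lambda>a. Z a t \<omega>) \<in> S"
    and t: "0 \<le> t" "t \<le> T"
  defines "l \<equiv> \<lambda>r \<omega>. (\<Sum>a\<in>UNIV. P (\<lambda>a. Z a r \<omega>) a * \<beta> a r \<omega>) + (\<Sum>a\<in>UNIV. \<Sum>b\<in>UNIV. R (\<lambda>a. Z a r \<omega>) a b * \<theta> a b r \<omega>)"
  shows "expectation (\<lambda>\<omega>. \<Psi> (\<lambda>a. Z a t \<omega>)) - expectation (\<lambda>\<omega>. \<Psi> (\<lambda>a. Z a 0 \<omega>)) = integral {0..t} (\<lambda>r. expectation (l r))"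
    and "continuous_on {0..} (\<lambda>r. expectation (l r))"
proof -
  have Zc: "\<And>a. cprocess C (Z a)" and \<beta>c: "\<And>a. cprocess C (\<beta> a)" and \<theta>c: "\<And>a b. cprocess C (\<theta> a b)"
    and ZF: "\<And>a t. 0 \<le> t \<Longrightarrow> Z a t \<in> borel_measurable (F t)"
    and Z4: "\<And>a s u. 0 \<le> s \<Longrightarrow> s \<le> u \<Longrightarrow> u \<le> T \<Longrightarrow> expectation (\<lambda>\<omega>. (Z a u \<omega> - Z a s \<omega>) ^ 4) \<le> C * (u - s)\<^sup>2"
    and Z1: "\<And>a s u \<xi> \<kappa>. 0 \<le> s \<Longrightarrow> s \<le> u \<Longrightarrow> u \<le> T \<Longrightarrow> \<xi> \<in> borel_measurable (F s) \<Longrightarrow> (\<forall>\<omega>\<in>space M. \<bar>\<xi> \<omega>\<bar> \<le> \<kappa>) \<Longrightarrow>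
        expectation (\<lambda>\<omega>. \<xi> \<omega> * (Z a u \<omega> - Z a s \<omega>)) = integral {s..u} (\<lambda>r. expectation (\<lambda>\<omega>. \<xi> \<omega> * \<beta> a r \<omega>))"
    and Z2: "\<And>a b s u \<xi> \<kappa>. 0 \<le> s \<Longrightarrow> s \<le> u \<Longrightarrow> u \<le> T \<Longrightarrow> \<xi> \<in> borel_measurable (F s) \<Longrightarrow> (\<forall>\<omega>\<in>space M. \<bar>\<xi> \<omega>\<bar> \<le> \<kappa>) \<Longrightarrow>
        \<bar>expectation (\<lambda>\<omega>. \<xi> \<omega> * ((Z a u \<omega> - Z a s \<omega>) * (Z b u \<omega> - Z b s \<omega>)))
             - integral {s..u} (\<lambda>r. expectation (\<lambda>\<omega>. \<xi> \<omega> * \<theta> a b r \<omega>))\<bar> \<le> C * \<kappa> * ((u - s) * sqrt (u - s))"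
    using fam unfolding ito_family_def by blast+
  have C0: "0 \<le> C" using cprocess_bound_nonneg[OF Zc] .
  define V where "V = (\<lambda>t \<omega> a. Z a t \<omega>)"
  have VS: "V t \<omega> \<in> S" if "0 \<le> t" "\<omega> \<in> space M" for t \<omega> unfolding V_def by (rule S[OF that])
  \<comment> \<open>The function is controlled on \<open>S\<close> only, hence the passage through
    the restricted Borel space.\<close>
  have Vm: "(\<lambda>\<omega>. f (V t \<omega>)) \<in> borel_measurable (F t)" if f: "blip S f" and t: "0 \<le> t" for f t
  proof -
    have "V t \<in> borel_measurable (F t)"
      unfolding V_def by (rule measurable_coordinatewise_then_product) (rule ZF[OF t])
    then have "V t \<in> measurable (F t) (restrict_space borel S)"
      using VS[OF t] by (intro measurable_restrict_space2) (auto simp: space_F)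
    moreover have "f \<in> borel_measurable (restrict_space borel S)"
      by (rule borel_measurable_continuous_on_restrict[OF blip_continuous_on[OF f]])
    ultimately show ?thesis by (rule measurable_compose)
  qed
  have Vc: "cprocess D (\<lambda>t \<omega>. f (V t \<omega>))" if f: "blip S f" and D: "\<And>z. z \<in> S \<Longrightarrow> \<bar>f z\<bar> \<le> D" for f D
    unfolding cprocess_def
  proof (intro conjI allI impI ballI)
    show "(\<lambda>\<omega>. f (V r \<omega>)) \<in> borel_measurable M" if "0 \<le> r" for r using measurable_F_M[OF Vm[OF f that]] .
    fix \<omega> assume w: "\<omega> \<in> space M"
    have "continuous_on {0..} (\<lambda>r. V r \<omega>)"
      unfolding V_def using cprocessD(2)[OF Zc w] by (intro continuous_on_coordinatewise_then_product)
    then show "continuous_on {0..} (\<lambda>r. f (V r \<omega>))"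
      by (rule continuous_on_compose2[OF blip_continuous_on[OF f]]) (use VS w in auto)
    show "\<bar>f (V r \<omega>)\<bar> \<le> D" if "0 \<le> r" for r using D VS[OF that w] .
  qed
  have bl: "blip S \<Psi>" "\<And>a. blip S (\<lambda>z. P z a)" "\<And>a b. blip S (\<lambda>z. R z a b)"
    using jet unfolding jet_def by auto
  obtain J where J: "J \<ge> 0" "\<And>z z'. z \<in> S \<Longrightarrow> z' \<in> S \<Longrightarrow> \<bar>\<Psi> z' - \<Psi> z - taylor2 (P z) (R z) (\<lambda>a. z' a - z a)\<bar> \<le> J * l1 z z' ^ 3"
    using jet unfolding jet_def by blast
  obtain K0 where K0: "\<And>z. z \<in> S \<Longrightarrow> \<bar>\<Psi> z\<bar> \<le> K0" using bl(1) unfolding blip_def by blast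
  obtain K1 where K1: "0 \<le> K1" "\<And>a z. z \<in> S \<Longrightarrow> \<bar>P z a\<bar> \<le> K1" "\<And>a z z'. z \<in> S \<Longrightarrow> z' \<in> S \<Longrightarrow> \<bar>P z' a - P z a\<bar> \<le> K1 * l1 z z'"
    using blip_uniform[of S "\<lambda>a z. P z a"] bl(2) by blast
  obtain K2 where K2: "0 \<le> K2" "\<And>i z. z \<in> S \<Longrightarrow> \<bar>R z (fst i) (snd i)\<bar> \<le> K2" "\<And>i z z'. z \<in> S \<Longrightarrow> z' \<in> S \<Longrightarrow> \<bar>R z' (fst i) (snd i) - R z (fst i) (snd i)\<bar> \<le> K2 * l1 z z'"
    using blip_uniform[of S "\<lambda>i z. R z (fst i) (snd i)"] bl(3) by blast
  define K where "K = max K1 K2"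
  have K: "0 \<le> K" unfolding K_def using K1 by simp
  have KP: "\<bar>P z a\<bar> \<le> K" if "z \<in> S" for z a using K1(2)[OF that, of a] unfolding K_def by linarith
  have KR: "\<bar>R z a b\<bar> \<le> K" if "z \<in> S" for z a b using K2(2)[OF that, of "(a, b)"] unfolding K_def by simp
  have KP': "\<bar>P z' a - P z a\<bar> \<le> K * l1 z z'" if "z \<in> S" "z' \<in> S" for z z' a
    using K1(3)[OF that, of a] mult_right_mono[of K1 K "l1 z z'"] l1_nonneg[of z z'] unfolding K_def by fastforce
  have KR': "\<bar>R z' a b - R z a b\<bar> \<le> K * l1 z z'" if "z \<in> S" "z' \<in> S" for z z' a b
    using K2(3)[OF that, of "(a, b)"] mult_right_mono[of K2 K "l1 z z'"] l1_nonneg[of z z'] unfolding K_def by fastforce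
  let ?n = "real CARD('k)"
  note c\<Psi> = Vc[OF bl(1) K0] and cP = Vc[OF bl(2) KP] and cR = Vc[OF bl(3) KR]
  have mP: "(\<lambda>\<omega>. P (V s \<omega>) a) \<in> borel_measurable (F s)" "(\<lambda>\<omega>. R (V s \<omega>) a b) \<in> borel_measurable (F s)" if "0 \<le> s" for s a b
    using Vm[OF bl(2) that] Vm[OF bl(3) that] by auto
  have l_V: "l = (\<lambda>r \<omega>. (\<Sum>a\<in>UNIV. P (V r \<omega>) a * \<beta> a r \<omega>) + (\<Sum>a\<in>UNIV. \<Sum>b\<in>UNIV. R (V r \<omega>) a b * \<theta> a b r \<omega>))"
    unfolding l_def V_def ..
  have iP: "integrable M (\<lambda>\<omega>. P (V r \<omega>) a * \<beta> a r \<omega>)" "integrable M (\<lambda>\<omega>. R (V r \<omega>) a b * \<theta> a b r \<omega>)" if "0 \<le> r" for r a b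
    using cprocess_integrable[OF cprocess_mult[OF cP \<beta>c] that] cprocess_integrable[OF cprocess_mult[OF cR \<theta>c] that] by auto
  have El: "expectation (l r) = (\<Sum>a\<in>UNIV. expectation (\<lambda>\<omega>. P (V r \<omega>) a * \<beta> a r \<omega>)) + (\<Sum>a\<in>UNIV. \<Sum>b\<in>UNIV. expectation (\<lambda>\<omega>. R (V r \<omega>) a b * \<theta> a b r \<omega>))"
    if "0 \<le> r" for r
    unfolding l_V using iP[OF that] by (simp add: Bochner_Integration.integral_sum Bochner_Integration.integrable_sum)
  have contP: "continuous_on {0..} (\<lambda>r. expectation (\<lambda>\<omega>. P (V r \<omega>) a * \<beta> a r \<omega>))"
     "continuous_on {0..} (\<lambda>r. expectation (\<lambda>\<omega>. R (V r \<omega>) a b * \<theta> a b r \<omega>))" for a b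
    using cprocess_expectation_continuous[OF cprocess_mult[OF cP \<beta>c]] cprocess_expectation_continuous[OF cprocess_mult[OF cR \<theta>c]] by auto
  have cl: "continuous_on {0..} (\<lambda>r. expectation (l r))"
    by (subst continuous_on_cong[OF refl El]) (auto intro!: continuous_intros contP)
  then show "continuous_on {0..} (\<lambda>r. expectation (l r))" .
  define A where "A = ?n ^ 3 * (?n * C)"
  have A0: "0 \<le> A" unfolding A_def using C0 by simp
  have \<rho>m: "(\<lambda>\<omega>. l1 (V s \<omega>) (V u \<omega>)) \<in> borel_measurable M" if "0 \<le> s" "0 \<le> u" for s u
    unfolding l1_def V_def using cprocessD(1)[OF Zc] that by (intro borel_measurable_sum borel_measurable_abs borel_measurable_diff) auto
  have \<rho>b: "\<bar>l1 (V s \<omega>) (V u \<omega>)\<bar> \<le> ?n * (2 * C)" if "0 \<le> s" "0 \<le> u" "\<omega> \<in> space M" for s u \<omega>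
    using l1_le_bounded[of "V s \<omega>" C "V u \<omega>"] l1_nonneg[of "V s \<omega>" "V u \<omega>"] cprocessD(3)[OF Zc that(3)] that unfolding V_def by auto
  have i\<rho>: "integrable M (\<lambda>\<omega>. l1 (V s \<omega>) (V u \<omega>) ^ k)" if "0 \<le> s" "0 \<le> u" for s u k
    using \<rho>m[OF that] power_mono[OF \<rho>b[OF that], of _ k]
    by (intro integrable_const_bound[of _ "(?n * (2 * C)) ^ k"]) (auto simp: power_abs)
  have \<rho>4: "expectation (\<lambda>\<omega>. l1 (V s \<omega>) (V u \<omega>) ^ 4) \<le> A * (u - s)\<^sup>2" if su: "0 \<le> s" "s \<le> u" "u \<le> T" for s u
  proof -
    have u: "0 \<le> u" using su by simp
    have i4: "integrable M (\<lambda>\<omega>. (Z a u \<omega> - Z a s \<omega>) ^ 4)" for a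
    proof (rule integrable_const_bound[of _ "(2 * C) ^ 4"])
      show "AE \<omega> in M. norm ((Z a u \<omega> - Z a s \<omega>) ^ 4) \<le> (2 * C) ^ 4"
      proof (rule AE_I2)
        fix \<omega> assume w: "\<omega> \<in> space M"
        have "\<bar>Z a u \<omega> - Z a s \<omega>\<bar> \<le> 2 * C" using cprocessD(3)[OF Zc w u, of a] cprocessD(3)[OF Zc w su(1), of a] by linarith
        then show "norm ((Z a u \<omega> - Z a s \<omega>) ^ 4) \<le> (2 * C) ^ 4" unfolding real_norm_def power_abs by (rule power_mono) simp
      qed
    qed (use cprocessD(1)[OF Zc] su u in \<open>auto intro!: borel_measurable_power borel_measurable_diff\<close>)
    have "expectation (\<lambda>\<omega>. l1 (V s \<omega>) (V u \<omega>) ^ 4) \<le> expectation (\<lambda>\<omega>. ?n ^ 3 * (\<Sum>a\<in>UNIV. (Z a u \<omega> - Z a s \<omega>) ^ 4))"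
      using i\<rho>[OF su(1) u, of 4] i4 l1_pow4[of "V s _" "V u _"] unfolding V_def
      by (intro integral_mono integrable_mult_right Bochner_Integration.integrable_sum) auto
    also have "\<dots> = ?n ^ 3 * (\<Sum>a\<in>UNIV. expectation (\<lambda>\<omega>. (Z a u \<omega> - Z a s \<omega>) ^ 4))"
      using i4 by (simp add: Bochner_Integration.integral_sum)
    also have "\<dots> \<le> ?n ^ 3 * (\<Sum>a\<in>(UNIV::'k set). C * (u - s)\<^sup>2)"
      using Z4[OF su] by (intro mult_left_mono sum_mono) auto
    also have "\<dots> = A * (u - s)\<^sup>2" unfolding A_def by simp
    finally show ?thesis .
  qed
  have \<rho>13: "expectation (\<lambda>\<omega>. l1 (V s \<omega>) (V u \<omega>)) \<le> (1 + A) * sqrt (u - s)"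
      "expectation (\<lambda>\<omega>. l1 (V s \<omega>) (V u \<omega>) ^ 3) \<le> (1 + A) * ((u - s) * sqrt (u - s))" if su: "0 \<le> s" "s \<le> u" "u \<le> T" for s u
  proof -
    have u: "0 \<le> u" using su by simp
    have "expectation (\<lambda>\<omega>. l1 (V s \<omega>) (V u \<omega>)) \<le> (1 + A) * sqrt (u - s) \<and>
      expectation (\<lambda>\<omega>. l1 (V s \<omega>) (V u \<omega>) ^ 3) \<le> (1 + A) * ((u - s) * sqrt (u - s))"
    proof (cases "s = u")
      case True
      then show ?thesis by (simp add: l1_def)
    next
      case False
      define \<delta> where "\<delta> = u - s"
      have d: "0 < \<delta>" using False su unfolding \<delta>_def by simp
      define w where "w = sqrt \<delta>"
      have w: "0 < w" "\<delta> = w * w" using d unfolding w_def by auto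
      have e4: "expectation (\<lambda>\<omega>. l1 (V s \<omega>) (V u \<omega>) ^ 4) \<le> A * \<delta>\<^sup>2" using \<rho>4[OF su] unfolding \<delta>_def .
      have "expectation (\<lambda>\<omega>. l1 (V s \<omega>) (V u \<omega>)) \<le> expectation (\<lambda>\<omega>. sqrt \<delta> + l1 (V s \<omega>) (V u \<omega>) ^ 4 / (\<delta> * sqrt \<delta>))"
        using i\<rho>[OF su(1) u, of 4] i\<rho>[OF su(1) u, of 1] young_sqrt(1)[OF d l1_nonneg] by (intro integral_mono) auto
      also have "\<dots> = sqrt \<delta> + expectation (\<lambda>\<omega>. l1 (V s \<omega>) (V u \<omega>) ^ 4) / (\<delta> * sqrt \<delta>)"
        using i\<rho>[OF su(1) u, of 4] by (simp add: prob_space)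
      also have "\<dots> \<le> sqrt \<delta> + A * \<delta>\<^sup>2 / (\<delta> * sqrt \<delta>)"
        using e4 d by (intro add_left_mono divide_right_mono) auto
      also have "\<dots> = (1 + A) * sqrt \<delta>"
        unfolding w_def[symmetric] w(2) using w(1) by (simp add: field_simps power2_eq_square)
      finally have 1: "expectation (\<lambda>\<omega>. l1 (V s \<omega>) (V u \<omega>)) \<le> (1 + A) * sqrt \<delta>" .
      have "expectation (\<lambda>\<omega>. l1 (V s \<omega>) (V u \<omega>) ^ 3) \<le> expectation (\<lambda>\<omega>. \<delta> * sqrt \<delta> + l1 (V s \<omega>) (V u \<omega>) ^ 4 / sqrt \<delta>)"
        using i\<rho>[OF su(1) u, of 4] i\<rho>[OF su(1) u, of 3] young_sqrt(2)[OF d l1_nonneg] by (intro integral_mono) auto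
      also have "\<dots> = \<delta> * sqrt \<delta> + expectation (\<lambda>\<omega>. l1 (V s \<omega>) (V u \<omega>) ^ 4) / sqrt \<delta>"
        using i\<rho>[OF su(1) u, of 4] by (simp add: prob_space)
      also have "\<dots> \<le> \<delta> * sqrt \<delta> + A * \<delta>\<^sup>2 / sqrt \<delta>"
        using e4 d by (intro add_left_mono divide_right_mono) auto
      also have "\<dots> = (1 + A) * (\<delta> * sqrt \<delta>)"
        unfolding w_def[symmetric] w(2) using w(1) by (simp add: field_simps power2_eq_square)
      finally show ?thesis using 1 unfolding \<delta>_def by blast
    qed
    then show "expectation (\<lambda>\<omega>. l1 (V s \<omega>) (V u \<omega>)) \<le> (1 + A) * sqrt (u - s)"
      "expectation (\<lambda>\<omega>. l1 (V s \<omega>) (V u \<omega>) ^ 3) \<le> (1 + A) * ((u - s) * sqrt (u - s))" by blast+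
  qed
  \<comment> \<open>Replacing a coefficient taken at time \<open>s\<close> by its current value
    costs the mean distance travelled, of order 1/2, integrated over an interval of length
    \<open>u - s\<close>.\<close>
  have freeze: "\<bar>integral {s..u} (\<lambda>r. expectation (\<lambda>\<omega>. p (V s \<omega>) * b r \<omega>)) - integral {s..u} (\<lambda>r. expectation (\<lambda>\<omega>. p (V r \<omega>) * b r \<omega>))\<bar>
      \<le> K * C * (1 + A) * ((u - s) * sqrt (u - s))"
    if su: "0 \<le> s" "s \<le> u" "u \<le> T" and b: "cprocess C b" and p: "blip S p" "\<And>z. z \<in> S \<Longrightarrow> \<bar>p z\<bar> \<le> K"
      "\<And>z z'. z \<in> S \<Longrightarrow> z' \<in> S \<Longrightarrow> \<bar>p z' - p z\<bar> \<le> K * l1 z z'" for s u b p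
  proof -
    have cs: "cprocess K (\<lambda>r \<omega>. p (V s \<omega>))"
      using p(2)[OF VS[OF su(1)]] measurable_F_M[OF Vm[OF p(1) su(1)]] by (intro cprocess_const)
    note c1 = cprocess_mult[OF cs b] and c2 = cprocess_mult[OF Vc[OF p(1,2)] b]
    have co: "continuous_on {s..u} (\<lambda>r. expectation (\<lambda>\<omega>. p (V s \<omega>) * b r \<omega>))" "continuous_on {s..u} (\<lambda>r. expectation (\<lambda>\<omega>. p (V r \<omega>) * b r \<omega>))"
      using cprocess_expectation_continuous[OF c1] cprocess_expectation_continuous[OF c2] su by (auto elim!: continuous_on_subset)
    have "integral {s..u} (\<lambda>r. expectation (\<lambda>\<omega>. p (V s \<omega>) * b r \<omega>)) - integral {s..u} (\<lambda>r. expectation (\<lambda>\<omega>. p (V r \<omega>) * b r \<omega>))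
      = integral {s..u} (\<lambda>r. expectation (\<lambda>\<omega>. p (V s \<omega>) * b r \<omega>) - expectation (\<lambda>\<omega>. p (V r \<omega>) * b r \<omega>))"
      using co by (intro Henstock_Kurzweil_Integration.integral_diff[symmetric] integrable_continuous_interval)
    moreover have "norm (integral {s..u} (\<lambda>r. expectation (\<lambda>\<omega>. p (V s \<omega>) * b r \<omega>) - expectation (\<lambda>\<omega>. p (V r \<omega>) * b r \<omega>)))
       \<le> (K * C * (1 + A) * sqrt (u - s)) * (u - s)"
    proof (rule integral_bound[OF su(2)])
      show "continuous_on {s..u} (\<lambda>r. expectation (\<lambda>\<omega>. p (V s \<omega>) * b r \<omega>) - expectation (\<lambda>\<omega>. p (V r \<omega>) * b r \<omega>))"
        using co by (intro continuous_intros)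
      fix r assume r: "r \<in> {s..u}"
      then have r0: "0 \<le> r" and sr: "s \<le> r" "r \<le> T" using su by auto
      have i: "integrable M (\<lambda>\<omega>. p (V s \<omega>) * b r \<omega>)" "integrable M (\<lambda>\<omega>. p (V r \<omega>) * b r \<omega>)"
        using cprocess_integrable[OF c1 r0] cprocess_integrable[OF c2 r0] by auto
      have "norm (expectation (\<lambda>\<omega>. p (V s \<omega>) * b r \<omega>) - expectation (\<lambda>\<omega>. p (V r \<omega>) * b r \<omega>))
         = norm (expectation (\<lambda>\<omega>. p (V s \<omega>) * b r \<omega> - p (V r \<omega>) * b r \<omega>))" using i by simp
      also have "\<dots> \<le> expectation (\<lambda>\<omega>. K * C * l1 (V s \<omega>) (V r \<omega>))"
      proof (rule abs_expectation_le)
        show "integrable M (\<lambda>\<omega>. p (V s \<omega>) * b r \<omega> - p (V r \<omega>) * b r \<omega>)" using i by simp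
        show "integrable M (\<lambda>\<omega>. K * C * l1 (V s \<omega>) (V r \<omega>))" using i\<rho>[OF su(1) r0, of 1] by simp
        fix \<omega> assume w: "\<omega> \<in> space M"
        have "norm (p (V s \<omega>) * b r \<omega> - p (V r \<omega>) * b r \<omega>) = \<bar>p (V r \<omega>) - p (V s \<omega>)\<bar> * \<bar>b r \<omega>\<bar>"
          by (simp add: left_diff_distrib[symmetric] abs_mult abs_minus_commute)
        also have "\<dots> \<le> (K * l1 (V s \<omega>) (V r \<omega>)) * C"
          using p(3)[OF VS[OF su(1) w] VS[OF r0 w]] cprocessD(3)[OF b w r0] K l1_nonneg by (intro mult_mono) auto
        finally show "norm (p (V s \<omega>) * b r \<omega> - p (V r \<omega>) * b r \<omega>) \<le> K * C * l1 (V s \<omega>) (V r \<omega>)" by (simp add: mult_ac)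
      qed
      also have "\<dots> = K * C * expectation (\<lambda>\<omega>. l1 (V s \<omega>) (V r \<omega>))" by simp
      also have "\<dots> \<le> K * C * ((1 + A) * sqrt (r - s))" using \<rho>13(1)[OF su(1) sr] K C0 by (intro mult_left_mono) auto
      also have "\<dots> \<le> K * C * ((1 + A) * sqrt (u - s))" using r K C0 A0 by (intro mult_left_mono) auto
      finally show "norm (expectation (\<lambda>\<omega>. p (V s \<omega>) * b r \<omega>) - expectation (\<lambda>\<omega>. p (V r \<omega>) * b r \<omega>)) \<le> K * C * (1 + A) * sqrt (u - s)" by (simp add: mult_ac)
    qed
    ultimately show ?thesis by (simp add: mult_ac)
  qed
  \<comment> \<open>The defect of the claimed formula, to be shown constant in time.\<close>
  define e where "e = (\<lambda>u. expectation (\<lambda>\<omega>. \<Psi> (V u \<omega>)) - integral {0..u} (\<lambda>r. expectation (l r)))"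
  \<comment> \<open>The three summands bound the errors of the linear part, of the quadratic part
    and of the Taylor remainder.\<close>
  define G where "G = ?n * (K * C * (1 + A)) + ?n * (?n * (C * K + K * C * (1 + A))) + J * (1 + A)"
  have "\<bar>e u - e s\<bar> \<le> G * ((u - s) * sqrt (u - s))" if su: "0 \<le> s" "s \<le> u" "u \<le> T" for s u
  proof -
    have u: "0 \<le> u" using su by simp
    let ?q = "(u - s) * sqrt (u - s)"
    have cls: "continuous_on {a..b} (\<lambda>r. expectation (l r))" if "0 \<le> a" for a b
      using cl that by (auto elim!: continuous_on_subset)
    have I: "integral {0..u} (\<lambda>r. expectation (l r)) - integral {0..s} (\<lambda>r. expectation (l r)) = integral {s..u} (\<lambda>r. expectation (l r))"
      using Henstock_Kurzweil_Integration.integral_combine[OF su(1,2), of "\<lambda>r. expectation (l r)"] integrable_continuous_interval[OF cls[of 0 u]] by simp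
    have "integral {s..u} (\<lambda>r. expectation (l r)) =
      integral {s..u} (\<lambda>r. (\<Sum>a\<in>UNIV. expectation (\<lambda>\<omega>. P (V r \<omega>) a * \<beta> a r \<omega>)) + (\<Sum>a\<in>UNIV. \<Sum>b\<in>UNIV. expectation (\<lambda>\<omega>. R (V r \<omega>) a b * \<theta> a b r \<omega>)))"
      using El su by (intro Henstock_Kurzweil_Integration.integral_cong) auto
    also have "\<dots> = (\<Sum>a\<in>UNIV. integral {s..u} (\<lambda>r. expectation (\<lambda>\<omega>. P (V r \<omega>) a * \<beta> a r \<omega>))) +
       (\<Sum>a\<in>UNIV. \<Sum>b\<in>UNIV. integral {s..u} (\<lambda>r. expectation (\<lambda>\<omega>. R (V r \<omega>) a b * \<theta> a b r \<omega>)))"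
    proof -
      have i: "(\<lambda>r. expectation (\<lambda>\<omega>. P (V r \<omega>) a * \<beta> a r \<omega>)) integrable_on {s..u}" "(\<lambda>r. expectation (\<lambda>\<omega>. R (V r \<omega>) a b * \<theta> a b r \<omega>)) integrable_on {s..u}" for a b
        by (intro integrable_continuous_interval continuous_on_subset[OF contP(1)] continuous_on_subset[OF contP(2)]; use su in auto)+
      show ?thesis using i
        by (simp add: Henstock_Kurzweil_Integration.integral_add Henstock_Kurzweil_Integration.integral_sum Henstock_Kurzweil_Integration.integrable_sum)
    qed
    finally have Il: "integral {s..u} (\<lambda>r. expectation (l r)) = (\<Sum>a\<in>UNIV. integral {s..u} (\<lambda>r. expectation (\<lambda>\<omega>. P (V r \<omega>) a * \<beta> a r \<omega>))) +
       (\<Sum>a\<in>UNIV. \<Sum>b\<in>UNIV. integral {s..u} (\<lambda>r. expectation (\<lambda>\<omega>. R (V r \<omega>) a b * \<theta> a b r \<omega>)))" .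
    let ?d = "\<lambda>\<omega> a. V u \<omega> a - V s \<omega> a"
    have md: "(\<lambda>\<omega>. ?d \<omega> a) \<in> borel_measurable M" for a
      unfolding V_def using cprocessD(1)[OF Zc] su u by auto
    have bd: "\<bar>?d \<omega> a\<bar> \<le> 2 * C" if "\<omega> \<in> space M" for \<omega> a
      unfolding V_def using cprocessD(3)[OF Zc that u, of a] cprocessD(3)[OF Zc that su(1), of a] by linarith
    have idP: "integrable M (\<lambda>\<omega>. P (V s \<omega>) a * ?d \<omega> a)" for a
    proof (rule integrable_const_bound[of _ "K * (2 * C)"])
      show "AE \<omega> in M. norm (P (V s \<omega>) a * ?d \<omega> a) \<le> K * (2 * C)"
        using KP[OF VS[OF su(1)]] bd K by (intro AE_I2) (simp only: real_norm_def abs_mult, intro mult_mono, auto)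
      show "(\<lambda>\<omega>. P (V s \<omega>) a * ?d \<omega> a) \<in> borel_measurable M"
        by (intro borel_measurable_times md measurable_F_M[OF mP(1)[OF su(1)]])
    qed
    have idR: "integrable M (\<lambda>\<omega>. R (V s \<omega>) a b * (?d \<omega> a * ?d \<omega> b))" for a b
    proof (rule integrable_const_bound[of _ "K * ((2 * C) * (2 * C))"])
      show "AE \<omega> in M. norm (R (V s \<omega>) a b * (?d \<omega> a * ?d \<omega> b)) \<le> K * ((2 * C) * (2 * C))"
        using KR[OF VS[OF su(1)]] bd K C0 by (intro AE_I2) (simp only: real_norm_def abs_mult, intro mult_mono, auto)
      show "(\<lambda>\<omega>. R (V s \<omega>) a b * (?d \<omega> a * ?d \<omega> b)) \<in> borel_measurable M"
        by (intro borel_measurable_times md measurable_F_M[OF mP(2)[OF su(1)]])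
    qed
    have it: "integrable M (\<lambda>\<omega>. taylor2 (P (V s \<omega>)) (R (V s \<omega>)) (?d \<omega>))"
      unfolding taylor2_def by (intro Bochner_Integration.integrable_add Bochner_Integration.integrable_sum idP idR)
    have Et: "expectation (\<lambda>\<omega>. taylor2 (P (V s \<omega>)) (R (V s \<omega>)) (?d \<omega>)) =
      (\<Sum>a\<in>UNIV. expectation (\<lambda>\<omega>. P (V s \<omega>) a * ?d \<omega> a)) + (\<Sum>a\<in>UNIV. \<Sum>b\<in>UNIV. expectation (\<lambda>\<omega>. R (V s \<omega>) a b * (?d \<omega> a * ?d \<omega> b)))"
      unfolding taylor2_def using idP idR by (simp add: Bochner_Integration.integral_sum Bochner_Integration.integrable_sum)
    have i\<Psi>: "integrable M (\<lambda>\<omega>. \<Psi> (V u \<omega>))" "integrable M (\<lambda>\<omega>. \<Psi> (V s \<omega>))"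
      using cprocess_integrable[OF c\<Psi> u] cprocess_integrable[OF c\<Psi> su(1)] by auto
    have "\<bar>expectation (\<lambda>\<omega>. \<Psi> (V u \<omega>) - \<Psi> (V s \<omega>) - taylor2 (P (V s \<omega>)) (R (V s \<omega>)) (?d \<omega>))\<bar> \<le> expectation (\<lambda>\<omega>. J * l1 (V s \<omega>) (V u \<omega>) ^ 3)"
      unfolding real_norm_def[symmetric]
      using i\<Psi> it i\<rho>[OF su(1) u, of 3] J(2)[OF VS[OF su(1)] VS[OF u]]
      by (intro abs_expectation_le) auto
    also have "\<dots> \<le> J * ((1 + A) * ?q)" using \<rho>13(2)[OF su] J(1) by (simp add: mult_left_mono)
    finally have rem: "\<bar>expectation (\<lambda>\<omega>. \<Psi> (V u \<omega>)) - expectation (\<lambda>\<omega>. \<Psi> (V s \<omega>)) - expectation (\<lambda>\<omega>. taylor2 (P (V s \<omega>)) (R (V s \<omega>)) (?d \<omega>))\<bar> \<le> J * (1 + A) * ?q"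
      using i\<Psi> it by (simp add: mult_ac)
    have lin: "\<bar>expectation (\<lambda>\<omega>. P (V s \<omega>) a * ?d \<omega> a) - integral {s..u} (\<lambda>r. expectation (\<lambda>\<omega>. P (V r \<omega>) a * \<beta> a r \<omega>))\<bar> \<le> K * C * (1 + A) * ?q" for a
    proof -
      have "expectation (\<lambda>\<omega>. P (V s \<omega>) a * ?d \<omega> a) = integral {s..u} (\<lambda>r. expectation (\<lambda>\<omega>. P (V s \<omega>) a * \<beta> a r \<omega>))"
        using Z1[OF su mP(1)[OF su(1)], of a K a] KP[OF VS[OF su(1)]] unfolding V_def by blast
      then show ?thesis using freeze[OF su \<beta>c bl(2) KP KP'] by simp
    qed
    have quad: "\<bar>expectation (\<lambda>\<omega>. R (V s \<omega>) a b * (?d \<omega> a * ?d \<omega> b)) - integral {s..u} (\<lambda>r. expectation (\<lambda>\<omega>. R (V r \<omega>) a b * \<theta> a b r \<omega>))\<bar> \<le> (C * K + K * C * (1 + A)) * ?q" for a b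
    proof -
      have "\<bar>expectation (\<lambda>\<omega>. R (V s \<omega>) a b * (?d \<omega> a * ?d \<omega> b)) - integral {s..u} (\<lambda>r. expectation (\<lambda>\<omega>. R (V s \<omega>) a b * \<theta> a b r \<omega>))\<bar> \<le> C * K * ?q"
        using Z2[OF su mP(2)[OF su(1)], of a b K a b] KR[OF VS[OF su(1)]] unfolding V_def by blast
      then show ?thesis using freeze[OF su \<theta>c[of a b] bl(3)[of a b] KR KR'] unfolding distrib_right by linarith
    qed
    have s1: "\<bar>(\<Sum>a\<in>UNIV. expectation (\<lambda>\<omega>. P (V s \<omega>) a * ?d \<omega> a)) - (\<Sum>a\<in>UNIV. integral {s..u} (\<lambda>r. expectation (\<lambda>\<omega>. P (V r \<omega>) a * \<beta> a r \<omega>)))\<bar> \<le> ?n * (K * C * (1 + A) * ?q)"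
    proof -
      have "\<bar>\<Sum>a\<in>(UNIV::'k set). expectation (\<lambda>\<omega>. P (V s \<omega>) a * ?d \<omega> a) - integral {s..u} (\<lambda>r. expectation (\<lambda>\<omega>. P (V r \<omega>) a * \<beta> a r \<omega>))\<bar> \<le> (\<Sum>a\<in>(UNIV::'k set). K * C * (1 + A) * ?q)"
        by (rule order_trans[OF sum_abs sum_mono]) (rule lin)
      then show ?thesis by (simp add: sum_subtractf)
    qed
    have s2: "\<bar>(\<Sum>a\<in>UNIV. \<Sum>b\<in>UNIV. expectation (\<lambda>\<omega>. R (V s \<omega>) a b * (?d \<omega> a * ?d \<omega> b))) - (\<Sum>a\<in>UNIV. \<Sum>b\<in>UNIV. integral {s..u} (\<lambda>r. expectation (\<lambda>\<omega>. R (V r \<omega>) a b * \<theta> a b r \<omega>)))\<bar> \<le> ?n * (?n * ((C * K + K * C * (1 + A)) * ?q))"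
    proof -
      have "\<bar>\<Sum>a\<in>(UNIV::'k set). \<Sum>b\<in>(UNIV::'k set). expectation (\<lambda>\<omega>. R (V s \<omega>) a b * (?d \<omega> a * ?d \<omega> b)) - integral {s..u} (\<lambda>r. expectation (\<lambda>\<omega>. R (V r \<omega>) a b * \<theta> a b r \<omega>))\<bar>
         \<le> (\<Sum>a\<in>(UNIV::'k set). \<Sum>b\<in>(UNIV::'k set). (C * K + K * C * (1 + A)) * ?q)"
        by (rule order_trans[OF sum_abs sum_mono], rule order_trans[OF sum_abs sum_mono]) (rule quad)
      then show ?thesis by (simp add: sum_subtractf)
    qed
    have "e u - e s = (expectation (\<lambda>\<omega>. \<Psi> (V u \<omega>)) - expectation (\<lambda>\<omega>. \<Psi> (V s \<omega>))) - integral {s..u} (\<lambda>r. expectation (l r))"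
      unfolding e_def I[symmetric] by simp
    then have "\<bar>e u - e s\<bar> \<le> J * (1 + A) * ?q + ?n * (K * C * (1 + A) * ?q) + ?n * (?n * ((C * K + K * C * (1 + A)) * ?q))"
      unfolding Il using rem s1 s2 unfolding Et by linarith
    also have "\<dots> = G * ?q" unfolding G_def by (simp add: algebra_simps)
    finally show ?thesis .
  qed
  from constant_of_three_halves_bound[OF this t] have "e t = e 0" .
  then show "expectation (\<lambda>\<omega>. \<Psi> (\<lambda>a. Z a t \<omega>)) - expectation (\<lambda>\<omega>. \<Psi> (\<lambda>a. Z a 0 \<omega>)) = integral {0..t} (\<lambda>r. expectation (l r))"
    unfolding e_def V_def by simp
qed

end

section \<open>Two solutions driven by one Brownian motion as an Ito family\<close>

lemma (in prob_space) cprocess_mono: "cprocess C f \<Longrightarrow> C \<le> D \<Longrightarrow> cprocess D f"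
  unfolding cprocess_def by fastforce

lemma sum_pow4_le: "(x + y) ^ 4 \<le> 8 * (x ^ 4 + y ^ 4)" for x y :: real
proof -
  have 1: "(x + y)\<^sup>2 \<le> 2 * (x\<^sup>2 + y\<^sup>2)"
    using sum_squares_bound[of x y] by (simp add: power2_sum)
  have "(x + y) ^ 4 = ((x + y)\<^sup>2)\<^sup>2" by simp
  also have "\<dots> \<le> (2 * (x\<^sup>2 + y\<^sup>2))\<^sup>2" by (intro power_mono 1) simp
  also have "\<dots> = 4 * (x\<^sup>2 + y\<^sup>2)\<^sup>2" unfolding power_mult_distrib by simp
  also have "(x\<^sup>2 + y\<^sup>2)\<^sup>2 \<le> 2 * ((x\<^sup>2)\<^sup>2 + (y\<^sup>2)\<^sup>2)"
    using sum_squares_bound[of "x\<^sup>2" "y\<^sup>2"] by (simp add: power2_sum)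
  finally show ?thesis by simp
qed

context brownian_motion
begin

lemma cprocess_comp:
  fixes f :: "real ^ 'n \<Rightarrow> real"
  assumes X: "\<And>t. 0 \<le> t \<Longrightarrow> X t \<in> borel_measurable M" "\<And>\<omega>. \<omega> \<in> space M \<Longrightarrow> continuous_on {0..} (\<lambda>t. X t \<omega>)"
    "\<And>\<omega> t. \<omega> \<in> space M \<Longrightarrow> 0 \<le> t \<Longrightarrow> X t \<omega> \<in> E"
    and f: "continuous_on E f" "\<And>x. x \<in> E \<Longrightarrow> \<bar>f x\<bar> \<le> C"
  shows "cprocess C (\<lambda>t \<omega>. f (X t \<omega>))"
  unfolding cprocess_def
proof (intro conjI allI impI ballI)
  fix t :: real assume t: "0 \<le> t"
  have "X t \<in> measurable M (restrict_space borel E)"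
    using X(1,3) t by (intro measurable_restrict_space2) auto
  then show "(\<lambda>\<omega>. f (X t \<omega>)) \<in> borel_measurable M"
    using borel_measurable_continuous_on_restrict[OF f(1)] by (rule measurable_compose)
next
  fix \<omega> assume w: "\<omega> \<in> space M"
  show "continuous_on {0..} (\<lambda>t. f (X t \<omega>))"
    by (rule continuous_on_compose2[OF f(1) X(2)[OF w]]) (use X(3)[OF w] in auto)
  show "\<bar>f (X t \<omega>)\<bar> \<le> C" if "0 \<le> t" for t using f(2) X(3)[OF w that] .
qed

text \<open>An increment is a stochastic integral of order 1/2 plus a drift of order 1. Hence only
  the product of two integrals contributes to the covariation density; products involving a drift
  have order 3/2 or higher. As both solutions share \<open>B\<close>, equal coordinates of different
  solutions are correlated, with density the product of their dispersion coefficients.\<close>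

theorem sde_solutions_ito_family:
  fixes XX :: "bool \<Rightarrow> real \<Rightarrow> 'w \<Rightarrow> real ^ 'n" and E :: "(real ^ 'n) set"
  assumes sol: "\<And>c. sde_solution M F B E \<sigma> b (XX c)"
    and E: "\<And>x. x \<in> E \<Longrightarrow> norm x \<le> L"
    and \<sigma>: "continuous_on E \<sigma>" "\<And>x. x \<in> E \<Longrightarrow> \<bar>\<sigma> x\<bar> \<le> K"
    and b: "continuous_on E b" "\<And>x. x \<in> E \<Longrightarrow> norm (b x) \<le> K"
    and T: "0 \<le> T" and L: "0 \<le> L" and K: "0 \<le> K"
  shows "\<exists>C. ito_family T C (\<lambda>a t \<omega>. XX (fst a) t \<omega> $ snd a) (\<lambda>a t \<omega>. b (XX (fst a) t \<omega>) $ snd a)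
     (\<lambda>a a' t \<omega>. if snd a = snd a' then \<sigma> (XX (fst a) t \<omega>) * \<sigma> (XX (fst a') t \<omega>) else 0)"
proof -
  have XF: "XX c t \<in> borel_measurable (F t)" if "0 \<le> t" for c t
    using sol[of c] that unfolding sde_solution_def adapted_def by blast
  have Xm: "XX c t \<in> borel_measurable M" if "0 \<le> t" for c t using XF[OF that] measurable_F_M by blast
  have Xc: "continuous_on {0..} (\<lambda>t. XX c t \<omega>)" and XE: "\<And>t. 0 \<le> t \<Longrightarrow> XX c t \<omega> \<in> E" if "\<omega> \<in> space M" for c \<omega>
    using sol[of c] that unfolding sde_solution_def by blast+
  have "\<exists>I. \<forall>c. has_ito_integral M F B (\<lambda>t \<omega>. \<sigma> (XX c t \<omega>)) (I c) \<and>
       (AE \<omega> in M. \<forall>t\<ge>0. set_integrable lborel {0..t} (\<lambda>s. b (XX c s \<omega>)) \<and>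
          XX c t \<omega> = XX c 0 \<omega> + I c t \<omega> + (LINT s:{0..t}|lborel. b (XX c s \<omega>)))"
    using sol unfolding sde_solution_def by (intro choice allI) blast
  then obtain I where I: "\<And>c. has_ito_integral M F B (\<lambda>t \<omega>. \<sigma> (XX c t \<omega>)) (I c)"
    and XI: "\<And>c. AE \<omega> in M. \<forall>t\<ge>0. set_integrable lborel {0..t} (\<lambda>s. b (XX c s \<omega>)) \<and>
          XX c t \<omega> = XX c 0 \<omega> + I c t \<omega> + (LINT s:{0..t}|lborel. b (XX c s \<omega>))" by blast
  have cX: "cprocess L (\<lambda>t \<omega>. XX c t \<omega> $ i)" for c i
  proof (rule cprocess_comp[where f="\<lambda>x. x $ i" and E=E])
    show "\<bar>x $ i\<bar> \<le> L" if "x \<in> E" for x using component_le_norm_cart[of x i] E[OF that] by linarith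
  qed (use Xm Xc XE in \<open>auto intro!: continuous_intros\<close>)
  have cb: "cprocess K (\<lambda>t \<omega>. b (XX c t \<omega>) $ i)" for c i
  proof (rule cprocess_comp[where f="\<lambda>x. b x $ i" and E=E])
    show "\<bar>b x $ i\<bar> \<le> K" if "x \<in> E" for x using component_le_norm_cart[of "b x" i] b(2)[OF that] by linarith
  qed (use Xm Xc XE b in \<open>auto intro!: continuous_intros\<close>)
  have c\<sigma>: "cprocess K (\<lambda>t \<omega>. \<sigma> (XX c t \<omega>))" for c
    by (rule cprocess_comp[where f=\<sigma> and E=E]) (use Xm Xc XE \<sigma> in auto)
  define \<theta> where "\<theta> = (\<lambda>(c, i::'n) (d, j::'n) t \<omega>. if i = j then \<sigma> (XX c t \<omega>) * \<sigma> (XX d t \<omega>) else 0)"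
  have c\<theta>: "cprocess (K * K) (\<theta> a a')" for a a'
    unfolding \<theta>_def split_beta
    using cprocess_mult[OF c\<sigma> c\<sigma>, of "fst a" "fst a'"] cprocess_const[of "\<lambda>_. 0" "K * K"] K by (cases "snd a = snd a'") auto
  have H\<sigma>: "\<bar>\<sigma> (XX c s \<omega>)\<bar> \<le> K" if "0 \<le> s" "\<omega> \<in> space M" for c s \<omega> using cprocessD(3)[OF c\<sigma> that(2,1)] .
  define A where "A = (\<lambda>c i s u \<omega>. integral {s..u} (\<lambda>r. b (XX c r \<omega>) $ i))"
  \<comment> \<open>The vector-valued Lebesgue integral of the drift is replaced by componentwise
    integrals over \<open>{s..u}\<close>, for which the \<open>cprocess\<close> facts hold.\<close>
  have dec: "AE \<omega> in M. XX c u \<omega> $ i - XX c s \<omega> $ i = (I c u \<omega> $ i - I c s \<omega> $ i) + A c i s u \<omega>"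
    if su: "0 \<le> s" "s \<le> u" for c i s u
    using XI[of c] AE_space
  proof eventually_elim
    fix \<omega> assume h: "\<forall>t\<ge>0. set_integrable lborel {0..t} (\<lambda>s. b (XX c s \<omega>)) \<and>
          XX c t \<omega> = XX c 0 \<omega> + I c t \<omega> + (LINT s:{0..t}|lborel. b (XX c s \<omega>))" and w: "\<omega> \<in> space M"
    have e: "XX c t \<omega> $ i = XX c 0 \<omega> $ i + I c t \<omega> $ i + integral {0..t} (\<lambda>r. b (XX c r \<omega>) $ i)" if t: "0 \<le> t" for t
    proof -
      have "(LINT s:{0..t}|lborel. b (XX c s \<omega>)) $ i = (LINT s:{0..t}|lborel. b (XX c s \<omega>) $ i)"
        unfolding set_lebesgue_integral_def
        using h t integral_bounded_linear[OF bounded_linear_vec_nth, of lborel "\<lambda>s. indicator {0..t} s *\<^sub>R b (XX c s \<omega>)" i]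
        by (simp add: set_integrable_def)
      also have "\<dots> = integral {0..t} (\<lambda>r. b (XX c r \<omega>) $ i)"
        using cprocess_integral(1)[OF cb order_refl t w] .
      finally show ?thesis using h t by (metis vector_add_component)
    qed
    have "continuous_on {0..u} (\<lambda>r. b (XX c r \<omega>) $ i)"
      by (rule continuous_on_subset[OF cprocessD(2)[OF cb w]]) auto
    then have "integral {0..u} (\<lambda>r. b (XX c r \<omega>) $ i) = integral {0..s} (\<lambda>r. b (XX c r \<omega>) $ i) + A c i s u \<omega>"
      unfolding A_def
      using Henstock_Kurzweil_Integration.integral_combine[OF su, of "\<lambda>r. b (XX c r \<omega>) $ i"] by (simp add: integrable_continuous_interval)
    then show "XX c u \<omega> $ i - XX c s \<omega> $ i = (I c u \<omega> $ i - I c s \<omega> $ i) + A c i s u \<omega>"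
      using e[of u] e[of s] su by simp
  qed
  define W where "W = 3 * K ^ 4"
  \<comment> \<open>One constant serves every clause: \<open>L\<close>, \<open>K\<close> and
    \<open>K * K\<close> bound the processes, the fourth summand the fourth moments, the last one
    the covariation error.\<close>
  define C where "C = L + K + K * K + 8 * (W + K ^ 4 * T\<^sup>2) + (2 * (K * (1 + W)) + K * K * sqrt T)"
  have W0: "0 \<le> W" unfolding W_def using K by simp
  have K4: "0 \<le> K ^ 4" using K by simp
  have nn: "0 \<le> K * K" "0 \<le> 8 * (W + K ^ 4 * T\<^sup>2)" "0 \<le> 2 * (K * (1 + W)) + K * K * sqrt T"
    using K W0 T K4 by (auto intro!: add_nonneg_nonneg mult_nonneg_nonneg)
  have Cge: "L \<le> C" "K \<le> C" "K * K \<le> C" "8 * (W + K ^ 4 * T\<^sup>2) \<le> C" "2 * (K * (1 + W)) + K * K * sqrt T \<le> C"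
    unfolding C_def using L K nn by linarith+
  have Im: "(\<lambda>\<omega>. I c t \<omega> $ i) \<in> borel_measurable M" if "0 \<le> t" for c t i
    using I[of c] that measurable_compose[OF _ borel_measurable_nth] unfolding has_ito_integral_def by blast
  have XXm: "(\<lambda>\<omega>. XX c t \<omega> $ i) \<in> borel_measurable M" if "0 \<le> t" for c t i
    using cprocessD(1)[OF cX that] .
  have main: "expectation (\<lambda>\<omega>. (XX c u \<omega> $ i - XX c s \<omega> $ i) ^ 4) \<le> C * (u - s)\<^sup>2 \<and>
     (\<forall>\<xi> \<kappa>. \<xi> \<in> borel_measurable (F s) \<longrightarrow> (\<forall>\<omega>\<in>space M. \<bar>\<xi> \<omega>\<bar> \<le> \<kappa>) \<longrightarrow>
       expectation (\<lambda>\<omega>. \<xi> \<omega> * (XX c u \<omega> $ i - XX c s \<omega> $ i)) = integral {s..u} (\<lambda>r. expectation (\<lambda>\<omega>. \<xi> \<omega> * b (XX c r \<omega>) $ i)) \<and>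
       \<bar>expectation (\<lambda>\<omega>. \<xi> \<omega> * ((XX c u \<omega> $ i - XX c s \<omega> $ i) * (XX d u \<omega> $ j - XX d s \<omega> $ j)))
             - integral {s..u} (\<lambda>r. expectation (\<lambda>\<omega>. \<xi> \<omega> * \<theta> (c, i) (d, j) r \<omega>))\<bar> \<le> C * \<kappa> * ((u - s) * sqrt (u - s)))"
    if su: "0 \<le> s" "s \<le> u" "u \<le> T" for c i d j s u
  proof (intro conjI allI impI)
    have u: "0 \<le> u" using su by simp
    define \<delta> where "\<delta> = u - s"
    have d0: "0 \<le> \<delta>" "\<delta> \<le> T" using su unfolding \<delta>_def by auto
    let ?I = "\<lambda>c i \<omega>. I c u \<omega> $ i - I c s \<omega> $ i"
    let ?X = "\<lambda>c i \<omega>. XX c u \<omega> $ i - XX c s \<omega> $ i"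
    let ?A = "\<lambda>c i \<omega>. A c i s u \<omega>"
    have mI: "?I c i \<in> borel_measurable M" for c i using Im su u by (intro borel_measurable_diff) auto
    have mX: "?X c i \<in> borel_measurable M" for c i using XXm su u by (intro borel_measurable_diff) auto
    have mA: "?A c i \<in> borel_measurable M" for c i unfolding A_def by (rule cprocess_integral(2)[OF cb su(1,2)])
    have bA: "\<bar>?A c i \<omega>\<bar> \<le> K * \<delta>" if "\<omega> \<in> space M" for c i \<omega>
      unfolding A_def \<delta>_def by (rule cprocess_integral(3)[OF cb su(1,2) that])
    have b1: "bounded_F s (\<lambda>_. 1)" by simp
    have I4: "integrable M (\<lambda>\<omega>. (?I c i \<omega>) ^ 4)" "expectation (\<lambda>\<omega>. (?I c i \<omega>) ^ 4) \<le> W * \<delta>\<^sup>2" for c i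
      unfolding W_def \<delta>_def using ito_increment_facts(1,2)[OF I I K H\<sigma> H\<sigma> su(1,2) b1] by auto
    have I1: "integrable M (?I c i)" for c i
      using ito_increment_facts(3)[OF I I K H\<sigma> H\<sigma> su(1,2) b1] by simp
    have dec': "AE \<omega> in M. ?X c i \<omega> = ?I c i \<omega> + ?A c i \<omega>" for c i using dec[OF su(1,2)] .
    have pow: "\<delta> ^ 4 \<le> T\<^sup>2 * \<delta>\<^sup>2"
    proof -
      have "\<delta> ^ 4 = \<delta>\<^sup>2 * \<delta>\<^sup>2" by (simp add: power2_eq_square power4_eq_xxxx)
      also have "\<dots> \<le> T\<^sup>2 * \<delta>\<^sup>2" using d0 by (intro mult_right_mono power_mono) auto
      finally show ?thesis .
    qed
    have iA4: "integrable M (\<lambda>\<omega>. 8 * ((?I c i \<omega>) ^ 4 + K ^ 4 * \<delta> ^ 4))" using I4(1) by simp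
    have "expectation (\<lambda>\<omega>. (?X c i \<omega>) ^ 4) = expectation (\<lambda>\<omega>. (?I c i \<omega> + ?A c i \<omega>) ^ 4)"
      using dec'[of c i] mX[of c i] mI[of c i] mA[of c i] by (intro integral_cong_AE) auto
    also have "\<dots> \<le> expectation (\<lambda>\<omega>. 8 * ((?I c i \<omega>) ^ 4 + K ^ 4 * \<delta> ^ 4))"
    proof (rule integral_mono_AE'[OF iA4])
      show "AE \<omega> in M. (?I c i \<omega> + ?A c i \<omega>) ^ 4 \<le> 8 * ((?I c i \<omega>) ^ 4 + K ^ 4 * \<delta> ^ 4)"
      proof (rule AE_I2)
        fix \<omega> assume "\<omega> \<in> space M"
        then have "\<bar>?A c i \<omega>\<bar> ^ 4 \<le> (K * \<delta>) ^ 4" using bA by (intro power_mono) auto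
        then have "(?A c i \<omega>) ^ 4 \<le> K ^ 4 * \<delta> ^ 4" by (simp add: power_mult_distrib power_even_abs)
        then show "(?I c i \<omega> + ?A c i \<omega>) ^ 4 \<le> 8 * ((?I c i \<omega>) ^ 4 + K ^ 4 * \<delta> ^ 4)"
          by (intro order_trans[OF sum_pow4_le] mult_left_mono add_left_mono) simp_all
      qed
      show "AE \<omega> in M. 0 \<le> 8 * ((?I c i \<omega>) ^ 4 + K ^ 4 * \<delta> ^ 4)" using K by (intro AE_I2) simp
    qed
    also have "\<dots> = 8 * (expectation (\<lambda>\<omega>. (?I c i \<omega>) ^ 4) + K ^ 4 * \<delta> ^ 4)" using I4(1) by (simp add: prob_space)
    also have "\<dots> \<le> 8 * (W * \<delta>\<^sup>2 + K ^ 4 * (T\<^sup>2 * \<delta>\<^sup>2))"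
      by (intro mult_left_mono add_mono I4(2) mult_left_mono[OF pow K4]) simp
    also have "\<dots> = 8 * (W + K ^ 4 * T\<^sup>2) * \<delta>\<^sup>2" by (simp add: algebra_simps)
    also have "\<dots> \<le> C * \<delta>\<^sup>2" using Cge(4) by (rule mult_right_mono) simp
    finally show "expectation (\<lambda>\<omega>. (XX c u \<omega> $ i - XX c s \<omega> $ i) ^ 4) \<le> C * (u - s)\<^sup>2" unfolding \<delta>_def .
    fix \<xi> :: "'w \<Rightarrow> real" and \<kappa> assume \<xi>F: "\<xi> \<in> borel_measurable (F s)" and \<xi>\<kappa>: "\<forall>\<omega>\<in>space M. \<bar>\<xi> \<omega>\<bar> \<le> \<kappa>"
    have \<xi>: "bounded_F s \<xi>" using \<xi>F \<xi>\<kappa> unfolding bounded_F_def by blast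
    have \<xi>m: "\<xi> \<in> borel_measurable M" using measurable_F_M[OF \<xi>F] .
    have \<kappa>0: "0 \<le> \<kappa>" using \<xi>\<kappa> not_empty by force
    have c\<xi>: "cprocess \<kappa> (\<lambda>_. \<xi>)" using cprocess_const[OF \<xi>m] \<xi>\<kappa> by blast
    have int\<xi>: "expectation (\<lambda>\<omega>. \<xi> \<omega> * integral {s..u} (\<lambda>r. f r \<omega>)) = integral {s..u} (\<lambda>r. expectation (\<lambda>\<omega>. \<xi> \<omega> * f r \<omega>))"
      if f: "cprocess D f" for D f
      using cprocess_integral(4)[OF cprocess_mult[OF c\<xi> f] su(1,2)] by simp
    have i\<xi>A: "integrable M (\<lambda>\<omega>. \<xi> \<omega> * ?A c i \<omega>)" for c i
    proof (rule integrable_const_bound[of _ "\<kappa> * (K * \<delta>)"])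
      show "AE \<omega> in M. norm (\<xi> \<omega> * ?A c i \<omega>) \<le> \<kappa> * (K * \<delta>)"
        using \<xi>\<kappa> bA \<kappa>0 by (intro AE_I2) (auto simp: abs_mult intro!: mult_mono)
    qed (intro borel_measurable_times \<xi>m mA)
    note f3 = ito_increment_facts(3)[OF I I K H\<sigma> H\<sigma> su(1,2) \<xi>]
    note f4 = ito_increment_facts(4)[OF I I K H\<sigma> H\<sigma> su(1,2) \<xi>]
    note f5 = ito_increment_facts(5)[OF I I K H\<sigma> H\<sigma> su(1,2) \<xi>]
    note f6 = ito_increment_facts(6)[OF I I K H\<sigma> H\<sigma> su(1,2) \<xi>]
    have "expectation (\<lambda>\<omega>. \<xi> \<omega> * ?X c i \<omega>) = expectation (\<lambda>\<omega>. \<xi> \<omega> * ?I c i \<omega> + \<xi> \<omega> * ?A c i \<omega>)"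
    proof (rule integral_cong_AE)
      show "(\<lambda>\<omega>. \<xi> \<omega> * ?X c i \<omega>) \<in> borel_measurable M" by (intro borel_measurable_times \<xi>m mX)
      show "(\<lambda>\<omega>. \<xi> \<omega> * ?I c i \<omega> + \<xi> \<omega> * ?A c i \<omega>) \<in> borel_measurable M"
        by (intro borel_measurable_add borel_measurable_times \<xi>m mI mA)
      show "AE \<omega> in M. \<xi> \<omega> * ?X c i \<omega> = \<xi> \<omega> * ?I c i \<omega> + \<xi> \<omega> * ?A c i \<omega>"
        using dec'[of c i] by eventually_elim (simp only: distrib_left)
    qed
    also have "\<dots> = expectation (\<lambda>\<omega>. \<xi> \<omega> * ?A c i \<omega>)"
      using f3[where i=i] f4[where i=i] i\<xi>A by (subst Bochner_Integration.integral_add) auto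
    also have "\<dots> = integral {s..u} (\<lambda>r. expectation (\<lambda>\<omega>. \<xi> \<omega> * b (XX c r \<omega>) $ i))"
      unfolding A_def by (rule int\<xi>[OF cb])
    finally show "expectation (\<lambda>\<omega>. \<xi> \<omega> * ?X c i \<omega>) = integral {s..u} (\<lambda>r. expectation (\<lambda>\<omega>. \<xi> \<omega> * b (XX c r \<omega>) $ i))" .
    have main: "expectation (\<lambda>\<omega>. \<xi> \<omega> * (?I c i \<omega> * ?I d j \<omega>)) = integral {s..u} (\<lambda>r. expectation (\<lambda>\<omega>. \<xi> \<omega> * \<theta> (c, i) (d, j) r \<omega>))"
    proof (cases "i = j")
      case True
      have "expectation (\<lambda>\<omega>. \<xi> \<omega> * (?I c i \<omega> * ?I d j \<omega>)) = expectation (\<lambda>\<omega>. \<xi> \<omega> * (LINT r:{s..u}|lborel. \<sigma> (XX c r \<omega>) * \<sigma> (XX d r \<omega>)))"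
        using f6[where i=i and l=j] True by simp
      also have "\<dots> = expectation (\<lambda>\<omega>. \<xi> \<omega> * integral {s..u} (\<lambda>r. \<sigma> (XX c r \<omega>) * \<sigma> (XX d r \<omega>)))"
        using cprocess_integral(1)[OF cprocess_mult[OF c\<sigma> c\<sigma>] su(1,2)] by (intro Bochner_Integration.integral_cong) auto
      also have "\<dots> = integral {s..u} (\<lambda>r. expectation (\<lambda>\<omega>. \<xi> \<omega> * (\<sigma> (XX c r \<omega>) * \<sigma> (XX d r \<omega>))))"
        by (rule int\<xi>[OF cprocess_mult[OF c\<sigma> c\<sigma>]])
      finally show ?thesis using True by (simp add: \<theta>_def)
    next
      case False
      then show ?thesis using f6[where i=i and l=j] by (simp add: \<theta>_def)
    qed
    let ?q = "\<delta> * sqrt \<delta>"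
    \<comment> \<open>The mean absolute increment of the integral is of order 1/2. Multiplied by the
      length of the interval, which bounds the drift up to the factor \<open>K\<close>, it has the
      admissible order 3/2.\<close>
    have EI: "\<delta> * expectation (\<lambda>\<omega>. \<bar>?I c i \<omega>\<bar>) \<le> (1 + W) * ?q" for c i
    proof (cases "\<delta> = 0")
      case False
      then have dp: "0 < \<delta>" using d0 by simp
      have "expectation (\<lambda>\<omega>. \<bar>?I c i \<omega>\<bar>) \<le> expectation (\<lambda>\<omega>. sqrt \<delta> + (?I c i \<omega>) ^ 4 / (\<delta> * sqrt \<delta>))"
      proof (rule integral_mono)
        show "integrable M (\<lambda>\<omega>. \<bar>?I c i \<omega>\<bar>)" using I1 by simp
        show "integrable M (\<lambda>\<omega>. sqrt \<delta> + (?I c i \<omega>) ^ 4 / (\<delta> * sqrt \<delta>))" using I4(1) by simp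
        show "\<bar>?I c i \<omega>\<bar> \<le> sqrt \<delta> + (?I c i \<omega>) ^ 4 / (\<delta> * sqrt \<delta>)" for \<omega>
          using young_sqrt(1)[OF dp, of "\<bar>?I c i \<omega>\<bar>"] by (simp add: power_even_abs)
      qed
      also have "\<dots> = sqrt \<delta> + expectation (\<lambda>\<omega>. (?I c i \<omega>) ^ 4) / (\<delta> * sqrt \<delta>)" using I4(1) by (simp add: prob_space)
      also have "\<dots> \<le> sqrt \<delta> + W * \<delta>\<^sup>2 / (\<delta> * sqrt \<delta>)"
        using I4(2)[of c i] dp by (intro add_left_mono divide_right_mono) auto
      also have "W * \<delta>\<^sup>2 / (\<delta> * sqrt \<delta>) = W * sqrt \<delta>"
        using dp real_sqrt_mult_self[of \<delta>] by (simp add: field_simps power2_eq_square)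
      finally have "expectation (\<lambda>\<omega>. \<bar>?I c i \<omega>\<bar>) \<le> (1 + W) * sqrt \<delta>" by (simp add: algebra_simps)
      then have "\<delta> * expectation (\<lambda>\<omega>. \<bar>?I c i \<omega>\<bar>) \<le> \<delta> * ((1 + W) * sqrt \<delta>)" using d0(1) by (rule mult_left_mono)
      then show ?thesis by (simp add: mult_ac)
    qed simp
    have cross: "integrable M (\<lambda>\<omega>. \<xi> \<omega> * (?I c i \<omega> * ?A d j \<omega>)) \<and> \<bar>expectation (\<lambda>\<omega>. \<xi> \<omega> * (?I c i \<omega> * ?A d j \<omega>))\<bar> \<le> \<kappa> * (K * (1 + W)) * ?q" for c i d j
    proof -
      have i: "integrable M (\<lambda>\<omega>. \<kappa> * K * \<delta> * \<bar>?I c i \<omega>\<bar>)" using I1 by simp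
      have le: "norm (\<xi> \<omega> * (?I c i \<omega> * ?A d j \<omega>)) \<le> \<kappa> * K * \<delta> * \<bar>?I c i \<omega>\<bar>" if w: "\<omega> \<in> space M" for \<omega>
      proof -
        have "\<bar>\<xi> \<omega>\<bar> * \<bar>?A d j \<omega>\<bar> \<le> \<kappa> * (K * \<delta>)" using \<xi>\<kappa> w bA \<kappa>0 by (intro mult_mono) auto
        then have "(\<bar>\<xi> \<omega>\<bar> * \<bar>?A d j \<omega>\<bar>) * \<bar>?I c i \<omega>\<bar> \<le> (\<kappa> * (K * \<delta>)) * \<bar>?I c i \<omega>\<bar>" by (rule mult_right_mono) simp
        then show ?thesis by (simp add: abs_mult mult_ac)
      qed
      have ii: "integrable M (\<lambda>\<omega>. \<xi> \<omega> * (?I c i \<omega> * ?A d j \<omega>))"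
      proof (rule Bochner_Integration.integrable_bound[OF i])
        show "(\<lambda>\<omega>. \<xi> \<omega> * (?I c i \<omega> * ?A d j \<omega>)) \<in> borel_measurable M" by (intro borel_measurable_times \<xi>m mI mA)
        show "AE \<omega> in M. norm (\<xi> \<omega> * (?I c i \<omega> * ?A d j \<omega>)) \<le> norm (\<kappa> * K * \<delta> * \<bar>?I c i \<omega>\<bar>)"
          by (rule AE_I2) (rule order_trans[OF le], auto)
      qed
      have "norm (expectation (\<lambda>\<omega>. \<xi> \<omega> * (?I c i \<omega> * ?A d j \<omega>))) \<le> expectation (\<lambda>\<omega>. \<kappa> * K * \<delta> * \<bar>?I c i \<omega>\<bar>)"
        by (rule abs_expectation_le[OF ii i le])
      also have "\<dots> = \<kappa> * K * (\<delta> * expectation (\<lambda>\<omega>. \<bar>?I c i \<omega>\<bar>))" by simp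
      also have "\<dots> \<le> \<kappa> * K * ((1 + W) * ?q)" using EI \<kappa>0 K by (intro mult_left_mono) auto
      finally show ?thesis using ii by (simp add: mult_ac)
    qed
    \<comment> \<open>The product of two drifts is of order 2; one factor
      \<open>sqrt \<delta>\<close> is traded for \<open>sqrt T\<close>, which is how the horizon
      enters the constant.\<close>
    have AA: "integrable M (\<lambda>\<omega>. \<xi> \<omega> * (?A c i \<omega> * ?A d j \<omega>)) \<and> \<bar>expectation (\<lambda>\<omega>. \<xi> \<omega> * (?A c i \<omega> * ?A d j \<omega>))\<bar> \<le> \<kappa> * (K * K * sqrt T) * ?q"
    proof -
      have le: "norm (\<xi> \<omega> * (?A c i \<omega> * ?A d j \<omega>)) \<le> \<kappa> * ((K * \<delta>) * (K * \<delta>))" if w: "\<omega> \<in> space M" for \<omega>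
        unfolding real_norm_def abs_mult using \<xi>\<kappa> w bA \<kappa>0 K d0 by (intro mult_mono) auto
      have ii: "integrable M (\<lambda>\<omega>. \<xi> \<omega> * (?A c i \<omega> * ?A d j \<omega>))"
        by (rule integrable_const_bound[of _ "\<kappa> * ((K * \<delta>) * (K * \<delta>))"]) (use le in \<open>auto intro!: AE_I2 borel_measurable_times \<xi>m mA\<close>)
      have "norm (expectation (\<lambda>\<omega>. \<xi> \<omega> * (?A c i \<omega> * ?A d j \<omega>))) \<le> expectation (\<lambda>\<omega>. \<kappa> * ((K * \<delta>) * (K * \<delta>)))"
        by (rule abs_expectation_le[OF ii _ le]) auto
      also have "\<dots> = \<kappa> * (K * K) * (\<delta> * (sqrt \<delta> * sqrt \<delta>))" using d0 by (simp add: prob_space mult_ac)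
      also have "\<dots> \<le> \<kappa> * (K * K) * (\<delta> * (sqrt \<delta> * sqrt T))" using d0 \<kappa>0 K by (intro mult_left_mono) auto
      finally show ?thesis using ii by (simp add: mult_ac)
    qed
    have "expectation (\<lambda>\<omega>. \<xi> \<omega> * (?X c i \<omega> * ?X d j \<omega>)) = expectation (\<lambda>\<omega>. \<xi> \<omega> * (?I c i \<omega> * ?I d j \<omega>) + \<xi> \<omega> * (?I c i \<omega> * ?A d j \<omega>)
        + \<xi> \<omega> * (?I d j \<omega> * ?A c i \<omega>) + \<xi> \<omega> * (?A c i \<omega> * ?A d j \<omega>))"
    proof (rule integral_cong_AE)
      show "(\<lambda>\<omega>. \<xi> \<omega> * (?X c i \<omega> * ?X d j \<omega>)) \<in> borel_measurable M" by (intro borel_measurable_times \<xi>m mX)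
      show "(\<lambda>\<omega>. \<xi> \<omega> * (?I c i \<omega> * ?I d j \<omega>) + \<xi> \<omega> * (?I c i \<omega> * ?A d j \<omega>)
        + \<xi> \<omega> * (?I d j \<omega> * ?A c i \<omega>) + \<xi> \<omega> * (?A c i \<omega> * ?A d j \<omega>)) \<in> borel_measurable M"
        by (intro borel_measurable_add borel_measurable_times \<xi>m mI mA)
      have alg: "x * ((p + q) * (p' + q')) = x * (p * p') + x * (p * q') + x * (p' * q) + x * (q * q')" for x p q p' q' :: real
        by (simp add: algebra_simps)
      show "AE \<omega> in M. \<xi> \<omega> * (?X c i \<omega> * ?X d j \<omega>) = \<xi> \<omega> * (?I c i \<omega> * ?I d j \<omega>) + \<xi> \<omega> * (?I c i \<omega> * ?A d j \<omega>)
        + \<xi> \<omega> * (?I d j \<omega> * ?A c i \<omega>) + \<xi> \<omega> * (?A c i \<omega> * ?A d j \<omega>)"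
        using dec'[of c i] dec'[of d j] by eventually_elim (simp only: alg)
    qed
    also have "\<dots> = expectation (\<lambda>\<omega>. \<xi> \<omega> * (?I c i \<omega> * ?I d j \<omega>)) + expectation (\<lambda>\<omega>. \<xi> \<omega> * (?I c i \<omega> * ?A d j \<omega>))
        + expectation (\<lambda>\<omega>. \<xi> \<omega> * (?I d j \<omega> * ?A c i \<omega>)) + expectation (\<lambda>\<omega>. \<xi> \<omega> * (?A c i \<omega> * ?A d j \<omega>))"
    proof -
      have i1: "integrable M (\<lambda>\<omega>. \<xi> \<omega> * (?I c i \<omega> * ?I d j \<omega>))" by (rule f5)
      note i2 = conjunct1[OF cross[of c i d j]] and i3 = conjunct1[OF cross[of d j c i]] and i4 = conjunct1[OF AA]
      show ?thesis
        by (simp only: Bochner_Integration.integral_add[OF Bochner_Integration.integrable_add[OF Bochner_Integration.integrable_add[OF i1 i2] i3] i4]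
          Bochner_Integration.integral_add[OF Bochner_Integration.integrable_add[OF i1 i2] i3] Bochner_Integration.integral_add[OF i1 i2])
    qed
    finally have "\<bar>expectation (\<lambda>\<omega>. \<xi> \<omega> * (?X c i \<omega> * ?X d j \<omega>)) - integral {s..u} (\<lambda>r. expectation (\<lambda>\<omega>. \<xi> \<omega> * \<theta> (c, i) (d, j) r \<omega>))\<bar>
       \<le> \<kappa> * (K * (1 + W)) * ?q + \<kappa> * (K * (1 + W)) * ?q + \<kappa> * (K * K * sqrt T) * ?q"
      unfolding main[symmetric] using cross[of c i d j] cross[of d j c i] AA by linarith
    also have "\<dots> = (2 * (K * (1 + W)) + K * K * sqrt T) * (\<kappa> * ?q)" by (simp add: algebra_simps)
    also have "\<dots> \<le> C * (\<kappa> * ?q)" using Cge(5) \<kappa>0 d0 by (intro mult_right_mono) auto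
    finally show "\<bar>expectation (\<lambda>\<omega>. \<xi> \<omega> * (?X c i \<omega> * ?X d j \<omega>)) - integral {s..u} (\<lambda>r. expectation (\<lambda>\<omega>. \<xi> \<omega> * \<theta> (c, i) (d, j) r \<omega>))\<bar> \<le> C * \<kappa> * ((u - s) * sqrt (u - s))"
      unfolding \<delta>_def by (simp add: mult_ac)
  qed
  have \<theta>eq: "\<theta> = (\<lambda>a a' t \<omega>. if snd a = snd a' then \<sigma> (XX (fst a) t \<omega>) * \<sigma> (XX (fst a') t \<omega>) else 0)"
    unfolding \<theta>_def by (auto simp: fun_eq_iff)
  have "ito_family T C (\<lambda>a t \<omega>. XX (fst a) t \<omega> $ snd a) (\<lambda>a t \<omega>. b (XX (fst a) t \<omega>) $ snd a) \<theta>"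
    unfolding ito_family_def
  proof (intro conjI allI impI)
    show "cprocess C (\<lambda>t \<omega>. XX (fst a) t \<omega> $ snd a)" for a :: "bool \<times> 'n" by (rule cprocess_mono[OF cX Cge(1)])
    show "cprocess C (\<lambda>t \<omega>. b (XX (fst a) t \<omega>) $ snd a)" for a :: "bool \<times> 'n" by (rule cprocess_mono[OF cb Cge(2)])
    show "cprocess C (\<theta> a a')" for a a' by (rule cprocess_mono[OF c\<theta> Cge(3)])
    show "(\<lambda>\<omega>. XX (fst a) t \<omega> $ snd a) \<in> borel_measurable (F t)" if "0 \<le> t" for a :: "bool \<times> 'n" and t
      using measurable_compose[OF XF[OF that] borel_measurable_nth] .
  next
    fix s u :: real assume su: "0 \<le> s" "s \<le> u" "u \<le> T"
    fix a :: "bool \<times> 'n"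
    show "expectation (\<lambda>\<omega>. (XX (fst a) u \<omega> $ snd a - XX (fst a) s \<omega> $ snd a) ^ 4) \<le> C * (u - s)\<^sup>2"
      using main[OF su] by blast
  next
    fix s u :: real and \<xi> :: "'w \<Rightarrow> real" and \<kappa> assume su: "0 \<le> s" "s \<le> u" "u \<le> T" and \<xi>: "\<xi> \<in> borel_measurable (F s)" "\<forall>\<omega>\<in>space M. \<bar>\<xi> \<omega>\<bar> \<le> \<kappa>"
    fix a :: "bool \<times> 'n"
    show "expectation (\<lambda>\<omega>. \<xi> \<omega> * (XX (fst a) u \<omega> $ snd a - XX (fst a) s \<omega> $ snd a)) =
      integral {s..u} (\<lambda>r. expectation (\<lambda>\<omega>. \<xi> \<omega> * b (XX (fst a) r \<omega>) $ snd a))"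
      using main[OF su] \<xi> by blast
    fix a' :: "bool \<times> 'n"
    show "\<bar>expectation (\<lambda>\<omega>. \<xi> \<omega> * ((XX (fst a) u \<omega> $ snd a - XX (fst a) s \<omega> $ snd a) * (XX (fst a') u \<omega> $ snd a' - XX (fst a') s \<omega> $ snd a'))) -
      integral {s..u} (\<lambda>r. expectation (\<lambda>\<omega>. \<xi> \<omega> * \<theta> a a' r \<omega>))\<bar> \<le> C * \<kappa> * ((u - s) * sqrt (u - s))"
      using conjunct2[OF main[OF su, of "fst a" "snd a" "fst a'" "snd a'"]] \<xi> by simp
  qed
  then show ?thesis unfolding \<theta>eq by blast
qed

end

section \<open>The generator near the boundary\<close>

text \<open>After scaling by the geometric mean, with \<open>t = sqrt (u / v)\<close>, the claim
  becomes \<open>t powr w - t powr (- w) \<le> w * (t - 1 / t)\<close> for t at least 1, that is,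
  sinh (w s) is at most w sinh s for s = ln t. The derivative of the difference of the two sides is
  w times a product of two nonnegative factors.\<close>

lemma powr_diff_le_geometric_mean:
  fixes u v w :: real
  assumes v: "0 < v" "v \<le> u" and w: "0 < w" "w < 1"
  shows "(u powr w - v powr w)\<^sup>2 \<le> w\<^sup>2 * ((u * v) powr (w - 1) * (u - v)\<^sup>2)"
proof -
  define t where "t = sqrt (u / v)"
  define m where "m = sqrt (u * v)"
  have t1: "1 \<le> t" using v unfolding t_def by (simp add: real_le_rsqrt)
  have m0: "0 < m" using v unfolding m_def by simp
  have u: "u = m * t" and v': "v = m / t"
    using v unfolding m_def t_def by (auto simp: real_sqrt_mult real_sqrt_divide)
  define f where "f = (\<lambda>t. w * (t - 1 / t) - (t powr w - t powr (- w)))"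
  have "f 1 \<le> f t"
  proof (rule DERIV_nonneg_imp_nondecreasing[OF t1])
    fix x :: real assume x: "1 \<le> x" "x \<le> t"
    have d: "(f has_real_derivative w * (1 + 1 / x\<^sup>2) - (w * x powr (w - 1) + w * x powr (- w - 1))) (at x)"
      unfolding f_def using x by (auto intro!: derivative_eq_intros simp: power2_eq_square field_simps)
    have le1: "x powr (w - 1) \<le> 1" "x powr (- w - 1) \<le> 1"
      using x w powr_mono[of "w - 1" 0 x] powr_mono[of "- w - 1" 0 x] by auto
    have "1 / x\<^sup>2 = x powr (w - 1) * x powr (- w - 1)"
      using x by (simp add: powr_add[symmetric] powr_minus powr_numeral divide_inverse)
    then have "(1 + 1 / x\<^sup>2) - (x powr (w - 1) + x powr (- w - 1)) = (1 - x powr (w - 1)) * (1 - x powr (- w - 1))"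
      by (simp add: algebra_simps)
    moreover have "0 \<le> (1 - x powr (w - 1)) * (1 - x powr (- w - 1))"
      using le1 by (intro mult_nonneg_nonneg) auto
    ultimately have "0 \<le> w * ((1 + 1 / x\<^sup>2) - (x powr (w - 1) + x powr (- w - 1)))" using w by simp
    then have "0 \<le> w * (1 + 1 / x\<^sup>2) - (w * x powr (w - 1) + w * x powr (- w - 1))" by (simp add: algebra_simps)
    then show "\<exists>y. DERIV f x :> y \<and> 0 \<le> y" using d by blast
  qed
  then have F: "t powr w - t powr (- w) \<le> w * (t - 1 / t)" unfolding f_def by simp
  have "u powr w = m powr w * t powr w" unfolding u using m0 t1 by (simp add: powr_mult)
  moreover have "v powr w = m powr w * t powr (- w)" unfolding v' using m0 t1 by (simp add: powr_divide powr_minus_divide)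
  ultimately have e1: "u powr w - v powr w = m powr w * (t powr w - t powr (- w))" by (simp add: algebra_simps)
  have "t powr (- w) \<le> t powr w" using t1 w by (intro powr_mono) auto
  then have pos: "0 \<le> t powr w - t powr (- w)" by simp
  have uv: "u * v = m powr 2" using m0 t1 unfolding u v' by (simp add: powr_numeral power2_eq_square)
  have "(u * v) powr (w - 1) * m\<^sup>2 = m powr (2 * (w - 1)) * m powr 2"
  proof (intro arg_cong2[where f="(*)"])
    show "(u * v) powr (w - 1) = m powr (2 * (w - 1))" unfolding uv by (rule powr_powr)
    show "m\<^sup>2 = m powr 2" using m0 by simp
  qed
  also have "\<dots> = m powr (w + w)" unfolding powr_add[symmetric] by (simp add: algebra_simps)
  also have "\<dots> = (m powr w)\<^sup>2" by (simp only: powr_add power2_eq_square)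
  finally have mm: "(u * v) powr (w - 1) * m\<^sup>2 = (m powr w)\<^sup>2" .
  have "u - v = m * (t - 1 / t)" unfolding u v' by (simp add: right_diff_distrib)
  then have "(u * v) powr (w - 1) * (u - v)\<^sup>2 = ((u * v) powr (w - 1) * m\<^sup>2) * (t - 1 / t)\<^sup>2"
    by (simp only: power_mult_distrib mult.assoc)
  then have e2: "(u * v) powr (w - 1) * (u - v)\<^sup>2 = (m powr w * (t - 1 / t))\<^sup>2"
    unfolding mm by (simp only: power_mult_distrib)
  show ?thesis unfolding e1 e2 power_mult_distrib[symmetric]
  proof (rule power_mono)
    show "m powr w * (t powr w - t powr (- w)) \<le> w * (m powr w * (t - 1 / t))"
      using mult_left_mono[OF F, of "m powr w"] by (simp add: mult_ac)
    show "0 \<le> m powr w * (t powr w - t powr (- w))" using pos by simp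
  qed
qed

lemma young_scaled: "0 < \<kappa> \<Longrightarrow> 2 * (x * y) \<le> \<kappa> * x\<^sup>2 + y\<^sup>2 / \<kappa>" for x y \<kappa> :: real
proof -
  assume k: "0 < \<kappa>"
  have "0 \<le> (\<kappa> * x - y)\<^sup>2 / \<kappa>" using k by simp
  also have "\<dots> = \<kappa> * x\<^sup>2 + y\<^sup>2 / \<kappa> - 2 * (x * y)" using k by (simp add: power2_eq_square field_simps)
  finally show ?thesis by simp
qed

text \<open>Here \<open>a = u powr (p - 2)\<close> and \<open>b = v powr (p - 2)\<close>, so that \<open>a * u\<^sup>2\<close> is the \<open>p\<close>-th power of \<open>u\<close>.\<close>

lemma generator_core_bound:
  fixes X Y :: "'a::real_inner" and u v a b d :: real
  assumes p: "0 < p" and \<kappa>: "0 < \<kappa>" and \<Lambda>: "0 \<le> \<Lambda>" and d: "0 \<le> d" and n: "0 \<le> n"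
    and uv: "0 \<le> v" "v \<le> u" "u \<le> 1" and ab: "1 \<le> a" "a \<le> b" "a * u \<le> 1" "b * v\<^sup>2 \<le> 1"
    and up: "0 \<le> a * u\<^sup>2 - b * v\<^sup>2" "a * u\<^sup>2 - b * v\<^sup>2 \<le> p * (a * u) * (u - v)"
    and A: "\<bar>Ax - Ay\<bar> \<le> \<Lambda> * d" and c: "\<bar>cx - cy\<bar> \<le> \<Lambda> * d" "0 \<le> cx" and XY: "norm (X - Y) \<le> \<Lambda> * d"
  shows "2 * (a * u\<^sup>2 - b * v\<^sup>2) * ((p * a * Ax - (p * n / 2) * cx * (a * u\<^sup>2)) - (p * b * Ay - (p * n / 2) * cy * (b * v\<^sup>2)))
       + p\<^sup>2 * (norm ((a * u) *\<^sub>R X - (b * v) *\<^sub>R Y))\<^sup>2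
     \<le> - 2 * p * Ay * (a * b * (u - v)\<^sup>2 - (a * u - b * v)\<^sup>2) + p\<^sup>2 * (1 + \<kappa>) * (norm Y)\<^sup>2 * (a * u - b * v)\<^sup>2
       + 2 * \<kappa> * (a * b * (u - v)\<^sup>2) + ((p\<^sup>2 * \<Lambda>)\<^sup>2 / \<kappa> + (p\<^sup>2 * n * \<Lambda>)\<^sup>2 / \<kappa> + p\<^sup>2 * (1 + 1 / \<kappa>) * \<Lambda>\<^sup>2) * d\<^sup>2"
proof -
  define \<Delta> where "\<Delta> = a * u\<^sup>2 - b * v\<^sup>2"
  define N where "N = a * b * (u - v)\<^sup>2"
  have \<Delta>0: "0 \<le> \<Delta>" using up(1) unfolding \<Delta>_def .
  have u0: "0 \<le> u" "0 \<le> u - v" using uv by auto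
  have au0: "0 \<le> a * u" using ab(1) u0 by simp
  have \<Delta>u: "\<Delta> \<le> p * (u - v)"
  proof -
    have "p * (a * u) * (u - v) \<le> p * 1 * (u - v)" using p ab(3) u0 by (intro mult_right_mono mult_left_mono) auto
    then show ?thesis using up(2) unfolding \<Delta>_def by simp
  qed
  have aa: "a * a \<le> a * b" using ab by (intro mult_left_mono) auto
  have aN: "(a * (u - v))\<^sup>2 \<le> N"
    unfolding N_def power_mult_distrib using mult_right_mono[OF aa, of "(u - v)\<^sup>2"] by (simp add: power2_eq_square)
  have uN: "(u - v)\<^sup>2 \<le> N"
  proof -
    have "1 \<le> a * b" using ab mult_mono[of 1 a 1 b] by auto
    then show ?thesis unfolding N_def using mult_right_mono[of 1 "a * b" "(u - v)\<^sup>2"] by simp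
  qed
  \<comment> \<open>The monotonicity of the singular drift in exact form: the difference of p-th
    powers times that of the powers with exponent p - 2 is \<open>- N\<close> plus the square of the
    difference of the powers with exponent p - 1. The same square appears in the quadratic
    variation, so the two can be compared.\<close>
  have Wid: "\<Delta> * (a - b) = - (N - (a * u - b * v)\<^sup>2)"
    unfolding \<Delta>_def N_def by (simp add: power2_eq_square algebra_simps)
  \<comment> \<open>The error of freezing the drift coefficient carries the less singular factor
    \<open>a\<close>. One of the two factors \<open>a\<close> that then occur is absorbed by
    \<open>a * u \<le> 1\<close>, the other stays in \<open>a * (u - v)\<close>, whose square is at
    most \<open>N\<close>.\<close>
  have t2: "2 * p * \<Delta> * a * (Ax - Ay) \<le> \<kappa> * N + (p\<^sup>2 * \<Lambda>)\<^sup>2 / \<kappa> * d\<^sup>2"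
  proof -
    have "\<Delta> * a \<le> (p * (a * u) * (u - v)) * a" using up(2) ab unfolding \<Delta>_def by (intro mult_right_mono) auto
    also have "\<dots> = p * (a * (u - v)) * (a * u)" by (simp add: mult_ac)
    also have "\<dots> \<le> p * (a * (u - v)) * 1" using p ab u0 by (intro mult_left_mono) auto
    finally have 1: "\<Delta> * a \<le> p * (a * (u - v))" by simp
    have "2 * p * \<Delta> * a * (Ax - Ay) \<le> 2 * p * \<Delta> * a * (\<Lambda> * d)"
      using A p \<Delta>0 ab by (intro mult_left_mono mult_nonneg_nonneg) auto
    also have "\<dots> = (2 * p * (\<Lambda> * d)) * (\<Delta> * a)" by (simp add: mult_ac)
    also have "\<dots> \<le> (2 * p * (\<Lambda> * d)) * (p * (a * (u - v)))"
      using 1 p \<Lambda> d by (intro mult_left_mono mult_nonneg_nonneg) auto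
    also have "\<dots> = 2 * ((a * (u - v)) * (p\<^sup>2 * \<Lambda> * d))" by (simp add: power2_eq_square mult_ac)
    also have "\<dots> \<le> \<kappa> * (a * (u - v))\<^sup>2 + (p\<^sup>2 * \<Lambda> * d)\<^sup>2 / \<kappa>" by (rule young_scaled[OF \<kappa>])
    also have "\<dots> \<le> \<kappa> * N + (p\<^sup>2 * \<Lambda> * d)\<^sup>2 / \<kappa>" using aN \<kappa> by (intro add_right_mono mult_left_mono) auto
    finally show ?thesis by (simp add: power_mult_distrib)
  qed
  \<comment> \<open>Freezing the coefficient leaves a multiple of \<Delta> with the favourable sign,
    which is dropped, and an error that is Lipschitz in \<open>d\<close>.\<close>
  have t1: "- (p * n) * \<Delta> * (cx * (a * u\<^sup>2) - cy * (b * v\<^sup>2)) \<le> \<kappa> * N + (p\<^sup>2 * n * \<Lambda>)\<^sup>2 / \<kappa> * d\<^sup>2"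
  proof -
    have pn: "0 \<le> p * n" using p n by simp
    have bv: "0 \<le> b * v\<^sup>2" using ab by simp
    have eq: "cx * (a * u\<^sup>2) - cy * (b * v\<^sup>2) = cx * \<Delta> + (cx - cy) * (b * v\<^sup>2)" unfolding \<Delta>_def by (simp add: algebra_simps)
    have "- ((cx - cy) * (b * v\<^sup>2)) \<le> \<bar>cx - cy\<bar> * (b * v\<^sup>2)"
      using bv by (metis abs_ge_minus_self abs_mult abs_of_nonneg)
    also have "\<dots> \<le> (\<Lambda> * d) * 1" using c ab bv \<Lambda> d by (intro mult_mono) auto
    finally have "- (cx * (a * u\<^sup>2) - cy * (b * v\<^sup>2)) \<le> \<Lambda> * d"
      unfolding eq using mult_nonneg_nonneg[OF c(2) \<Delta>0] by linarith
    then have "(p * n * \<Delta>) * (- (cx * (a * u\<^sup>2) - cy * (b * v\<^sup>2))) \<le> (p * n * \<Delta>) * (\<Lambda> * d)"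
      using pn \<Delta>0 by (intro mult_left_mono) auto
    also have "\<dots> \<le> (p * n * (p * (u - v))) * (\<Lambda> * d)"
      using \<Delta>u pn \<Lambda> d by (intro mult_right_mono mult_left_mono) auto
    also have "\<dots> = (u - v) * (p\<^sup>2 * n * \<Lambda> * d)" by (simp add: power2_eq_square mult_ac)
    also have "\<dots> \<le> 2 * ((u - v) * (p\<^sup>2 * n * \<Lambda> * d))"
      using u0 n \<Lambda> d by (simp add: mult_nonneg_nonneg)
    also have "\<dots> \<le> \<kappa> * (u - v)\<^sup>2 + (p\<^sup>2 * n * \<Lambda> * d)\<^sup>2 / \<kappa>" by (rule young_scaled[OF \<kappa>])
    also have "\<dots> \<le> \<kappa> * N + (p\<^sup>2 * n * \<Lambda> * d)\<^sup>2 / \<kappa>" using uN \<kappa> by (intro add_right_mono mult_left_mono) auto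
    also have "(p\<^sup>2 * n * \<Lambda> * d)\<^sup>2 / \<kappa> = (p\<^sup>2 * n * \<Lambda>)\<^sup>2 / \<kappa> * d\<^sup>2" by (simp add: power_mult_distrib)
    finally show ?thesis by (simp only: mult_minus_left mult_minus_right)
  qed
  \<comment> \<open>The dispersion vector is frozen at \<open>Y\<close>; the error is multiplied by
    \<open>a * u\<close>, which is at most 1.\<close>
  have t3: "(norm ((a * u) *\<^sub>R X - (b * v) *\<^sub>R Y))\<^sup>2 \<le> (1 + \<kappa>) * (norm Y)\<^sup>2 * (a * u - b * v)\<^sup>2 + (1 + 1 / \<kappa>) * \<Lambda>\<^sup>2 * d\<^sup>2"
  proof -
    let ?r = "\<bar>a * u - b * v\<bar> * norm Y" and ?s = "(a * u) * norm (X - Y)"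
    have "(a * u) *\<^sub>R X - (b * v) *\<^sub>R Y = (a * u - b * v) *\<^sub>R Y + (a * u) *\<^sub>R (X - Y)" by (simp add: algebra_simps)
    then have "norm ((a * u) *\<^sub>R X - (b * v) *\<^sub>R Y) \<le> ?r + ?s"
      using norm_triangle_ineq[of "(a * u - b * v) *\<^sub>R Y" "(a * u) *\<^sub>R (X - Y)"] au0 by simp
    then have "(norm ((a * u) *\<^sub>R X - (b * v) *\<^sub>R Y))\<^sup>2 \<le> (?r + ?s)\<^sup>2" by (intro power_mono) auto
    also have "\<dots> = ?r\<^sup>2 + 2 * (?r * ?s) + ?s\<^sup>2" by (simp add: power2_sum)
    also have "\<dots> \<le> ?r\<^sup>2 + (\<kappa> * ?r\<^sup>2 + ?s\<^sup>2 / \<kappa>) + ?s\<^sup>2" using young_scaled[OF \<kappa>, of ?r ?s] by linarith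
    also have "\<dots> = (1 + \<kappa>) * ?r\<^sup>2 + (1 + 1 / \<kappa>) * ?s\<^sup>2" by (simp add: algebra_simps)
    also have "\<dots> \<le> (1 + \<kappa>) * ?r\<^sup>2 + (1 + 1 / \<kappa>) * (\<Lambda> * d)\<^sup>2"
    proof -
      have "?s \<le> 1 * (\<Lambda> * d)" using XY ab au0 \<Lambda> d by (intro mult_mono) auto
      then have "?s\<^sup>2 \<le> (\<Lambda> * d)\<^sup>2" using au0 by (intro power_mono) auto
      then show ?thesis using \<kappa> by (intro add_left_mono mult_left_mono) auto
    qed
    also have "?r\<^sup>2 = (norm Y)\<^sup>2 * (a * u - b * v)\<^sup>2" by (simp only: power_mult_distrib power2_abs mult.commute)
    finally show ?thesis by (simp only: power_mult_distrib mult.assoc)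
  qed
  have "2 * \<Delta> * ((p * a * Ax - (p * n / 2) * cx * (a * u\<^sup>2)) - (p * b * Ay - (p * n / 2) * cy * (b * v\<^sup>2)))
     = 2 * p * Ay * (\<Delta> * (a - b)) + 2 * p * \<Delta> * a * (Ax - Ay) + (- (p * n) * \<Delta> * (cx * (a * u\<^sup>2) - cy * (b * v\<^sup>2)))"
  proof -
    \<comment> \<open>The drift coefficient is frozen at the second point, where the singular factor
      \<open>b\<close> is the larger one. This puts the exact identity \<open>Wid\<close> on the
      singular part and only the factor \<open>a\<close> on the error.\<close>
    have id: "2 * D * ((p * a * x - k * c * e) - (p * b * y - k * f * g)) = 2 * p * y * (D * (a - b)) + 2 * p * D * a * (x - y) + (- (2 * k) * D * (c * e - f * g))"
      for D x y c e f g k :: real by algebra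
    have h: "2 * (p * n / 2) = p * n" by simp
    show ?thesis using id[of \<Delta> Ax "p * n / 2" cx "a * u\<^sup>2" Ay cy "b * v\<^sup>2"] unfolding h .
  qed
  also have "\<dots> \<le> - 2 * p * Ay * (N - (a * u - b * v)\<^sup>2) + (\<kappa> * N + (p\<^sup>2 * \<Lambda>)\<^sup>2 / \<kappa> * d\<^sup>2) + (\<kappa> * N + (p\<^sup>2 * n * \<Lambda>)\<^sup>2 / \<kappa> * d\<^sup>2)"
  proof (rule add_mono[OF add_mono[OF eq_refl t2] t1])
    show "2 * p * Ay * (\<Delta> * (a - b)) = - 2 * p * Ay * (N - (a * u - b * v)\<^sup>2)"
      unfolding Wid by (simp only: mult_minus_left mult_minus_right)
  qed
  finally have m: "2 * \<Delta> * ((p * a * Ax - (p * n / 2) * cx * (a * u\<^sup>2)) - (p * b * Ay - (p * n / 2) * cy * (b * v\<^sup>2)))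
     \<le> - 2 * p * Ay * (N - (a * u - b * v)\<^sup>2) + (\<kappa> * N + (p\<^sup>2 * \<Lambda>)\<^sup>2 / \<kappa> * d\<^sup>2) + (\<kappa> * N + (p\<^sup>2 * n * \<Lambda>)\<^sup>2 / \<kappa> * d\<^sup>2)" .
  have "p\<^sup>2 * (norm ((a * u) *\<^sub>R X - (b * v) *\<^sub>R Y))\<^sup>2 \<le> p\<^sup>2 * ((1 + \<kappa>) * (norm Y)\<^sup>2 * (a * u - b * v)\<^sup>2 + (1 + 1 / \<kappa>) * \<Lambda>\<^sup>2 * d\<^sup>2)"
    using t3 by (rule mult_left_mono) simp
  with m have "2 * \<Delta> * ((p * a * Ax - (p * n / 2) * cx * (a * u\<^sup>2)) - (p * b * Ay - (p * n / 2) * cy * (b * v\<^sup>2)))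
       + p\<^sup>2 * (norm ((a * u) *\<^sub>R X - (b * v) *\<^sub>R Y))\<^sup>2
     \<le> (- 2 * p * Ay * (N - (a * u - b * v)\<^sup>2) + (\<kappa> * N + (p\<^sup>2 * \<Lambda>)\<^sup>2 / \<kappa> * d\<^sup>2) + (\<kappa> * N + (p\<^sup>2 * n * \<Lambda>)\<^sup>2 / \<kappa> * d\<^sup>2))
       + p\<^sup>2 * ((1 + \<kappa>) * (norm Y)\<^sup>2 * (a * u - b * v)\<^sup>2 + (1 + 1 / \<kappa>) * \<Lambda>\<^sup>2 * d\<^sup>2)"
    by (rule add_mono)
  also have "\<dots> = - 2 * p * Ay * (N - (a * u - b * v)\<^sup>2) + p\<^sup>2 * (1 + \<kappa>) * (norm Y)\<^sup>2 * (a * u - b * v)\<^sup>2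
       + 2 * \<kappa> * N + ((p\<^sup>2 * \<Lambda>)\<^sup>2 / \<kappa> + (p\<^sup>2 * n * \<Lambda>)\<^sup>2 / \<kappa> + p\<^sup>2 * (1 + 1 / \<kappa>) * \<Lambda>\<^sup>2) * d\<^sup>2"
  proof -
    have "(x + (\<kappa> * N + c1 * e) + (\<kappa> * N + c2 * e)) + p\<^sup>2 * ((1 + \<kappa>) * y * z + k * l * e) = x + p\<^sup>2 * (1 + \<kappa>) * y * z + 2 * \<kappa> * N + (c1 + c2 + p\<^sup>2 * k * l) * e"
      for x c1 c2 e y z k l :: real by algebra
    then show ?thesis .
  qed
  finally show ?thesis unfolding \<Delta>_def N_def .
qed

text \<open>Encoding a function of one variable as a function of a single coordinate makes the
  closure of \<open>blip\<close> under sums and products directly usable.\<close>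

definition lipb :: "(real \<Rightarrow> real) \<Rightarrow> bool" where
  "lipb f \<longleftrightarrow> blip {z::unit \<Rightarrow> real. z () \<in> {0..1}} (\<lambda>z. f (z ()))"

lemma lipb_bounds:
  assumes "lipb f"
  shows "\<exists>C\<ge>0. (\<forall>r\<in>{0..1}. \<bar>f r\<bar> \<le> C) \<and> (\<forall>r\<in>{0..1}. \<forall>s\<in>{0..1}. \<bar>f r - f s\<bar> \<le> C * \<bar>r - s\<bar>)"
proof -
  obtain C where C: "C \<ge> 0" "\<And>z::unit \<Rightarrow> real. z () \<in> {0..1} \<Longrightarrow> \<bar>f (z ())\<bar> \<le> C"
    "\<And>(z::unit \<Rightarrow> real) z'. z () \<in> {0..1} \<Longrightarrow> z' () \<in> {0..1} \<Longrightarrow> \<bar>f (z' ()) - f (z ())\<bar> \<le> C * l1 z z'"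
    using assms unfolding lipb_def blip_def by blast
  show ?thesis
  proof (intro exI[of _ C] conjI ballI)
    fix r s :: real assume "r \<in> {0..1}" "s \<in> {0..1}"
    then show "\<bar>f r - f s\<bar> \<le> C * \<bar>r - s\<bar>" using C(3)[of "\<lambda>_. s" "\<lambda>_. r"] by (simp add: l1_def UNIV_unit)
  next
    fix r :: real assume "r \<in> {0..1}"
    then show "\<bar>f r\<bar> \<le> C" using C(2)[of "\<lambda>_. r"] by simp
  qed (rule C(1))
qed

lemma lipb_lipschitz:
  assumes "L-lipschitz_on {0..1} f" shows "lipb f"
proof -
  have L: "L \<ge> 0" "\<And>r s. r \<in> {0..1} \<Longrightarrow> s \<in> {0..1} \<Longrightarrow> \<bar>f r - f s\<bar> \<le> L * \<bar>r - s\<bar>"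
    using lipschitz_on_nonneg[OF assms] lipschitz_onD[OF assms] by (auto simp: dist_real_def)
  have "\<bar>f r\<bar> \<le> \<bar>f 0\<bar> + L" if "r \<in> {0..1}" for r
  proof -
    have "\<bar>f r - f 0\<bar> \<le> L * \<bar>r - 0\<bar>" by (rule L) (use that in auto)
    also have "\<dots> \<le> L * 1" using L(1) that by (intro mult_left_mono) auto
    finally show ?thesis by linarith
  qed
  moreover have "\<bar>f (z' ()) - f (z ())\<bar> \<le> (\<bar>f 0\<bar> + L) * l1 z z'" if "z () \<in> {0..1}" "z' () \<in> {0..1}" for z z' :: "unit \<Rightarrow> real"
  proof -
    have "\<bar>f (z' ()) - f (z ())\<bar> \<le> L * l1 z z'" using L(2)[OF that(2,1)] by (simp add: l1_def UNIV_unit)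
    also have "\<dots> \<le> (\<bar>f 0\<bar> + L) * l1 z z'" by (intro mult_right_mono l1_nonneg) simp
    finally show ?thesis .
  qed
  ultimately show ?thesis unfolding lipb_def blip_def using L(1) by (intro exI[of _ "\<bar>f 0\<bar> + L"]) auto
qed

lemma lipb_mult: "lipb f \<Longrightarrow> lipb g \<Longrightarrow> lipb (\<lambda>r. f r * g r)"
  unfolding lipb_def by (rule blip_mult)

lemma lipb_add: "lipb f \<Longrightarrow> lipb g \<Longrightarrow> lipb (\<lambda>r. f r + g r)"
  unfolding lipb_def by (rule blip_add)

lemma lipb_const: "lipb (\<lambda>r. c)"
  unfolding lipb_def by simp

lemma lipb_id: "lipb (\<lambda>r. r)"
  unfolding lipb_def by (rule blip_component[where C=1]) auto

lemma lipb_continuous: assumes "lipb f" shows "continuous_on {0..1} f"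
proof -
  obtain C where C: "0 \<le> C" "\<forall>r\<in>{0..1}. \<forall>s\<in>{0..1}. \<bar>f r - f s\<bar> \<le> C * \<bar>r - s\<bar>" using lipb_bounds[OF assms] by blast
  then have "C-lipschitz_on {0..1} f" by (intro lipschitz_onI) (auto simp: dist_real_def)
  then show ?thesis by (rule lipschitz_on_continuous_on)
qed

lemma powr_diff_le_MVT:
  fixes u v p :: real
  assumes "0 < v" "v \<le> u" "1 < p"
  shows "u powr p - v powr p \<le> p * u powr (p - 1) * (u - v)"
proof (cases "u = v")
  case False
  then have vu: "v < u" using assms by simp
  have "\<exists>z>v. z < u \<and> u powr p - v powr p = (u - v) * (p * z powr (p - 1))"
    by (rule MVT2[OF vu]) (use assms in \<open>auto intro!: derivative_eq_intros\<close>)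
  then obtain z where z: "v < z" "z < u" "u powr p - v powr p = (u - v) * (p * z powr (p - 1))" by blast
  have "z powr (p - 1) \<le> u powr (p - 1)" using z assms by (intro powr_mono2) auto
  then have "(u - v) * (p * z powr (p - 1)) \<le> (u - v) * (p * u powr (p - 1))" using assms vu by (intro mult_left_mono) auto
  then show ?thesis unfolding z(3) by (simp add: mult_ac)
qed simp

section \<open>Generator bounds for the regularised powers of \<open>h\<close>\<close>

locale ball_sde =
  fixes \<gamma> g :: "real \<Rightarrow> real"
  assumes \<gamma>_pos: "\<forall>r\<in>{0..1}. 0 < \<gamma> r" and g_pos: "\<forall>r\<in>{0..1}. 0 < g r"
    and \<gamma>_lip: "\<exists>L. L-lipschitz_on {0..1} \<gamma>" and g_lip: "\<exists>L. L-lipschitz_on {0..1} g"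
    and ratio: "g 1 / (\<gamma> 1)\<^sup>2 > sqrt 2 - 1"
begin

definition p :: real where "p = 2 - 1 / sqrt 2"
definition q :: real where "q = p / 2"

lemma p_bounds: "1 < p" "p < 2" "0 < p"
proof -
  have "0 < 1 / sqrt 2" "1 / sqrt 2 < 1" by simp_all
  then show "1 < p" "p < 2" "0 < p" unfolding p_def by linarith+
qed

lemma q_bounds: "1 / 2 < q" "q < 1" "0 < q"
  unfolding q_def using p_bounds by auto

text \<open>The value of \<open>p\<close> minimises \<open>(p - 1)\<^sup>2 / (2 - p) + (2 - p)\<close>, with minimum \<open>2 * (sqrt 2 - 1)\<close>.\<close>

lemma critical: "(p - 1)\<^sup>2 * (\<gamma> 1)\<^sup>2 < 2 * (2 - p) * (g 1 + (q - 1) * (\<gamma> 1)\<^sup>2)"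
proof -
  \<comment> \<open>With \<open>z = 2 - p\<close> the claim is that
    \<open>(1 - 2 * z + 2 * z\<^sup>2) * (\<gamma> 1)\<^sup>2\<close> is less than
    \<open>2 * z * g 1\<close>. Since \<open>z\<^sup>2 = 1 / 2\<close>, this is the hypothesis on
    the ratio, with sqrt 2 written as 2 z, multiplied by 2 z.\<close>
  define z where "z = 1 / sqrt 2"
  have z: "0 < z" "z\<^sup>2 = 1 / 2" unfolding z_def by (auto simp: power_divide)
  have s: "sqrt 2 = 2 * z" unfolding z_def by (simp add: real_div_sqrt)
  have pz: "p = 2 - z" "q = 1 - z / 2" unfolding q_def p_def z_def by auto
  have g1: "0 < (\<gamma> 1)\<^sup>2" using \<gamma>_pos by (metis atLeastAtMost_iff order_refl zero_le_one zero_less_power)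
  have "(2 * z - 1) * (\<gamma> 1)\<^sup>2 < g 1" using ratio g1 unfolding s by (simp add: pos_less_divide_eq)
  then have "(2 * z) * ((2 * z - 1) * (\<gamma> 1)\<^sup>2) < (2 * z) * g 1" using z by (intro mult_strict_left_mono) auto
  moreover have "(2 * z) * ((2 * z - 1) * (\<gamma> 1)\<^sup>2) = (4 * z\<^sup>2 - 2 * z) * (\<gamma> 1)\<^sup>2" by (simp add: algebra_simps power2_eq_square)
  ultimately have 1: "(2 - 2 * z) * (\<gamma> 1)\<^sup>2 < 2 * z * g 1" unfolding z by simp
  have "(p - 1)\<^sup>2 * (\<gamma> 1)\<^sup>2 = (1 - 2 * z + z\<^sup>2) * (\<gamma> 1)\<^sup>2" unfolding pz by (simp add: power2_eq_square algebra_simps)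
  moreover have "2 * (2 - p) * (g 1 + (q - 1) * (\<gamma> 1)\<^sup>2) = 2 * z * g 1 - z\<^sup>2 * (\<gamma> 1)\<^sup>2" unfolding pz by (simp add: power2_eq_square algebra_simps)
  ultimately show ?thesis using 1 unfolding z by (simp add: algebra_simps)
qed

lemma lipb_\<gamma>: "lipb \<gamma>" and lipb_g: "lipb g"
  using \<gamma>_lip g_lip lipb_lipschitz by blast+

text \<open>The radial coefficient of the singular drift: the inward drift and the Ito correction of
  the power \<open>q\<close> both act at order \<open>h powr (q - 1)\<close> and together contribute
  \<open>p * Af\<close> times this power.\<close>

definition Af :: "real \<Rightarrow> real" where "Af r = (r * r) * (g r + (q - 1) * (\<gamma> r * \<gamma> r))"

lemma lipb_Af: "lipb Af"
  unfolding Af_def by (intro lipb_mult lipb_add lipb_const lipb_id lipb_\<gamma> lipb_g)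

definition h :: "'a::real_inner \<Rightarrow> real" where "h x = 1 - (norm x)\<^sup>2"

lemma h_bounds: "norm x \<le> 1 \<Longrightarrow> 0 \<le> h x" "h x \<le> 1" "norm x < 1 \<Longrightarrow> 0 < h x"
  unfolding h_def by (auto simp: power_le_one abs_square_less_1)

text \<open>The drift and the dispersion vector of \<open>(h X + \<epsilon>) powr q\<close>, and the drift of the square of
  the difference of two such processes.\<close>

definition Aop :: "real \<Rightarrow> real \<Rightarrow> 'a::real_inner \<Rightarrow> real" where
  "Aop \<epsilon> n x = q * (h x + \<epsilon>) powr (q - 1) * (2 * g (norm x) * (norm x)\<^sup>2 - n * (h x * (\<gamma> (norm x))\<^sup>2))
     + 2 * q * (q - 1) * (h x + \<epsilon>) powr (q - 2) * (h x * (\<gamma> (norm x))\<^sup>2 * (norm x)\<^sup>2)"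

definition Mop :: "real \<Rightarrow> 'a::real_inner \<Rightarrow> 'a" where
  "Mop \<epsilon> x = (2 * q * (h x + \<epsilon>) powr (q - 1) * sqrt (h x) * \<gamma> (norm x)) *\<^sub>R x"

definition Lop :: "real \<Rightarrow> real \<Rightarrow> 'a::real_inner \<Rightarrow> 'a \<Rightarrow> real" where
  "Lop \<epsilon> n x y = 2 * ((h x + \<epsilon>) powr q - (h y + \<epsilon>) powr q) * (Aop \<epsilon> n x - Aop \<epsilon> n y) + (norm (Mop \<epsilon> x - Mop \<epsilon> y))\<^sup>2"

lemma Lop_sym: "Lop \<epsilon> n x y = Lop \<epsilon> n y x"
  unfolding Lop_def by (simp add: norm_minus_commute algebra_simps)

lemma norm_lip:
  assumes "\<And>r s. r \<in> {0..1} \<Longrightarrow> s \<in> {0..1} \<Longrightarrow> \<bar>f r - f s\<bar> \<le> C * \<bar>r - s\<bar>" "0 \<le> C" "norm x \<le> 1" "norm (y::'a::real_inner) \<le> 1"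
  shows "\<bar>f (norm x) - f (norm y)\<bar> \<le> C * norm (x - y)"
proof -
  have "\<bar>f (norm x) - f (norm y)\<bar> \<le> C * \<bar>norm x - norm y\<bar>" using assms by (intro assms(1)) auto
  also have "\<dots> \<le> C * norm (x - y)" using norm_triangle_ineq3[of x y] assms(2) by (rule mult_left_mono)
  finally show ?thesis .
qed

text \<open>Inside the ball and without regularisation, the factor \<open>h\<close> of the squared
  dispersion raises the exponent \<open>q - 2\<close> of the Ito correction to \<open>q - 1\<close>.
  Both singular drift terms then merge into \<open>Af\<close>, which brings the generator into the
  form treated by \<open>generator_core_bound\<close>.\<close>

lemma Lop_0:
  assumes "norm x < 1" "norm y < 1"
  shows "Lop 0 n x y =
    (let u = sqrt (h x); v = sqrt (h y); a = u powr (p - 2); b = v powr (p - 2) in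
      2 * (a * u\<^sup>2 - b * v\<^sup>2) * ((p * a * Af (norm x) - (p * n / 2) * (\<gamma> (norm x))\<^sup>2 * (a * u\<^sup>2)) - (p * b * Af (norm y) - (p * n / 2) * (\<gamma> (norm y))\<^sup>2 * (b * v\<^sup>2)))
       + p\<^sup>2 * (norm ((a * u) *\<^sub>R (\<gamma> (norm x) *\<^sub>R x) - (b * v) *\<^sub>R (\<gamma> (norm y) *\<^sub>R y)))\<^sup>2)"
proof -
  have a: "sqrt (h z) powr (p - 2) = h z powr (q - 1)" "h z powr q = h z powr (q - 1) * (sqrt (h z))\<^sup>2"
     "h z powr (q - 2) * h z = h z powr (q - 1)" if "norm z < 1" for z :: 'a
  proof -
    have hz: "0 < h z" by (rule h_bounds(3)[OF that])
    show "sqrt (h z) powr (p - 2) = h z powr (q - 1)"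
      using hz by (simp add: powr_half_sqrt[symmetric] powr_powr q_def diff_divide_distrib)
    have "h z powr q = h z powr (q - 1) * h z powr 1" unfolding powr_add[symmetric] by simp
    then show "h z powr q = h z powr (q - 1) * (sqrt (h z))\<^sup>2" using hz by simp
    have "h z powr (q - 2) * h z = h z powr (q - 2) * h z powr 1" using hz by simp
    also have "\<dots> = h z powr (q - 1)" unfolding powr_add[symmetric] by simp
    finally show "h z powr (q - 2) * h z = h z powr (q - 1)" .
  qed
  have p2: "p = 2 * q" unfolding q_def by simp
  have A: "Aop 0 n z = p * h z powr (q - 1) * Af (norm z) - (p * n / 2) * (\<gamma> (norm z))\<^sup>2 * (h z powr (q - 1) * (sqrt (h z))\<^sup>2)" if z: "norm z < 1" for z :: 'a
  proof -
    have hz: "0 < h z" by (rule h_bounds(3)[OF z])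
    have "Aop 0 n z = q * h z powr (q - 1) * (2 * g (norm z) * (norm z)\<^sup>2 - n * (h z * (\<gamma> (norm z))\<^sup>2))
       + 2 * q * (q - 1) * (h z powr (q - 2) * h z) * ((\<gamma> (norm z))\<^sup>2 * (norm z)\<^sup>2)"
      unfolding Aop_def by (simp add: mult_ac)
    also have "\<dots> = p * h z powr (q - 1) * Af (norm z) - (p * n / 2) * (\<gamma> (norm z))\<^sup>2 * (h z powr (q - 1) * (sqrt (h z))\<^sup>2)"
      unfolding a(3)[OF z] unfolding Af_def p2 using hz by (simp add: power2_eq_square algebra_simps)
    finally show ?thesis .
  qed
  have M: "Mop 0 z = p *\<^sub>R ((h z powr (q - 1) * sqrt (h z)) *\<^sub>R (\<gamma> (norm z) *\<^sub>R z))" for z :: 'a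
    unfolding Mop_def q_def by (simp add: mult_ac)
  have "(norm (Mop 0 x - Mop 0 y))\<^sup>2 = p\<^sup>2 * (norm ((h x powr (q - 1) * sqrt (h x)) *\<^sub>R (\<gamma> (norm x) *\<^sub>R x) - (h y powr (q - 1) * sqrt (h y)) *\<^sub>R (\<gamma> (norm y) *\<^sub>R y)))\<^sup>2"
    unfolding M scaleR_right_diff_distrib[symmetric] norm_scaleR by (simp add: power_mult_distrib)
  then show ?thesis
    unfolding Lop_def A[OF assms(1)] A[OF assms(2)] Let_def a(1)[OF assms(1)] a(1)[OF assms(2)] by (simp add: a(2)[OF assms(1)] a(2)[OF assms(2)])
qed

text \<open>For \<kappa> = 0 and r = 1 the expression is \<open>p\<^sup>2\<close> times the
  difference of the two sides of \<open>critical\<close>, hence negative. A small \<kappa> and a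
  neighbourhood of 1 preserve this by continuity.\<close>

lemma boundary_coefficient:
  obtains \<kappa> c \<rho> where "0 < \<kappa>" "0 < c" "0 \<le> \<rho>" "\<rho> < 1"
    "\<And>r. \<rho> \<le> r \<Longrightarrow> r \<le> 1 \<Longrightarrow> 0 \<le> Af r \<and> - 2 * p * Af r * (1 - (p - 1)\<^sup>2) + p\<^sup>2 * (1 + \<kappa>) * (\<gamma> r * r)\<^sup>2 * (p - 1)\<^sup>2 + 2 * \<kappa> \<le> - c"
proof -
  define \<phi> where "\<phi> = (\<lambda>\<kappa> r. - 2 * p * Af r * (1 - (p - 1)\<^sup>2) + p\<^sup>2 * (1 + \<kappa>) * (\<gamma> r * r)\<^sup>2 * (p - 1)\<^sup>2 + 2 * \<kappa>)"
  have A1: "Af 1 = g 1 + (q - 1) * (\<gamma> 1)\<^sup>2" unfolding Af_def by (simp add: power2_eq_square)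
  have "0 \<le> (p - 1)\<^sup>2 * (\<gamma> 1)\<^sup>2" by simp
  then have "0 < 2 * (2 - p) * Af 1" using critical unfolding A1 by linarith
  then have A1p: "0 < Af 1" using p_bounds by (simp add: zero_less_mult_iff)
  have w: "1 - (p - 1)\<^sup>2 = p * (2 - p)" by (simp add: power2_eq_square algebra_simps)
  have "\<phi> 0 1 = p\<^sup>2 * ((p - 1)\<^sup>2 * (\<gamma> 1)\<^sup>2 - 2 * (2 - p) * Af 1)"
    unfolding \<phi>_def w by (simp add: power2_eq_square algebra_simps)
  also have "\<dots> < 0" using critical p_bounds unfolding A1 by (simp add: mult_less_0_iff)
  finally have \<phi>0: "\<phi> 0 1 < 0" .
  define D where "D = p\<^sup>2 * (\<gamma> 1)\<^sup>2 * (p - 1)\<^sup>2 + 2"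
  have D: "0 < D" unfolding D_def by (intro add_nonneg_pos) auto
  \<comment> \<open>At radius 1 the expression is affine in \<kappa> with slope \<open>D\<close>, so
    this choice uses up half of its negative value; continuity in the radius is then allowed another
    quarter.\<close>
  define \<kappa> where "\<kappa> = - \<phi> 0 1 / (2 * D)"
  have \<kappa>: "0 < \<kappa>" unfolding \<kappa>_def using \<phi>0 D by (simp add: divide_neg_pos)
  have "\<phi> \<kappa> 1 = \<phi> 0 1 + \<kappa> * D" unfolding \<phi>_def D_def by (simp add: algebra_simps)
  also have "\<dots> = \<phi> 0 1 / 2" unfolding \<kappa>_def using D by (simp add: field_simps)
  finally have \<phi>1: "\<phi> \<kappa> 1 < \<phi> 0 1 / 4" using \<phi>0 by simp
  have cA: "continuous_on {0..1} Af" by (rule lipb_continuous[OF lipb_Af])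
  have c\<phi>: "continuous_on {0..1} (\<phi> \<kappa>)"
    unfolding \<phi>_def by (intro continuous_intros cA lipb_continuous lipb_\<gamma>)
  have "\<forall>\<^sub>F r in at 1 within {0..1}. \<phi> \<kappa> r < \<phi> 0 1 / 4"
    using c\<phi> \<phi>1 unfolding continuous_on_def by (intro order_tendstoD(2)) auto
  moreover have "\<forall>\<^sub>F r in at 1 within {0..1}. 0 < Af r"
    using cA A1p unfolding continuous_on_def by (intro order_tendstoD(1)) auto
  ultimately have "\<forall>\<^sub>F r in at 1 within {0..1}. \<phi> \<kappa> r < \<phi> 0 1 / 4 \<and> 0 < Af r" by eventually_elim simp
  then obtain \<delta> where \<delta>: "0 < \<delta>" "\<And>r. r \<in> {0..1} \<Longrightarrow> r \<noteq> 1 \<Longrightarrow> dist r 1 < \<delta> \<Longrightarrow> \<phi> \<kappa> r < \<phi> 0 1 / 4 \<and> 0 < Af r"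
    unfolding eventually_at by blast
  define \<rho> where "\<rho> = max 0 (1 - \<delta> / 2)"
  show ?thesis
  proof (rule that[of \<kappa> "- \<phi> 0 1 / 4" \<rho>])
    show "0 < \<kappa>" "0 < - \<phi> 0 1 / 4" "0 \<le> \<rho>" "\<rho> < 1" using \<kappa> \<phi>0 \<delta>(1) unfolding \<rho>_def by auto
    fix r assume r: "\<rho> \<le> r" "r \<le> 1"
    have "\<phi> \<kappa> r < \<phi> 0 1 / 4 \<and> 0 < Af r"
    proof (cases "r = 1")
      case False
      then show ?thesis using r \<delta>(1) unfolding \<rho>_def by (intro \<delta>(2)) (auto simp: dist_real_def)
    qed (use \<phi>1 A1p in simp)
    moreover have "\<phi> \<kappa> r = - 2 * p * Af r * (1 - (p - 1)\<^sup>2) + p\<^sup>2 * (1 + \<kappa>) * (\<gamma> r * r)\<^sup>2 * (p - 1)\<^sup>2 + 2 * \<kappa>"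
      by (simp add: \<phi>_def)
    ultimately show "0 \<le> Af r \<and> - 2 * p * Af r * (1 - (p - 1)\<^sup>2) + p\<^sup>2 * (1 + \<kappa>) * (\<gamma> r * r)\<^sup>2 * (p - 1)\<^sup>2 + 2 * \<kappa> \<le> - (- \<phi> 0 1 / 4)"
      by linarith
  qed
qed

text \<open>By symmetry \<open>y\<close> is the point nearer to the sphere. The coefficients in
  \<open>generator_core_bound\<close> are frozen at \<open>y\<close>, so its norm alone decides
  between two regimes. Near the sphere \<open>boundary_coefficient\<close> leaves the negative
  surplus. Otherwise both values of \<open>h\<close> are at least \<open>1 - \<rho>\<^sup>2\<close>,
  where all powers are Lipschitz, and everything is bounded by the squared distance.\<close>

lemma Lop_0_bound:
  assumes n: "0 \<le> n"
  shows "\<exists>C\<ge>0. \<exists>c>0. \<forall>x y::'a::real_inner. norm x < 1 \<longrightarrow> norm y < 1 \<longrightarrow>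
    Lop 0 n x y \<le> C * (norm (x - y))\<^sup>2 - c * (sqrt (h x) - sqrt (h y))\<^sup>2"
proof -
  obtain \<kappa> c \<rho> where \<kappa>: "0 < \<kappa>" and c: "0 < c" and \<rho>: "0 \<le> \<rho>" "\<rho> < 1"
    and coeff: "\<And>r. \<rho> \<le> r \<Longrightarrow> r \<le> 1 \<Longrightarrow> 0 \<le> Af r \<and> - 2 * p * Af r * (1 - (p - 1)\<^sup>2) + p\<^sup>2 * (1 + \<kappa>) * (\<gamma> r * r)\<^sup>2 * (p - 1)\<^sup>2 + 2 * \<kappa> \<le> - c"
    by (rule boundary_coefficient) blast
  obtain C1 where C1: "0 \<le> C1" "\<forall>r\<in>{0..1}. \<bar>Af r\<bar> \<le> C1" "\<forall>r\<in>{0..1}. \<forall>s\<in>{0..1}. \<bar>Af r - Af s\<bar> \<le> C1 * \<bar>r - s\<bar>"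
    using lipb_bounds[OF lipb_Af] by blast
  obtain C2 where C2: "0 \<le> C2" "\<forall>r\<in>{0..1}. \<forall>s\<in>{0..1}. \<bar>\<gamma> r * \<gamma> r - \<gamma> s * \<gamma> s\<bar> \<le> C2 * \<bar>r - s\<bar>"
    using lipb_bounds[OF lipb_mult[OF lipb_\<gamma> lipb_\<gamma>]] by blast
  obtain C3 where C3: "0 \<le> C3" "\<forall>r\<in>{0..1}. \<bar>\<gamma> r\<bar> \<le> C3" "\<forall>r\<in>{0..1}. \<forall>s\<in>{0..1}. \<bar>\<gamma> r - \<gamma> s\<bar> \<le> C3 * \<bar>r - s\<bar>"
    using lipb_bounds[OF lipb_\<gamma>] by blast
  define \<Lambda> where "\<Lambda> = C1 + C2 + 2 * C3"
  have \<Lambda>: "0 \<le> \<Lambda>" "C1 \<le> \<Lambda>" "C2 \<le> \<Lambda>" "2 * C3 \<le> \<Lambda>" unfolding \<Lambda>_def using C1 C2 C3 by auto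
  define K where "K = (p\<^sup>2 * \<Lambda>)\<^sup>2 / \<kappa> + (p\<^sup>2 * n * \<Lambda>)\<^sup>2 / \<kappa> + p\<^sup>2 * (1 + 1 / \<kappa>) * \<Lambda>\<^sup>2"
  have K: "0 \<le> K" unfolding K_def using \<kappa> by (intro add_nonneg_nonneg mult_nonneg_nonneg divide_nonneg_nonneg) auto
  define \<eta> where "\<eta> = sqrt (1 - \<rho>\<^sup>2)"
  have \<eta>: "0 < \<eta>" using \<rho> unfolding \<eta>_def by (simp add: abs_square_less_1)
  define Q where "Q = 2 * p * C1 + p\<^sup>2 * (1 + \<kappa>) * C3\<^sup>2 + 2 * \<kappa>"
  have Q: "0 \<le> Q" unfolding Q_def using p_bounds C1 \<kappa> by (intro add_nonneg_nonneg mult_nonneg_nonneg) auto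
  define E where "E = \<eta> powr (p - 2) * \<eta> powr (p - 2)"
  have E: "0 \<le> E" unfolding E_def by simp
  \<comment> \<open>The second summand is for the inner regime: \<open>Q * E\<close> bounds the
    generator there, and the added \<open>c\<close> restores the surplus term, whose square is at
    most the squared distance divided by \<open>\<eta>\<^sup>2\<close>.\<close>
  define CC where "CC = K + (Q * E + c) / \<eta>\<^sup>2"
  have CC: "K \<le> CC" "0 \<le> CC" unfolding CC_def using K Q E c \<eta> by auto
  have main: "Lop 0 n x y \<le> CC * (norm (x - y))\<^sup>2 - c * (sqrt (h x) - sqrt (h y))\<^sup>2"
    if x: "norm x < 1" and y: "norm y < 1" and le: "h y \<le> h x" for x y :: 'a
  proof -
    define u where "u = sqrt (h x)"
    define v where "v = sqrt (h y)"
    define a where "a = u powr (p - 2)"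
    define b where "b = v powr (p - 2)"
    define d where "d = norm (x - y)"
    have v0: "0 < v" and vu: "v \<le> u" and u1: "u \<le> 1" using h_bounds[of x] h_bounds[of y] x y le unfolding u_def v_def by auto
    have u0: "0 < u" "v \<le> 1" using v0 vu u1 by auto
    have d0: "0 \<le> d" unfolding d_def by simp
    have mono: "s powr (p - 2) \<le> r powr (p - 2)" if "0 < r" "r \<le> s" for r s :: real
      using that p_bounds by (intro powr_mono2') auto
    have ab: "1 \<le> a" "a \<le> b" unfolding a_def b_def using mono[OF u0(1) u1] mono[OF v0 vu] by auto
    have au: "a * u = u powr (p - 1)" and au2: "a * u\<^sup>2 = u powr p"
      unfolding a_def using u0 powr_add[of u "p - 2" 1] powr_add[of u "p - 2" 2] by (simp_all add: powr_numeral)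
    have bv: "b * v = v powr (p - 1)" and bv2: "b * v\<^sup>2 = v powr p"
      unfolding b_def using v0 powr_add[of v "p - 2" 1] powr_add[of v "p - 2" 2] by (simp_all add: powr_numeral)
    have au': "a * u \<le> 1" using au u1 u0 p_bounds powr_mono2[of "p - 1" u 1] by simp
    have bv': "b * v\<^sup>2 \<le> 1" using bv2 u0 v0 p_bounds powr_mono2[of p v 1] by simp
    have up: "0 \<le> a * u\<^sup>2 - b * v\<^sup>2" "a * u\<^sup>2 - b * v\<^sup>2 \<le> p * (a * u) * (u - v)"
      using au au2 bv2 powr_mono2[of p v u] v0 vu p_bounds powr_diff_le_MVT[OF v0 vu p_bounds(1)] by auto
    have X: "(a * u - b * v)\<^sup>2 \<le> (p - 1)\<^sup>2 * (a * b * (u - v)\<^sup>2)"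
      using powr_diff_le_geometric_mean[OF v0 vu, of "p - 1"] p_bounds v0 u0 unfolding au bv unfolding a_def b_def
      by (simp add: powr_mult)
    have nx: "norm x \<le> 1" "norm y \<le> 1" using x y by auto
    have A: "\<bar>Af (norm x) - Af (norm y)\<bar> \<le> \<Lambda> * d"
      using norm_lip[of Af C1, OF _ C1(1) nx] C1(3) mult_right_mono[OF \<Lambda>(2) d0] unfolding d_def by fastforce
    have cc: "\<bar>(\<gamma> (norm x))\<^sup>2 - (\<gamma> (norm y))\<^sup>2\<bar> \<le> \<Lambda> * d"
      using norm_lip[of "\<lambda>r. \<gamma> r * \<gamma> r" C2, OF _ C2(1) nx] C2(2) mult_right_mono[OF \<Lambda>(3) d0] unfolding d_def power2_eq_square by fastforce
    have XY: "norm (\<gamma> (norm x) *\<^sub>R x - \<gamma> (norm y) *\<^sub>R y) \<le> \<Lambda> * d"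
    proof -
      have eq: "\<gamma> (norm x) *\<^sub>R x - \<gamma> (norm y) *\<^sub>R y = (\<gamma> (norm x) - \<gamma> (norm y)) *\<^sub>R x + \<gamma> (norm y) *\<^sub>R (x - y)" by (simp add: algebra_simps)
      have "norm (\<gamma> (norm x) *\<^sub>R x - \<gamma> (norm y) *\<^sub>R y) \<le> \<bar>\<gamma> (norm x) - \<gamma> (norm y)\<bar> * norm x + \<bar>\<gamma> (norm y)\<bar> * d"
        unfolding eq d_def using norm_triangle_ineq[of "(\<gamma> (norm x) - \<gamma> (norm y)) *\<^sub>R x" "\<gamma> (norm y) *\<^sub>R (x - y)"] by simp
      also have "\<dots> \<le> (C3 * d) * 1 + C3 * d"
        using norm_lip[of \<gamma> C3, OF _ C3(1) nx] C3 nx d0 unfolding d_def by (intro add_mono mult_mono) auto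
      also have "\<dots> = (2 * C3) * d" by simp
      also have "\<dots> \<le> \<Lambda> * d" using \<Lambda>(4) d0 by (rule mult_right_mono)
      finally show ?thesis .
    qed
    define N where "N = a * b * (u - v)\<^sup>2"
    define Xw where "Xw = (a * u - b * v)\<^sup>2"
    let ?r = "norm y"
    have L: "Lop 0 n x y = 2 * (a * u\<^sup>2 - b * v\<^sup>2) * ((p * a * Af (norm x) - (p * n / 2) * (\<gamma> (norm x))\<^sup>2 * (a * u\<^sup>2)) - (p * b * Af (norm y) - (p * n / 2) * (\<gamma> (norm y))\<^sup>2 * (b * v\<^sup>2)))
       + p\<^sup>2 * (norm ((a * u) *\<^sub>R (\<gamma> (norm x) *\<^sub>R x) - (b * v) *\<^sub>R (\<gamma> (norm y) *\<^sub>R y)))\<^sup>2"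
      unfolding Lop_0[OF x y] Let_def u_def v_def a_def b_def ..
    have core: "Lop 0 n x y \<le> - 2 * p * Af ?r * (N - Xw) + p\<^sup>2 * (1 + \<kappa>) * (norm (\<gamma> ?r *\<^sub>R y))\<^sup>2 * Xw + 2 * \<kappa> * N + K * d\<^sup>2"
      unfolding L N_def Xw_def K_def
      by (rule generator_core_bound[OF p_bounds(3) \<kappa> \<Lambda>(1) d0 n less_imp_le[OF v0] vu u1 ab au' bv' up A cc _ XY]) simp
    have nY: "(norm (\<gamma> ?r *\<^sub>R y))\<^sup>2 = (\<gamma> ?r * ?r)\<^sup>2" by (simp add: power_mult_distrib)
    have N0: "0 \<le> N" unfolding N_def using ab by simp
    have Xw0: "0 \<le> Xw" unfolding Xw_def by simp
    have XN: "Xw \<le> (p - 1)\<^sup>2 * N" using X unfolding Xw_def N_def .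
    have uN: "(u - v)\<^sup>2 \<le> N"
    proof -
      have "1 \<le> a * b" using ab mult_mono[of 1 a 1 b] by auto
      then show ?thesis unfolding N_def using mult_right_mono[of 1 "a * b" "(u - v)\<^sup>2"] by simp
    qed
    show ?thesis
    proof (cases "\<rho> \<le> ?r")
      case True
      note cf = coeff[OF True nx(2)]
      let ?Z = "p\<^sup>2 * (1 + \<kappa>) * (\<gamma> ?r * ?r)\<^sup>2"
      \<comment> \<open>The bound \<open>XN\<close> on \<open>Xw\<close> may be inserted only with a
        nonnegative coefficient, which is why \<open>Af\<close> must be nonnegative near the
        sphere.\<close>
      have Z: "0 \<le> 2 * p * Af ?r + ?Z" using cf p_bounds \<kappa> by simp
      have "- 2 * p * Af ?r * (N - Xw) + ?Z * Xw + 2 * \<kappa> * N = - 2 * p * Af ?r * N + (2 * p * Af ?r + ?Z) * Xw + 2 * \<kappa> * N"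
        by (simp add: algebra_simps)
      also have "\<dots> \<le> - 2 * p * Af ?r * N + (2 * p * Af ?r + ?Z) * ((p - 1)\<^sup>2 * N) + 2 * \<kappa> * N"
        using mult_left_mono[OF XN Z] by simp
      also have "\<dots> = (- 2 * p * Af ?r * (1 - (p - 1)\<^sup>2) + ?Z * (p - 1)\<^sup>2 + 2 * \<kappa>) * N"
        by (simp only: algebra_simps)
      also have "\<dots> \<le> - c * N" using cf N0 by (intro mult_right_mono) auto
      also have "\<dots> \<le> - c * (u - v)\<^sup>2" using uN c by simp
      finally have "Lop 0 n x y \<le> - c * (u - v)\<^sup>2 + K * d\<^sup>2" using core unfolding nY by linarith
      also have "\<dots> \<le> - c * (u - v)\<^sup>2 + CC * d\<^sup>2" using CC by (intro add_left_mono mult_right_mono) auto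
      finally show ?thesis unfolding u_def v_def d_def by simp
    next
      case False
      have vh: "\<eta> \<le> v"
      proof -
        have "(norm y)\<^sup>2 \<le> \<rho>\<^sup>2" using False by (intro power_mono) auto
        then show ?thesis unfolding \<eta>_def v_def h_def by simp
      qed
      have bE: "b \<le> \<eta> powr (p - 2)" unfolding b_def using mono[OF \<eta> vh] .
      have abE: "a * b \<le> E" unfolding E_def using ab bE by (intro mult_mono) auto
      have uv2: "(u - v)\<^sup>2 \<le> d\<^sup>2 / \<eta>\<^sup>2"
      proof -
        have hu: "u\<^sup>2 = h x" "v\<^sup>2 = h y" using h_bounds[of x] h_bounds[of y] nx unfolding u_def v_def by auto
        have "(u - v) * (u + v) = (norm y)\<^sup>2 - (norm x)\<^sup>2" using hu unfolding h_def by (simp add: power2_eq_square algebra_simps)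
        also have "\<dots> = (norm y - norm x) * (norm y + norm x)" by (simp add: power2_eq_square algebra_simps)
        also have "\<dots> \<le> d * 2"
          using norm_triangle_ineq3[of x y] nx d0 unfolding d_def by (intro mult_mono) auto
        finally have 1: "(u - v) * (u + v) \<le> d * 2" .
        have "(u - v) * (2 * \<eta>) \<le> (u - v) * (u + v)" using vh vu by (intro mult_left_mono) auto
        then have "(u - v) * \<eta> \<le> d" using 1 by simp
        then have "((u - v) * \<eta>)\<^sup>2 \<le> d\<^sup>2" using vu \<eta> by (intro power_mono) auto
        then show ?thesis using \<eta> by (simp add: power_mult_distrib pos_le_divide_eq)
      qed
      have NE: "N \<le> E * (d\<^sup>2 / \<eta>\<^sup>2)"
        unfolding N_def using abE uv2 E by (intro mult_mono) auto
      have w1: "(p - 1)\<^sup>2 \<le> 1" using p_bounds by (simp add: power_le_one)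
      have XwN: "Xw \<le> N" using XN mult_right_mono[OF w1 N0] by simp
      have r01: "?r \<in> {0..1}" using nx by simp
      have Y2: "(\<gamma> ?r * ?r)\<^sup>2 \<le> C3\<^sup>2"
      proof -
        have "\<bar>\<gamma> ?r * ?r\<bar> \<le> C3 * 1" unfolding abs_mult using C3 r01 by (intro mult_mono) auto
        then show ?thesis using C3(1) by (simp add: abs_le_square_iff[symmetric])
      qed
      have "- 2 * p * Af ?r * (N - Xw) \<le> 2 * p * C1 * N"
      proof -
        have "- Af ?r \<le> C1" using C1(2) r01 by (auto simp: abs_le_iff)
        then have "(- Af ?r) * (N - Xw) \<le> C1 * (N - Xw)" using XwN by (intro mult_right_mono) auto
        also have "\<dots> \<le> C1 * N" using C1(1) Xw0 by (intro mult_left_mono) auto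
        finally have "(2 * p) * ((- Af ?r) * (N - Xw)) \<le> (2 * p) * (C1 * N)" using p_bounds by (intro mult_left_mono) auto
        moreover have "- 2 * p * Af ?r * (N - Xw) = (2 * p) * ((- Af ?r) * (N - Xw))"
          by (simp only: mult_minus_left mult_minus_right mult.assoc)
        ultimately show ?thesis by (simp only: mult.assoc)
      qed
      moreover have "p\<^sup>2 * (1 + \<kappa>) * (\<gamma> ?r * ?r)\<^sup>2 * Xw \<le> p\<^sup>2 * (1 + \<kappa>) * C3\<^sup>2 * N"
        using Y2 XwN Xw0 \<kappa> by (intro mult_mono) auto
      ultimately have "Lop 0 n x y \<le> 2 * p * C1 * N + p\<^sup>2 * (1 + \<kappa>) * C3\<^sup>2 * N + 2 * \<kappa> * N + K * d\<^sup>2"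
        using core unfolding nY by linarith
      also have "\<dots> = Q * N + K * d\<^sup>2" unfolding Q_def by (simp add: algebra_simps)
      also have "\<dots> \<le> Q * (E * (d\<^sup>2 / \<eta>\<^sup>2)) + K * d\<^sup>2" using NE Q by (intro add_right_mono mult_left_mono) auto
      also have "\<dots> = CC * d\<^sup>2 - c * (d\<^sup>2 / \<eta>\<^sup>2)" unfolding CC_def by (simp add: field_simps add_divide_distrib)
      also have "\<dots> \<le> CC * d\<^sup>2 - c * (u - v)\<^sup>2" using mult_left_mono[OF uv2 less_imp_le[OF c]] by linarith
      finally show ?thesis unfolding u_def v_def d_def .
    qed
  qed
  show ?thesis
  proof (rule exI[of _ CC], rule conjI[OF CC(2)], rule exI[of _ c], rule conjI[OF c], intro allI impI)
    fix x y :: 'a assume xy: "norm x < 1" "norm y < 1"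
    show "Lop 0 n x y \<le> CC * (norm (x - y))\<^sup>2 - c * (sqrt (h x) - sqrt (h y))\<^sup>2"
    proof (cases "h y \<le> h x")
      case True
      then show ?thesis using main xy by blast
    next
      case False
      then have "Lop 0 n y x \<le> CC * (norm (y - x))\<^sup>2 - c * (sqrt (h y) - sqrt (h x))\<^sup>2" using main xy by auto
      then show ?thesis by (simp add: Lop_sym[of 0 n x y] norm_minus_commute power2_commute)
    qed
  qed
qed

text \<open>The generator is not bounded below uniformly in \<epsilon>, but singular terms of the
  harmful sign stay controlled. Let \<open>y\<close> be the point nearer to the sphere. Its singular
  drift enters with a minus sign and has a lower bound, as \<open>Af\<close> is nonnegative near the
  sphere. The drift at \<open>x\<close> is multiplied by at most
  \<open>(h x + \<epsilon>) powr q\<close>, which compensates its growth because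
  \<open>2 * q - 1\<close> is positive.\<close>

lemma Lop_upper:
  assumes n: "0 \<le> n"
  shows "\<exists>C\<ge>0. \<forall>\<epsilon> x (y::'a::real_inner). 0 < \<epsilon> \<longrightarrow> \<epsilon> \<le> 1 \<longrightarrow> norm x \<le> 1 \<longrightarrow> norm y \<le> 1 \<longrightarrow> Lop \<epsilon> n x y \<le> C"
proof -
  obtain \<kappa> c \<rho> where \<rho>: "0 \<le> \<rho>" "\<rho> < 1"
    and coeff: "\<And>r. \<rho> \<le> r \<Longrightarrow> r \<le> 1 \<Longrightarrow> 0 \<le> Af r \<and> - 2 * p * Af r * (1 - (p - 1)\<^sup>2) + p\<^sup>2 * (1 + \<kappa>) * (\<gamma> r * r)\<^sup>2 * (p - 1)\<^sup>2 + 2 * \<kappa> \<le> - c"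
    by (rule boundary_coefficient) blast
  obtain B1 where B1: "0 \<le> B1" "\<forall>r\<in>{0..1}. \<bar>\<gamma> r\<bar> \<le> B1" using lipb_bounds[OF lipb_\<gamma>] by blast
  obtain B2 where B2: "0 \<le> B2" "\<forall>r\<in>{0..1}. \<bar>g r\<bar> \<le> B2" using lipb_bounds[OF lipb_g] by blast
  define \<eta> where "\<eta> = 1 - \<rho>\<^sup>2"
  have \<eta>: "0 < \<eta>" using \<rho> unfolding \<eta>_def by (simp add: abs_square_less_1)
  define D where "D = q * (2 * B2 + n * B1\<^sup>2) + 2 * q * (1 - q) * B1\<^sup>2"
  have D: "0 \<le> D" unfolding D_def using q_bounds n B1 B2 by simp
  \<comment> \<open>The first summand is the lower bound for the drift near the sphere, the second
    that away from it.\<close>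
  define D' where "D' = 2 * q * n * B1\<^sup>2 + \<eta> powr (q - 1) * D"
  have D': "0 \<le> D'" unfolding D'_def using q_bounds n D by simp
  have pw2: "a powr s \<le> 2" if "0 < a" "a \<le> 2" "0 \<le> s" "s \<le> 1" for a s :: real
  proof -
    have "a powr s \<le> 2 powr s" using that by (intro powr_mono2) auto
    also have "\<dots> \<le> 2 powr 1" using that by (intro powr_mono) auto
    finally show ?thesis by simp
  qed
  have hd: "(h z + \<epsilon>) powr (s - 1) * h z \<le> (h z + \<epsilon>) powr s" if "0 < \<epsilon>" "norm z \<le> 1" for z :: 'a and \<epsilon> s
  proof -
    have h0: "0 \<le> h z" by (rule h_bounds(1)[OF that(2)])
    have "(h z + \<epsilon>) powr (s - 1) * h z \<le> (h z + \<epsilon>) powr (s - 1) * (h z + \<epsilon>)" using that by (intro mult_left_mono) auto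
    also have "\<dots> = (h z + \<epsilon>) powr s" using h0 that powr_add[of "h z + \<epsilon>" "s - 1" 1] by simp
    finally show ?thesis .
  qed
  have g2: "(\<gamma> (norm z))\<^sup>2 \<le> B1\<^sup>2" "\<bar>g (norm z)\<bar> \<le> B2" "(norm z)\<^sup>2 \<le> 1" if "norm z \<le> 1" for z :: 'a
    using B1 B2 that by (auto simp: abs_le_square_iff[symmetric] power_le_one)
  have Aabs: "\<bar>Aop \<epsilon> n z\<bar> \<le> (h z + \<epsilon>) powr (q - 1) * D" if e: "0 < \<epsilon>" and z: "norm z \<le> 1" for z :: 'a and \<epsilon>
  proof -
    have h0: "0 \<le> h z" "h z \<le> 1" using h_bounds(1)[OF z] h_bounds(2)[of z] by auto
    let ?P = "(h z + \<epsilon>) powr (q - 1)"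
    have n1: "\<bar>n * (h z * (\<gamma> (norm z))\<^sup>2)\<bar> \<le> n * B1\<^sup>2"
    proof -
      have "h z * (\<gamma> (norm z))\<^sup>2 \<le> 1 * B1\<^sup>2" using h0 g2[OF z] by (intro mult_mono) auto
      then have "n * (h z * (\<gamma> (norm z))\<^sup>2) \<le> n * B1\<^sup>2" using n by (intro mult_left_mono) auto
      then show ?thesis using n h0 by simp
    qed
    have n2: "\<bar>2 * g (norm z) * (norm z)\<^sup>2\<bar> \<le> 2 * B2"
    proof -
      have "\<bar>g (norm z)\<bar> * (norm z)\<^sup>2 \<le> B2 * 1" using g2[OF z] B2 by (intro mult_mono) auto
      then show ?thesis by (simp add: abs_mult)
    qed
    have n12: "\<bar>2 * g (norm z) * (norm z)\<^sup>2 - n * (h z * (\<gamma> (norm z))\<^sup>2)\<bar> \<le> 2 * B2 + n * B1\<^sup>2" using n1 n2 by linarith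
    have "\<bar>q * ?P * (2 * g (norm z) * (norm z)\<^sup>2 - n * (h z * (\<gamma> (norm z))\<^sup>2))\<bar> \<le> q * ?P * (2 * B2 + n * B1\<^sup>2)"
      unfolding abs_mult using n12 q_bounds by (intro mult_mono) auto
    moreover have "\<bar>2 * q * (q - 1) * (h z + \<epsilon>) powr (q - 2) * (h z * (\<gamma> (norm z))\<^sup>2 * (norm z)\<^sup>2)\<bar> \<le> 2 * q * (1 - q) * (?P * B1\<^sup>2)"
    proof -
      have "(h z + \<epsilon>) powr (q - 2) * h z \<le> ?P" using hd[OF e z, of "q - 1"] by simp
      moreover have "(\<gamma> (norm z))\<^sup>2 * (norm z)\<^sup>2 \<le> B1\<^sup>2 * 1" using g2[OF z] by (intro mult_mono) auto
      ultimately have "((h z + \<epsilon>) powr (q - 2) * h z) * ((\<gamma> (norm z))\<^sup>2 * (norm z)\<^sup>2) \<le> ?P * B1\<^sup>2"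
        using h0 by (intro mult_mono) auto
      then have "(2 * q * (1 - q)) * (((h z + \<epsilon>) powr (q - 2) * h z) * ((\<gamma> (norm z))\<^sup>2 * (norm z)\<^sup>2)) \<le> (2 * q * (1 - q)) * (?P * B1\<^sup>2)"
        using q_bounds by (intro mult_left_mono) auto
      moreover have "\<bar>2 * q * (q - 1) * (h z + \<epsilon>) powr (q - 2) * (h z * (\<gamma> (norm z))\<^sup>2 * (norm z)\<^sup>2)\<bar> = (2 * q * (1 - q)) * (((h z + \<epsilon>) powr (q - 2) * h z) * ((\<gamma> (norm z))\<^sup>2 * (norm z)\<^sup>2))"
        using q_bounds h0 by (simp add: abs_mult mult_ac)
      ultimately show ?thesis by simp
    qed
    ultimately have "\<bar>Aop \<epsilon> n z\<bar> \<le> q * ?P * (2 * B2 + n * B1\<^sup>2) + 2 * q * (1 - q) * (?P * B1\<^sup>2)"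
      unfolding Aop_def by linarith
    also have "\<dots> = ?P * D" unfolding D_def by (simp add: algebra_simps)
    finally show ?thesis .
  qed
  have Alow: "- Aop \<epsilon> n z \<le> D'" if e: "0 < \<epsilon>" "\<epsilon> \<le> 1" and z: "norm z \<le> 1" for z :: 'a and \<epsilon>
  proof (cases "\<rho> \<le> norm z")
    case True
    then have A0: "0 \<le> Af (norm z)" using coeff z by blast
    have h0: "0 \<le> h z" "h z \<le> 1" using h_bounds(1)[OF z] h_bounds(2)[of z] by auto
    let ?P = "(h z + \<epsilon>) powr (q - 1)"
    let ?G = "(\<gamma> (norm z))\<^sup>2 * (norm z)\<^sup>2"
    \<comment> \<open>As \<open>q - 1\<close> is negative, enlarging the Ito correction to order
      \<open>q - 1\<close> goes in the right direction; it then combines with the inward drift into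
      a multiple of \<open>Af\<close>.\<close>
    have s1: "(h z + \<epsilon>) powr (q - 2) * h z \<le> ?P" using hd[OF e(1) z, of "q - 1"] by simp
    have s2: "?P * h z \<le> 2" using hd[OF e(1) z, of q] pw2[of "h z + \<epsilon>" q] h0 e q_bounds by linarith
    have "- Aop \<epsilon> n z = - (2 * q * ?P * g (norm z) * (norm z)\<^sup>2) + q * n * (?P * h z) * (\<gamma> (norm z))\<^sup>2 + (2 * q * (1 - q)) * (((h z + \<epsilon>) powr (q - 2) * h z) * ?G)"
      unfolding Aop_def by (simp add: algebra_simps)
    also have "\<dots> \<le> - (2 * q * ?P * g (norm z) * (norm z)\<^sup>2) + q * n * 2 * B1\<^sup>2 + (2 * q * (1 - q)) * (?P * ?G)"
    proof (intro add_mono order_refl)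
      show "q * n * (?P * h z) * (\<gamma> (norm z))\<^sup>2 \<le> q * n * 2 * B1\<^sup>2"
        using q_bounds n s2 g2[OF z] h0 by (intro mult_mono mult_left_mono) auto
      show "(2 * q * (1 - q)) * (((h z + \<epsilon>) powr (q - 2) * h z) * ?G) \<le> (2 * q * (1 - q)) * (?P * ?G)"
        using q_bounds s1 by (intro mult_left_mono mult_right_mono) auto
    qed
    also have "\<dots> = 2 * q * n * B1\<^sup>2 - 2 * q * ?P * Af (norm z)"
      unfolding Af_def by (simp add: power2_eq_square algebra_simps)
    also have "\<dots> \<le> 2 * q * n * B1\<^sup>2" using A0 q_bounds by simp
    also have "\<dots> \<le> D'" unfolding D'_def using D by simp
    finally show ?thesis .
  next
    case False
    then have "(norm z)\<^sup>2 \<le> \<rho>\<^sup>2" by (intro power_mono) auto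
    then have "\<eta> \<le> h z + \<epsilon>" unfolding \<eta>_def h_def using e by simp
    then have "(h z + \<epsilon>) powr (q - 1) \<le> \<eta> powr (q - 1)" using \<eta> q_bounds by (intro powr_mono2') auto
    then have "(h z + \<epsilon>) powr (q - 1) * D \<le> \<eta> powr (q - 1) * D" using D by (rule mult_right_mono)
    moreover have "0 \<le> 2 * q * n * B1\<^sup>2" using q_bounds n by simp
    ultimately show ?thesis using Aabs[OF e(1) z] unfolding D'_def by linarith
  qed
  have Mb: "norm (Mop \<epsilon> z) \<le> 4 * q * B1" if e: "0 < \<epsilon>" "\<epsilon> \<le> 1" and z: "norm z \<le> 1" for z :: 'a and \<epsilon>
  proof -
    have h0: "0 \<le> h z" "h z \<le> 1" using h_bounds(1)[OF z] h_bounds(2)[of z] by auto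
    let ?P = "(h z + \<epsilon>) powr (q - 1)"
    have "?P * sqrt (h z) \<le> ?P * sqrt (h z + \<epsilon>)" using e by (intro mult_left_mono) auto
    \<comment> \<open>The dispersion stays bounded uniformly in \<epsilon> because \<open>q\<close>
      exceeds 1/2.\<close>
    also have "\<dots> = (h z + \<epsilon>) powr (q - 1 / 2)" using h0 e powr_add[of "h z + \<epsilon>" "q - 1" "1/2"] by (simp add: powr_half_sqrt)
    also have "\<dots> \<le> 2" using q_bounds h0 e by (intro pw2) auto
    finally have s: "?P * sqrt (h z) \<le> 2" .
    have "norm (Mop \<epsilon> z) = 2 * q * (?P * sqrt (h z)) * (\<bar>\<gamma> (norm z)\<bar> * norm z)"
      unfolding Mop_def using q_bounds h0 by (simp add: abs_mult mult_ac)
    also have "\<dots> \<le> 2 * q * 2 * (B1 * 1)" using s q_bounds z B1 h0 by (intro mult_mono mult_left_mono) auto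
    finally show ?thesis by simp
  qed
  define C where "C = 4 * D + 4 * D' + (8 * q * B1)\<^sup>2"
  have main: "Lop \<epsilon> n x y \<le> C" if e: "0 < \<epsilon>" "\<epsilon> \<le> 1" and x: "norm x \<le> 1" and y: "norm y \<le> 1" and le: "h y \<le> h x" for x y :: 'a and \<epsilon>
  proof -
    let ?a = "(h x + \<epsilon>) powr q" and ?b = "(h y + \<epsilon>) powr q"
    have h0: "0 \<le> h y" "0 \<le> h x" "h x \<le> 1" using h_bounds(1)[OF x] h_bounds(1)[OF y] h_bounds(2)[of x] by auto
    have ab: "?b \<le> ?a" using le h0 e q_bounds by (intro powr_mono2) auto
    have a2: "?a \<le> 2" using h0 e q_bounds by (intro pw2) auto
    have aA: "?a * \<bar>Aop \<epsilon> n x\<bar> \<le> 2 * D"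
    proof -
      have "?a * \<bar>Aop \<epsilon> n x\<bar> \<le> ?a * ((h x + \<epsilon>) powr (q - 1) * D)" using Aabs[OF e(1) x] by (intro mult_left_mono) auto
      also have "\<dots> = (h x + \<epsilon>) powr (q + (q - 1)) * D" unfolding powr_add by simp
      also have "\<dots> \<le> 2 * D" using h0 e q_bounds D by (intro mult_right_mono pw2) auto
      finally show ?thesis .
    qed
    have "(?a - ?b) * (Aop \<epsilon> n x - Aop \<epsilon> n y) \<le> (?a - ?b) * (\<bar>Aop \<epsilon> n x\<bar> + D')"
      using ab Alow[OF e y] by (intro mult_left_mono) auto
    also have "\<dots> \<le> ?a * (\<bar>Aop \<epsilon> n x\<bar> + D')" using D' by (intro mult_right_mono) auto
    also have "\<dots> = ?a * \<bar>Aop \<epsilon> n x\<bar> + ?a * D'" by (simp add: distrib_left)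
    also have "\<dots> \<le> 2 * D + 2 * D'" using aA a2 D' by (intro add_mono mult_right_mono) auto
    finally have 1: "(?a - ?b) * (Aop \<epsilon> n x - Aop \<epsilon> n y) \<le> 2 * D + 2 * D'" .
    have "norm (Mop \<epsilon> x - Mop \<epsilon> y) \<le> 8 * q * B1" using norm_triangle_ineq4[of "Mop \<epsilon> x" "Mop \<epsilon> y"] Mb[OF e x] Mb[OF e y] by linarith
    then have "(norm (Mop \<epsilon> x - Mop \<epsilon> y))\<^sup>2 \<le> (8 * q * B1)\<^sup>2" by (intro power_mono) auto
    then show ?thesis using 1 unfolding Lop_def C_def mult.assoc by linarith
  qed
  have C0: "0 \<le> C" unfolding C_def using D D' by simp
  show ?thesis
  proof (intro exI[of _ C] conjI allI impI C0)
    fix \<epsilon> :: real and x y :: 'a assume a: "0 < \<epsilon>" "\<epsilon> \<le> 1" "norm x \<le> 1" "norm y \<le> 1"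
    show "Lop \<epsilon> n x y \<le> C"
      using main[OF a] main[OF a(1,2,4,3)] Lop_sym[of \<epsilon> n x y] by (cases "h y \<le> h x") auto
  qed
qed

text \<open>On the sphere only the inward drift survives: \<open>Aop\<close> at \<open>y\<close>
  equals \<open>2 * q * g 1 * \<epsilon> powr (q - 1)\<close>, which tends to infinity. Its
  coefficient in the generator tends to minus twice a positive power of \<open>h x\<close>, and all
  other terms converge.\<close>

lemma Lop_tendsto_at_bot:
  assumes e: "\<epsilon> \<longlonglongrightarrow> 0" "\<And>k::nat. 0 < \<epsilon> k" and x: "norm x < 1" and y: "norm (y::'a::real_inner) = 1"
  shows "filterlim (\<lambda>k. Lop (\<epsilon> k) n x y) at_bot sequentially"
proof -
  have hx: "0 < h x" by (rule h_bounds(3)[OF x])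
  have hy: "h y = 0" unfolding h_def y by simp
  have My: "Mop \<epsilon> y = 0" for \<epsilon> unfolding Mop_def hy by simp
  have Ay: "Aop \<epsilon> n y = 2 * q * g 1 * \<epsilon> powr (q - 1)" for \<epsilon> unfolding Aop_def hy y by simp
  have A: "(\<lambda>k. Aop (\<epsilon> k) n x) \<longlonglongrightarrow> Aop 0 n x"
    unfolding Aop_def using hx e by (intro tendsto_intros) auto
  have Mx: "(\<lambda>k. Mop (\<epsilon> k) x) \<longlonglongrightarrow> Mop 0 x"
    unfolding Mop_def using hx e by (intro tendsto_intros) auto
  have ex: "(\<lambda>k. (h x + \<epsilon> k) powr q - (0 + \<epsilon> k) powr q) \<longlonglongrightarrow> (h x + 0) powr q - (0 + 0) powr q"
  proof (intro tendsto_diff)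
    show "(\<lambda>k. (h x + \<epsilon> k) powr q) \<longlonglongrightarrow> (h x + 0) powr q" using hx e by (intro tendsto_intros) auto
    have "(\<lambda>k. \<epsilon> k powr q) \<longlonglongrightarrow> 0 powr q"
      using e q_bounds by (intro tendsto_powr' tendsto_const) (auto intro!: always_eventually less_imp_le)
    then show "(\<lambda>k. (0 + \<epsilon> k) powr q) \<longlonglongrightarrow> (0 + 0) powr q" by simp
  qed
  have g1: "0 < g 1" using g_pos by simp
  have "(\<lambda>k. \<epsilon> k powr (1 - q)) \<longlonglongrightarrow> 0 powr (1 - q)"
    using e q_bounds by (intro tendsto_powr' tendsto_const) (auto intro!: always_eventually less_imp_le)
  then have "(\<lambda>k. \<epsilon> k powr (1 - q)) \<longlonglongrightarrow> 0" by simp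
  then have "filterlim (\<lambda>k. inverse (\<epsilon> k powr (1 - q))) at_top sequentially"
    by (rule filterlim_inverse_at_top) (use e(2) in \<open>auto intro!: always_eventually simp: less_imp_neq[symmetric]\<close>)
  then have P: "filterlim (\<lambda>k. \<epsilon> k powr (q - 1)) at_top sequentially" by (simp add: powr_minus[symmetric])
  have "filterlim (\<lambda>k. 2 * q * g 1 * \<epsilon> k powr (q - 1)) at_top sequentially"
    by (rule filterlim_tendsto_pos_mult_at_top[OF tendsto_const _ P]) (use q_bounds g1 in simp)
  then have "filterlim (\<lambda>k. - Aop (\<epsilon> k) n x + Aop (\<epsilon> k) n y) at_top sequentially"
    unfolding Ay by (rule filterlim_tendsto_add_at_top[OF tendsto_minus[OF A]])
  then have "filterlim (\<lambda>k. ((h x + \<epsilon> k) powr q - (0 + \<epsilon> k) powr q) * (- Aop (\<epsilon> k) n x + Aop (\<epsilon> k) n y)) at_top sequentially"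
    using hx by (intro filterlim_tendsto_pos_mult_at_top[OF ex]) auto
  then have "filterlim (\<lambda>k. 2 * (((h x + \<epsilon> k) powr q - (0 + \<epsilon> k) powr q) * (- Aop (\<epsilon> k) n x + Aop (\<epsilon> k) n y))) at_top sequentially"
    by (intro filterlim_tendsto_pos_mult_at_top[OF tendsto_const]) auto
  moreover have "(\<lambda>k. - (norm (Mop (\<epsilon> k) x - Mop (\<epsilon> k) y))\<^sup>2) \<longlonglongrightarrow> - (norm (Mop 0 x - 0))\<^sup>2"
    unfolding My by (intro tendsto_intros Mx)
  ultimately have "filterlim (\<lambda>k. - (norm (Mop (\<epsilon> k) x - Mop (\<epsilon> k) y))\<^sup>2 + 2 * (((h x + \<epsilon> k) powr q - (0 + \<epsilon> k) powr q) * (- Aop (\<epsilon> k) n x + Aop (\<epsilon> k) n y))) at_top sequentially"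
    by (intro filterlim_tendsto_add_at_top)
  moreover have "- (norm (Mop (\<epsilon> k) x - Mop (\<epsilon> k) y))\<^sup>2 + 2 * (((h x + \<epsilon> k) powr q - (0 + \<epsilon> k) powr q) * (- Aop (\<epsilon> k) n x + Aop (\<epsilon> k) n y)) = - Lop (\<epsilon> k) n x y" for k
    unfolding Lop_def hy by (simp add: algebra_simps)
  ultimately have "filterlim (\<lambda>k. - Lop (\<epsilon> k) n x y) at_top sequentially" by simp
  then show ?thesis by (simp add: filterlim_uminus_at_top)
qed

text \<open>For two interior points the generator converges to its value at \<epsilon> = 0; for one
  point on the sphere it falls below any bound; for two points on the sphere both the functional and
  the dispersion vectors vanish. The limiting bound therefore holds on all pairs of the closed ball,
  with no statement about how long a solution stays on the sphere.\<close>

lemma Lop_eventually: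
  assumes e: "\<epsilon> \<longlonglongrightarrow> 0" "\<And>k::nat. 0 < \<epsilon> k"
    and bound: "\<And>x y::'a::real_inner. norm x < 1 \<Longrightarrow> norm y < 1 \<Longrightarrow> Lop 0 n x y \<le> C * (norm (x - y))\<^sup>2 - c * (sqrt (h x) - sqrt (h y))\<^sup>2"
    and C: "0 \<le> C" and x: "norm x \<le> 1" and y: "norm (y::'a) \<le> 1" and \<delta>: "0 < \<delta>"
  shows "\<forall>\<^sub>F k in sequentially. Lop (\<epsilon> k) n x y \<le> C * (norm (x - y))\<^sup>2 - c * (sqrt (h x) - sqrt (h y))\<^sup>2 + \<delta>"
proof -
  have bot: "\<forall>\<^sub>F k in sequentially. Lop (\<epsilon> k) n x' y' \<le> Z" if "norm x' < 1" "norm y' = 1" for x' y' :: 'a and Z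
    using Lop_tendsto_at_bot[OF e that] unfolding filterlim_at_bot by blast
  consider "norm x < 1" "norm y < 1" | "norm x < 1" "norm y = 1" | "norm x = 1" "norm y < 1" | "norm x = 1" "norm y = 1"
    using x y by linarith
  then show ?thesis
  proof cases
    case 1
    have hx: "0 < h x" "0 < h y" using h_bounds(3) 1 by auto
    have A: "(\<lambda>k. Aop (\<epsilon> k) n z) \<longlonglongrightarrow> Aop 0 n z" "(\<lambda>k. Mop (\<epsilon> k) z) \<longlonglongrightarrow> Mop 0 z" "(\<lambda>k. (h z + \<epsilon> k) powr q) \<longlonglongrightarrow> (h z + 0) powr q" if "0 < h z" for z :: 'a
      unfolding Aop_def Mop_def using that e by (intro tendsto_intros; simp)+
    have "(\<lambda>k. Lop (\<epsilon> k) n x y) \<longlonglongrightarrow> Lop 0 n x y"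
      unfolding Lop_def by (intro tendsto_intros A hx)
    moreover have "Lop 0 n x y < C * (norm (x - y))\<^sup>2 - c * (sqrt (h x) - sqrt (h y))\<^sup>2 + \<delta>"
      using bound[OF 1] \<delta> by linarith
    ultimately have "\<forall>\<^sub>F k in sequentially. Lop (\<epsilon> k) n x y < C * (norm (x - y))\<^sup>2 - c * (sqrt (h x) - sqrt (h y))\<^sup>2 + \<delta>"
      by (rule order_tendstoD(2))
    then show ?thesis by eventually_elim simp
  next
    case 2
    then show ?thesis by (rule bot)
  next
    case 3
    show ?thesis unfolding Lop_sym[of _ n x y] by (rule bot[OF 3(2,1)])
  next
    case 4
    then have hx: "h x = 0" "h y = 0" unfolding h_def by auto
    have M: "Mop \<epsilon> x = 0" "Mop \<epsilon> y = 0" for \<epsilon> unfolding Mop_def hx by auto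
    have "Lop (\<epsilon> k) n x y = 0" for k unfolding Lop_def M unfolding hx by simp
    then show ?thesis using C \<delta> hx by (simp add: add_nonneg_nonneg)
  qed
qed

end

section \<open>Taylor expansions on pairs of points of the ball\<close>

text \<open>On an interval bounded away from 0 the power has bounded derivatives up to order three.
  The constant degenerates as \<epsilon> tends to 0, which is harmless: Dynkin's formula is exact
  for each fixed \<epsilon>.\<close>

lemma powr_taylor_bounds:
  fixes q \<epsilon> :: real
  assumes \<epsilon>: "0 < \<epsilon>" and L: "\<epsilon> \<le> L"
  shows "\<exists>D\<ge>0. (\<forall>y\<in>{\<epsilon>..L}. \<bar>y powr q\<bar> \<le> D \<and> \<bar>q * y powr (q - 1)\<bar> \<le> D \<and> \<bar>q * (q - 1) / 2 * y powr (q - 2)\<bar> \<le> D) \<and>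
    (\<forall>y\<in>{\<epsilon>..L}. \<forall>y'\<in>{\<epsilon>..L}. \<bar>y' powr q - y powr q\<bar> \<le> D * \<bar>y' - y\<bar> \<and>
      \<bar>q * y' powr (q - 1) - q * y powr (q - 1)\<bar> \<le> D * \<bar>y' - y\<bar> \<and>
      \<bar>q * (q - 1) / 2 * y' powr (q - 2) - q * (q - 1) / 2 * y powr (q - 2)\<bar> \<le> D * \<bar>y' - y\<bar> \<and>
      \<bar>y' powr q - y powr q - q * y powr (q - 1) * (y' - y) - q * (q - 1) / 2 * y powr (q - 2) * (y' - y)\<^sup>2\<bar> \<le> D * \<bar>y' - y\<bar> ^ 3)"
proof -
  let ?J = "{\<epsilon>..L}"
  \<comment> \<open>For m up to 3 this is the m-th derivative of the power, as the form of Taylor's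
    theorem applied below requires.\<close>
  define f where "f = (\<lambda>m y. (if m = 0 then 1 else if m = 1 then q else if m = 2 then q * (q - 1) else q * (q - 1) * (q - 2)) * y powr (q - real (m::nat)))"
  have d: "(f m has_real_derivative f (Suc m) y) (at y)" if "m < 3" "y \<in> ?J" for m y
  proof -
    have y: "0 < y" using that \<epsilon> by auto
    have "m = 0 \<or> m = 1 \<or> m = 2" using that by auto
    then show ?thesis unfolding f_def using y by (elim disjE) (auto intro!: derivative_eq_intros simp: algebra_simps)
  qed
  have "\<exists>D. \<forall>y\<in>?J. \<bar>f m y\<bar> \<le> D" for m
  proof -
    have "continuous_on ?J (f m)" unfolding f_def using \<epsilon> by (intro continuous_intros) auto
    then have "bounded (f m ` ?J)" by (intro compact_imp_bounded compact_continuous_image) auto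
    then show ?thesis unfolding bounded_iff by auto
  qed
  then obtain E where E: "\<And>m y. y \<in> ?J \<Longrightarrow> \<bar>f m y\<bar> \<le> E m" by metis
  define D where "D = \<bar>E 0\<bar> + \<bar>E 1\<bar> + \<bar>E 2\<bar> + \<bar>E 3\<bar>"
  have fD: "\<bar>f m y\<bar> \<le> D" if "y \<in> ?J" "m \<le> 3" for m y
  proof -
    have "m = 0 \<or> m = 1 \<or> m = 2 \<or> m = 3" using that by auto
    then have "\<bar>E m\<bar> \<le> D" unfolding D_def by auto
    then show ?thesis using E[OF that(1), of m] by linarith
  qed
  have D0: "0 \<le> D" unfolding D_def by simp
  have lip: "\<bar>f m y' - f m y\<bar> \<le> D * \<bar>y' - y\<bar>" if "y \<in> ?J" "y' \<in> ?J" "m < 3" for m y y'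
    using field_differentiable_bound[of ?J "f m" "f (Suc m)" D y' y] d[OF that(3)] fD that
    by (auto intro: DERIV_subset)
  have f0: "f 0 y = y powr q" and f1: "f 1 y = q * y powr (q - 1)" and f2: "f 2 y = q * (q - 1) * y powr (q - 2)" for y
    unfolding f_def by auto
  have tay: "\<bar>y' powr q - y powr q - q * y powr (q - 1) * (y' - y) - q * (q - 1) / 2 * y powr (q - 2) * (y' - y)\<^sup>2\<bar> \<le> D * \<bar>y' - y\<bar> ^ 3"
    if y: "y \<in> ?J" "y' \<in> ?J" for y y'
  proof (cases "y' = y")
    case False
    have "\<exists>t. (if y' < y then y' < t \<and> t < y else y < t \<and> t < y') \<and>
      f 0 y' = (\<Sum>m<3. f m y / fact m * (y' - y) ^ m) + f 3 t / fact 3 * (y' - y) ^ 3"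
      using y False d by (intro Taylor[of 3 f "f 0" \<epsilon> L]) auto
    then obtain t where t: "if y' < y then y' < t \<and> t < y else y < t \<and> t < y'"
      "f 0 y' = (\<Sum>m<3. f m y / fact m * (y' - y) ^ m) + f 3 t / fact 3 * (y' - y) ^ 3" by blast
    have tJ: "t \<in> ?J" using t(1) y by (auto split: if_splits)
    have "(\<Sum>m<3. f m y / fact m * (y' - y) ^ m) = f 0 y + f 1 y * (y' - y) + f 2 y / 2 * (y' - y)\<^sup>2"
      by (simp add: numeral_3_eq_3 numeral_2_eq_2)
    then have "y' powr q - y powr q - q * y powr (q - 1) * (y' - y) - q * (q - 1) / 2 * y powr (q - 2) * (y' - y)\<^sup>2 = f 3 t / fact 3 * (y' - y) ^ 3"
      using t(2) unfolding f0 f1 f2 by (simp add: algebra_simps)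
    also have "\<bar>f 3 t / fact 3 * (y' - y) ^ 3\<bar> \<le> D * \<bar>y' - y\<bar> ^ 3"
    proof -
      have "\<bar>f 3 t / fact 3\<bar> \<le> D" using fD[OF tJ, of 3] D0 by (simp add: fact_numeral)
      then show ?thesis unfolding abs_mult power_abs by (rule mult_right_mono) simp
    qed
    finally show ?thesis .
  qed (use D0 in simp)
  show ?thesis
  proof (intro exI[of _ D] conjI ballI D0)
    fix y assume y: "y \<in> ?J"
    show "\<bar>y powr q\<bar> \<le> D" "\<bar>q * y powr (q - 1)\<bar> \<le> D" using fD[OF y, of 0] fD[OF y, of 1] unfolding f0 f1 by auto
    have "\<bar>f 2 y / 2\<bar> \<le> D" using fD[OF y, of 2] D0 by simp
    then show "\<bar>q * (q - 1) / 2 * y powr (q - 2)\<bar> \<le> D" unfolding f2 by simp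
    fix y' assume y': "y' \<in> ?J"
    show "\<bar>y' powr q - y powr q\<bar> \<le> D * \<bar>y' - y\<bar>" "\<bar>q * y' powr (q - 1) - q * y powr (q - 1)\<bar> \<le> D * \<bar>y' - y\<bar>"
      using lip[OF y y', of 0] lip[OF y y', of 1] unfolding f0 f1 by auto
    have "\<bar>(f 2 y' - f 2 y) / 2\<bar> \<le> D * \<bar>y' - y\<bar>" using lip[OF y y', of 2] D0 by (simp add: mult_nonneg_nonneg)
    then show "\<bar>q * (q - 1) / 2 * y' powr (q - 2) - q * (q - 1) / 2 * y powr (q - 2)\<bar> \<le> D * \<bar>y' - y\<bar>"
      unfolding f2 by (simp add: diff_divide_distrib)
    show "\<bar>y' powr q - y powr q - q * y powr (q - 1) * (y' - y) - q * (q - 1) / 2 * y powr (q - 2) * (y' - y)\<^sup>2\<bar> \<le> D * \<bar>y' - y\<bar> ^ 3"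
      by (rule tay[OF y y'])
  qed
qed

section \<open>A pair of points as one point with tagged coordinates\<close>

lemma sum_bool_pair:
  fixes f :: "bool \<times> 'n::finite \<Rightarrow> real"
  shows "(\<Sum>a\<in>UNIV. f a) = (\<Sum>i\<in>UNIV. f (True, i)) + (\<Sum>i\<in>UNIV. f (False, i))"
proof -
  have "(\<Sum>a\<in>UNIV. f a) = (\<Sum>c\<in>UNIV. \<Sum>i\<in>UNIV. f (c, i))"
    by (simp add: sum.cartesian_product)
  then show ?thesis by (simp add: UNIV_bool)
qed

definition vc :: "bool \<Rightarrow> (bool \<times> 'n::finite \<Rightarrow> real) \<Rightarrow> real ^ 'n" where
  "vc c z = (\<chi> i. z (c, i))"

definition ball_pairs :: "(bool \<times> 'n::finite \<Rightarrow> real) set" where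
  "ball_pairs = {z. \<forall>c. norm (vc c z) \<le> 1}"

lemma ball_pairs_norm: "z \<in> ball_pairs \<Longrightarrow> norm (vc c z) \<le> 1"
  unfolding ball_pairs_def by blast

lemma ball_pairs_component: "z \<in> ball_pairs \<Longrightarrow> \<bar>z a\<bar> \<le> 1"
  using component_le_norm_cart[of "vc (fst a) z" "snd a"] ball_pairs_norm[of z "fst a"] unfolding vc_def by auto

lemma blip_ball_pairs_component: "blip ball_pairs (\<lambda>z. z a)"
  by (rule blip_component[OF ball_pairs_component]) auto

lemma norm_vc: "(norm (vc c z))\<^sup>2 = (\<Sum>i\<in>UNIV. (z (c, i))\<^sup>2)"
  unfolding power2_norm_eq_inner inner_vec_def vc_def by (simp add: power2_eq_square)

text \<open>For quadratic polynomials the second order expansion has no remainder and its matrix is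
  constant.\<close>

lemma jetI_exact:
  assumes "blip S \<Psi>" "\<And>a. blip S (\<lambda>z. P z a)" "\<And>z z'. z \<in> S \<Longrightarrow> z' \<in> S \<Longrightarrow> \<Psi> z' - \<Psi> z = taylor2 (P z) R (\<lambda>a. z' a - z a)"
  shows "jet S \<Psi> P (\<lambda>z. R)"
  unfolding jet_def using assms by (auto intro!: exI[of _ 0])

definition dh :: "bool \<Rightarrow> (bool \<times> 'n \<Rightarrow> real) \<Rightarrow> bool \<times> 'n \<Rightarrow> real" where
  "dh c z a = (if fst a = c then - 2 * z a else 0)"

text \<open>Half the Hessian of \<open>h\<close>, hence -1 rather than -2 on the diagonal.\<close>

definition d2h :: "bool \<Rightarrow> bool \<times> 'n \<Rightarrow> bool \<times> 'n \<Rightarrow> real" where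
  "d2h c a b = (if a = b \<and> fst a = c then - 1 else 0)"

definition sgnb :: "bool \<Rightarrow> real" where "sgnb c = (if c then 1 else - 1)"

lemma jet_norm_diff:
  "jet (ball_pairs :: (bool \<times> 'n::finite \<Rightarrow> real) set) (\<lambda>z. (norm (vc True z - vc False z))\<^sup>2)
     (\<lambda>z a. 2 * sgnb (fst a) * (z (True, snd a) - z (False, snd a)))
     (\<lambda>z a b. if snd a = snd b then sgnb (fst a) * sgnb (fst b) else 0)"
proof (rule jetI_exact)
  have n: "(norm (vc True z - vc False z))\<^sup>2 = (\<Sum>i\<in>UNIV. (z (True, i) - z (False, i)) * (z (True, i) - z (False, i)))" for z :: "bool \<times> 'n \<Rightarrow> real"
    unfolding power2_norm_eq_inner inner_vec_def vc_def by simp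
  show "blip ball_pairs (\<lambda>z :: bool \<times> 'n \<Rightarrow> real. (norm (vc True z - vc False z))\<^sup>2)"
    unfolding n by (intro blip_sum blip_mult blip_diff blip_ball_pairs_component)
  show "blip ball_pairs (\<lambda>z :: bool \<times> 'n \<Rightarrow> real. 2 * sgnb (fst a) * (z (True, snd a) - z (False, snd a)))" for a
    by (intro blip_mult blip_diff blip_ball_pairs_component blip_const)
  fix z z' :: "bool \<times> 'n \<Rightarrow> real"
  show "(norm (vc True z' - vc False z'))\<^sup>2 - (norm (vc True z - vc False z))\<^sup>2 =
    taylor2 (\<lambda>a. 2 * sgnb (fst a) * (z (True, snd a) - z (False, snd a))) (\<lambda>a b. if snd a = snd b then sgnb (fst a) * sgnb (fst b) else 0) (\<lambda>a. z' a - z a)"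
    unfolding n taylor2_def sum_bool_pair
    by (simp add: sgnb_def if_distrib[of "\<lambda>x. x * _"] sum.distrib[symmetric] sum_subtractf[symmetric] cong: if_cong)
      (intro sum.cong refl, simp add: algebra_simps)
qed

context ball_sde
begin

lemma jet_h:
  "jet (ball_pairs :: (bool \<times> 'n::finite \<Rightarrow> real) set) (\<lambda>z. h (vc c z) + \<epsilon>) (dh c) (\<lambda>z. d2h c)"
proof (rule jetI_exact)
  have n: "h (vc c z) + \<epsilon> = (1 + \<epsilon>) - (\<Sum>i\<in>UNIV. z (c, i) * z (c, i))" for z :: "bool \<times> 'n \<Rightarrow> real"
    unfolding h_def norm_vc by (simp add: power2_eq_square)
  show "blip ball_pairs (\<lambda>z :: bool \<times> 'n \<Rightarrow> real. h (vc c z) + \<epsilon>)"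
    unfolding n by (intro blip_diff blip_sum blip_mult blip_ball_pairs_component blip_const)
  show "blip ball_pairs (\<lambda>z :: bool \<times> 'n \<Rightarrow> real. dh c z a)" for a
    unfolding dh_def by (cases "fst a = c") (auto intro!: blip_minus blip_cmult blip_ball_pairs_component)
  fix z z' :: "bool \<times> 'n \<Rightarrow> real"
  show "(h (vc c z') + \<epsilon>) - (h (vc c z) + \<epsilon>) = taylor2 (dh c z) (d2h c) (\<lambda>a. z' a - z a)"
    unfolding n taylor2_def sum_bool_pair dh_def d2h_def
    by (cases c) (simp_all add: if_distrib[of "\<lambda>x. x * _"] sum.distrib[symmetric] sum_subtractf[symmetric] cong: if_cong,
      (simp add: sum_negf[symmetric] algebra_simps sum.distrib[symmetric] sum_subtractf[symmetric])+)
qed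

definition \<phi>1 :: "real \<Rightarrow> real" where "\<phi>1 y = q * y powr (q - 1)"
definition \<phi>2 :: "real \<Rightarrow> real" where "\<phi>2 y = q * (q - 1) / 2 * y powr (q - 2)"

lemma jet_h_powr:
  assumes \<epsilon>: "0 < \<epsilon>"
  shows "jet (ball_pairs :: (bool \<times> 'n::finite \<Rightarrow> real) set) (\<lambda>z. (h (vc c z) + \<epsilon>) powr q) (\<lambda>z a. \<phi>1 (h (vc c z) + \<epsilon>) * dh c z a)
     (\<lambda>z a b. \<phi>1 (h (vc c z) + \<epsilon>) * d2h c a b + \<phi>2 (h (vc c z) + \<epsilon>) * (dh c z a * dh c z b))"
proof -
  obtain D where D: "0 \<le> D"
    "\<forall>y\<in>{\<epsilon>..1 + \<epsilon>}. \<bar>y powr q\<bar> \<le> D \<and> \<bar>q * y powr (q - 1)\<bar> \<le> D \<and> \<bar>q * (q - 1) / 2 * y powr (q - 2)\<bar> \<le> D"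
    "\<forall>y\<in>{\<epsilon>..1 + \<epsilon>}. \<forall>y'\<in>{\<epsilon>..1 + \<epsilon>}. \<bar>y' powr q - y powr q\<bar> \<le> D * \<bar>y' - y\<bar> \<and>
      \<bar>q * y' powr (q - 1) - q * y powr (q - 1)\<bar> \<le> D * \<bar>y' - y\<bar> \<and>
      \<bar>q * (q - 1) / 2 * y' powr (q - 2) - q * (q - 1) / 2 * y powr (q - 2)\<bar> \<le> D * \<bar>y' - y\<bar> \<and>
      \<bar>y' powr q - y powr q - q * y powr (q - 1) * (y' - y) - q * (q - 1) / 2 * y powr (q - 2) * (y' - y)\<^sup>2\<bar> \<le> D * \<bar>y' - y\<bar> ^ 3"
    using powr_taylor_bounds[OF \<epsilon>, of "1 + \<epsilon>" q] by auto
  show ?thesis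
  proof (rule jet_compose[OF jet_h, where L=1 and J="{\<epsilon>..1 + \<epsilon>}" and D=D and \<phi>="\<lambda>y. y powr q"])
    show "h (vc c z) + \<epsilon> \<in> {\<epsilon>..1 + \<epsilon>}" if "z \<in> ball_pairs" for z :: "bool \<times> 'n \<Rightarrow> real"
      using h_bounds(1)[OF ball_pairs_norm[OF that]] h_bounds(2)[of "vc c z"] by simp
  qed (use D ball_pairs_component in \<open>simp_all add: \<phi>1_def \<phi>2_def\<close>)
qed

definition dpsi :: "real \<Rightarrow> (bool \<times> 'n::finite \<Rightarrow> real) \<Rightarrow> bool \<times> 'n \<Rightarrow> real" where
  "dpsi \<epsilon> z a = \<phi>1 (h (vc True z) + \<epsilon>) * dh True z a - \<phi>1 (h (vc False z) + \<epsilon>) * dh False z a"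

definition d2psi :: "real \<Rightarrow> (bool \<times> 'n::finite \<Rightarrow> real) \<Rightarrow> bool \<times> 'n \<Rightarrow> bool \<times> 'n \<Rightarrow> real" where
  "d2psi \<epsilon> z a b = (\<phi>1 (h (vc True z) + \<epsilon>) * d2h True a b + \<phi>2 (h (vc True z) + \<epsilon>) * (dh True z a * dh True z b))
    - (\<phi>1 (h (vc False z) + \<epsilon>) * d2h False a b + \<phi>2 (h (vc False z) + \<epsilon>) * (dh False z a * dh False z b))"

definition psi :: "real \<Rightarrow> (bool \<times> 'n::finite \<Rightarrow> real) \<Rightarrow> real" where
  "psi \<epsilon> z = (h (vc True z) + \<epsilon>) powr q - (h (vc False z) + \<epsilon>) powr q"

lemma jet_psi_square:
  assumes \<epsilon>: "0 < \<epsilon>" "\<epsilon> \<le> 1"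
  shows "jet (ball_pairs :: (bool \<times> 'n::finite \<Rightarrow> real) set) (\<lambda>z. (psi \<epsilon> z)\<^sup>2) (\<lambda>z a. 2 * psi \<epsilon> z * dpsi \<epsilon> z a)
    (\<lambda>z a b. 2 * psi \<epsilon> z * d2psi \<epsilon> z a b + 1 * (dpsi \<epsilon> z a * dpsi \<epsilon> z b))"
\<comment> \<open>The outer function is the square, half of whose second derivative is 1. The range
  \<open>{- 2..2}\<close> holds because both powers lie between 0 and 2 for \<epsilon> at most
  1.\<close>
proof (rule jet_compose[where L=1 and J="{- 2..2}" and D=4 and \<phi>="\<lambda>y. y\<^sup>2" and ?\<phi>1.0="\<lambda>y. 2 * y" and ?\<phi>2.0="\<lambda>y. 1"])
  show "jet (ball_pairs :: (bool \<times> 'n \<Rightarrow> real) set) (psi \<epsilon>) (dpsi \<epsilon>) (d2psi \<epsilon>)"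
    using jet_diff[OF jet_h_powr[OF \<epsilon>(1), of True] jet_h_powr[OF \<epsilon>(1), of False]]
    unfolding psi_def dpsi_def d2psi_def .
  show "psi \<epsilon> z \<in> {- 2..2}" if z: "z \<in> ball_pairs" for z :: "bool \<times> 'n \<Rightarrow> real"
  proof -
    have le: "(h (vc c z) + \<epsilon>) powr q \<le> 2" for c
    proof -
      have "(h (vc c z) + \<epsilon>) powr q \<le> 2 powr q"
        using h_bounds(1)[OF ball_pairs_norm[OF z]] h_bounds(2)[of "vc c z"] \<epsilon> q_bounds by (intro powr_mono2) auto
      also have "\<dots> \<le> 2 powr 1" using q_bounds by (intro powr_mono) auto
      finally show ?thesis by simp
    qed
    have ge: "0 \<le> (h (vc c z) + \<epsilon>) powr q" for c by simp
    show ?thesis using le[of True] le[of False] ge[of True] ge[of False] unfolding psi_def atLeastAtMost_iff by linarith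
  qed
  have sq: "y'\<^sup>2 - y\<^sup>2 = (y' + y) * (y' - y)" for y y' :: real by (simp add: power2_eq_square algebra_simps)
  show "\<bar>y'\<^sup>2 - y\<^sup>2\<bar> \<le> 4 * \<bar>y' - y\<bar>" if "y \<in> {- 2..2}" "y' \<in> {- 2..2}" for y y' :: real
    unfolding sq abs_mult using that by (intro mult_right_mono) auto
  show "\<bar>y\<^sup>2\<bar> \<le> 4" if "y \<in> {- 2..2}" for y :: real
  proof -
    have "\<bar>y\<bar> \<le> \<bar>2::real\<bar>" using that by auto
    then have "y\<^sup>2 \<le> 2\<^sup>2" by (simp only: abs_le_square_iff)
    then show ?thesis by simp
  qed
  show "\<bar>y'\<^sup>2 - y\<^sup>2 - 2 * y * (y' - y) - 1 * (y' - y)\<^sup>2\<bar> \<le> 4 * \<bar>y' - y\<bar> ^ 3" for y y' :: real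
  proof -
    have "y'\<^sup>2 - y\<^sup>2 - 2 * y * (y' - y) - 1 * (y' - y)\<^sup>2 = 0" by (simp add: power2_eq_square algebra_simps)
    then show ?thesis by simp
  qed
  show "\<bar>2 * y' - 2 * y\<bar> \<le> 4 * \<bar>y' - y\<bar>" for y y' :: real by (simp only: right_diff_distrib[symmetric] abs_mult) simp
qed (use ball_pairs_component in auto)

section \<open>The generator of the pair of solutions\<close>

definition \<sigma> :: "'a::real_inner \<Rightarrow> real" where "\<sigma> x = sqrt (1 - (norm x)\<^sup>2) * \<gamma> (norm x)"
definition b :: "'a::real_inner \<Rightarrow> 'a" where "b x = - (g (norm x) *\<^sub>R x)"

definition drift :: "(bool \<times> 'n::finite \<Rightarrow> real) \<Rightarrow> bool \<times> 'n \<Rightarrow> real" where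
  "drift z a = b (vc (fst a) z) $ snd a"

definition covar :: "(bool \<times> 'n::finite \<Rightarrow> real) \<Rightarrow> bool \<times> 'n \<Rightarrow> bool \<times> 'n \<Rightarrow> real" where
  "covar z a a' = (if snd a = snd a' then \<sigma> (vc (fst a) z) * \<sigma> (vc (fst a') z) else 0)"

definition lin :: "(bool \<times> 'n::finite \<Rightarrow> real) \<Rightarrow> (bool \<times> 'n \<Rightarrow> real) \<Rightarrow> real" where
  "lin z v = (\<Sum>a\<in>UNIV. v a * drift z a)"

definition quad :: "(bool \<times> 'n::finite \<Rightarrow> real) \<Rightarrow> (bool \<times> 'n \<Rightarrow> bool \<times> 'n \<Rightarrow> real) \<Rightarrow> real" where
  "quad z r = (\<Sum>a\<in>UNIV. \<Sum>a'\<in>UNIV. r a a' * covar z a a')"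

lemma quad_eq:
  "quad z r = (\<Sum>i\<in>UNIV. r (True, i) (True, i)) * (\<sigma> (vc True z))\<^sup>2
    + (\<Sum>i\<in>UNIV. r (True, i) (False, i) + r (False, i) (True, i)) * (\<sigma> (vc True z) * \<sigma> (vc False z))
    + (\<Sum>i\<in>UNIV. r (False, i) (False, i)) * (\<sigma> (vc False z))\<^sup>2"
  unfolding quad_def covar_def sum_bool_pair
  by (simp add: if_distrib[of "\<lambda>x. _ * x"] power2_eq_square sum.distrib sum_distrib_right cong: if_cong)
    (simp add: algebra_simps sum.distrib sum_distrib_left)

lemma lin_eq: "lin z v = (\<Sum>i\<in>UNIV. v (True, i) * b (vc True z) $ i) + (\<Sum>i\<in>UNIV. v (False, i) * b (vc False z) $ i)"
  unfolding lin_def drift_def sum_bool_pair by simp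

text \<open>The diagonal blocks yield the two drifts and the squared norms of the dispersion
  vectors. The mixed blocks, present because the Brownian motion is shared, yield the inner product
  that completes the square of their difference.\<close>

lemma generator_psi:
  fixes z :: "bool \<times> 'n::finite \<Rightarrow> real"
  assumes z: "z \<in> ball_pairs"
  shows "lin z (\<lambda>a. 2 * psi \<epsilon> z * dpsi \<epsilon> z a) + quad z (\<lambda>a b. 2 * psi \<epsilon> z * d2psi \<epsilon> z a b + 1 * (dpsi \<epsilon> z a * dpsi \<epsilon> z b))
    = Lop \<epsilon> (real CARD('n)) (vc True z) (vc False z)"
proof -
  let ?x = "vc True z" and ?y = "vc False z"
  have \<sigma>2: "(\<sigma> (vc c z))\<^sup>2 = h (vc c z) * (\<gamma> (norm (vc c z)))\<^sup>2" for c
    unfolding \<sigma>_def h_def[symmetric] using h_bounds(1)[OF ball_pairs_norm[OF z]] by (simp add: power_mult_distrib)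
  have xi: "vc c z $ i = z (c, i)" for c i unfolding vc_def by simp
  have nx: "(\<Sum>i\<in>UNIV. z (c, i) * z (c, i)) = (norm (vc c z))\<^sup>2" for c unfolding norm_vc by (simp add: power2_eq_square)
  have ip: "(\<Sum>i\<in>UNIV. z (True, i) * z (False, i)) = inner ?x ?y" unfolding inner_vec_def xi by simp
  let ?p = "\<phi>1 (h ?x + \<epsilon>)" and ?p' = "\<phi>1 (h ?y + \<epsilon>)" and ?r = "\<phi>2 (h ?x + \<epsilon>)" and ?r' = "\<phi>2 (h ?y + \<epsilon>)"
  have l: "lin z (\<lambda>a. 2 * psi \<epsilon> z * dpsi \<epsilon> z a) = 2 * psi \<epsilon> z * (?p * (2 * g (norm ?x) * (norm ?x)\<^sup>2) - ?p' * (2 * g (norm ?y) * (norm ?y)\<^sup>2))"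
    unfolding lin_eq dpsi_def dh_def nx[symmetric] b_def
    by (simp add: xi sum_distrib_left sum_negf right_diff_distrib mult_ac)
  have q1: "quad z (\<lambda>a b. 2 * psi \<epsilon> z * d2psi \<epsilon> z a b + 1 * (dpsi \<epsilon> z a * dpsi \<epsilon> z b)) =
     (2 * psi \<epsilon> z * (- ?p * real CARD('n) + ?r * 4 * (norm ?x)\<^sup>2) + 4 * ?p\<^sup>2 * (norm ?x)\<^sup>2) * (\<sigma> ?x)\<^sup>2
     + (- 8 * (?p * ?p') * inner ?x ?y) * (\<sigma> ?x * \<sigma> ?y)
     + (2 * psi \<epsilon> z * (?p' * real CARD('n) - ?r' * 4 * (norm ?y)\<^sup>2) + 4 * ?p'\<^sup>2 * (norm ?y)\<^sup>2) * (\<sigma> ?y)\<^sup>2"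
    unfolding quad_eq
  proof (intro arg_cong2[where f="(+)"] arg_cong2[where f="(*)"] refl)
    show "(\<Sum>i\<in>UNIV. 2 * psi \<epsilon> z * d2psi \<epsilon> z (True, i) (True, i) + 1 * (dpsi \<epsilon> z (True, i) * dpsi \<epsilon> z (True, i))) =
      2 * psi \<epsilon> z * (- ?p * real CARD('n) + ?r * 4 * (norm ?x)\<^sup>2) + 4 * ?p\<^sup>2 * (norm ?x)\<^sup>2"
    proof -
      have "2 * psi \<epsilon> z * d2psi \<epsilon> z (True, i) (True, i) + 1 * (dpsi \<epsilon> z (True, i) * dpsi \<epsilon> z (True, i)) =
        - (2 * psi \<epsilon> z * ?p) + (2 * psi \<epsilon> z * ?r * 4 + 4 * ?p\<^sup>2) * (z (True, i) * z (True, i))" for i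
        unfolding d2psi_def dpsi_def dh_def d2h_def by (simp add: power2_eq_square algebra_simps)
      then show ?thesis unfolding nx[symmetric]
        by (simp only: sum.distrib sum_distrib_left[symmetric] sum_constant) (simp add: algebra_simps)
    qed
    show "(\<Sum>i\<in>UNIV. 2 * psi \<epsilon> z * d2psi \<epsilon> z (True, i) (False, i) + 1 * (dpsi \<epsilon> z (True, i) * dpsi \<epsilon> z (False, i)) +
        (2 * psi \<epsilon> z * d2psi \<epsilon> z (False, i) (True, i) + 1 * (dpsi \<epsilon> z (False, i) * dpsi \<epsilon> z (True, i)))) = - 8 * (?p * ?p') * inner ?x ?y"
      unfolding ip[symmetric] d2psi_def dpsi_def dh_def d2h_def
      by (simp add: sum_distrib_left sum_negf mult_ac)
    show "(\<Sum>i\<in>UNIV. 2 * psi \<epsilon> z * d2psi \<epsilon> z (False, i) (False, i) + 1 * (dpsi \<epsilon> z (False, i) * dpsi \<epsilon> z (False, i))) =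
      2 * psi \<epsilon> z * (?p' * real CARD('n) - ?r' * 4 * (norm ?y)\<^sup>2) + 4 * ?p'\<^sup>2 * (norm ?y)\<^sup>2"
    proof -
      have "2 * psi \<epsilon> z * d2psi \<epsilon> z (False, i) (False, i) + 1 * (dpsi \<epsilon> z (False, i) * dpsi \<epsilon> z (False, i)) =
        2 * psi \<epsilon> z * ?p' + (- (2 * psi \<epsilon> z * ?r' * 4) + 4 * ?p'\<^sup>2) * (z (False, i) * z (False, i))" for i
        unfolding d2psi_def dpsi_def dh_def d2h_def by (simp add: power2_eq_square algebra_simps)
      then show ?thesis unfolding nx[symmetric]
        by (simp only: sum.distrib sum_distrib_left[symmetric] sum_constant) (simp add: algebra_simps)
    qed
  qed
  \<comment> \<open>The gradient of \<open>h\<close> points inward, so the dispersion vector is in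
    fact the negative of \<open>Mop\<close>; the sign disappears in the norm of a
    difference.\<close>
  have M: "Mop \<epsilon> (vc c z) = (2 * \<phi>1 (h (vc c z) + \<epsilon>) * \<sigma> (vc c z)) *\<^sub>R vc c z" for c
    unfolding Mop_def \<phi>1_def \<sigma>_def h_def by (simp add: mult_ac)
  have M2: "(norm (Mop \<epsilon> ?x - Mop \<epsilon> ?y))\<^sup>2 = 4 * ?p\<^sup>2 * (norm ?x)\<^sup>2 * (\<sigma> ?x)\<^sup>2 - 8 * (?p * ?p') * inner ?x ?y * (\<sigma> ?x * \<sigma> ?y) + 4 * ?p'\<^sup>2 * (norm ?y)\<^sup>2 * (\<sigma> ?y)\<^sup>2"
    unfolding M power2_norm_eq_inner
    by (simp add: inner_diff_left inner_diff_right inner_commute[of ?y ?x] power2_eq_square algebra_simps)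
  have A: "Aop \<epsilon> (real CARD('n)) (vc c z) = \<phi>1 (h (vc c z) + \<epsilon>) * (2 * g (norm (vc c z)) * (norm (vc c z))\<^sup>2 - real CARD('n) * (\<sigma> (vc c z))\<^sup>2)
     + \<phi>2 (h (vc c z) + \<epsilon>) * 4 * (norm (vc c z))\<^sup>2 * (\<sigma> (vc c z))\<^sup>2" for c
    unfolding Aop_def \<phi>1_def \<phi>2_def \<sigma>2 by (simp add: mult_ac)
  show ?thesis unfolding l q1 Lop_def M2 A psi_def[symmetric] by (simp add: algebra_simps)
qed

lemma generator_norm_diff:
  fixes z :: "bool \<times> 'n::finite \<Rightarrow> real"
  shows "lin z (\<lambda>a. 2 * sgnb (fst a) * (z (True, snd a) - z (False, snd a))) + quad z (\<lambda>a b. if snd a = snd b then sgnb (fst a) * sgnb (fst b) else 0)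
    = 2 * inner (vc True z - vc False z) (b (vc True z) - b (vc False z)) + real CARD('n) * (\<sigma> (vc True z) - \<sigma> (vc False z))\<^sup>2"
proof -
  have xi: "vc c z $ i = z (c, i)" for c i unfolding vc_def by simp
  have "lin z (\<lambda>a. 2 * sgnb (fst a) * (z (True, snd a) - z (False, snd a))) = 2 * inner (vc True z - vc False z) (b (vc True z) - b (vc False z))"
    unfolding lin_eq inner_vec_def
    by (simp add: xi sgnb_def sum_distrib_left sum.distrib[symmetric]) (intro sum.cong refl, simp add: algebra_simps)
  moreover have "quad z (\<lambda>a b. if snd a = snd b then sgnb (fst a) * sgnb (fst b) else 0) = real CARD('n) * (\<sigma> (vc True z) - \<sigma> (vc False z))\<^sup>2"
    unfolding quad_eq by (simp add: sgnb_def power2_eq_square algebra_simps)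
  ultimately show ?thesis by simp
qed

text \<open>The dispersion coefficient fails to be Lipschitz only through its factor
  \<open>sqrt (h x)\<close>. Splitting this factor off leaves the square of the difference of the
  roots, the very quantity that the surplus in \<open>Lop_0_bound\<close> controls.\<close>

lemma generator_norm_diff_bound:
  assumes n: "0 \<le> n"
  shows "\<exists>C>0. \<forall>x y::'a::real_inner. norm x \<le> 1 \<longrightarrow> norm y \<le> 1 \<longrightarrow>
    2 * inner (x - y) (b x - b y) + n * (\<sigma> x - \<sigma> y)\<^sup>2 \<le> C * (norm (x - y))\<^sup>2 + C * (sqrt (h x) - sqrt (h y))\<^sup>2"
proof -
  obtain C1 where C1: "0 \<le> C1" "\<forall>r\<in>{0..1}. \<bar>\<gamma> r\<bar> \<le> C1" "\<forall>r\<in>{0..1}. \<forall>s\<in>{0..1}. \<bar>\<gamma> r - \<gamma> s\<bar> \<le> C1 * \<bar>r - s\<bar>" using lipb_bounds[OF lipb_\<gamma>] by blast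
  obtain C2 where C2: "0 \<le> C2" "\<forall>r\<in>{0..1}. \<bar>g r\<bar> \<le> C2" "\<forall>r\<in>{0..1}. \<forall>s\<in>{0..1}. \<bar>g r - g s\<bar> \<le> C2 * \<bar>r - s\<bar>" using lipb_bounds[OF lipb_g] by blast
  \<comment> \<open>The added 1 makes the constant positive, since the final argument divides by
    it.\<close>
  define C where "C = 4 * C2 + n * (2 * C1\<^sup>2) + 1"
  have C0: "0 < C" unfolding C_def using C1 C2 n by (intro add_nonneg_pos) auto
  have "2 * inner (x - y) (b x - b y) + n * (\<sigma> x - \<sigma> y)\<^sup>2 \<le> C * (norm (x - y))\<^sup>2 + C * (sqrt (h x) - sqrt (h y))\<^sup>2"
    if x: "norm x \<le> 1" and y: "norm y \<le> 1" for x y :: 'a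
  proof -
    let ?d = "norm (x - y)" and ?s = "\<bar>sqrt (h x) - sqrt (h y)\<bar>"
    have eq: "b x - b y = (g (norm y) - g (norm x)) *\<^sub>R x + g (norm y) *\<^sub>R (y - x)" unfolding b_def by (simp add: algebra_simps)
    have "norm (b x - b y) \<le> \<bar>g (norm x) - g (norm y)\<bar> * norm x + \<bar>g (norm y)\<bar> * ?d"
      unfolding eq using norm_triangle_ineq[of "(g (norm y) - g (norm x)) *\<^sub>R x" "g (norm y) *\<^sub>R (y - x)"] by (simp add: norm_minus_commute abs_minus_commute)
    also have "\<dots> \<le> (C2 * ?d) * 1 + C2 * ?d"
      using norm_lip[of g C2, OF _ C2(1) x y] C2 x y by (intro add_mono mult_mono) auto
    finally have bb: "norm (b x - b y) \<le> 2 * C2 * ?d" by simp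
    have "inner (x - y) (b x - b y) \<le> ?d * norm (b x - b y)" by (rule norm_cauchy_schwarz)
    also have "\<dots> \<le> ?d * (2 * C2 * ?d)" using bb by (intro mult_left_mono) auto
    finally have 1: "2 * inner (x - y) (b x - b y) \<le> 4 * C2 * ?d\<^sup>2" by (simp add: power2_eq_square mult_ac)
    have h1: "0 \<le> h x" "h x \<le> 1" using h_bounds(1)[OF x] h_bounds(2)[of x] by auto
    have eq2: "\<sigma> x - \<sigma> y = sqrt (h x) * (\<gamma> (norm x) - \<gamma> (norm y)) + (sqrt (h x) - sqrt (h y)) * \<gamma> (norm y)"
      unfolding \<sigma>_def h_def by (simp add: algebra_simps)
    have "\<bar>\<sigma> x - \<sigma> y\<bar> \<le> sqrt (h x) * \<bar>\<gamma> (norm x) - \<gamma> (norm y)\<bar> + ?s * \<bar>\<gamma> (norm y)\<bar>"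
      unfolding eq2 using h1 by (intro order_trans[OF abs_triangle_ineq]) (simp add: abs_mult)
    also have "\<dots> \<le> 1 * (C1 * ?d) + ?s * C1"
      using norm_lip[of \<gamma> C1, OF _ C1(1) x y] C1 h1 y by (intro add_mono mult_mono) auto
    finally have "\<bar>\<sigma> x - \<sigma> y\<bar> \<le> C1 * (?d + ?s)" by (simp add: algebra_simps)
    then have "\<bar>\<sigma> x - \<sigma> y\<bar>\<^sup>2 \<le> (C1 * (?d + ?s))\<^sup>2" by (intro power_mono) auto
    also have "\<dots> = C1\<^sup>2 * (?d + ?s)\<^sup>2" by (simp add: power_mult_distrib)
    also have "\<dots> \<le> C1\<^sup>2 * (2 * (?d\<^sup>2 + ?s\<^sup>2))"
    proof (rule mult_left_mono)
      show "(?d + ?s)\<^sup>2 \<le> 2 * (?d\<^sup>2 + ?s\<^sup>2)" using sum_squares_bound[of ?d ?s] by (simp add: power2_sum)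
    qed simp
    finally have "n * (\<sigma> x - \<sigma> y)\<^sup>2 \<le> n * (C1\<^sup>2 * (2 * (?d\<^sup>2 + ?s\<^sup>2)))" using n by (intro mult_left_mono) auto
    also have "\<dots> = (n * (2 * C1\<^sup>2)) * ?d\<^sup>2 + (n * (2 * C1\<^sup>2)) * (sqrt (h x) - sqrt (h y))\<^sup>2" by (simp add: algebra_simps)
    finally have 2: "n * (\<sigma> x - \<sigma> y)\<^sup>2 \<le> (n * (2 * C1\<^sup>2)) * ?d\<^sup>2 + (n * (2 * C1\<^sup>2)) * (sqrt (h x) - sqrt (h y))\<^sup>2" .
    have 3: "4 * C2 * ?d\<^sup>2 + (n * (2 * C1\<^sup>2)) * ?d\<^sup>2 \<le> C * ?d\<^sup>2" unfolding C_def distrib_right by simp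
    have 4: "(n * (2 * C1\<^sup>2)) * (sqrt (h x) - sqrt (h y))\<^sup>2 \<le> C * (sqrt (h x) - sqrt (h y))\<^sup>2"
      unfolding C_def using C2 by (intro mult_right_mono) auto
    show ?thesis using 1 2 3 4 by linarith
  qed
  then show ?thesis using C0 by blast
qed

end

section \<open>Pathwise uniqueness\<close>

text \<open>The sequence has an upper bound but no uniform lower one. Its maximum with
  \<open>g\<close> is bounded on both sides and converges to \<open>g\<close>, so dominated
  convergence applies to the maximum, which dominates the sequence.\<close>

lemma (in finite_measure) reverse_fatou_eventually:
  fixes f :: "nat \<Rightarrow> 'a \<Rightarrow> real"
  assumes f: "\<And>k. integrable M (f k)" "\<And>k x. x \<in> space M \<Longrightarrow> f k x \<le> D"
    and g: "g \<in> borel_measurable M" "\<And>x. x \<in> space M \<Longrightarrow> \<bar>g x\<bar> \<le> D"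
    and lim: "\<And>x \<delta>. x \<in> space M \<Longrightarrow> 0 < \<delta> \<Longrightarrow> \<forall>\<^sub>F k in sequentially. f k x \<le> g x + \<delta>" and \<delta>: "0 < \<delta>"
  shows "\<forall>\<^sub>F k in sequentially. integral\<^sup>L M (f k) \<le> integral\<^sup>L M g + \<delta>"
proof -
  have fm: "f k \<in> borel_measurable M" for k using f(1) by auto
  have b: "\<bar>max (f k x) (g x)\<bar> \<le> D" if "x \<in> space M" for k x using f(2)[OF that, of k] g(2)[OF that] by linarith
  have mm: "(\<lambda>x. max (f k x) (g x)) \<in> borel_measurable M" for k using fm g(1) by (intro borel_measurable_max)
  have im: "integrable M (\<lambda>x. max (f k x) (g x))" for k
    by (rule integrable_const_bound[of _ D]) (use b mm in auto)
  have "(\<lambda>k. integral\<^sup>L M (\<lambda>x. max (f k x) (g x))) \<longlonglongrightarrow> integral\<^sup>L M g"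
  proof (rule integral_dominated_convergence[where w="\<lambda>_. D"])
    show "AE x in M. (\<lambda>k. max (f k x) (g x)) \<longlonglongrightarrow> g x"
    proof (rule AE_I2)
      fix x assume x: "x \<in> space M"
      show "(\<lambda>k. max (f k x) (g x)) \<longlonglongrightarrow> g x"
      proof (rule order_tendstoI)
        fix a assume "a < g x"
        then show "\<forall>\<^sub>F k in sequentially. a < max (f k x) (g x)" by (intro always_eventually) auto
      next
        fix a assume a: "g x < a"
        have "\<forall>\<^sub>F k in sequentially. f k x \<le> g x + (a - g x) / 2" using lim[OF x, of "(a - g x) / 2"] a by simp
        then show "\<forall>\<^sub>F k in sequentially. max (f k x) (g x) < a"
        proof eventually_elim
          case (elim k)
          then have "f k x < a" using a by (simp add: field_simps)
          then show ?case using a by simp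
        qed
      qed
    qed
  qed (use b mm g in auto)
  then have "\<forall>\<^sub>F k in sequentially. integral\<^sup>L M (\<lambda>x. max (f k x) (g x)) < integral\<^sup>L M g + \<delta>"
    by (rule order_tendstoD(2)) (use \<delta> in simp)
  then show ?thesis
  proof eventually_elim
    case (elim k)
    have "integral\<^sup>L M (f k) \<le> integral\<^sup>L M (\<lambda>x. max (f k x) (g x))" by (intro integral_mono f(1) im) simp
    then show ?case using elim by linarith
  qed
qed

lemma reverse_fatou_interval:
  fixes f :: "nat \<Rightarrow> real \<Rightarrow> real"
  assumes f: "\<And>k. continuous_on {0..T} (f k)" "\<And>k x. x \<in> {0..T} \<Longrightarrow> f k x \<le> D"
    and g: "continuous_on {0..T} g" "\<And>x. x \<in> {0..T} \<Longrightarrow> \<bar>g x\<bar> \<le> D"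
    and lim: "\<And>x \<delta>. x \<in> {0..T} \<Longrightarrow> 0 < \<delta> \<Longrightarrow> \<forall>\<^sub>F k in sequentially. f k x \<le> g x + \<delta>" and \<delta>: "0 < \<delta>"
  shows "\<forall>\<^sub>F k in sequentially. integral {0..T} (f k) \<le> integral {0..T} g + \<delta>"
proof -
  let ?N = "restrict_space lborel {0..T}"
  have sp: "space ?N = {0..T}" by (simp add: space_restrict_space)
  interpret N: finite_measure ?N
    by (rule finite_measureI) (simp add: sp emeasure_restrict_space emeasure_lborel_Icc_eq)
  have eq: "integral\<^sup>L ?N F = integral {0..T} F" and int: "integrable ?N F" if F: "continuous_on {0..T} F" for F :: "real \<Rightarrow> real"
  proof -
    have si: "set_integrable lborel {0..T} F" by (rule borel_integrable_atLeastAtMost'[OF F])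
    show "integral\<^sup>L ?N F = integral {0..T} F"
      using set_borel_integral_eq_integral(2)[OF si] by (simp add: integral_restrict_space set_lebesgue_integral_def)
    show "integrable ?N F" using si by (simp add: integrable_restrict_space set_integrable_def)
  qed
  show ?thesis
    using N.reverse_fatou_eventually[of f D g \<delta>] int[OF f(1)] f(2) int[OF g(1)] g(2) lim \<delta>
    unfolding sp eq[OF f(1)] eq[OF g(1)] by auto
qed

lemma gronwall_zero:
  fixes v :: "real \<Rightarrow> real"
  assumes v: "continuous_on {0..} v" "\<And>t. 0 \<le> t \<Longrightarrow> 0 \<le> v t" and le: "\<And>t. 0 \<le> t \<Longrightarrow> v t \<le> K * integral {0..t} v"
    and K: "0 \<le> K" and t: "0 \<le> t"
  shows "v t = 0"
proof -
  have cv: "continuous_on {0..t} v" using v(1) by (rule continuous_on_subset) auto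
  \<comment> \<open>The minus sign turns the nonincreasing function of Gronwall's proof into a
    nondecreasing one.\<close>
  define W where "W = (\<lambda>x. - (integral {0..x} v * exp (- (K * x))))"
  have d: "((\<lambda>x. integral {0..x} v) has_real_derivative v x) (at x within {0..t})" if "x \<in> {0..t}" for x
    by (rule integral_has_real_derivative[OF cv that])
  have cW: "continuous_on {0..t} W"
    unfolding W_def using d by (intro continuous_intros DERIV_continuous_on) auto
  have "W 0 \<le> W t"
  proof (rule DERIV_nonneg_imp_increasing_open[OF t _ cW])
    fix x assume x: "0 < x" "x < t"
    have "at x within {0..t} = at x" using x by (intro at_within_interior) auto
    then have "((\<lambda>x. integral {0..x} v) has_real_derivative v x) (at x)" using d[of x] x by simp
    then have D: "(W has_real_derivative - (v x * exp (- (K * x)) + integral {0..x} v * (exp (- (K * x)) * - K))) (at x)"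
      unfolding W_def by (auto intro!: derivative_eq_intros)
    have "0 \<le> (K * integral {0..x} v - v x) * exp (- (K * x))" using le[of x] x by simp
    then have "0 \<le> - (v x * exp (- (K * x)) + integral {0..x} v * (exp (- (K * x)) * - K))" by (simp add: algebra_simps)
    then show "\<exists>y. DERIV W x :> y \<and> 0 \<le> y" using D by blast
  qed
  then have "integral {0..t} v * exp (- (K * t)) \<le> 0" unfolding W_def by simp
  then have "integral {0..t} v \<le> 0" by (simp add: mult_le_0_iff not_less)
  then have "K * integral {0..t} v \<le> 0" using K by (simp add: mult_nonneg_nonpos)
  then show ?thesis using le[OF t] v(2)[OF t] by linarith
qed

text \<open>The exceptional null set may depend on the time, so the identities are first collected
  over countably many rational times and then extended by continuity of the paths.\<close>

lemma (in prob_space) AE_eq_of_continuous: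
  fixes X Y :: "real \<Rightarrow> 'a \<Rightarrow> 'b::t2_space"
  assumes c: "\<And>\<omega>. \<omega> \<in> space M \<Longrightarrow> continuous_on {0..} (\<lambda>t. X t \<omega>)" "\<And>\<omega>. \<omega> \<in> space M \<Longrightarrow> continuous_on {0..} (\<lambda>t. Y t \<omega>)"
    and eq: "\<And>t. 0 \<le> t \<Longrightarrow> AE \<omega> in M. X t \<omega> = Y t \<omega>"
  shows "AE \<omega> in M. \<forall>t\<ge>0. X t \<omega> = Y t \<omega>"
proof -
  have "AE \<omega> in M. \<forall>n::nat. \<forall>k::nat. X (real k / real (Suc n)) \<omega> = Y (real k / real (Suc n)) \<omega>"
    using eq by (simp add: AE_all_countable)
  then show ?thesis using AE_space
  proof eventually_elim
    fix \<omega> assume E: "\<forall>n::nat. \<forall>k::nat. X (real k / real (Suc n)) \<omega> = Y (real k / real (Suc n)) \<omega>" and w: "\<omega> \<in> space M"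
    show "\<forall>t\<ge>0. X t \<omega> = Y t \<omega>"
    proof (intro allI impI)
      fix t :: real assume t: "0 \<le> t"
      let ?q = "\<lambda>n. real_of_int \<lfloor>real (Suc n) * t\<rfloor> / real (Suc n)"
      have q0: "?q n \<in> {0..}" for n using t by simp
      have same: "X (?q n) \<omega> = Y (?q n) \<omega>" for n
      proof -
        have "real_of_int \<lfloor>real (Suc n) * t\<rfloor> = real (nat \<lfloor>real (Suc n) * t\<rfloor>)" using t by simp
        then show ?thesis using E by metis
      qed
      have lim: "(\<lambda>n. f (?q n)) \<longlonglongrightarrow> f t" if "continuous_on {0..} f" for f :: "real \<Rightarrow> 'b"
      proof (rule continuous_on_tendsto_compose[OF that floor_approximation])
        show "t \<in> {0..}" using t by simp
        show "\<forall>\<^sub>F n in sequentially. ?q n \<in> {0..}" by (intro always_eventually allI q0)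
      qed
      have "(\<lambda>n. X (?q n) \<omega>) \<longlonglongrightarrow> X t \<omega>" "(\<lambda>n. Y (?q n) \<omega>) \<longlonglongrightarrow> Y t \<omega>"
        by (rule lim[OF c(1)[OF w]], rule lim[OF c(2)[OF w]])
      then show "X t \<omega> = Y t \<omega>" unfolding same by (rule LIMSEQ_unique)
    qed
  qed
qed

context brownian_motion
begin

text \<open>Dynkin's formula is used twice. For the squared functional only the sign of its
  expectation matters: in the limit of small \<epsilon> it says that c times the time integral of
  \<open>Ew\<close> is at most C times that of \<open>v\<close>. For the squared distance it bounds
  \<open>v\<close> by multiples of both integrals. A weighted sum eliminates \<open>Ew\<close> and
  leaves Gronwall's hypothesis for \<open>v\<close>.\<close>

theorem ball_sde_second_moment:
  fixes XX :: "bool \<Rightarrow> real \<Rightarrow> 'w \<Rightarrow> real ^ 'n"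
  assumes ball: "ball_sde \<gamma> g"
    and sol: "\<And>c. sde_solution M F B {x. norm x \<le> 1} (\<lambda>x. sqrt (1 - (norm x)\<^sup>2) * \<gamma> (norm x)) (\<lambda>x. - (g (norm x) *\<^sub>R x)) (XX c)"
    and X0: "AE \<omega> in M. XX True 0 \<omega> = XX False 0 \<omega>"
    and t: "0 \<le> t"
  shows "expectation (\<lambda>\<omega>. (norm (XX True t \<omega> - XX False t \<omega>))\<^sup>2) = 0"
proof -
  interpret S: ball_sde \<gamma> g by (rule ball)
  let ?E = "{x :: real ^ 'n. norm x \<le> 1}"
  have \<sigma>: "(\<lambda>x::real^'n. sqrt (1 - (norm x)\<^sup>2) * \<gamma> (norm x)) = S.\<sigma>" and b: "(\<lambda>x::real^'n. - (g (norm x) *\<^sub>R x)) = S.b"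
    unfolding S.\<sigma>_def S.b_def by auto
  have sol': "sde_solution M F B ?E S.\<sigma> S.b (XX c)" for c using sol[of c] unfolding \<sigma> b .
  have Xm: "XX c r \<in> borel_measurable M" if "0 \<le> r" for c r
    using sol[of c] that measurable_F_M unfolding sde_solution_def adapted_def by blast
  have Xc: "continuous_on {0..} (\<lambda>r. XX c r \<omega>)" if "\<omega> \<in> space M" for c \<omega>
    using sol[of c] that unfolding sde_solution_def by blast
  have XE: "norm (XX c r \<omega>) \<le> 1" if "0 \<le> r" "\<omega> \<in> space M" for c r \<omega>
    using sol[of c] that unfolding sde_solution_def by blast
  obtain K1 where K1: "0 \<le> K1" "\<forall>r\<in>{0..1}. \<bar>\<gamma> r\<bar> \<le> K1" using lipb_bounds[OF S.lipb_\<gamma>] by blast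
  obtain K2 where K2: "0 \<le> K2" "\<forall>r\<in>{0..1}. \<bar>g r\<bar> \<le> K2" using lipb_bounds[OF S.lipb_g] by blast
  define K where "K = max K1 K2"
  have K: "0 \<le> K" "K1 \<le> K" "K2 \<le> K" unfolding K_def using K1 by auto
  have cn: "continuous_on ?E (\<lambda>x. f (norm x))" if "continuous_on {0..1} f" for f :: "real \<Rightarrow> real"
    by (rule continuous_on_compose2[OF that]) (auto intro!: continuous_intros)
  have c\<sigma>: "continuous_on ?E S.\<sigma>" unfolding S.\<sigma>_def
    by (intro continuous_intros cn lipb_continuous S.lipb_\<gamma>)
  have cb: "continuous_on ?E S.b" unfolding S.b_def
    by (intro continuous_intros cn lipb_continuous S.lipb_g)
  have b\<sigma>: "\<bar>S.\<sigma> x\<bar> \<le> K" if "x \<in> ?E" for x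
  proof -
    have h: "0 \<le> S.h x" "S.h x \<le> 1" using S.h_bounds(1)[of x] S.h_bounds(2)[of x] that by auto
    have "\<bar>S.\<sigma> x\<bar> = sqrt (S.h x) * \<bar>\<gamma> (norm x)\<bar>" unfolding S.\<sigma>_def S.h_def[symmetric] using h by (simp add: abs_mult)
    also have "\<dots> \<le> 1 * K" using h K1 K that by (intro mult_mono) (auto intro: order_trans)
    finally show ?thesis by simp
  qed
  have bb: "norm (S.b x) \<le> K" if "x \<in> ?E" for x
  proof -
    have "norm (S.b x) = \<bar>g (norm x)\<bar> * norm x" unfolding S.b_def by simp
    also have "\<dots> \<le> K * 1" using K2 K that by (intro mult_mono) (auto intro: order_trans)
    finally show ?thesis by simp
  qed
  have nE: "norm x \<le> 1" if "x \<in> ?E" for x using that by simp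
  define V where "V = (\<lambda>r \<omega> (a :: bool \<times> 'n). XX (fst a) r \<omega> $ snd a)"
  have vcV: "vc c (V r \<omega>) = XX c r \<omega>" for c r \<omega> unfolding vc_def V_def by (simp add: vec_eq_iff)
  have VB: "V r \<omega> \<in> ball_pairs" if "0 \<le> r" "\<omega> \<in> space M" for r \<omega>
    unfolding ball_pairs_def using XE[OF that] by (simp add: vcV)
  define n where "n = real CARD('n)"
  have n: "0 \<le> n" unfolding n_def by simp
  have dynkin': "expectation (\<lambda>\<omega>. \<Psi> (V T \<omega>)) - expectation (\<lambda>\<omega>. \<Psi> (V 0 \<omega>)) =
      integral {0..T} (\<lambda>r. expectation (\<lambda>\<omega>. S.lin (V r \<omega>) (P (V r \<omega>)) + S.quad (V r \<omega>) (R (V r \<omega>))))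
     \<and> continuous_on {0..} (\<lambda>r. expectation (\<lambda>\<omega>. S.lin (V r \<omega>) (P (V r \<omega>)) + S.quad (V r \<omega>) (R (V r \<omega>))))"
    if jet: "jet ball_pairs \<Psi> P R" and T: "0 \<le> T" for \<Psi> P R T
  proof -
    \<comment> \<open>The constant of an Ito family depends on the horizon, so the family is formed
      anew for each \<open>T\<close>.\<close>
    obtain C where fam: "ito_family T C (\<lambda>a t \<omega>. XX (fst a) t \<omega> $ snd a) (\<lambda>a t \<omega>. S.b (XX (fst a) t \<omega>) $ snd a)
       (\<lambda>a a' t \<omega>. if snd a = snd a' then S.\<sigma> (XX (fst a) t \<omega>) * S.\<sigma> (XX (fst a') t \<omega>) else 0)"
      using sde_solutions_ito_family[where XX=XX, OF sol' nE c\<sigma> b\<sigma> cb bb T zero_le_one K(1)] by blast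
    have VS: "(\<lambda>a. XX (fst a) r \<omega> $ snd a) \<in> ball_pairs" if "0 \<le> r" "\<omega> \<in> space M" for r \<omega>
      using VB[OF that] unfolding V_def .
    show ?thesis
      using dynkin[OF fam jet VS T order_refl]
      unfolding S.lin_def S.quad_def S.drift_def S.covar_def vcV unfolding V_def by blast
  qed
  define \<epsilon> where "\<epsilon> = (\<lambda>k::nat. 1 / real (Suc k))"
  have \<epsilon>: "0 < \<epsilon> k" "\<epsilon> k \<le> 1" for k unfolding \<epsilon>_def by auto
  have \<epsilon>0: "\<epsilon> \<longlonglongrightarrow> 0" unfolding \<epsilon>_def by (rule lim_1_over_n[THEN LIMSEQ_Suc])
  let ?X = "XX True" and ?Y = "XX False"
  define EL where "EL = (\<lambda>k r. expectation (\<lambda>\<omega>. S.lin (V r \<omega>) (\<lambda>a. 2 * S.psi (\<epsilon> k) (V r \<omega>) * S.dpsi (\<epsilon> k) (V r \<omega>) a)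
     + S.quad (V r \<omega>) (\<lambda>a a'. 2 * S.psi (\<epsilon> k) (V r \<omega>) * S.d2psi (\<epsilon> k) (V r \<omega>) a a' + 1 * (S.dpsi (\<epsilon> k) (V r \<omega>) a * S.dpsi (\<epsilon> k) (V r \<omega>) a'))))"
  have EL_Lop: "EL k r = expectation (\<lambda>\<omega>. S.Lop (\<epsilon> k) n (?X r \<omega>) (?Y r \<omega>))" if "0 \<le> r" for k r
    unfolding EL_def
  proof (intro Bochner_Integration.integral_cong refl)
    fix \<omega> assume "\<omega> \<in> space M"
    from S.generator_psi[OF VB[OF that this], of "\<epsilon> k"]
    show "S.lin (V r \<omega>) (\<lambda>a. 2 * S.psi (\<epsilon> k) (V r \<omega>) * S.dpsi (\<epsilon> k) (V r \<omega>) a) + S.quad (V r \<omega>) (\<lambda>a a'. 2 * S.psi (\<epsilon> k) (V r \<omega>) * S.d2psi (\<epsilon> k) (V r \<omega>) a a' + 1 * (S.dpsi (\<epsilon> k) (V r \<omega>) a * S.dpsi (\<epsilon> k) (V r \<omega>) a'))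
      = S.Lop (\<epsilon> k) n (?X r \<omega>) (?Y r \<omega>)"
      unfolding vcV n_def by simp
  qed
  have dpsi: "expectation (\<lambda>\<omega>. (S.psi (\<epsilon> k) (V T \<omega>))\<^sup>2) - expectation (\<lambda>\<omega>. (S.psi (\<epsilon> k) (V 0 \<omega>))\<^sup>2) = integral {0..T} (EL k)
      \<and> continuous_on {0..} (EL k)" if "0 \<le> T" for k T
    using dynkin'[OF S.jet_psi_square[OF \<epsilon>] that, of k] unfolding EL_def .
  define v where "v = (\<lambda>r. expectation (\<lambda>\<omega>. (norm (?X r \<omega> - ?Y r \<omega>))\<^sup>2))"
  define Ew where "Ew = (\<lambda>r. expectation (\<lambda>\<omega>. (sqrt (S.h (?X r \<omega>)) - sqrt (S.h (?Y r \<omega>)))\<^sup>2))"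
  define EQ where "EQ = (\<lambda>r. expectation (\<lambda>\<omega>. 2 * inner (?X r \<omega> - ?Y r \<omega>) (S.b (?X r \<omega>) - S.b (?Y r \<omega>)) + n * (S.\<sigma> (?X r \<omega>) - S.\<sigma> (?Y r \<omega>))\<^sup>2))"
  have dQ: "v T - v 0 = integral {0..T} EQ \<and> continuous_on {0..} EQ" if "0 \<le> T" for T
    using dynkin'[OF jet_norm_diff that] unfolding S.generator_norm_diff vcV v_def EQ_def n_def .
  have cvd: "cprocess 4 (\<lambda>r \<omega>. (norm (?X r \<omega> - ?Y r \<omega>))\<^sup>2)"
    unfolding cprocess_def
  proof (intro conjI allI impI ballI)
    show "(\<lambda>\<omega>. (norm (?X r \<omega> - ?Y r \<omega>))\<^sup>2) \<in> borel_measurable M" if "0 \<le> r" for r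
      using Xm[OF that, of True] Xm[OF that, of False] by measurable
    fix \<omega> assume w: "\<omega> \<in> space M"
    show "continuous_on {0..} (\<lambda>r. (norm (?X r \<omega> - ?Y r \<omega>))\<^sup>2)" by (intro continuous_intros Xc[OF w])
    fix r :: real assume r: "0 \<le> r"
    have "norm (?X r \<omega> - ?Y r \<omega>) \<le> 2" using norm_triangle_ineq4[of "?X r \<omega>" "?Y r \<omega>"] XE[OF r w, of True] XE[OF r w, of False] by linarith
    then have "(norm (?X r \<omega> - ?Y r \<omega>))\<^sup>2 \<le> 2\<^sup>2" by (intro power_mono) auto
    then show "\<bar>(norm (?X r \<omega> - ?Y r \<omega>))\<^sup>2\<bar> \<le> 4" by simp
  qed
  have cw: "cprocess 1 (\<lambda>r \<omega>. (sqrt (S.h (?X r \<omega>)) - sqrt (S.h (?Y r \<omega>)))\<^sup>2)"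
    unfolding cprocess_def
  proof (intro conjI allI impI ballI)
    show "(\<lambda>\<omega>. (sqrt (S.h (?X r \<omega>)) - sqrt (S.h (?Y r \<omega>)))\<^sup>2) \<in> borel_measurable M" if "0 \<le> r" for r
      unfolding S.h_def using Xm[OF that, of True] Xm[OF that, of False] by measurable
    fix \<omega> assume w: "\<omega> \<in> space M"
    show "continuous_on {0..} (\<lambda>r. (sqrt (S.h (?X r \<omega>)) - sqrt (S.h (?Y r \<omega>)))\<^sup>2)" unfolding S.h_def by (intro continuous_intros Xc[OF w])
    fix r :: real assume r: "0 \<le> r"
    have "0 \<le> sqrt (S.h (XX c r \<omega>)) \<and> sqrt (S.h (XX c r \<omega>)) \<le> 1" for c
      using S.h_bounds(1)[OF XE[OF r w]] S.h_bounds(2) by auto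
    from this[of True] this[of False] have "\<bar>sqrt (S.h (?X r \<omega>)) - sqrt (S.h (?Y r \<omega>))\<bar> \<le> 1" by linarith
    then show "\<bar>(sqrt (S.h (?X r \<omega>)) - sqrt (S.h (?Y r \<omega>)))\<^sup>2\<bar> \<le> 1" by (simp add: abs_square_le_1)
  qed
  have iv: "integrable M (\<lambda>\<omega>. (norm (?X r \<omega> - ?Y r \<omega>))\<^sup>2)" and iw: "integrable M (\<lambda>\<omega>. (sqrt (S.h (?X r \<omega>)) - sqrt (S.h (?Y r \<omega>)))\<^sup>2)" if "0 \<le> r" for r
    using cprocess_integrable[OF cvd that] cprocess_integrable[OF cw that] by auto
  have contv: "continuous_on {0..} v" and contw: "continuous_on {0..} Ew"
    unfolding v_def Ew_def by (rule cprocess_expectation_continuous[OF cvd], rule cprocess_expectation_continuous[OF cw])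
  have v0: "0 \<le> v r" for r unfolding v_def by simp
  have w0: "0 \<le> Ew r" for r unfolding Ew_def by simp
  have v4: "v r \<le> 4" and w1: "Ew r \<le> 1" if r: "0 \<le> r" for r
  proof -
    have "v r \<le> expectation (\<lambda>_. 4)" unfolding v_def
      using iv[OF r] cprocessD(3)[OF cvd _ r] by (intro integral_mono) auto
    then show "v r \<le> 4" by (simp add: prob_space)
    have "Ew r \<le> expectation (\<lambda>_. 1)" unfolding Ew_def
      using iw[OF r] cprocessD(3)[OF cw _ r] by (intro integral_mono) auto
    then show "Ew r \<le> 1" by (simp add: prob_space)
  qed
  obtain C c where C: "0 \<le> C" and c: "0 < c" and L0: "\<And>x y::real^'n. norm x < 1 \<Longrightarrow> norm y < 1 \<Longrightarrow>
      S.Lop 0 n x y \<le> C * (norm (x - y))\<^sup>2 - c * (sqrt (S.h x) - sqrt (S.h y))\<^sup>2"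
    using S.Lop_0_bound[OF n, where 'a="real^'n"] by blast
  obtain D where D: "0 \<le> D" "\<And>\<epsilon> x (y::real^'n). 0 < \<epsilon> \<Longrightarrow> \<epsilon> \<le> 1 \<Longrightarrow> norm x \<le> 1 \<Longrightarrow> norm y \<le> 1 \<Longrightarrow> S.Lop \<epsilon> n x y \<le> D"
    using S.Lop_upper[OF n, where 'a="real^'n"] by blast
  obtain C2 where C2: "0 < C2" and Q2: "\<And>x y::real^'n. norm x \<le> 1 \<Longrightarrow> norm y \<le> 1 \<Longrightarrow>
      2 * inner (x - y) (S.b x - S.b y) + n * (S.\<sigma> x - S.\<sigma> y)\<^sup>2 \<le> C2 * (norm (x - y))\<^sup>2 + C2 * (sqrt (S.h x) - sqrt (S.h y))\<^sup>2"
    using S.generator_norm_diff_bound[OF n, where 'a="real^'n"] by blast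
  \<comment> \<open>This weight on the squared distance makes its contribution of \<open>Ew\<close>
    exactly as large as the surplus available to absorb it.\<close>
  define \<mu> where "\<mu> = c / C2"
  have \<mu>: "0 < \<mu>" "\<mu> * C2 = c" unfolding \<mu>_def using c C2 by auto
  define G where "G = (\<lambda>r \<omega>. C * (norm (?X r \<omega> - ?Y r \<omega>))\<^sup>2 - c * (sqrt (S.h (?X r \<omega>)) - sqrt (S.h (?Y r \<omega>)))\<^sup>2)"
  \<comment> \<open>A common bound: from above for the generators, for every \<epsilon>, and on both
    sides for their limiting bound, as \<open>v\<close> is at most 4 and \<open>Ew\<close> at most
    1.\<close>
  define DD where "DD = D + 4 * C + c"
  have DD: "D \<le> DD" "4 * C + c \<le> DD" unfolding DD_def using D C c by auto
  have iG: "integrable M (G r)" if "0 \<le> r" for r unfolding G_def using iv[OF that] iw[OF that] by auto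
  have EG: "expectation (G r) = C * v r - c * Ew r" if "0 \<le> r" for r
    unfolding G_def v_def Ew_def using iv[OF that] iw[OF that] by simp
  have Gb: "\<bar>C * a - c * a'\<bar> \<le> DD" if "0 \<le> a" "a \<le> 4" "0 \<le> a'" "a' \<le> 1" for a a'
  proof -
    have "C * a \<le> C * 4" "c * a' \<le> c * 1" "0 \<le> C * a" "0 \<le> c * a'" using that C c by (auto intro!: mult_left_mono)
    then have "C * a - c * a' \<le> DD" "- (C * a - c * a') \<le> DD" using DD(2) C c by linarith+
    then show ?thesis by (rule abs_leI)
  qed
  \<comment> \<open>For a fixed positive \<epsilon> the generator is continuous on a compact set,
    hence measurable along the solutions and bounded. This bound may depend on k and serves
    integrability only; uniformity comes from \<open>Lop_upper\<close>.\<close>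
  have mL: "(\<lambda>\<omega>. S.Lop (\<epsilon> k) n (?X r \<omega>) (?Y r \<omega>)) \<in> borel_measurable M"
    and bL: "\<exists>J. \<forall>\<omega>\<in>space M. \<bar>S.Lop (\<epsilon> k) n (?X r \<omega>) (?Y r \<omega>)\<bar> \<le> J" if r: "0 \<le> r" for k r
  proof -
    have cg: "continuous_on ?E (\<lambda>x. \<gamma> (norm x))" "continuous_on ?E (\<lambda>x. g (norm x))"
      by (intro cn lipb_continuous S.lipb_\<gamma> S.lipb_g)+
    have hp: "1 - (norm x)\<^sup>2 + \<epsilon> k \<noteq> 0" if "x \<in> ?E" for x
    proof -
      have "0 \<le> 1 - (norm x)\<^sup>2" using that by (simp add: power_le_one)
      then show ?thesis using \<epsilon>(1)[of k] by linarith
    qed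
    have cA: "continuous_on ?E (S.Aop (\<epsilon> k) n)"
      unfolding S.Aop_def S.h_def using hp by (intro continuous_intros cg) auto
    have cM: "continuous_on ?E (S.Mop (\<epsilon> k))"
      unfolding S.Mop_def S.h_def using hp by (intro continuous_intros cg) auto
    have cp: "continuous_on ?E (\<lambda>x. (S.h x + \<epsilon> k) powr S.q)"
      unfolding S.h_def using hp by (intro continuous_intros) auto
    have comp: "continuous_on (?E \<times> ?E) (\<lambda>z. f (fst z))" "continuous_on (?E \<times> ?E) (\<lambda>z. f (snd z))" if "continuous_on ?E f" for f :: "real^'n \<Rightarrow> 'z::topological_space"
      by (rule continuous_on_compose2[OF that]; auto intro!: continuous_intros)+
    have cL: "continuous_on (?E \<times> ?E) (\<lambda>z. S.Lop (\<epsilon> k) n (fst z) (snd z))"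
      unfolding S.Lop_def by (intro continuous_intros comp cA cM cp)
    have "(\<lambda>\<omega>. (?X r \<omega>, ?Y r \<omega>)) \<in> borel_measurable M" using Xm[OF r] by (intro borel_measurable_Pair)
    then have "(\<lambda>\<omega>. (?X r \<omega>, ?Y r \<omega>)) \<in> measurable M (restrict_space borel (?E \<times> ?E))"
      using XE[OF r] by (intro measurable_restrict_space2) auto
    from measurable_compose[OF this borel_measurable_continuous_on_restrict[OF cL]]
    show "(\<lambda>\<omega>. S.Lop (\<epsilon> k) n (?X r \<omega>) (?Y r \<omega>)) \<in> borel_measurable M" by simp
    have "?E = cball 0 1" by (auto simp: dist_norm)
    then have "compact (?E \<times> ?E)" by (simp add: compact_Times)
    then have "bounded ((\<lambda>z. S.Lop (\<epsilon> k) n (fst z) (snd z)) ` (?E \<times> ?E))"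
      by (intro compact_imp_bounded compact_continuous_image cL)
    then obtain J where "\<forall>z\<in>?E \<times> ?E. \<bar>S.Lop (\<epsilon> k) n (fst z) (snd z)\<bar> \<le> J" unfolding bounded_iff by auto
    then show "\<exists>J. \<forall>\<omega>\<in>space M. \<bar>S.Lop (\<epsilon> k) n (?X r \<omega>) (?Y r \<omega>)\<bar> \<le> J" using XE[OF r] by (intro exI[of _ J]) fastforce
  qed
  have iL: "integrable M (\<lambda>\<omega>. S.Lop (\<epsilon> k) n (?X r \<omega>) (?Y r \<omega>))" if r: "0 \<le> r" for k r
    using bL[OF r, of k] mL[OF r, of k] by (auto intro!: integrable_const_bound AE_I2)
  have LD: "S.Lop (\<epsilon> k) n (?X r \<omega>) (?Y r \<omega>) \<le> DD" if "0 \<le> r" "\<omega> \<in> space M" for k r \<omega>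
    by (rule order_trans[OF D(2)[OF \<epsilon> XE[OF that] XE[OF that]] DD(1)])
  have ELD: "EL k r \<le> DD" if r: "0 \<le> r" for k r
  proof -
    have "EL k r \<le> expectation (\<lambda>_. DD)" unfolding EL_Lop[OF r]
      using iL[OF r] LD[OF r] by (intro integral_mono) auto
    then show ?thesis by (simp add: prob_space)
  qed
  have lim1: "\<forall>\<^sub>F k in sequentially. EL k r \<le> (C * v r - c * Ew r) + \<delta>" if r: "0 \<le> r" and \<delta>: "0 < \<delta>" for r \<delta>
  proof -
    have "\<forall>\<^sub>F k in sequentially. expectation (\<lambda>\<omega>. S.Lop (\<epsilon> k) n (?X r \<omega>) (?Y r \<omega>)) \<le> expectation (G r) + \<delta>"
    proof (rule reverse_fatou_eventually[OF iL[OF r]])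
      show "S.Lop (\<epsilon> k) n (?X r \<omega>) (?Y r \<omega>) \<le> DD" if "\<omega> \<in> space M" for k \<omega>
        by (rule LD[OF r that])
      show "G r \<in> borel_measurable M" using iG[OF r] by auto
      show "\<bar>G r \<omega>\<bar> \<le> DD" if "\<omega> \<in> space M" for \<omega>
        unfolding G_def using cprocessD(3)[OF cvd that r] cprocessD(3)[OF cw that r] by (intro Gb) auto
      show "\<forall>\<^sub>F k in sequentially. S.Lop (\<epsilon> k) n (?X r \<omega>) (?Y r \<omega>) \<le> G r \<omega> + \<delta>'" if "\<omega> \<in> space M" "0 < \<delta>'" for \<omega> \<delta>'
        unfolding G_def by (rule S.Lop_eventually[OF \<epsilon>0 \<epsilon>(1) L0 C XE[OF r that(1)] XE[OF r that(1)] that(2)])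
    qed (rule \<delta>)
    then show ?thesis unfolding EL_Lop[OF r] EG[OF r] .
  qed
  \<comment> \<open>The reverse Fatou bound is applied in the sample point for each time, then in
    time. Each passage holds up to an arbitrary positive error, so one sufficiently large k suffices
    for a given \<delta>.\<close>
  have key: "\<mu> * v T \<le> (C + c) * integral {0..T} v" if T: "0 \<le> T" for T
  proof (rule field_le_epsilon)
    fix \<delta> :: real assume \<delta>: "0 < \<delta>"
    have sub: "continuous_on {0..T} f" if "continuous_on {0..} f" for f :: "real \<Rightarrow> real" using that by (rule continuous_on_subset) auto
    have int: "f integrable_on {0..T}" if "continuous_on {0..} f" for f :: "real \<Rightarrow> real"
      using sub[OF that] by (rule integrable_continuous_interval)
    have cEL: "continuous_on {0..} (EL k)" for k using dpsi[OF order_refl] by blast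
    have cEG: "continuous_on {0..} (\<lambda>r. C * v r - c * Ew r)" by (intro continuous_intros contv contw)
    have "\<forall>\<^sub>F k in sequentially. integral {0..T} (EL k) \<le> integral {0..T} (\<lambda>r. C * v r - c * Ew r) + \<delta>"
    proof (rule reverse_fatou_interval[OF sub[OF cEL] _ sub[OF cEG] _ _ \<delta>])
      show "EL k r \<le> DD" if "r \<in> {0..T}" for k r using ELD that by auto
      show "\<bar>C * v r - c * Ew r\<bar> \<le> DD" if "r \<in> {0..T}" for r using that v0 w0 v4 w1 by (intro Gb) auto
      show "\<forall>\<^sub>F k in sequentially. EL k r \<le> (C * v r - c * Ew r) + \<delta>'" if "r \<in> {0..T}" "0 < \<delta>'" for r \<delta>'
        using lim1 that by auto
    qed
    then obtain k where k: "integral {0..T} (EL k) \<le> integral {0..T} (\<lambda>r. C * v r - c * Ew r) + \<delta>"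
      using eventually_happens'[OF sequentially_bot] by blast
    have psi0: "expectation (\<lambda>\<omega>. (S.psi (\<epsilon> k) (V 0 \<omega>))\<^sup>2) = 0"
    proof -
      have "AE \<omega> in M. (S.psi (\<epsilon> k) (V 0 \<omega>))\<^sup>2 = 0" using X0 by eventually_elim (simp add: S.psi_def vcV)
      then show ?thesis by (rule integral_eq_zero_AE)
    qed
    have v00: "v 0 = 0"
    proof -
      have "AE \<omega> in M. (norm (?X 0 \<omega> - ?Y 0 \<omega>))\<^sup>2 = 0" using X0 by eventually_elim simp
      then show ?thesis unfolding v_def by (rule integral_eq_zero_AE)
    qed
    have "0 \<le> expectation (\<lambda>\<omega>. (S.psi (\<epsilon> k) (V T \<omega>))\<^sup>2)" by simp
    then have e1: "0 \<le> integral {0..T} (EL k)" using conjunct1[OF dpsi[OF T, of k]] psi0 by linarith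
    have e2: "v T = integral {0..T} EQ" using dQ[OF T] v00 by simp
    have EQle: "EQ r \<le> C2 * v r + C2 * Ew r" if r: "0 \<le> r" for r
    proof -
      have i: "integrable M (\<lambda>\<omega>. C2 * (norm (?X r \<omega> - ?Y r \<omega>))\<^sup>2 + C2 * (sqrt (S.h (?X r \<omega>)) - sqrt (S.h (?Y r \<omega>)))\<^sup>2)"
        using iv[OF r] iw[OF r] by simp
      have "EQ r \<le> expectation (\<lambda>\<omega>. C2 * (norm (?X r \<omega> - ?Y r \<omega>))\<^sup>2 + C2 * (sqrt (S.h (?X r \<omega>)) - sqrt (S.h (?Y r \<omega>)))\<^sup>2)"
        unfolding EQ_def
      proof (rule integral_mono_AE'[OF i])
        show "AE \<omega> in M. 2 * inner (?X r \<omega> - ?Y r \<omega>) (S.b (?X r \<omega>) - S.b (?Y r \<omega>)) + n * (S.\<sigma> (?X r \<omega>) - S.\<sigma> (?Y r \<omega>))\<^sup>2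
          \<le> C2 * (norm (?X r \<omega> - ?Y r \<omega>))\<^sup>2 + C2 * (sqrt (S.h (?X r \<omega>)) - sqrt (S.h (?Y r \<omega>)))\<^sup>2"
          using Q2 XE[OF r] by (intro AE_I2) auto
        show "AE \<omega> in M. 0 \<le> C2 * (norm (?X r \<omega> - ?Y r \<omega>))\<^sup>2 + C2 * (sqrt (S.h (?X r \<omega>)) - sqrt (S.h (?Y r \<omega>)))\<^sup>2"
          using C2 by (intro AE_I2) auto
      qed
      also have "\<dots> = C2 * v r + C2 * Ew r" unfolding v_def Ew_def using iv[OF r] iw[OF r] by simp
      finally show ?thesis .
    qed
    have "integral {0..T} EQ \<le> integral {0..T} (\<lambda>r. C2 * v r + C2 * Ew r)"
      using dQ[OF T] EQle by (intro integral_le int continuous_intros contv contw) auto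
    also have "\<dots> = C2 * integral {0..T} v + C2 * integral {0..T} Ew"
      using int[OF contv] int[OF contw] by (subst Henstock_Kurzweil_Integration.integral_add) (auto intro: integrable_on_mult_right)
    finally have "\<mu> * v T \<le> \<mu> * (C2 * integral {0..T} v + C2 * integral {0..T} Ew)"
      unfolding e2 using \<mu>(1) by (intro mult_left_mono) auto
    also have "\<dots> = (\<mu> * C2) * integral {0..T} v + (\<mu> * C2) * integral {0..T} Ew" by (simp add: algebra_simps)
    finally have e3: "\<mu> * v T \<le> c * integral {0..T} v + c * integral {0..T} Ew" unfolding \<mu>(2) .
    have "integral {0..T} (\<lambda>r. C * v r - c * Ew r) = C * integral {0..T} v - c * integral {0..T} Ew"
      using int[OF contv] int[OF contw] by (subst Henstock_Kurzweil_Integration.integral_diff) (auto intro: integrable_on_mult_right)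
    then show "\<mu> * v T \<le> (C + c) * integral {0..T} v + \<delta>" using k e1 e3 unfolding distrib_right by linarith
  qed
  have "v t = 0"
  proof (rule gronwall_zero[OF contv v0 _ _ t])
    show "v r \<le> ((C + c) / \<mu>) * integral {0..r} v" if "0 \<le> r" for r
      using key[OF that] \<mu>(1) by (simp add: pos_le_divide_eq mult.commute)
    show "0 \<le> (C + c) / \<mu>" using C c \<mu> by simp
  qed
  then show ?thesis unfolding v_def .
qed

end

theorem theorem1p1:
  fixes \<gamma> g :: "real \<Rightarrow> real"
  assumes "\<forall>r\<in>{0..1}. 0 < \<gamma> r" and "\<forall>r\<in>{0..1}. 0 < g r"
    and "\<exists>L. L-lipschitz_on {0..1} \<gamma>" and "\<exists>L. L-lipschitz_on {0..1} g"
    and "g 1 / (\<gamma> 1)\<^sup>2 > sqrt 2 - 1"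
  shows "pathwise_unique TYPE('w) {x :: real ^ 'n. norm x \<le> 1}
    (\<lambda>x. sqrt (1 - (norm x)\<^sup>2) * \<gamma> (norm x))
    (\<lambda>x. - (g (norm x) *\<^sub>R x))"
  unfolding pathwise_unique_def
proof (intro allI impI)
  fix M :: "'w measure" and F and B X Y :: "real \<Rightarrow> 'w \<Rightarrow> real ^ 'n"
  let ?\<sigma> = "\<lambda>x :: real ^ 'n. sqrt (1 - (norm x)\<^sup>2) * \<gamma> (norm x)" and ?b = "\<lambda>x :: real ^ 'n. - (g (norm x) *\<^sub>R x)"
  assume X: "sde_solution M F B {x. norm x \<le> 1} ?\<sigma> ?b X" and Y: "sde_solution M F B {x. norm x \<le> 1} ?\<sigma> ?b Y"
    and X0: "AE \<omega> in M. X 0 \<omega> = Y 0 \<omega>"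
  have bs: "ball_sde \<gamma> g" using assms by unfold_locales
  interpret brownian_motion M F B using X unfolding sde_solution_def by blast
  define XX where "XX = (\<lambda>c. if c then X else Y)"
  have sol: "sde_solution M F B {x. norm x \<le> 1} ?\<sigma> ?b (XX c)" for c unfolding XX_def using X Y by simp
  have m: "X t \<in> borel_measurable M" "Y t \<in> borel_measurable M" and bd: "\<forall>\<omega>\<in>space M. norm (X t \<omega>) \<le> 1 \<and> norm (Y t \<omega>) \<le> 1" if "0 \<le> t" for t
    using X Y that measurable_F_M unfolding sde_solution_def adapted_def by blast+
  show "AE \<omega> in M. \<forall>t\<ge>0. X t \<omega> = Y t \<omega>"
  proof (rule AE_eq_of_continuous)
    show "continuous_on {0..} (\<lambda>t. X t \<omega>)" "continuous_on {0..} (\<lambda>t. Y t \<omega>)" if "\<omega> \<in> space M" for \<omega>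
      using X Y that unfolding sde_solution_def by blast+
    fix t :: real assume t: "0 \<le> t"
    have E: "expectation (\<lambda>\<omega>. (norm (X t \<omega> - Y t \<omega>))\<^sup>2) = 0"
      using ball_sde_second_moment[where XX=XX, OF bs sol _ t] X0 unfolding XX_def by simp
    have "integrable M (\<lambda>\<omega>. (norm (X t \<omega> - Y t \<omega>))\<^sup>2)"
    proof (rule integrable_const_bound[of _ "2\<^sup>2"])
      show "AE \<omega> in M. norm ((norm (X t \<omega> - Y t \<omega>))\<^sup>2) \<le> 2\<^sup>2"
      proof (rule AE_I2)
        fix \<omega> assume "\<omega> \<in> space M"
        then have "norm (X t \<omega> - Y t \<omega>) \<le> 2" using bd[OF t] norm_triangle_ineq4[of "X t \<omega>" "Y t \<omega>"] by fastforce
        then have "(norm (X t \<omega> - Y t \<omega>))\<^sup>2 \<le> 2\<^sup>2" by (intro power_mono) auto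
        then show "norm ((norm (X t \<omega> - Y t \<omega>))\<^sup>2) \<le> 2\<^sup>2" by simp
      qed
    qed (use m[OF t] in measurable)
    then have "AE \<omega> in M. (norm (X t \<omega> - Y t \<omega>))\<^sup>2 = 0"
      using E by (subst (asm) integral_nonneg_eq_0_iff_AE) auto
    then show "AE \<omega> in M. X t \<omega> = Y t \<omega>" by eventually_elim simp
  qed
qed

end
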